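(* Let $R$ be a bounded linear operator on $L^2(\mathbb{R}^d)$ and let $A\in\mathbb{C}$. The following two statements are equivalent: (i) There is some $S\in\mathcal{W}$ such that $R\star S=A\cdot\mathrm{tr}(S)+h$ for some $h\in C_0(\mathbb{R}^{2d})$. (ii) There is some $a\in W(\mathbb{R}^{2d})$ such that $R\star a=A\cdot\int_{\mathbb{R}^{2d}}a(z)\,dz\cdot I_{L^2}+K$ for some compact operator $K\in\mathcal{K}$. If one of these equivalent statements holds, then both of the following hold: (1) For any $T\in\mathcal{S}^1$, $R\star T=A\cdot\mathrm{tr}(T)+h_T$ for some $h_T\in C_0(\mathbb{R}^{2d})$. (2) For any $g\in L^1(\mathbb{R}^{2d})$, $R\star g=A\cdot\int_{\mathbb{R}^{2d}}g(z)\,dz\cdot I_{L^2}+K_g$ for some compact operator $K_g\in\mathcal{K}$.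
   Context: $\mathcal{S}^1$ is the space of trace class operators on $L^2(\mathbb{R}^d)$, $\mathcal{K}$ the compact operators on $L^2(\mathbb{R}^d)$, $I_{L^2}$ the identity operator on $L^2(\mathbb{R}^d)$. For $z=(x,\omega)\in\mathbb{R}^{2d}$, $(\pi(z)\psi)(t)=e^{2\pi i\omega\cdot t}\psi(t-x)$ for $\psi\in L^2(\mathbb{R}^d)$, and $\alpha_z(R)=\pi(z)R\pi(z)^*$ for a bounded operator $R$. $P$ is the parity operator $(P\psi)(t)=\psi(-t)$ and $\check{S}=PSP$. For a bounded operator $R$ on $L^2(\mathbb{R}^d)$ and $S\in\mathcal{S}^1$, $R\star S$ is the bounded continuous function $R\star S(z)=\mathrm{tr}(R\,\alpha_z(\check{S}))$ on $\mathbb{R}^{2d}$. For $a\in L^1(\mathbb{R}^{2d})$, $R\star a=a\star R$ is the bounded operator $\int_{\mathbb{R}^{2d}}a(z)\alpha_z(R)\,dz$ (integral interpreted weakly). The symplectic Fourier transform of $a\in L^1(\mathbb{R}^{2d})$ is $\mathcal{F}_\sigma(a)(z)=\int_{\mathbb{R}^{2d}}a(z')e^{-2\pi i\sigma(z,z')}\,dz'$ with $\sigma((x_1,\omega_1),(x_2,\omega_2))=\omega_1\cdot x_2-\omega_2\cdot x_1$. The Fourier-Wigner transform of $S\in\mathcal{S}^1$ is $\mathcal{F}_W(S)(z)=e^{-\pi i x\cdot\omega}\mathrm{tr}(\pi(-z)S)$ for $z=(x,\omega)$. Define $W(\mathbb{R}^{2d})=\{a\in L^1(\mathbb{R}^{2d}):\mathcal{F}_\sigma(a)(z)\neq0\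 \forall z\in\mathbb{R}^{2d}\}$ and $\mathcal{W}=\{S\in\mathcal{S}^1:\mathcal{F}_W(S)(z)\neq0\ \forall z\in\mathbb{R}^{2d}\}$. *)

theory Defs
  imports "HOL-Analysis.Analysis"
begin

lemma borel_measurable_cnj [measurable (raw)]:
  "f \<in> borel_measurable M \<Longrightarrow> (\<lambda>x. cnj (f x)) \<in> borel_measurable M"
  by (rule borel_measurable_continuous_on[OF continuous_on_cnj[OF continuous_on_id]])

definition square_integrable :: "('a::euclidean_space \<Rightarrow> complex) \<Rightarrow> bool" where
  "square_integrable f \<longleftrightarrow>
     f \<in> borel_measurable lborel \<and> integrable lborel (\<lambda>t. (cmod (f t))\<^sup>2)"

definition L2_rel :: "('a::euclidean_space \<Rightarrow> complex) \<Rightarrow> ('a \<Rightarrow> complex) \<Rightarrow> bool" where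
  "L2_rel f g \<longleftrightarrow> square_integrable f \<and> square_integrable g \<and> (AE t in lborel. f t = g t)"

lemma square_integrable_zero: "square_integrable (\<lambda>_. 0)"
  by (simp add: square_integrable_def)

lemma square_integrable_scale:
  assumes "square_integrable f"
  shows "square_integrable (\<lambda>t. c * f t)"
  using assms by (auto simp: square_integrable_def norm_mult power_mult_distrib)

lemma square_integrable_add:
  assumes "square_integrable f" "square_integrable g"
  shows "square_integrable (\<lambda>t. f t + g t)"
proof -
  have [measurable]: "f \<in> borel_measurable lborel" "g \<in> borel_measurable lborel"
    using assms by (auto simp: square_integrable_def)
  have bound: "(cmod (f t + g t))\<^sup>2 \<le> 2 * (cmod (f t))\<^sup>2 + 2 * (cmod (g t))\<^sup>2" for t
  proof -
    have "(cmod (f t + g t))\<^sup>2 \<le> (cmod (f t) + cmod (g t))\<^sup>2"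
      by (intro power_mono norm_triangle_ineq) auto
    also have "\<dots> \<le> 2 * (cmod (f t))\<^sup>2 + 2 * (cmod (g t))\<^sup>2"
      using sum_squares_bound[of "cmod (f t)" "cmod (g t)"] by (simp add: power2_sum)
    finally show ?thesis .
  qed
  have int: "integrable lborel (\<lambda>t. 2 * (cmod (f t))\<^sup>2 + 2 * (cmod (g t))\<^sup>2)"
    using assms by (auto simp: square_integrable_def)
  have "integrable lborel (\<lambda>t. (cmod (f t + g t))\<^sup>2)"
    using bound by (intro Bochner_Integration.integrable_bound[OF int]) auto
  then show ?thesis
    by (simp add: square_integrable_def)
qed

lemma integrable_mult_cnj:
  assumes "square_integrable f" "square_integrable g"
  shows "integrable lborel (\<lambda>t. f t * cnj (g t))"
proof -
  have [measurable]: "f \<in> borel_measurable lborel" "g \<in> borel_measurable lborel"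
    using assms by (auto simp: square_integrable_def)
  have bound: "cmod (f t * cnj (g t)) \<le> (cmod (f t))\<^sup>2 + (cmod (g t))\<^sup>2" for t
  proof -
    have "2 * (cmod (f t) * cmod (g t)) \<le> (cmod (f t))\<^sup>2 + (cmod (g t))\<^sup>2"
      using sum_squares_bound[of "cmod (f t)" "cmod (g t)"] by simp
    moreover have "0 \<le> cmod (f t) * cmod (g t)" by simp
    ultimately show ?thesis
      unfolding norm_mult complex_mod_cnj by linarith
  qed
  have int: "integrable lborel (\<lambda>t. (cmod (f t))\<^sup>2 + (cmod (g t))\<^sup>2)"
    using assms by (auto simp: square_integrable_def)
  show ?thesis
  proof (rule Bochner_Integration.integrable_bound[OF int])
    show "(\<lambda>t. f t * cnj (g t)) \<in> borel_measurable lborel"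
      by measurable
    show "AE t in lborel. norm (f t * cnj (g t)) \<le> norm ((cmod (f t))\<^sup>2 + (cmod (g t))\<^sup>2)"
    proof (rule AE_I2)
      fix t
      show "norm (f t * cnj (g t)) \<le> norm ((cmod (f t))\<^sup>2 + (cmod (g t))\<^sup>2)"
        using bound[of t] abs_ge_self[of "(cmod (f t))\<^sup>2 + (cmod (g t))\<^sup>2"]
        unfolding real_norm_def by linarith
    qed
  qed
qed

quotient_type (overloaded) 'a L2 = "'a::euclidean_space \<Rightarrow> complex" / partial: L2_rel
proof (rule part_equivpI)
  show "\<exists>f. L2_rel f f"
    using square_integrable_zero by (auto simp: L2_rel_def)
  show "symp L2_rel"
    by (auto simp: L2_rel_def symp_def elim: AE_mp)
  show "transp L2_rel"
    by (auto simp: L2_rel_def transp_def elim: AE_mp)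
qed

lift_definition scaleC_L2 :: "complex \<Rightarrow> 'a::euclidean_space L2 \<Rightarrow> 'a L2" (infixr "*\<^sub>C" 75)
  is "\<lambda>c f t. c * f t"
  by (auto simp: L2_rel_def intro: square_integrable_scale)

text \<open>The inner product is linear in its first argument.\<close>

lift_definition cinner :: "'a::euclidean_space L2 \<Rightarrow> 'a L2 \<Rightarrow> complex"
  is "\<lambda>f g. \<integral>t. f t * cnj (g t) \<partial>lborel"
proof -
  fix f f' g g' :: "'a \<Rightarrow> complex"
  assume *: "L2_rel f f'" "L2_rel g g'"
  then have [measurable]: "f \<in> borel_measurable lborel" "g \<in> borel_measurable lborel"
    "f' \<in> borel_measurable lborel" "g' \<in> borel_measurable lborel"
    by (auto simp: L2_rel_def square_integrable_def)
  from * have "AE t in lborel. f t = f' t" "AE t in lborel. g t = g' t"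
    by (auto simp: L2_rel_def)
  then have "AE t in lborel. f t * cnj (g t) = f' t * cnj (g' t)"
    by eventually_elim simp
  then show "(\<integral>t. f t * cnj (g t) \<partial>lborel) = (\<integral>t. f' t * cnj (g' t) \<partial>lborel)"
    by (intro integral_cong_AE) measurable
qed

instantiation L2 :: (euclidean_space) ab_group_add
begin

lift_definition zero_L2 :: "'a L2" is "\<lambda>_. 0"
  by (simp add: L2_rel_def square_integrable_zero)

lift_definition plus_L2 :: "'a L2 \<Rightarrow> 'a L2 \<Rightarrow> 'a L2" is "\<lambda>f g t. f t + g t"
  by (auto simp: L2_rel_def intro: square_integrable_add)

lift_definition uminus_L2 :: "'a L2 \<Rightarrow> 'a L2" is "\<lambda>f t. - f t"
  by (auto simp: L2_rel_def square_integrable_def)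

definition minus_L2 :: "'a L2 \<Rightarrow> 'a L2 \<Rightarrow> 'a L2" where
  "minus_L2 f g = f + - g"

instance
proof
  fix f g h :: "'a L2"
  show "f + g + h = f + (g + h)"
    by transfer (auto simp: L2_rel_def intro!: square_integrable_add)
  show "f + g = g + f"
    by transfer (auto simp: L2_rel_def intro!: square_integrable_add)
  show "0 + f = f"
    by transfer (auto simp: L2_rel_def)
  show "- f + f = 0"
    by transfer (auto simp: L2_rel_def intro: square_integrable_zero)
  show "f - g = f + - g"
    by (fact minus_L2_def)
qed

end

lemma cinner_add_left: "cinner (f + g) h = cinner f h + cinner g h"
  by transfer
    (auto simp: L2_rel_def algebra_simps integrable_mult_cnj
      intro!: Bochner_Integration.integral_add)

lemma cinner_scaleC_left: "cinner (c *\<^sub>C f) g = c * cinner f g"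
  by transfer (simp add: mult.assoc)

lemma cinner_commute: "cinner f g = cnj (cinner g f)"
proof (transfer)
  fix f g :: "'a \<Rightarrow> complex"
  have "cnj (\<integral>t. g t * cnj (f t) \<partial>lborel) = (\<integral>t. cnj (g t * cnj (f t)) \<partial>lborel)"
    by (rule Bochner_Integration.integral_cnj[symmetric])
  then show "(\<integral>t. f t * cnj (g t) \<partial>lborel) = cnj (\<integral>t. g t * cnj (f t) \<partial>lborel)"
    by (simp add: mult.commute)
qed

lemma cinner_self: "\<exists>r\<ge>0. cinner f f = of_real r \<and> (r = 0 \<longleftrightarrow> f = 0)"
proof (transfer)
  fix f :: "'a \<Rightarrow> complex"
  assume "L2_rel f f"
  then have f: "square_integrable f"
    by (simp add: L2_rel_def)
  then have [measurable]: "f \<in> borel_measurable lborel"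
    and int: "integrable lborel (\<lambda>t. (cmod (f t))\<^sup>2)"
    by (auto simp: square_integrable_def)
  let ?r = "\<integral>t. (cmod (f t))\<^sup>2 \<partial>lborel"
  have 1: "(\<integral>t. f t * cnj (f t) \<partial>lborel) = of_real ?r"
    by (simp add: complex_mult_cnj cmod_power2 flip: integral_complex_of_real)
  have "?r = 0 \<longleftrightarrow> (AE t in lborel. (cmod (f t))\<^sup>2 = 0)"
    using int by (intro integral_nonneg_eq_0_iff_AE) auto
  then have 2: "?r = 0 \<longleftrightarrow> L2_rel f (\<lambda>_. 0)"
    using f by (simp add: L2_rel_def square_integrable_zero)
  have 3: "0 \<le> ?r"
    by (intro integral_nonneg_AE) auto
  show "\<exists>r\<ge>0. (\<integral>t. f t * cnj (f t) \<partial>lborel) = of_real r \<and> (r = 0 \<longleftrightarrow> L2_rel f (\<lambda>_. 0))"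
    using 1 2 3 by blast
qed

instantiation L2 :: (euclidean_space) real_inner
begin

definition scaleR_L2 :: "real \<Rightarrow> 'a L2 \<Rightarrow> 'a L2" where
  "scaleR_L2 r f = of_real r *\<^sub>C f"

definition inner_L2 :: "'a L2 \<Rightarrow> 'a L2 \<Rightarrow> real" where
  "inner_L2 f g = Re (cinner f g)"

definition norm_L2 :: "'a L2 \<Rightarrow> real" where
  "norm_L2 f = sqrt (inner f f)"

definition sgn_L2 :: "'a L2 \<Rightarrow> 'a L2" where
  "sgn_L2 f = inverse (norm f) *\<^sub>R f"

definition dist_L2 :: "'a L2 \<Rightarrow> 'a L2 \<Rightarrow> real" where
  "dist_L2 f g = norm (f - g)"

definition uniformity_L2 :: "('a L2 \<times> 'a L2) filter" where
  "uniformity_L2 = (INF e\<in>{0<..}. principal {(f, g). dist f g < e})"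

definition open_L2 :: "'a L2 set \<Rightarrow> bool" where
  "open_L2 U \<longleftrightarrow> (\<forall>f\<in>U. \<forall>\<^sub>F (f', g) in uniformity. f' = f \<longrightarrow> g \<in> U)"

instance
proof
  fix f g h :: "'a L2" and r s :: real and U :: "'a L2 set"
  show "r *\<^sub>R (f + g) = r *\<^sub>R f + r *\<^sub>R g"
    unfolding scaleR_L2_def
    by transfer
      (auto simp: L2_rel_def distrib_left intro!: square_integrable_add square_integrable_scale)
  show "(r + s) *\<^sub>R f = r *\<^sub>R f + s *\<^sub>R f"
    unfolding scaleR_L2_def
    by transfer
      (auto simp: L2_rel_def distrib_right intro!: square_integrable_add square_integrable_scale)
  show "r *\<^sub>R s *\<^sub>R f = (r * s) *\<^sub>R f"
    unfolding scaleR_L2_def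
    by transfer (auto simp: L2_rel_def mult.assoc intro!: square_integrable_scale)
  show "1 *\<^sub>R f = f"
    unfolding scaleR_L2_def by transfer (auto simp: L2_rel_def)
  show "inner f g = inner g f"
    unfolding inner_L2_def by (subst cinner_commute) simp
  show "inner (f + g) h = inner f h + inner g h"
    by (simp add: inner_L2_def cinner_add_left)
  show "inner (r *\<^sub>R f) g = r * inner f g"
    by (simp add: inner_L2_def scaleR_L2_def cinner_scaleC_left)
  show "0 \<le> inner f f"
    using cinner_self[of f] by (auto simp: inner_L2_def)
  show "inner f f = 0 \<longleftrightarrow> f = 0"
    using cinner_self[of f] by (auto simp: inner_L2_def)
qed (fact norm_L2_def sgn_L2_def dist_L2_def uniformity_L2_def open_L2_def)+

end

definition bounded_clinear :: "('a::euclidean_space L2 \<Rightarrow> 'a L2) \<Rightarrow> bool" where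
  "bounded_clinear R \<longleftrightarrow> bounded_linear R \<and> (\<forall>c f. R (c *\<^sub>C f) = c *\<^sub>C R f)"

definition compact_operator :: "('a::euclidean_space L2 \<Rightarrow> 'a L2) \<Rightarrow> bool" where
  "compact_operator K \<longleftrightarrow> bounded_clinear K \<and> compact (closure (K ` cball 0 1))"

text \<open>
  For a bounded operator the adjoint exists by the Riesz representation theorem and is unique;
  likewise a bounded operator has exactly one positive absolute value.
\<close>

definition cadjoint :: "('a::euclidean_space L2 \<Rightarrow> 'a L2) \<Rightarrow> 'a L2 \<Rightarrow> 'a L2" where
  "cadjoint R = (THE T. \<forall>f g. cinner (R f) g = cinner f (T g))"

definition positive_operator :: "('a::euclidean_space L2 \<Rightarrow> 'a L2) \<Rightarrow> bool" where
  "positive_operator B \<longleftrightarrow> bounded_clinear B \<and> (\<forall>f. cinner (B f) f \<in> \<real>\<^sub>\<ge>\<^sub>0)"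

definition abs_operator :: "('a::euclidean_space L2 \<Rightarrow> 'a L2) \<Rightarrow> 'a L2 \<Rightarrow> 'a L2" where
  "abs_operator S = (THE B. positive_operator B \<and> B \<circ> B = cadjoint S \<circ> S)"

text \<open>An orthonormal basis is rendered as a maximal orthonormal set.\<close>

definition is_onb :: "'a::euclidean_space L2 set \<Rightarrow> bool" where
  "is_onb E \<longleftrightarrow>
     (\<forall>e\<in>E. \<forall>e'\<in>E. cinner e e' = (if e = e' then 1 else 0)) \<and>
     (\<forall>f. (\<forall>e\<in>E. cinner f e = 0) \<longrightarrow> f = 0)"

definition trace_class :: "('a::euclidean_space L2 \<Rightarrow> 'a L2) \<Rightarrow> bool" where
  "trace_class S \<longleftrightarrow> bounded_clinear S \<and>
     (\<exists>E. is_onb E \<and> (\<lambda>e. cinner (abs_operator S e) e) summable_on E)"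

text \<open>For trace class operators the value does not depend on the orthonormal basis.\<close>

definition op_trace :: "('a::euclidean_space L2 \<Rightarrow> 'a L2) \<Rightarrow> complex" where
  "op_trace S = (\<Sum>\<^sub>\<infinity>e\<in>(SOME E. is_onb E). cinner (S e) e)"

text \<open>
  A point of phase space is a pair \<open>z = (x, \<omega>)\<close> of a position and a frequency.
\<close>

lemma lborel_distr_sign_affine:
  fixes x :: "'a::euclidean_space" and s :: real
  assumes "\<bar>s\<bar> = 1"
  shows "distr lborel borel (\<lambda>t. x + s *\<^sub>R t) = lborel"
  using lborel_affine[of s x] assms by (simp add: density_1)

lemma square_integrable_affine:
  fixes f :: "'a::euclidean_space \<Rightarrow> complex"
  assumes f: "square_integrable f" and s: "\<bar>s\<bar> = 1"
  shows "square_integrable (\<lambda>t. f (x + s *\<^sub>R t))"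
proof -
  have [measurable]: "f \<in> borel_measurable borel"
    using f by (auto simp: square_integrable_def)
  have "integrable (distr lborel borel (\<lambda>t. x + s *\<^sub>R t)) (\<lambda>t. (cmod (f t))\<^sup>2)"
    using f by (simp add: lborel_distr_sign_affine[OF s] square_integrable_def)
  then have "integrable lborel (\<lambda>t. (cmod (f (x + s *\<^sub>R t)))\<^sup>2)"
    by (subst (asm) integrable_distr_eq) auto
  then show ?thesis
    by (simp add: square_integrable_def)
qed

lemma AE_lborel_affine:
  fixes f g :: "'a::euclidean_space \<Rightarrow> complex"
  assumes f: "f \<in> borel_measurable lborel" and g: "g \<in> borel_measurable lborel"
    and s: "\<bar>s\<bar> = 1" and eq: "AE t in lborel. f t = g t"
  shows "AE t in lborel. f (x + s *\<^sub>R t) = g (x + s *\<^sub>R t)"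
proof -
  have [measurable]: "f \<in> borel_measurable borel" "g \<in> borel_measurable borel"
    using f g by simp_all
  have "AE t in distr lborel borel (\<lambda>t. x + s *\<^sub>R t). f t = g t"
    unfolding lborel_distr_sign_affine[OF s] by (rule eq)
  then show ?thesis
    by (subst (asm) AE_distr_iff) auto
qed

lemma L2_rel_affine:
  assumes "L2_rel f g" "\<bar>s\<bar> = 1"
  shows "L2_rel (\<lambda>t. f (x + s *\<^sub>R t)) (\<lambda>t. g (x + s *\<^sub>R t))"
proof -
  have "square_integrable f" "square_integrable g" "AE t in lborel. f t = g t"
    using assms by (auto simp: L2_rel_def)
  moreover from this have "f \<in> borel_measurable lborel" "g \<in> borel_measurable lborel"
    by (auto simp: square_integrable_def)
  ultimately show ?thesis
    unfolding L2_rel_def using assms(2)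
    by (blast intro: square_integrable_affine AE_lborel_affine)
qed

lemma square_integrable_unimodular:
  assumes "square_integrable f" "u \<in> borel_measurable lborel" "\<And>t. cmod (u t) = 1"
  shows "square_integrable (\<lambda>t. u t * f t)"
  using assms by (auto simp: square_integrable_def norm_mult power_mult_distrib)

lift_definition tf_shift :: "'a \<times> 'a \<Rightarrow> 'a::euclidean_space L2 \<Rightarrow> 'a L2"
  is "\<lambda>(x, \<omega>) \<psi> t. exp (2 * pi * \<i> * of_real (\<omega> \<bullet> t)) * \<psi> (t - x)"
proof -
  fix z :: "'a \<times> 'a" and \<psi> \<phi> :: "'a \<Rightarrow> complex"
  assume rel: "L2_rel \<psi> \<phi>"
  obtain x \<omega> where z: "z = (x, \<omega>)"
    by (cases z)
  have "L2_rel (\<lambda>t. \<psi> (- x + 1 *\<^sub>R t)) (\<lambda>t. \<phi> (- x + 1 *\<^sub>R t))"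
    by (rule L2_rel_affine[OF rel]) simp
  then have shifted: "L2_rel (\<lambda>t. \<psi> (t - x)) (\<lambda>t. \<phi> (t - x))"
    by simp
  have "cmod (exp (2 * pi * \<i> * of_real (\<omega> \<bullet> t))) = 1" for t
    by simp
  moreover have "(\<lambda>t. exp (2 * pi * \<i> * of_real (\<omega> \<bullet> t))) \<in> borel_measurable lborel"
    by (simp add: borel_measurable_continuous_onI continuous_intros)
  ultimately show "L2_rel
      ((case z of (x, \<omega>) \<Rightarrow> \<lambda>\<psi> t. exp (2 * pi * \<i> * of_real (\<omega> \<bullet> t)) * \<psi> (t - x)) \<psi>)
      ((case z of (x, \<omega>) \<Rightarrow> \<lambda>\<psi> t. exp (2 * pi * \<i> * of_real (\<omega> \<bullet> t)) * \<psi> (t - x)) \<phi>)"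
    using shifted unfolding L2_rel_def z
    by (auto intro!: square_integrable_unimodular)
qed

lift_definition parity :: "'a::euclidean_space L2 \<Rightarrow> 'a L2" is "\<lambda>\<psi> t. \<psi> (- t)"
  using L2_rel_affine[where s = "-1" and x = 0] by simp

definition alpha ::
    "'a \<times> 'a \<Rightarrow> ('a::euclidean_space L2 \<Rightarrow> 'a L2) \<Rightarrow> 'a L2 \<Rightarrow> 'a L2" where
  "alpha z R = tf_shift z \<circ> R \<circ> cadjoint (tf_shift z)"

definition conv_op_op ::
    "('a::euclidean_space L2 \<Rightarrow> 'a L2) \<Rightarrow> ('a L2 \<Rightarrow> 'a L2) \<Rightarrow> 'a \<times> 'a \<Rightarrow> complex" where
  "conv_op_op R S z = op_trace (R \<circ> alpha z (parity \<circ> S \<circ> parity))"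

text \<open>
  The operator-valued integral of \<open>a z\<close> times \<open>alpha z R\<close> in the weak sense: its sesquilinear
  form is the integral of the forms. For integrable \<open>a\<close> and bounded \<open>R\<close> exactly one such
  operator exists.
\<close>

definition conv_op_fun ::
    "('a::euclidean_space L2 \<Rightarrow> 'a L2) \<Rightarrow> ('a \<times> 'a \<Rightarrow> complex) \<Rightarrow> 'a L2 \<Rightarrow> 'a L2" where
  "conv_op_fun R a = (THE T. bounded_clinear T \<and>
     (\<forall>f g. cinner (T f) g = (\<integral>z. a z * cinner (alpha z R f) g \<partial>lborel)))"

definition symplectic :: "'a::euclidean_space \<times> 'a \<Rightarrow> 'a \<times> 'a \<Rightarrow> real" where
  "symplectic z z' = snd z \<bullet> fst z' - snd z' \<bullet> fst z"

definition symplectic_fourier ::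
    "('a::euclidean_space \<times> 'a \<Rightarrow> complex) \<Rightarrow> 'a \<times> 'a \<Rightarrow> complex" where
  "symplectic_fourier a z =
     (\<integral>z'. a z' * exp (- 2 * pi * \<i> * of_real (symplectic z z')) \<partial>lborel)"

definition fourier_wigner ::
    "('a::euclidean_space L2 \<Rightarrow> 'a L2) \<Rightarrow> 'a \<times> 'a \<Rightarrow> complex" where
  "fourier_wigner S z =
     exp (- pi * \<i> * of_real (fst z \<bullet> snd z)) * op_trace (tf_shift (- z) \<circ> S)"

definition wiener_functions :: "('a::euclidean_space \<times> 'a \<Rightarrow> complex) set" where
  "wiener_functions = {a. integrable lborel a \<and> (\<forall>z. symplectic_fourier a z \<noteq> 0)}"

definition wiener_operators :: "('a::euclidean_space L2 \<Rightarrow> 'a L2) set" where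
  "wiener_operators = {S. trace_class S \<and> (\<forall>z. fourier_wigner S z \<noteq> 0)}"

definition C0_functions :: "('b::real_normed_vector \<Rightarrow> complex) set" where
  "C0_functions = {h. continuous_on UNIV h \<and> (h \<longlongrightarrow> 0) at_infinity}"

end

theory Submission
  imports Defs "HOL-Probability.Probability" "HOL-Real_Asymp.Real_Asymp"
    "HOL-Complex_Analysis.Great_Picard"
begin

text \<open>Replacing \<open>R\<close> by \<open>R - A I\<close> one may assume \<open>A = 0\<close>. A trace class operator is an absolutely
  convergent series of rank one operators, so that everything is expressed by the matrix coefficients
  \<open>\<langle>R \<pi>(z) f, \<pi>(z) g\<rangle>\<close>.

  From (i) to (ii): convolve \<open>R \<star> S\<close> with the projection onto a Gaussian window \<open>\<phi>\<close>. By Moyal's identity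
  the result is \<open>R \<star> a\<close> with \<open>a(z) = \<langle>S \<pi>(z) \<phi>, \<pi>(z) \<phi>\<rangle>\<close>, whose Fourier transform is that of \<open>S\<close> times a
  Gaussian; and it is compact because \<open>R \<star> S\<close> vanishes at infinity.

  From (ii) to (2): the functions \<open>g\<close> with \<open>R \<star> g\<close> compact form a closed convolution ideal of \<open>L\<^sup>1\<close>, so
  Wiener's theorem applies. If \<open>a\<close> is in the ideal and its Fourier transform does not vanish, then a
  modulated heat kernel is reached by iterating a division by the Fourier transform of \<open>a\<close> at the
  frequency of modulation, which is accurate for narrow bands; trigonometric polynomials then yield
  an approximate identity.

  From (2) to (1): \<open>\<pi>(z) f\<close> tends weakly to zero, so the matrix coefficients of a compact \<open>R \<star> b\<close> vanish
  at infinity; for \<open>b\<close> an approximate identity they approximate those of \<open>R\<close> uniformly.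
  Finally, the projection onto the window is in \<open>\<W>\<close>, so (1) implies (i).\<close>

subsection \<open>Square-integrable functions\<close>

text \<open>Wiener's theorem is obtained by quantitative approximation in L1, not through a quotient
  Banach algebra. Modulated heat kernels form a convolution semigroup, so the relative errors of
  successive divisions multiply: after \<open>k\<close> steps the distance from the ideal is at most
  \<open>(1/2)^k\<close>, while the time parameter \<open>T\<close> has grown only linearly. Passing
  from the kernel of mass one to a Gaussian of height one costs \<open>sqrt T ^ DIM\<close>, which
  the geometric factor absorbs. The loss must not depend on the trigonometric polynomial multiplied
  with this Gaussian, so frequencies and coefficient sums have to stay bounded along the
  approximation. This singles out the Fejer kernel: integrable, and a pointwise limit of polynomials
  with coefficient sum 1 and a common band. On the operator side compactness is tested on weakly
  null sequences, so that sums, limits and integrals of compact operators reduce to limits of norms.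
  The Gaussian window is chosen because its short-time Fourier transform is integrable, which
  permits the exchange of integrals, because that transform has no zeros, and because the orbit of
  the window is total.\<close>

lemma L2_abs_rep [simp]: "abs_L2 (rep_L2 X) = X"
  using Quotient3_L2 by (rule Quotient3_abs_rep)

lemma square_integrable_rep [simp]: "square_integrable (rep_L2 X)"
proof -
  have "L2_rel (rep_L2 X) (rep_L2 X)"
    using Quotient3_L2 by (rule Quotient3_rep_reflp)
  then show ?thesis by (simp add: L2_rel_def)
qed

lemma borel_measurable_rep_L2 [measurable]: "rep_L2 X \<in> borel_measurable borel"
  using square_integrable_rep[of X] by (simp add: square_integrable_def)

lemma abs_L2_eq_iff:
  "square_integrable f \<Longrightarrow> square_integrable g \<Longrightarrow> abs_L2 f = abs_L2 g \<longleftrightarrow> (AE t in lborel. f t = g t)"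
  using Quotient3_rel[OF Quotient3_L2, of f g] by (simp add: L2_rel_def)

lemma cinner_abs_L2:
  assumes "square_integrable f" "square_integrable g"
  shows "cinner (abs_L2 f) (abs_L2 g) = (\<integral>t. f t * cnj (g t) \<partial>lborel)"
  using assms by (subst cinner.abs_eq) (auto simp: L2_rel_def eq_onp_def)

lemma plus_abs_L2:
  assumes "square_integrable f" "square_integrable g"
  shows "abs_L2 f + abs_L2 g = abs_L2 (\<lambda>t. f t + g t)"
  using assms by (subst plus_L2.abs_eq) (auto simp: L2_rel_def eq_onp_def)

lemma scaleC_abs_L2:
  assumes "square_integrable f"
  shows "c *\<^sub>C abs_L2 f = abs_L2 (\<lambda>t. c * f t)"
  using assms by (subst scaleC_L2.abs_eq) (auto simp: L2_rel_def eq_onp_def)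

lemma uminus_abs_L2:
  assumes "square_integrable f"
  shows "- abs_L2 f = abs_L2 (\<lambda>t. - f t)"
  using assms by (subst uminus_L2.abs_eq) (auto simp: L2_rel_def eq_onp_def)

lemma square_integrable_uminus: "square_integrable f \<Longrightarrow> square_integrable (\<lambda>t. - f t)"
  using square_integrable_scale[of f "-1"] by simp

lemma square_integrable_diff:
  "square_integrable f \<Longrightarrow> square_integrable g \<Longrightarrow> square_integrable (\<lambda>t. f t - g t)"
  using square_integrable_add[of f "\<lambda>t. - g t"] square_integrable_uminus[of g] by simp

lemma minus_abs_L2:
  assumes "square_integrable f" "square_integrable g"
  shows "abs_L2 f - abs_L2 g = abs_L2 (\<lambda>t. f t - g t)"
  unfolding minus_L2_def
  using assms by (simp add: uminus_abs_L2 plus_abs_L2 square_integrable_uminus)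

lemma norm_abs_L2:
  assumes "square_integrable f"
  shows "(norm (abs_L2 f))\<^sup>2 = (\<integral>t. (cmod (f t))\<^sup>2 \<partial>lborel)"
proof -
  have "(norm (abs_L2 f))\<^sup>2 = Re (cinner (abs_L2 f) (abs_L2 f))"
    by (simp add: power2_norm_eq_inner inner_L2_def)
  also have "\<dots> = Re (\<integral>t. of_real ((cmod (f t))\<^sup>2) \<partial>lborel)"
    using assms by (simp add: cinner_abs_L2 complex_mult_cnj cmod_power2)
  also have "\<dots> = (\<integral>t. (cmod (f t))\<^sup>2 \<partial>lborel)"
    by (subst integral_complex_of_real) simp
  finally show ?thesis .
qed

lemma nn_integral_norm_L2:
  assumes "square_integrable f"
  shows "(\<integral>\<^sup>+t. ennreal ((cmod (f t))\<^sup>2) \<partial>lborel) = ennreal ((norm (abs_L2 f))\<^sup>2)"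
  using assms by (subst nn_integral_eq_integral) (auto simp: norm_abs_L2 square_integrable_def)

lemma square_integrable_iff_nn:
  assumes "f \<in> borel_measurable borel"
  shows "square_integrable f \<longleftrightarrow> (\<integral>\<^sup>+t. ennreal ((cmod (f t))\<^sup>2) \<partial>lborel) < \<infinity>"
  using assms by (simp add: square_integrable_def integrable_iff_bounded)

lemma square_integrable_cmod: "square_integrable f \<Longrightarrow> square_integrable (\<lambda>t. complex_of_real (cmod (f t)))"
  by (auto simp: square_integrable_def)

lemma square_integrable_sum:
  "(\<And>i. i \<in> I \<Longrightarrow> square_integrable (f i)) \<Longrightarrow> square_integrable (\<lambda>t. \<Sum>i\<in>I. f i t)"
  by (induction I rule: infinite_finite_induct) (auto simp: square_integrable_zero intro: square_integrable_add)

lemma sum_abs_L2: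
  "(\<And>i. i \<in> I \<Longrightarrow> square_integrable (f i)) \<Longrightarrow> (\<Sum>i\<in>I. abs_L2 (f i)) = abs_L2 (\<lambda>t. \<Sum>i\<in>I. f i t)"
  by (induction I rule: infinite_finite_induct)
    (auto simp: zero_L2_def plus_abs_L2 square_integrable_sum)

text \<open>Riesz-Fischer. The partial sums \<open>G n\<close> of the absolute increments have L2
  norm at most 2, so by monotone convergence their supremum is finite almost everywhere and the
  representatives converge pointwise. Fatou's lemma turns the Cauchy estimate \<open>tail\<close>
  into norm convergence to the pointwise limit.\<close>

lemma L2_fast_Cauchy_convergent:
  fixes X :: "nat \<Rightarrow> 'a::euclidean_space L2"
  assumes fast: "\<And>n. norm (X (Suc n) - X n) \<le> (1/2)^n"
  shows "\<exists>Y. X \<longlonglongrightarrow> Y"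
proof -
  define f where "f n = rep_L2 (X n)" for n
  have sf [simp]: "square_integrable (f n)" for n by (simp add: f_def)
  have [measurable]: "f n \<in> borel_measurable borel" for n by (simp add: f_def)
  have absf: "abs_L2 (f n) = X n" for n by (simp add: f_def)
  have tail: "norm (X m - X n) \<le> 2 * (1/2)^n" if "n \<le> m" for n m
  proof -
    have "norm (X (n + k) - X n) \<le> 2 * (1/2)^n - 2 * (1/2)^(n+k)" for k
    proof (induction k)
      case (Suc k)
      have "norm (X (n + Suc k) - X n) \<le> norm (X (Suc (n + k)) - X (n + k)) + norm (X (n + k) - X n)"
        using norm_triangle_ineq[of "X (Suc (n + k)) - X (n + k)" "X (n + k) - X n"] by simp
      also have "\<dots> \<le> (1/2)^(n+k) + (2 * (1/2)^n - 2 * (1/2)^(n+k))"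
        using Suc fast[of "n + k"] by linarith
      finally show ?case by simp
    qed simp
    from this[of "m - n"] that show ?thesis
      by (smt (verit) le_add_diff_inverse zero_le_power divide_nonneg_nonneg)
  qed
  define d where "d n t = f (Suc n) t - f n t" for n t
  have sd: "square_integrable (d n)" for n
    unfolding d_def by (intro square_integrable_diff sf)
  define G where "G n t = (\<Sum>k<n. cmod (d k t))" for n t
  have [measurable]: "d n \<in> borel_measurable borel" for n unfolding d_def by measurable
  have [measurable]: "G n \<in> borel_measurable borel" for n unfolding G_def by measurable
  have Gbound: "(\<integral>\<^sup>+t. ennreal ((G n t)\<^sup>2) \<partial>lborel) \<le> 4" for n
  proof -
    let ?D = "\<lambda>k. \<lambda>t. complex_of_real (cmod (d k t))"
    have sD: "square_integrable (?D k)" for k by (intro square_integrable_cmod sd)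
    have "norm (abs_L2 (\<lambda>t. \<Sum>k<n. ?D k t)) \<le> (\<Sum>k<n. norm (abs_L2 (?D k)))"
      by (subst sum_abs_L2[symmetric]) (auto intro: norm_sum sD)
    also have "\<dots> \<le> (\<Sum>k<n. (1/2)^k)"
    proof (rule sum_mono)
      fix k
      have "(norm (abs_L2 (?D k)))\<^sup>2 = (norm (abs_L2 (d k)))\<^sup>2"
        by (simp add: norm_abs_L2 sD sd)
      moreover have "abs_L2 (d k) = X (Suc k) - X k"
        unfolding d_def using minus_abs_L2[of "f (Suc k)" "f k"] by (simp add: absf)
      ultimately show "norm (abs_L2 (?D k)) \<le> (1/2)^k" using fast[of k] by simp
    qed
    also have "\<dots> \<le> 2"
    proof -
      have "(\<Sum>k<n. (1/2)^k) = 2 - 2 * (1/2 :: real)^n"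
        by (induction n) (auto simp: field_simps)
      then show ?thesis by simp
    qed
    finally have "(norm (abs_L2 (\<lambda>t. \<Sum>k<n. ?D k t)))\<^sup>2 \<le> 2\<^sup>2"
      by (intro power_mono) auto
    moreover have "(\<integral>\<^sup>+t. ennreal ((G n t)\<^sup>2) \<partial>lborel) = ennreal ((norm (abs_L2 (\<lambda>t. \<Sum>k<n. ?D k t)))\<^sup>2)"
      using nn_integral_norm_L2[OF square_integrable_sum[of "{..<n}" ?D]] sD
      by (simp add: G_def flip: of_real_sum)
    ultimately show ?thesis by (simp add: ennreal_leI flip: ennreal_numeral)
  qed
  have "(\<integral>\<^sup>+t. (SUP n. ennreal ((G n t)\<^sup>2)) \<partial>lborel) = (SUP n. \<integral>\<^sup>+t. ennreal ((G n t)\<^sup>2) \<partial>lborel)"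
    by (rule nn_integral_monotone_convergence_SUP)
      (auto simp: incseq_def le_fun_def G_def intro!: ennreal_leI power_mono sum_mono2 sum_nonneg)
  also have "\<dots> \<le> 4" by (intro SUP_least Gbound)
  finally have "(\<integral>\<^sup>+t. (SUP n. ennreal ((G n t)\<^sup>2)) \<partial>lborel) \<noteq> \<infinity>"
    by (auto simp: top_unique)
  then have "AE t in lborel. (SUP n. ennreal ((G n t)\<^sup>2)) \<noteq> \<infinity>"
    by (intro nn_integral_PInf_AE) auto
  then have conv: "AE t in lborel. convergent (\<lambda>n. f n t)"
  proof eventually_elim
    fix t assume "(SUP n. ennreal ((G n t)\<^sup>2)) \<noteq> \<infinity>"
    then obtain c where c: "c \<ge> 0" "(SUP n. ennreal ((G n t)\<^sup>2)) = ennreal c"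
      by (cases "(SUP n. ennreal ((G n t)\<^sup>2))") auto
    have "ennreal ((G n t)\<^sup>2) \<le> ennreal c" for n
      unfolding c(2)[symmetric] by (rule SUP_upper) simp
    then have "(G n t)\<^sup>2 \<le> c" for n using c(1) by simp
    then have "G n t \<le> sqrt c" for n
      by (simp add: real_le_rsqrt)
    then have "summable (\<lambda>k. cmod (d k t))"
      unfolding G_def by (intro summableI_nonneg_bounded) auto
    then have "summable (\<lambda>k. d k t)" by (rule summable_norm_cancel)
    then have "convergent (\<lambda>n. \<Sum>k<n. d k t)" by (simp add: summable_iff_convergent)
    moreover have "(\<Sum>k<n. d k t) = f n t - f 0 t" for n
      unfolding d_def by (rule sum_lessThan_telescope)
    ultimately have "convergent (\<lambda>n. f n t - f 0 t + f 0 t)"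
      by (intro convergent_add) (auto intro: convergent_const)
    then show "convergent (\<lambda>n. f n t)" by simp
  qed
  \<comment> \<open>\<open>lim\<close> has an unspecified value where the sequence diverges; that
    set is null, and \<open>F\<close> is measurable all the same.\<close>
  define F where "F t = lim (\<lambda>n. f n t)" for t
  have [measurable]: "F \<in> borel_measurable borel"
    unfolding F_def by measurable
  have lim: "AE t in lborel. (\<lambda>n. f n t) \<longlonglongrightarrow> F t"
    using conv by eventually_elim (simp add: F_def convergent_LIMSEQ_iff)
  have dist: "(\<integral>\<^sup>+t. ennreal ((cmod (F t - f n t))\<^sup>2) \<partial>lborel) \<le> ennreal ((2 * (1/2)^n)\<^sup>2)" for n
  proof -
    have "(\<integral>\<^sup>+t. ennreal ((cmod (F t - f n t))\<^sup>2) \<partial>lborel)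
        = (\<integral>\<^sup>+t. liminf (\<lambda>m. ennreal ((cmod (f m t - f n t))\<^sup>2)) \<partial>lborel)"
    proof (rule nn_integral_cong_AE, use lim in eventually_elim)
      fix t assume "(\<lambda>m. f m t) \<longlonglongrightarrow> F t"
      then have "(\<lambda>m. ennreal ((cmod (f m t - f n t))\<^sup>2)) \<longlonglongrightarrow> ennreal ((cmod (F t - f n t))\<^sup>2)"
        by (intro tendsto_ennrealI tendsto_intros)
      then show "ennreal ((cmod (F t - f n t))\<^sup>2) = liminf (\<lambda>m. ennreal ((cmod (f m t - f n t))\<^sup>2))"
        by (rule lim_imp_Liminf[OF sequentially_bot, symmetric])
    qed
    also have "\<dots> \<le> liminf (\<lambda>m. \<integral>\<^sup>+t. ennreal ((cmod (f m t - f n t))\<^sup>2) \<partial>lborel)"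
      by (rule nn_integral_liminf) measurable
    also have "\<dots> \<le> ennreal ((2 * (1/2)^n)\<^sup>2)"
    proof (rule Liminf_le)
      have "\<forall>\<^sub>F m in sequentially. n \<le> m" by (rule eventually_ge_at_top)
      then show "\<forall>\<^sub>F m in sequentially. (\<integral>\<^sup>+t. ennreal ((cmod (f m t - f n t))\<^sup>2) \<partial>lborel) \<le> ennreal ((2 * (1/2)^n)\<^sup>2)"
      proof eventually_elim
        fix m assume "n \<le> m"
        have "(\<integral>\<^sup>+t. ennreal ((cmod (f m t - f n t))\<^sup>2) \<partial>lborel) = ennreal ((norm (X m - X n))\<^sup>2)"
          using nn_integral_norm_L2[OF square_integrable_diff[OF sf sf], of m n] minus_abs_L2[of "f m" "f n"]
          by (simp add: absf)
        also have "\<dots> \<le> ennreal ((2 * (1/2)^n)\<^sup>2)"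
          using tail[OF \<open>n \<le> m\<close>] by (intro ennreal_leI power_mono) auto
        finally show "(\<integral>\<^sup>+t. ennreal ((cmod (f m t - f n t))\<^sup>2) \<partial>lborel) \<le> ennreal ((2 * (1/2)^n)\<^sup>2)" .
      qed
    qed simp
    finally show ?thesis .
  qed
  have sFf: "square_integrable (\<lambda>t. F t - f n t)" for n
    using dist[of n] by (subst square_integrable_iff_nn) (auto intro: le_less_trans)
  have sF: "square_integrable F"
    using square_integrable_add[OF sFf[of 0] sf[of 0]] by simp
  have "norm (X n - abs_L2 F) \<le> 2 * (1/2)^n" for n
  proof -
    have "abs_L2 F - X n = abs_L2 (\<lambda>t. F t - f n t)"
      using minus_abs_L2[OF sF sf, of n] by (simp add: absf)
    then have "ennreal ((norm (abs_L2 F - X n))\<^sup>2) \<le> ennreal ((2 * (1/2)^n)\<^sup>2)"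
      using dist[of n] nn_integral_norm_L2[OF sFf, of n] by simp
    then have "(norm (abs_L2 F - X n))\<^sup>2 \<le> (2 * (1/2)^n)\<^sup>2"
      by (subst (asm) ennreal_le_iff) auto
    then show ?thesis
      by (subst norm_minus_commute) (rule power2_le_imp_le, auto)
  qed
  moreover have "(\<lambda>n. 2 * (1/2)^n :: real) \<longlonglongrightarrow> 0"
    by (intro tendsto_mult_right_zero LIMSEQ_realpow_zero) auto
  ultimately have "(\<lambda>n. X n - abs_L2 F) \<longlonglongrightarrow> 0"
    by (intro Lim_null_comparison[of "\<lambda>n. X n - abs_L2 F" "\<lambda>n. 2 * (1/2)^n"]) auto
  then have "X \<longlonglongrightarrow> abs_L2 F"
    by (rule LIM_zero_cancel)
  then show ?thesis by blast
qed

instance L2 :: (euclidean_space) complete_space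
proof
  fix X :: "nat \<Rightarrow> 'a L2"
  assume X: "Cauchy X"
  have "\<exists>N. \<forall>m\<ge>N. \<forall>n\<ge>N. dist (X m) (X n) < (1/2)^k" for k
    using X unfolding Cauchy_def by (auto dest!: spec[of _ "(1/2)^k"])
  then obtain N where N: "\<And>k m n. m \<ge> N k \<Longrightarrow> n \<ge> N k \<Longrightarrow> dist (X m) (X n) < (1/2)^k"
    by metis
  \<comment> \<open>The sum dominates \<open>N k\<close>, so \<open>r k\<close> lies beyond the
    threshold; the summand \<open>k\<close> makes \<open>r\<close> strictly increasing.\<close>
  define r where "r k = (\<Sum>i\<le>k. N i) + k" for k
  have rN: "N k \<le> r k" for k
    unfolding r_def by (intro trans_le_add1 member_le_sum) auto
  have r: "strict_mono r" unfolding r_def by (intro strict_monoI_Suc) simp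
  have "norm (X (r (Suc n)) - X (r n)) \<le> (1/2)^n" for n
    using N[where k = n and m = "r (Suc n)" and n = "r n"] rN[of n] strict_mono_less[OF r, of n "Suc n"]
    by (simp add: dist_norm)
  then have "\<exists>Y. (X \<circ> r) \<longlonglongrightarrow> Y"
    by (intro L2_fast_Cauchy_convergent) simp
  then show "convergent X"
    using Cauchy_converges_subseq[OF X r] by (auto simp: convergent_def)
qed

instance L2 :: (euclidean_space) banach ..

subsection \<open>The Hilbert space\<close>

lemma cinner_0_left [simp]: "cinner 0 g = 0"
  using cinner_add_left[of 0 0 g] by simp

lemma cinner_minus_left [simp]: "cinner (- f) g = - cinner f g"
  using cinner_add_left[of f "- f" g] by (simp add: eq_neg_iff_add_eq_0 add.commute)

lemma cinner_diff_left: "cinner (f - g) h = cinner f h - cinner g h"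
  using cinner_add_left[of f "- g" h] by simp

lemma cinner_0_right [simp]: "cinner f 0 = 0"
  by (subst cinner_commute) simp

lemma cinner_add_right: "cinner f (g + h) = cinner f g + cinner f h"
  by (subst (1 2 3) cinner_commute) (simp add: cinner_add_left)

lemma cinner_diff_right: "cinner f (g - h) = cinner f g - cinner f h"
  by (subst (1 2 3) cinner_commute) (simp add: cinner_diff_left)

lemma cinner_scaleC_right: "cinner f (c *\<^sub>C g) = cnj c * cinner f g"
  by (subst (1 2) cinner_commute) (simp add: cinner_scaleC_left)

lemma cinner_norm: "cinner f f = complex_of_real ((norm f)\<^sup>2)"
proof -
  obtain r where "r \<ge> 0" "cinner f f = of_real r" using cinner_self by blast
  then show ?thesis by (simp add: power2_norm_eq_inner inner_L2_def)
qed

lemma inner_L2_Re: "inner f g = Re (cinner f g)"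
  by (fact inner_L2_def)

lemma L2_eqI:
  assumes "\<And>h. cinner f h = cinner g h"
  shows "f = g"
proof -
  have "cinner (f - g) (f - g) = 0"
    by (simp add: cinner_diff_left assms)
  then show ?thesis by (simp add: cinner_norm)
qed

lemma scaleC_add_right: "c *\<^sub>C (f + g) = c *\<^sub>C f + c *\<^sub>C g"
  by (rule L2_eqI) (simp add: cinner_add_left cinner_scaleC_left algebra_simps)

lemma scaleC_diff_right: "c *\<^sub>C (f - g) = c *\<^sub>C f - c *\<^sub>C g"
  by (rule L2_eqI) (simp add: cinner_diff_left cinner_scaleC_left algebra_simps)

lemma scaleC_add_left: "(c + d) *\<^sub>C f = c *\<^sub>C f + d *\<^sub>C f"
  by (rule L2_eqI) (simp add: cinner_add_left cinner_scaleC_left algebra_simps)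

lemma scaleC_scaleC [simp]: "c *\<^sub>C d *\<^sub>C f = (c * d) *\<^sub>C f"
  by (rule L2_eqI) (simp add: cinner_scaleC_left)

lemma scaleC_one [simp]: "1 *\<^sub>C f = f"
  by (rule L2_eqI) (simp add: cinner_scaleC_left)

lemma scaleC_0_left [simp]: "0 *\<^sub>C f = 0"
  by (rule L2_eqI) (simp add: cinner_scaleC_left)

lemma scaleR_scaleC: "r *\<^sub>R f = complex_of_real r *\<^sub>C f"
  by (fact scaleR_L2_def)

lemma norm_scaleC [simp]: "norm (c *\<^sub>C f) = cmod c * norm f"
proof -
  have "complex_of_real ((norm (c *\<^sub>C f))\<^sup>2) = of_real ((cmod c * norm f)\<^sup>2)"
    unfolding cinner_norm[symmetric] cinner_scaleC_left cinner_scaleC_right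
    by (simp add: cinner_norm power_mult_distrib complex_norm_square mult.assoc del: of_real_power)
  then have "(norm (c *\<^sub>C f))\<^sup>2 = (cmod c * norm f)\<^sup>2"
    by (simp only: of_real_eq_iff)
  then show ?thesis by simp
qed

lemma cinner_Cauchy_Schwarz: "cmod (cinner f g) \<le> norm f * norm g"
proof -
  \<comment> \<open>A unimodular factor turns the complex inner product into its modulus, so that
    the real Cauchy-Schwarz inequality applies. If the inner product is 0 then so is
    \<open>c\<close>, and the estimates persist.\<close>
  define c where "c = cnj (sgn (cinner f g))"
  have "c * cinner f g = of_real (cmod (cinner f g))"
  proof -
    have "c * cinner f g = (cinner f g * cnj (cinner f g)) / of_real (cmod (cinner f g))"
      by (simp add: c_def sgn_eq)
    then show ?thesis by (simp add: power2_eq_square flip: complex_norm_square)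
  qed
  then have "cmod (cinner f g) = inner (c *\<^sub>C f) g"
    by (simp add: inner_L2_Re cinner_scaleC_left)
  also have "\<dots> \<le> norm (c *\<^sub>C f) * norm g" by (rule norm_cauchy_schwarz)
  also have "\<dots> \<le> norm f * norm g"
    by (intro mult_right_mono) (auto simp: c_def norm_sgn mult_le_cancel_right1)
  finally show ?thesis .
qed

text \<open>Lifts real orthogonality and symmetry to complex ones: the imaginary part is a real
  inner product with the rotated vector.\<close>

lemma cinner_inner: "cinner f g = Complex (inner f g) (inner f (\<i> *\<^sub>C g))"
  by (simp add: complex_eq_iff inner_L2_Re cinner_scaleC_right)

lemma bounded_bilinear_cinner: "bounded_bilinear cinner"
proof (unfold_locales, goal_cases)
  case 5
  show ?case by (rule exI[of _ 1]) (simp add: cinner_Cauchy_Schwarz)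
qed (simp_all add: cinner_add_left cinner_add_right scaleR_scaleC cinner_scaleC_left
      cinner_scaleC_right scaleR_conv_of_real)

lemma bounded_linear_cinner_left: "bounded_linear (\<lambda>f. cinner f g)"
  by (rule bounded_bilinear.bounded_linear_left[OF bounded_bilinear_cinner])

lemmas tendsto_cinner [tendsto_intros] = bounded_bilinear.tendsto[OF bounded_bilinear_cinner]
lemmas continuous_on_cinner [continuous_intros] = bounded_bilinear.continuous_on[OF bounded_bilinear_cinner]
lemmas cinner_sum_left = bounded_bilinear.sum_left[OF bounded_bilinear_cinner]
lemmas cinner_sum_right = bounded_bilinear.sum_right[OF bounded_bilinear_cinner]

lemma bounded_linear_scaleC: "bounded_linear (\<lambda>f. c *\<^sub>C f)"
  by (rule bounded_linear_intro[of _ "cmod c"])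
    (auto simp: scaleC_add_right scaleR_scaleC mult.commute)

lemma bounded_clinearI:
  assumes "\<And>f g. R (f + g) = R f + R g" "\<And>c f. R (c *\<^sub>C f) = c *\<^sub>C R f"
    and "\<And>f. norm (R f) \<le> C * norm f"
  shows "bounded_clinear R"
  unfolding bounded_clinear_def
  using assms by (auto simp: scaleR_scaleC mult.commute intro!: bounded_linear_intro[of _ C])

lemma bounded_clinearD:
  assumes "bounded_clinear R"
  shows "R (f + g) = R f + R g" "R (f - g) = R f - R g" "R (c *\<^sub>C f) = c *\<^sub>C R f"
    "R 0 = 0" "bounded_linear R" "norm (R f) \<le> onorm R * norm f"
  using assms
  by (auto simp: bounded_clinear_def linear_simps onorm)

lemma bounded_clinear_bound:
  assumes "bounded_clinear R"
  obtains C where "C \<ge> 0" "\<And>f. norm (R f) \<le> C * norm f"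
  using bounded_clinearD(5,6)[OF assms] onorm_pos_le by blast

lemma bounded_clinear_compose:
  assumes "bounded_clinear R" "bounded_clinear S"
  shows "bounded_clinear (R \<circ> S)"
  using assms unfolding bounded_clinear_def o_def by (auto intro: bounded_linear_compose)

lemma bounded_clinear_diff:
  assumes "bounded_clinear R" "bounded_clinear S"
  shows "bounded_clinear (\<lambda>f. R f - S f)"
  using assms unfolding bounded_clinear_def
  by (auto intro: bounded_linear_sub simp: scaleC_diff_right)

lemma bounded_clinear_scaleC: "bounded_clinear (\<lambda>f. c *\<^sub>C f)"
  unfolding bounded_clinear_def by (simp add: bounded_linear_scaleC mult.commute)

section \<open>Orthogonal projection, Riesz representation and adjoints\<close>

text \<open>A minimising sequence is Cauchy by the parallelogram law, its limit realises the
  distance, and a residue not orthogonal to \<open>S\<close> could be shortened. The real form is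
  enough: for a complex subspace, testing \<open>\<i> *\<^sub>C s\<close> as well gives complex
  orthogonality.\<close>

lemma hilbert_projection:
  fixes S :: "'h::{real_inner,complete_space} set"
  assumes S: "subspace S" "closed S"
  shows "\<exists>p\<in>S. \<forall>s\<in>S. inner (x - p) s = 0"
proof -
  define d where "d = infdist x S"
  have ne: "S \<noteq> {}" using subspace_0[OF S(1)] by auto
  have "\<exists>s\<in>S. dist x s < d + 1 / Suc n" for n
  proof -
    have "(INF a\<in>S. dist x a) < d + 1 / Suc n" using ne by (simp add: d_def infdist_notempty)
    then show ?thesis using ne by (subst (asm) cINF_less_iff) (auto intro: bdd_belowI2[of _ 0])
  qed
  then obtain s where s: "\<And>n. s n \<in> S" "\<And>n. dist x (s n) < d + 1 / Suc n" by metis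
  have dle: "d \<le> norm (x - u)" if "u \<in> S" for u
    using infdist_le[OF that, of x] by (simp add: d_def dist_norm)
  have d0: "d \<ge> 0" by (simp add: d_def infdist_nonneg)
  have par: "(norm (s m - s n))\<^sup>2 \<le> 4 * (2 * d + 1) / Suc N" if "N \<le> m" "N \<le> n" for m n N
  proof -
    define a b where "a = x - s m" and "b = x - s n"
    \<comment> \<open>The midpoint of two points of \<open>S\<close> is in \<open>S\<close>, hence
      at distance at least \<open>d\<close> from \<open>x\<close>; this bounds \<open>a + b\<close>
      from below in the parallelogram law.\<close>
    have h: "(1/2) *\<^sub>R (s m + s n) \<in> S" using s(1) S(1) by (intro subspace_scale subspace_add) auto
    have ab: "a + b = 2 *\<^sub>R (x - (1/2) *\<^sub>R (s m + s n))"
      by (simp add: a_def b_def algebra_simps scaleR_2)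
    have "(norm (s m - s n))\<^sup>2 = (norm (b - a))\<^sup>2"
      by (simp add: a_def b_def)
    also have "\<dots> = 2 * (norm a)\<^sup>2 + 2 * (norm b)\<^sup>2 - (norm (a + b))\<^sup>2"
      unfolding power2_norm_eq_inner by (simp add: inner_simps inner_commute algebra_simps)
    also have "(norm (a + b))\<^sup>2 = 4 * (norm (x - (1/2) *\<^sub>R (s m + s n)))\<^sup>2"
      unfolding ab by (simp add: power_mult_distrib)
    also have "2 * (norm a)\<^sup>2 + 2 * (norm b)\<^sup>2 - 4 * (norm (x - (1/2) *\<^sub>R (s m + s n)))\<^sup>2
        \<le> 2 * (d + 1 / Suc N)\<^sup>2 + 2 * (d + 1 / Suc N)\<^sup>2 - 4 * d\<^sup>2"
    proof -
      have "1 / real (Suc m) \<le> 1 / Suc N" "1 / real (Suc n) \<le> 1 / Suc N"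
        using that by (auto intro!: divide_left_mono)
      then have "norm a \<le> d + 1 / Suc N" "norm b \<le> d + 1 / Suc N"
        using s(2)[of m] s(2)[of n] by (simp_all add: a_def b_def dist_norm)
      then have "(norm a)\<^sup>2 \<le> (d + 1 / Suc N)\<^sup>2" "(norm b)\<^sup>2 \<le> (d + 1 / Suc N)\<^sup>2"
        by (auto intro!: power_mono)
      moreover have "d\<^sup>2 \<le> (norm (x - (1/2) *\<^sub>R (s m + s n)))\<^sup>2"
        using dle[OF h] d0 by (intro power_mono)
      ultimately show ?thesis by linarith
    qed
    also have "\<dots> = 4 * (2 * d + 1 / Suc N) * (1 / Suc N)"
      by (simp add: power2_eq_square algebra_simps)
    also have "\<dots> \<le> 4 * (2 * d + 1) * (1 / Suc N)"
      by (intro mult_right_mono mult_left_mono add_left_mono) auto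
    finally show ?thesis by simp
  qed
  have "Cauchy s"
  proof (rule metric_CauchyI)
    fix e :: real assume "e > 0"
    define c where "c = 4 * (2 * d + 1)"
    have "c > 0" using d0 by (simp add: c_def)
    obtain N where N: "c / e\<^sup>2 < real N" using reals_Archimedean2 by blast
    have "dist (s m) (s n) < e" if "m \<ge> N" "n \<ge> N" for m n
    proof -
      have "c / Suc N < e\<^sup>2" using N \<open>e > 0\<close> \<open>c > 0\<close>
        by (simp add: field_simps) (smt (verit) zero_less_power)
      then have "(norm (s m - s n))\<^sup>2 < e\<^sup>2" using par[OF that] by (simp add: c_def)
      then show ?thesis using \<open>e > 0\<close> by (simp add: dist_norm power2_less_imp_less)
    qed
    then show "\<exists>M. \<forall>m\<ge>M. \<forall>n\<ge>M. dist (s m) (s n) < e" by blast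
  qed
  then obtain p where p: "s \<longlonglongrightarrow> p" using Cauchy_convergent convergent_def by blast
  have pS: "p \<in> S" using closed_sequentially[OF S(2)] s(1) p by blast
  have "(\<lambda>n. d + 1 / Suc n) \<longlonglongrightarrow> d + 0"
    by (intro tendsto_add tendsto_const lim_1_over_n LIMSEQ_Suc[of "\<lambda>n. 1 / real n"])
  moreover have "(\<lambda>n. dist x (s n)) \<longlonglongrightarrow> dist x p" by (intro tendsto_intros p)
  ultimately have xp: "norm (x - p) \<le> d"
    using s(2) by (auto intro!: LIMSEQ_le simp: less_imp_le dist_norm)
  have "inner (x - p) u = 0" if u: "u \<in> S" for u
  proof (rule ccontr)
    assume nz: "inner (x - p) u \<noteq> 0"
    then have u0: "inner u u > 0" by auto
    \<comment> \<open>The minimiser of the quadratic in \<open>t\<close>: subtracting this multiple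
      of \<open>u\<close> would bring \<open>x\<close> closer to \<open>S\<close> than
      \<open>d\<close>.\<close>
    define t where "t = inner (x - p) u / inner u u"
    have "p + t *\<^sub>R u \<in> S" using pS u S(1) by (intro subspace_add subspace_scale)
    then have "d \<le> norm (x - p - t *\<^sub>R u)" using dle by (simp add: diff_diff_add)
    then have "(norm (x - p))\<^sup>2 \<le> (norm (x - p - t *\<^sub>R u))\<^sup>2"
      using xp by (intro power_mono) auto
    also have "\<dots> = (norm (x - p))\<^sup>2 - 2 * t * inner (x - p) u + t * t * inner u u"
      unfolding power2_norm_eq_inner by (simp add: inner_diff_left inner_diff_right inner_commute algebra_simps)
    also have "\<dots> = (norm (x - p))\<^sup>2 - (inner (x - p) u)\<^sup>2 / inner u u"
      using u0 by (simp add: t_def power2_eq_square)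
    finally have "(inner (x - p) u)\<^sup>2 / inner u u \<le> 0" by simp
    then show False using nz u0 by (simp add: divide_le_0_iff)
  qed
  then show ?thesis using pS by blast
qed

text \<open>The orthogonal complement of the kernel is a line. It is spanned by the residue
  \<open>w\<close> of any vector outside the kernel, and rescaling \<open>w\<close> gives the
  representing vector.\<close>

lemma riesz_representation_real:
  fixes \<phi> :: "'h::{real_inner,complete_space} \<Rightarrow> real"
  assumes "bounded_linear \<phi>"
  shows "\<exists>y. \<forall>x. \<phi> x = inner x y"
proof (cases "\<forall>x. \<phi> x = 0")
  case False
  then obtain x where x: "\<phi> x \<noteq> 0" by blast
  interpret bounded_linear \<phi> by fact
  let ?S = "{x. \<phi> x = 0}"
  have "subspace ?S" by (auto simp: subspace_def add scaleR zero)
  moreover have "closed ?S"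
    by (intro closed_Collect_eq continuous_intros linear_continuous_on assms)
  ultimately obtain p where p: "\<phi> p = 0" "\<And>s. \<phi> s = 0 \<Longrightarrow> inner (x - p) s = 0"
    using hilbert_projection[of ?S x] by auto
  define w where "w = x - p"
  have w: "\<phi> w = \<phi> x" by (simp add: w_def diff p)
  then have w0: "inner w w \<noteq> 0" using x zero by auto
  have "\<phi> v = inner v ((\<phi> w / inner w w) *\<^sub>R w)" for v
  proof -
    have "\<phi> (v - (\<phi> v / \<phi> w) *\<^sub>R w) = 0" using w x by (simp add: diff scaleR)
    then have "inner w (v - (\<phi> v / \<phi> w) *\<^sub>R w) = 0" using p(2) by (simp add: w_def)
    then have "inner w v = (\<phi> v / \<phi> w) * inner w w" by (simp add: inner_diff_right)
    then show ?thesis using w w0 x by (simp add: inner_commute[of v])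
  qed
  then show ?thesis by blast
qed (auto intro: exI[of _ 0])

lemma riesz_representation:
  fixes \<phi> :: "'a::euclidean_space L2 \<Rightarrow> complex"
  assumes "\<And>f g. \<phi> (f + g) = \<phi> f + \<phi> g" "\<And>c f. \<phi> (c *\<^sub>C f) = c * \<phi> f"
    and "\<And>f. cmod (\<phi> f) \<le> C * norm f"
  shows "\<exists>y. \<forall>f. \<phi> f = cinner f y"
proof -
  have "bounded_linear (\<lambda>f. Re (\<phi> f))"
    using assms(1,2) order.trans[OF abs_Re_le_cmod assms(3)]
    by (intro bounded_linear_intro[of _ C]) (auto simp: scaleR_scaleC mult.commute)
  then obtain y where y: "\<And>f. Re (\<phi> f) = inner f y"
    using riesz_representation_real by blast
  have "\<phi> f = cinner f y" for f
    using y[of f] y[of "\<i> *\<^sub>C f"] by (simp add: complex_eq_iff inner_L2_Re cinner_scaleC_left assms(2))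
  then show ?thesis by blast
qed

text \<open>The common source of operators given by forms: adjoints, weak integrals and the
  localisation operator in \<open>compact_conv_op_fun_berezin\<close>. Riesz representation is
  applied to the conjugated form because the form is conjugate linear in \<open>g\<close>.\<close>

lemma sesquilinear_operator:
  fixes B :: "'a::euclidean_space L2 \<Rightarrow> 'a L2 \<Rightarrow> complex"
  assumes "\<And>f f' g. B (f + f') g = B f g + B f' g" "\<And>c f g. B (c *\<^sub>C f) g = c * B f g"
    and "\<And>f g g'. B f (g + g') = B f g + B f g'" "\<And>c f g. B f (c *\<^sub>C g) = cnj c * B f g"
    and bound: "\<And>f g. cmod (B f g) \<le> C * norm f * norm g"
  shows "\<exists>T. bounded_clinear T \<and> (\<forall>f g. cinner (T f) g = B f g)"
proof -
  have "\<exists>y. \<forall>g. cnj (B f g) = cinner g y" for f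
    using assms(3,4) bound[of f]
    by (intro riesz_representation[where C = "C * norm f"]) auto
  then obtain T where "\<And>f g. cnj (B f g) = cinner g (T f)" by metis
  then have T: "cinner (T f) g = B f g" for f g
    by (subst cinner_commute) (metis complex_cnj_cnj)
  have "norm (T f) \<le> C * norm f" for f
  proof (cases "T f = 0")
    case True
    \<comment> \<open>\<open>C\<close> comes without a sign; the bound on the diagonal forces it to
      be nonnegative as soon as there is a nonzero vector.\<close>
    have "0 \<le> C * norm f" if "norm f > 0"
      using bound[of f f] that by (smt (verit) norm_ge_zero zero_le_mult_iff)
    then show ?thesis using True by (cases "f = 0") auto
  next
    case False
    have "norm (T f) * norm (T f) = cmod (cinner (T f) (T f))"
      by (simp add: cinner_norm norm_power power2_eq_square norm_mult)
    also have "\<dots> \<le> C * norm f * norm (T f)" unfolding T by (rule bound)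
    finally show ?thesis using False by simp
  qed
  then have "bounded_clinear T"
    by (intro bounded_clinearI[where C = C] L2_eqI)
      (auto simp: cinner_add_left cinner_scaleC_left T assms)
  with T show ?thesis by blast
qed

lemma ex_cadjoint:
  assumes "bounded_clinear R"
  shows "\<exists>T. bounded_clinear T \<and> (\<forall>f g. cinner (R f) g = cinner f (T g))"
proof -
  obtain C where C: "C \<ge> 0" "\<And>f. norm (R f) \<le> C * norm f" using bounded_clinear_bound[OF assms] by metis
  have "cmod (cinner f (R g)) \<le> C * norm f * norm g" for f g
    using cinner_Cauchy_Schwarz[of f "R g"] mult_left_mono[OF C(2)[of g] norm_ge_zero[of f]]
    by (simp add: algebra_simps)
  then obtain T where "bounded_clinear T" "\<And>f g. cinner (T f) g = cinner f (R g)"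
    using sesquilinear_operator[of "\<lambda>f g. cinner f (R g)" C] bounded_clinearD[OF assms]
    by (auto simp: cinner_add_left cinner_add_right cinner_scaleC_left cinner_scaleC_right)
  then show ?thesis by (metis cinner_commute)
qed

lemma cadjoint_eqI:
  assumes "\<And>f g. cinner (R f) g = cinner f (T g)"
  shows "cadjoint R = T"
  unfolding cadjoint_def
proof (rule the_equality)
  fix T' assume T': "\<forall>f g. cinner (R f) g = cinner f (T' g)"
  show "T' = T"
    by (intro ext L2_eqI) (metis T' assms cinner_commute)
qed (use assms in blast)

lemma cadjoint:
  assumes "bounded_clinear R"
  shows "bounded_clinear (cadjoint R)" "cinner (R f) g = cinner f (cadjoint R g)"
proof -
  obtain T where T: "bounded_clinear T" "\<forall>f g. cinner (R f) g = cinner f (T g)"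
    using ex_cadjoint[OF assms] by blast
  then have "cadjoint R = T" by (intro cadjoint_eqI) auto
  with T show "bounded_clinear (cadjoint R)" "cinner (R f) g = cinner f (cadjoint R g)" by auto
qed

text \<open>The density principle behind most later extensions: a property defining a closed complex
  subspace holds for all vectors once those having it are total. The residue of the projection is
  orthogonal to the subspace, hence 0.\<close>

lemma closed_csubspace_total:
  fixes C :: "'a::euclidean_space L2 set"
  assumes "closed C" "0 \<in> C" "\<And>f g. f \<in> C \<Longrightarrow> g \<in> C \<Longrightarrow> f + g \<in> C"
    "\<And>c f. f \<in> C \<Longrightarrow> c *\<^sub>C f \<in> C"
    and total: "\<And>f. (\<And>g. g \<in> C \<Longrightarrow> cinner f g = 0) \<Longrightarrow> f = 0"
  shows "f \<in> C"
proof -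
  have "subspace C" using assms by (auto simp: subspace_def scaleR_scaleC)
  then obtain p where p: "p \<in> C" "\<And>s. s \<in> C \<Longrightarrow> inner (f - p) s = 0"
    using hilbert_projection[of C f] \<open>closed C\<close> by blast
  have "cinner (f - p) g = 0" if "g \<in> C" for g
    using p(2)[OF that] p(2)[OF assms(4)[OF that, of \<i>]] by (simp add: cinner_inner zero_complex.ctr)
  then have "f - p = 0" by (rule total)
  then show ?thesis using p(1) by simp
qed

subsection \<open>Orthonormal bases and the trace\<close>

definition orthonormal :: "'a::euclidean_space L2 set \<Rightarrow> bool" where
  "orthonormal E \<longleftrightarrow> (\<forall>e\<in>E. \<forall>e'\<in>E. cinner e e' = (if e = e' then 1 else 0))"

lemma orthonormalD: "orthonormal E \<Longrightarrow> e \<in> E \<Longrightarrow> e' \<in> E \<Longrightarrow> cinner e e' = (if e = e' then 1 else 0)"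
  by (auto simp: orthonormal_def)

lemma orthonormal_subset: "orthonormal E \<Longrightarrow> Y \<subseteq> E \<Longrightarrow> orthonormal Y"
  using orthonormalD[of E] by (simp add: orthonormal_def[of Y] subset_iff)

lemma has_sum_metric:
  "(f has_sum l) A \<longleftrightarrow> (\<forall>\<epsilon>>0. \<exists>X. finite X \<and> X \<subseteq> A \<and>
     (\<forall>Y. finite Y \<and> X \<subseteq> Y \<and> Y \<subseteq> A \<longrightarrow> dist (sum f Y) l < \<epsilon>))"
  unfolding has_sum_def tendsto_iff eventually_finite_subsets_at_top ..

lemma is_onb_orthonormal: "is_onb E \<Longrightarrow> orthonormal E"
  by (auto simp: is_onb_def orthonormal_def)

text \<open>Zorn's lemma for orthonormal sets under inclusion; a nonzero vector orthogonal to a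
  maximal one could be normalised and added. Prescribing \<open>E\<^sub>0\<close> gives a basis
  through a given unit vector, as in \<open>rank_one_trace_class\<close>.\<close>

lemma orthonormal_extend:
  fixes E\<^sub>0 :: "'a::euclidean_space L2 set"
  assumes "orthonormal E\<^sub>0"
  shows "\<exists>E. E\<^sub>0 \<subseteq> E \<and> is_onb E"
proof -
  let ?A = "{E. E\<^sub>0 \<subseteq> E \<and> orthonormal E}"
  have "\<exists>M\<in>?A. \<forall>X\<in>?A. M \<subseteq> X \<longrightarrow> X = M"
  proof (rule subset_Zorn_nonempty)
    show "?A \<noteq> {}" using assms by auto
    fix C assume C: "C \<noteq> {}" "subset.chain ?A C"
    then have CA: "C \<subseteq> ?A" by (auto simp: subset_chain_def)
    moreover have "orthonormal (\<Union>C)"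
      unfolding orthonormal_def
    proof (intro ballI)
      fix e e' assume "e \<in> \<Union>C" "e' \<in> \<Union>C"
      then obtain X Y where XY: "X \<in> C" "Y \<in> C" "e \<in> X" "e' \<in> Y" by blast
      then have "X \<subseteq> Y \<or> Y \<subseteq> X" using C(2) by (auto simp: subset_chain_def)
      then obtain Z where "Z \<in> C" "e \<in> Z" "e' \<in> Z" using XY by blast
      moreover from this have "orthonormal Z" using CA by auto
      ultimately show "cinner e e' = (if e = e' then 1 else 0)" by (simp add: orthonormalD)
    qed
    ultimately show "\<Union>C \<in> ?A" using C(1) by blast
  qed
  then obtain M where M: "E\<^sub>0 \<subseteq> M" "orthonormal M"
    and max: "\<And>X. orthonormal X \<Longrightarrow> M \<subseteq> X \<Longrightarrow> X = M" by auto
  have "f = 0" if f: "\<forall>e\<in>M. cinner f e = 0" for f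
  proof (rule ccontr)
    assume "f \<noteq> 0"
    define g where "g = complex_of_real (1 / norm f) *\<^sub>C f"
    have "norm g = 1" using \<open>f \<noteq> 0\<close> by (simp add: g_def norm_divide)
    then have gg: "cinner g g = 1" by (simp add: cinner_norm)
    have ge: "cinner g e = 0" if "e \<in> M" for e using f that by (simp add: g_def cinner_scaleC_left)
    then have eg: "cinner e g = 0" if "e \<in> M" for e using that cinner_commute[of e g] by simp
    have "orthonormal (insert g M)"
      using M(2) gg ge eg unfolding orthonormal_def by auto
    then have "g \<in> M" using max[of "insert g M"] by auto
    then show False using ge gg by force
  qed
  then have "is_onb M" using M(2) unfolding is_onb_def orthonormal_def by blast
  with M(1) show ?thesis by blast
qed

lemma ex_is_onb: "\<exists>E :: 'a::euclidean_space L2 set. is_onb E"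
  using orthonormal_extend[of "{}"] by (auto simp: orthonormal_def)

lemma orthonormal_proj:
  fixes F :: "'a::euclidean_space L2 set"
  assumes "orthonormal F" "finite F"
  shows "(norm (f - (\<Sum>e\<in>F. cinner f e *\<^sub>C e)))\<^sup>2 = (norm f)\<^sup>2 - (\<Sum>e\<in>F. (cmod (cinner f e))\<^sup>2)"
    and "(norm (\<Sum>e\<in>F. cinner f e *\<^sub>C e))\<^sup>2 = (\<Sum>e\<in>F. (cmod (cinner f e))\<^sup>2)"
proof -
  define p where "p = (\<Sum>e\<in>F. cinner f e *\<^sub>C e)"
  let ?s = "\<Sum>e\<in>F. (cmod (cinner f e))\<^sup>2"
  have pe: "cinner p e = cinner f e" if "e \<in> F" for e
  proof -
    have "cinner p e = (\<Sum>e'\<in>F. cinner f e' * (if e' = e then 1 else 0))"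
      unfolding p_def cinner_sum_left cinner_scaleC_left
      by (intro sum.cong refl) (use assms(1) that in \<open>auto simp: orthonormalD\<close>)
    then show ?thesis using that assms(2) by (simp add: if_distrib cong: if_cong)
  qed
  have xp: "cinner x p = (\<Sum>e\<in>F. cnj (cinner f e) * cinner x e)" for x
    unfolding p_def cinner_sum_right cinner_scaleC_right ..
  have fp: "cinner f p = of_real ?s"
    by (simp add: xp complex_norm_square mult.commute del: of_real_power)
  have pp: "cinner p p = of_real ?s"
    unfolding xp by (simp add: pe complex_norm_square mult.commute del: of_real_power)
  have pf: "cinner p f = of_real ?s"
    using cinner_commute[of p f] fp by simp
  show "(norm p)\<^sup>2 = ?s"
    using pp unfolding cinner_norm of_real_eq_iff .
  have "complex_of_real ((norm (f - p))\<^sup>2) = of_real ((norm f)\<^sup>2 - ?s)"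
    unfolding cinner_norm[symmetric] cinner_diff_left cinner_diff_right fp pp pf
    by (simp add: cinner_norm)
  then show "(norm (f - p))\<^sup>2 = (norm f)\<^sup>2 - ?s"
    unfolding of_real_eq_iff .
qed

lemma bessel:
  assumes "orthonormal F" "finite F"
  shows "(\<Sum>e\<in>F. (cmod (cinner f e))\<^sup>2) \<le> (norm f)\<^sup>2"
  using orthonormal_proj(1)[OF assms, of f] by (smt (verit) zero_le_power2)

text \<open>The vectors with a convergent expansion contain the basis, which is total, and form a
  closed subspace: by Bessel the finite partial sums are contractions, uniformly in the finite index
  set.\<close>

lemma onb_has_sum:
  fixes E :: "'a::euclidean_space L2 set"
  assumes E: "is_onb E"
  shows "((\<lambda>e. cinner f e *\<^sub>C e) has_sum f) E"
proof -
  have on: "orthonormal E" using E by (rule is_onb_orthonormal)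
  let ?C = "{f. ((\<lambda>e. cinner f e *\<^sub>C e) has_sum f) E}"
  have EC: "e \<in> ?C" if "e \<in> E" for e
  proof -
    have "((\<lambda>e'. cinner e e' *\<^sub>C e') has_sum e) E"
      by (rule has_sum_finite_neutralI[where B = "{e}"]) (use that on in \<open>auto simp: orthonormalD\<close>)
    then show ?thesis by simp
  qed
  have "f \<in> ?C"
  proof (rule closed_csubspace_total)
    show "closed ?C"
    proof (unfold closed_sequential_limits, intro allI impI, elim conjE)
      fix X g assume X: "\<forall>n. X n \<in> ?C" and lim: "X \<longlonglongrightarrow> g"
      show "g \<in> ?C"
        unfolding mem_Collect_eq has_sum_metric
      proof (intro allI impI)
        fix \<epsilon> :: real assume "\<epsilon> > 0"
        then obtain n where n: "norm (X n - g) < \<epsilon> / 3"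
          using LIMSEQ_D[OF lim, of "\<epsilon> / 3"] by auto
        have "((\<lambda>e. cinner (X n) e *\<^sub>C e) has_sum X n) E" using X by auto
        then obtain F where F: "finite F" "F \<subseteq> E"
          and F': "\<And>Y. finite Y \<Longrightarrow> F \<subseteq> Y \<Longrightarrow> Y \<subseteq> E \<Longrightarrow> dist (\<Sum>e\<in>Y. cinner (X n) e *\<^sub>C e) (X n) < \<epsilon> / 3"
          unfolding has_sum_metric using \<open>\<epsilon> > 0\<close> by (metis zero_less_divide_iff zero_less_numeral)
        have "dist (\<Sum>e\<in>Y. cinner g e *\<^sub>C e) g < \<epsilon>" if Y: "finite Y" "F \<subseteq> Y" "Y \<subseteq> E" for Y
        proof -
          have onY: "orthonormal Y" using on Y(3) by (rule orthonormal_subset)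
          have "(norm (\<Sum>e\<in>Y. cinner (X n - g) e *\<^sub>C e))\<^sup>2 \<le> (norm (X n - g))\<^sup>2"
            using bessel[OF onY Y(1)] orthonormal_proj(2)[OF onY Y(1)] by simp
          then have 1: "norm (\<Sum>e\<in>Y. cinner (X n - g) e *\<^sub>C e) < \<epsilon> / 3"
            using n by (meson le_less_trans norm_ge_zero power2_le_imp_le)
          have 2: "(\<Sum>e\<in>Y. cinner g e *\<^sub>C e) - g
             = ((\<Sum>e\<in>Y. cinner (X n) e *\<^sub>C e) - X n) + (X n - g) - (\<Sum>e\<in>Y. cinner (X n - g) e *\<^sub>C e)"
          proof -
            have "cinner (X n - g) e *\<^sub>C e = cinner (X n) e *\<^sub>C e - cinner g e *\<^sub>C e" for e
              by (rule L2_eqI) (simp add: cinner_diff_left cinner_scaleC_left algebra_simps)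
            then show ?thesis by (simp add: sum_subtractf)
          qed
          have "norm ((\<Sum>e\<in>Y. cinner g e *\<^sub>C e) - g) \<le>
            norm ((\<Sum>e\<in>Y. cinner (X n) e *\<^sub>C e) - X n) + norm (X n - g) + norm (\<Sum>e\<in>Y. cinner (X n - g) e *\<^sub>C e)"
            unfolding 2
            by (rule order_trans[OF norm_triangle_ineq4], rule add_right_mono, rule norm_triangle_ineq)
          with 1 n F'[OF Y] show ?thesis by (simp add: dist_norm)
        qed
        with F show "\<exists>X. finite X \<and> X \<subseteq> E \<and> (\<forall>Y. finite Y \<and> X \<subseteq> Y \<and> Y \<subseteq> E \<longrightarrow> dist (\<Sum>e\<in>Y. cinner g e *\<^sub>C e) g < \<epsilon>)"
          by (intro exI[of _ F]) auto
      qed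
    qed
    show "0 \<in> ?C" by (simp add: has_sum_0)
    show "f + g \<in> ?C" if "f \<in> ?C" "g \<in> ?C" for f g
    proof -
      have "((\<lambda>e. cinner f e *\<^sub>C e) has_sum f) E" "((\<lambda>e. cinner g e *\<^sub>C e) has_sum g) E"
        using that by simp_all
      from has_sum_add[OF this] show ?thesis by (simp add: cinner_add_left scaleC_add_left)
    qed
    show "c *\<^sub>C f \<in> ?C" if "f \<in> ?C" for c f
    proof -
      have "((\<lambda>e. cinner f e *\<^sub>C e) has_sum f) E" using that by simp
      from has_sum_bounded_linear[OF bounded_linear_scaleC[of c] this] show ?thesis
        by (simp add: cinner_scaleC_left o_def)
    qed
    show "h = 0" if "\<And>g. g \<in> ?C \<Longrightarrow> cinner h g = 0" for h
      using E that EC unfolding is_onb_def by blast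
  qed
  then show ?thesis by simp
qed

lemma parseval:
  assumes "is_onb E"
  shows "((\<lambda>e. cinner f e * cinner e g) has_sum cinner f g) E"
  using has_sum_bounded_linear[OF bounded_linear_cinner_left onb_has_sum[OF assms], of f g]
  by (simp add: o_def cinner_scaleC_left)

lemma orthonormal_sum_mult_le:
  assumes "orthonormal F" "finite F"
  shows "(\<Sum>e\<in>F. cmod (cinner f e) * cmod (cinner e g)) \<le> norm f * norm g"
proof -
  have "(\<Sum>e\<in>F. cmod (cinner f e) * cmod (cinner g e)) \<le> L2_set (\<lambda>e. cmod (cinner f e)) F * L2_set (\<lambda>e. cmod (cinner g e)) F"
    using L2_set_mult_ineq[of "\<lambda>e. cmod (cinner f e)" "\<lambda>e. cmod (cinner g e)" F] by simp
  also have "\<dots> \<le> norm f * norm g"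
    unfolding L2_set_def using bessel[OF assms]
    by (intro mult_mono) (auto intro: real_le_lsqrt simp: sum_nonneg)
  moreover have "cmod (cinner g e) = cmod (cinner e g)" for e
    by (subst cinner_commute) simp
  ultimately show ?thesis by simp
qed

text \<open>The series of rank one operators \<open>f \<mapsto> cinner f (v n) *\<^sub>C u n\<close>, taken weakly.\<close>

definition nuclear_rep :: "('a::euclidean_space L2 \<Rightarrow> 'a L2) \<Rightarrow> (nat \<Rightarrow> 'a L2) \<Rightarrow> (nat \<Rightarrow> 'a L2) \<Rightarrow> bool" where
  "nuclear_rep T u v \<longleftrightarrow> summable (\<lambda>n. norm (u n) * norm (v n)) \<and>
     (\<forall>f g. (\<lambda>n. cinner f (v n) * cinner (u n) g) sums cinner (T f) g)"

lemma nuclear_rep_summable: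
  assumes "nuclear_rep T u v"
  shows "summable (\<lambda>n. cmod (cinner (u n) (v n)))"
proof (rule summable_comparison_test')
  show "summable (\<lambda>n. norm (u n) * norm (v n))" using assms by (simp add: nuclear_rep_def)
qed (simp add: cinner_Cauchy_Schwarz)

text \<open>Justifies the choice of a basis by \<open>SOME\<close> in \<open>op_trace\<close>.
  Expanding in any orthonormal basis gives an absolutely summable double family, by Bessel and
  Cauchy-Schwarz; after interchanging the sums, Parseval removes the basis.\<close>

lemma op_trace_nuclear:
  fixes T :: "'a::euclidean_space L2 \<Rightarrow> 'a L2"
  assumes T: "nuclear_rep T u v"
  shows "(\<lambda>n. cinner (u n) (v n)) sums op_trace T"
proof -
  define E where "E = (SOME E :: 'a L2 set. is_onb E)"
  have E: "is_onb E" unfolding E_def by (rule someI_ex[OF ex_is_onb])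
  have on: "orthonormal E" using E by (rule is_onb_orthonormal)
  define F where "F n e = cinner (u n) e * cinner e (v n)" for n e
  have nE: "(\<lambda>e. norm (F n e)) summable_on E" "infsum (\<lambda>e. norm (F n e)) E \<le> norm (u n) * norm (v n)" for n
  proof -
    have b: "(\<Sum>e\<in>Y. norm (F n e)) \<le> norm (u n) * norm (v n)" if "finite Y" "Y \<subseteq> E" for Y
    proof -
      have "orthonormal Y" using on that(2) by (rule orthonormal_subset)
      from orthonormal_sum_mult_le[OF this that(1)] show ?thesis by (simp add: F_def norm_mult)
    qed
    show s: "(\<lambda>e. norm (F n e)) summable_on E"
      by (rule nonneg_bounded_partial_sums_imp_summable_on[where C = "norm (u n) * norm (v n)"])
        (use b in \<open>auto intro!: eventually_finite_subsets_at_top_weakI\<close>)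
    show "infsum (\<lambda>e. norm (F n e)) E \<le> norm (u n) * norm (v n)"
      by (rule infsum_le_finite_sums[OF s]) (use b in auto)
  qed
  have suv: "(\<lambda>n. norm (u n) * norm (v n)) summable_on UNIV"
    using T by (intro summable_nonneg_imp_summable_on) (auto simp: nuclear_rep_def)
  have inner_s: "(\<lambda>n. infsum (\<lambda>e. norm (F n e)) E) summable_on UNIV"
    by (rule summable_on_comparison_test[OF suv]) (auto intro: nE infsum_nonneg)
  have "(\<lambda>(n, e). norm (F n e)) summable_on UNIV \<times> E"
    by (rule summable_on_SigmaI[where g = "\<lambda>n. infsum (\<lambda>e. norm (F n e)) E"])
      (use nE inner_s in auto)
  moreover have "(\<lambda>p. norm (case p of (n, e) \<Rightarrow> F n e)) = (\<lambda>(n, e). norm (F n e))"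
    by auto
  ultimately have "(\<lambda>(n, e). F n e) summable_on UNIV \<times> E"
    using abs_summable_summable[of "\<lambda>(n, e). F n e" "UNIV \<times> E"] by simp
  then have swap: "infsum (\<lambda>n. infsum (\<lambda>e. F n e) E) UNIV = infsum (\<lambda>e. infsum (\<lambda>n. F n e) UNIV) E"
    by (rule infsum_swap_banach)
  have 1: "infsum (\<lambda>e. F n e) E = cinner (u n) (v n)" for n
    unfolding F_def by (rule infsumI[OF parseval[OF E]])
  have 2: "infsum (\<lambda>n. F n e) UNIV = cinner (T e) e" if "e \<in> E" for e
  proof -
    have "cmod (cinner e e) = 1" using on that by (simp add: orthonormalD)
    then have "(norm e)\<^sup>2 = 1" by (simp add: cinner_norm norm_power)
    then have n1: "norm e = 1" using norm_ge_zero[of e] by (auto simp: power2_eq_1_iff simp del: norm_ge_zero)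
    have "(\<lambda>n. F n e) sums cinner (T e) e"
    proof -
      have "(\<lambda>n. cinner e (v n) * cinner (u n) e) sums cinner (T e) e"
        using T by (simp add: nuclear_rep_def)
      then show ?thesis unfolding F_def by (subst mult.commute)
    qed
    moreover have "summable (\<lambda>n. norm (F n e))"
    proof (rule summable_comparison_test')
      show "summable (\<lambda>n. norm (u n) * norm (v n))" using T by (simp add: nuclear_rep_def)
      fix n :: nat
      show "norm (norm (F n e)) \<le> norm (u n) * norm (v n)"
        using cinner_Cauchy_Schwarz[of "u n" e] cinner_Cauchy_Schwarz[of e "v n"] n1
        by (simp add: F_def norm_mult mult_mono)
    qed
    ultimately show ?thesis
      by (intro infsumI) (rule norm_summable_imp_has_sum)
  qed
  have "op_trace T = infsum (\<lambda>e. cinner (T e) e) E"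
    unfolding op_trace_def E_def ..
  also have "\<dots> = infsum (\<lambda>e. infsum (\<lambda>n. F n e) UNIV) E"
    by (rule infsum_cong) (simp add: 2)
  also have "\<dots> = infsum (\<lambda>n. cinner (u n) (v n)) UNIV"
    unfolding swap[symmetric] 1 ..
  finally have tr: "op_trace T = infsum (\<lambda>n. cinner (u n) (v n)) UNIV" .
  have "((\<lambda>n. cinner (u n) (v n)) has_sum op_trace T) UNIV"
    unfolding tr using nuclear_rep_summable[OF T]
    by (rule has_sum_infsum[OF norm_summable_imp_summable_on])
  then show ?thesis by (rule has_sum_imp_sums)
qed

text \<open>A right factor acts on \<open>v n\<close> through its adjoint, so only the adjoint
  relation is asked of \<open>S\<close>. Thus \<open>S\<close> may itself contain an adjoint, as in
  \<open>conv_op_op_sums\<close>, and \<open>cadjoint\<close> of the composition is never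
  computed.\<close>

lemma nuclear_rep_compose:
  assumes T: "nuclear_rep T u v" and R: "bounded_clinear R"
    and S: "\<And>f g. cinner (S f) g = cinner f (S' g)" and S': "\<And>f. norm (S' f) \<le> C * norm f"
  shows "nuclear_rep (R \<circ> T \<circ> S) (\<lambda>n. R (u n)) (\<lambda>n. S' (v n))"
proof -
  obtain K where K: "K \<ge> 0" "\<And>f. norm (R f) \<le> K * norm f" using bounded_clinear_bound[OF R] by metis
  have "summable (\<lambda>n. norm (R (u n)) * norm (S' (v n)))"
  proof (rule summable_comparison_test')
    show "summable (\<lambda>n. K * C * (norm (u n) * norm (v n)))"
      using T by (intro summable_mult) (simp add: nuclear_rep_def)
    fix n :: nat
    have "norm (R (u n)) * norm (S' (v n)) \<le> (K * norm (u n)) * (C * norm (v n))"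
      using K S' by (intro mult_mono) auto
    then show "norm (norm (R (u n)) * norm (S' (v n))) \<le> K * C * (norm (u n) * norm (v n))"
      by (simp add: algebra_simps)
  qed
  moreover have "(\<lambda>n. cinner f (S' (v n)) * cinner (R (u n)) g) sums cinner ((R \<circ> T \<circ> S) f) g" for f g
    using T unfolding nuclear_rep_def o_def by (simp add: S[symmetric] cadjoint[OF R])
  ultimately show ?thesis by (simp add: nuclear_rep_def)
qed

subsection \<open>Square roots of positive operators\<close>

text \<open>Square roots are first constructed over the reals, in the complete normed space of
  \<open>blinfun\<close>. Symmetry is part of the definition because a real positive form does not
  imply it; complex linearity is recovered later from a commutation property of the root.\<close>

definition pos_sym :: "('h::real_inner \<Rightarrow>\<^sub>L 'h) \<Rightarrow> bool" where
  "pos_sym B \<longleftrightarrow> (\<forall>f g. inner (B f) g = inner f (B g)) \<and> (\<forall>f. 0 \<le> inner (B f) f)"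

lemma pos_symD: "pos_sym B \<Longrightarrow> inner (B f) g = inner f (B g)" "pos_sym B \<Longrightarrow> 0 \<le> inner (B f) f"
  by (auto simp: pos_sym_def)

lemma pos_sym_Cauchy_Schwarz:
  assumes B: "pos_sym B"
  shows "(inner (B f) g)\<^sup>2 \<le> inner (B f) f * inner (B g) g"
proof -
  have q: "0 \<le> inner (B f) f + 2 * t * inner (B f) g + t\<^sup>2 * inner (B g) g" for t
  proof -
    have "0 \<le> inner (B (f + t *\<^sub>R g)) (f + t *\<^sub>R g)" by (rule pos_symD[OF B])
    also have "\<dots> = inner (B f) f + t * inner (B f) g + t * inner (B g) f + t * t * inner (B g) g"
      by (simp add: blinfun.add_right blinfun.scaleR_right inner_add_left inner_add_right algebra_simps)
    also have "inner (B g) f = inner (B f) g" using pos_symD(1)[OF B, of f g] by (simp add: inner_commute)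
    finally show ?thesis by (simp add: power2_eq_square algebra_simps)
  qed
  show ?thesis
  proof (cases "inner (B g) g = 0")
    case True
    have "inner (B f) g = 0"
    proof (rule ccontr)
      assume nz: "inner (B f) g \<noteq> 0"
      \<comment> \<open>The quadratic has become affine in \<open>t\<close>, and this choice gives
        it the value -1.\<close>
      define t where "t = - (inner (B f) f + 1) / (2 * inner (B f) g)"
      have "2 * t * inner (B f) g = - (inner (B f) f + 1)" using nz by (simp add: t_def)
      then show False using q[of t] True by simp
    qed
    then show ?thesis using True by simp
  next
    case False
    then have pos: "inner (B g) g > 0" using pos_symD(2)[OF B, of g] by simp
    define t where "t = - inner (B f) g / inner (B g) g"
    have "inner (B f) f + 2 * t * inner (B f) g + t\<^sup>2 * inner (B g) g
        = inner (B f) f - (inner (B f) g)\<^sup>2 / inner (B g) g"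
      using pos by (simp add: t_def power2_eq_square field_simps)
    then have "(inner (B f) g)\<^sup>2 / inner (B g) g \<le> inner (B f) f" using q[of t] by simp
    then show ?thesis using pos by (simp add: field_simps)
  qed
qed

lemma pos_sym_eq_0:
  assumes B: "pos_sym B" "inner (B f) f = 0"
  shows "B f = 0"
proof -
  have "(inner (B f) (B f))\<^sup>2 \<le> 0"
    using pos_sym_Cauchy_Schwarz[OF B(1), of f "B f"] B(2) by simp
  then show ?thesis by simp
qed

text \<open>Iterates the fixed point equation \<open>Y = (C + Y^2) / 2\<close>, that is
  \<open>(1 - Y)^2 = 1 - C\<close>: the wanted root of \<open>1 - C\<close> is
  \<open>1 - Y\<close>.\<close>

fun sqrt_iter :: "('h::real_normed_vector \<Rightarrow>\<^sub>L 'h) \<Rightarrow> nat \<Rightarrow> 'h \<Rightarrow>\<^sub>L 'h" where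
  "sqrt_iter C 0 = 0"
| "sqrt_iter C (Suc n) = (1/2) *\<^sub>R (C + (sqrt_iter C n o\<^sub>L sqrt_iter C n))"

text \<open>The same iteration for the scalar \<open>C = 1\<close>. It is increasing and bounded by
  1, and majorises the operator iteration for every \<open>C\<close> of norm at most 1.\<close>

fun sqrt_iter_real :: "nat \<Rightarrow> real" where
  "sqrt_iter_real 0 = 0"
| "sqrt_iter_real (Suc n) = (1 + (sqrt_iter_real n)\<^sup>2) / 2"

lemma sqrt_iter_real_bounds: "0 \<le> sqrt_iter_real n \<and> sqrt_iter_real n \<le> 1"
proof (induction n)
  case (Suc n)
  then have "(sqrt_iter_real n)\<^sup>2 \<le> 1" by (simp add: power_le_one)
  then show ?case by simp
qed simp

lemma sqrt_iter_real_mono: "sqrt_iter_real n \<le> sqrt_iter_real (Suc n)"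
  using zero_le_power2[of "1 - sqrt_iter_real n"] by (simp add: power2_eq_square algebra_simps)

lemma sqrt_iter_real_convergent: "convergent sqrt_iter_real"
  by (rule Bseq_monoseq_convergent)
    (use sqrt_iter_real_bounds sqrt_iter_real_mono in
      \<open>auto intro!: BseqI'[of _ 1] incseq_imp_monoseq incseq_SucI simp del: sqrt_iter_real.simps\<close>)

lemma blinfun_compose_bilinear:
  fixes A B C :: "'h::real_normed_vector \<Rightarrow>\<^sub>L 'h"
  shows "(A + B) o\<^sub>L C = (A o\<^sub>L C) + (B o\<^sub>L C)" "A o\<^sub>L (B + C) = (A o\<^sub>L B) + (A o\<^sub>L C)"
    "(A - B) o\<^sub>L C = (A o\<^sub>L C) - (B o\<^sub>L C)" "A o\<^sub>L (B - C) = (A o\<^sub>L B) - (A o\<^sub>L C)"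
    "(r *\<^sub>R A) o\<^sub>L B = r *\<^sub>R (A o\<^sub>L B)" "A o\<^sub>L (r *\<^sub>R B) = r *\<^sub>R (A o\<^sub>L B)"
    "0 o\<^sub>L A = 0" "A o\<^sub>L 0 = 0"
  by (auto intro!: blinfun_eqI simp: blinfun.bilinear_simps)

lemma blinfun_compose_assoc: "(A o\<^sub>L B) o\<^sub>L C = A o\<^sub>L (B o\<^sub>L C)"
  by (rule blinfun_eqI) simp

text \<open>The recursion has nonnegative coefficients, so norms and increments are majorised
  termwise by the scalar iteration. For the increments,
  \<open>Y Y - Z Z = Y (Y - Z) + (Y - Z) Z\<close>, an identity independent of
  commutativity.\<close>

lemma sqrt_iter_bounds:
  fixes C :: "'h::real_normed_vector \<Rightarrow>\<^sub>L 'h"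
  assumes "norm C \<le> 1"
  shows "norm (sqrt_iter C n) \<le> sqrt_iter_real n"
    "norm (sqrt_iter C (Suc n) - sqrt_iter C n) \<le> sqrt_iter_real (Suc n) - sqrt_iter_real n"
proof -
  show 1: "norm (sqrt_iter C n) \<le> sqrt_iter_real n" for n
  proof (induction n)
    case (Suc n)
    have "norm (C + (sqrt_iter C n o\<^sub>L sqrt_iter C n)) \<le> norm C + norm (sqrt_iter C n) * norm (sqrt_iter C n)"
      by (rule order_trans[OF norm_triangle_ineq]) (simp add: norm_blinfun_compose)
    also have "\<dots> \<le> 1 + sqrt_iter_real n * sqrt_iter_real n"
      using assms Suc sqrt_iter_real_bounds by (intro add_mono mult_mono) auto
    finally show ?case by (simp add: power2_eq_square)
  qed simp
  show "norm (sqrt_iter C (Suc n) - sqrt_iter C n) \<le> sqrt_iter_real (Suc n) - sqrt_iter_real n"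
  proof (induction n)
    case 0
    then show ?case using assms by simp
  next
    case (Suc n)
    let ?Y = "sqrt_iter C (Suc n)" and ?Z = "sqrt_iter C n"
    let ?y = "sqrt_iter_real (Suc n)" and ?z = "sqrt_iter_real n"
    have "sqrt_iter C (Suc (Suc n)) - ?Y = (1/2) *\<^sub>R (C + (?Y o\<^sub>L ?Y)) - (1/2) *\<^sub>R (C + (?Z o\<^sub>L ?Z))"
      using sqrt_iter.simps(2)[of C "Suc n"] sqrt_iter.simps(2)[of C n] by presburger
    also have "\<dots> = (1/2) *\<^sub>R ((?Y o\<^sub>L ?Y) - (?Z o\<^sub>L ?Z))"
      by (simp only: scaleR_diff_right[symmetric] add_diff_cancel_left)
    also have "(?Y o\<^sub>L ?Y) - (?Z o\<^sub>L ?Z) = (?Y o\<^sub>L (?Y - ?Z)) + ((?Y - ?Z) o\<^sub>L ?Z)"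
      by (simp only: blinfun_compose_bilinear) simp
    finally have "sqrt_iter C (Suc (Suc n)) - ?Y = (1/2) *\<^sub>R ((?Y o\<^sub>L (?Y - ?Z)) + ((?Y - ?Z) o\<^sub>L ?Z))" .
    then have "norm (sqrt_iter C (Suc (Suc n)) - ?Y) = (1/2) * norm ((?Y o\<^sub>L (?Y - ?Z)) + ((?Y - ?Z) o\<^sub>L ?Z))"
      by (simp del: sqrt_iter.simps)
    also have "\<dots> \<le> (1/2) * (norm ?Y * norm (?Y - ?Z) + norm (?Y - ?Z) * norm ?Z)"
      by (intro mult_left_mono order_trans[OF norm_triangle_ineq] add_mono norm_blinfun_compose) auto
    also have "\<dots> \<le> (1/2) * (?y * (?y - ?z) + (?y - ?z) * ?z)"
      using Suc 1 sqrt_iter_real_bounds sqrt_iter_real_mono[of n]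
      by (intro mult_left_mono add_mono mult_mono) (auto simp del: sqrt_iter_real.simps sqrt_iter.simps)
    also have "\<dots> = (1 + ?y\<^sup>2) / 2 - (1 + ?z\<^sup>2) / 2"
      by (simp only: power2_eq_square) (simp add: field_simps del: sqrt_iter_real.simps)
    also have "\<dots> = sqrt_iter_real (Suc (Suc n)) - ?y"
      using sqrt_iter_real.simps(2)[of "Suc n"] sqrt_iter_real.simps(2)[of n] by presburger
    finally show ?case .
  qed
qed

lemma sqrt_iter_convergent:
  fixes C :: "'h::banach \<Rightarrow>\<^sub>L 'h"
  assumes "norm C \<le> 1"
  shows "convergent (sqrt_iter C)"
proof -
  have le: "norm (sqrt_iter C (n + k) - sqrt_iter C n) \<le> sqrt_iter_real (n + k) - sqrt_iter_real n" for n k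
  proof (induction k)
    case (Suc k)
    have "norm (sqrt_iter C (n + Suc k) - sqrt_iter C n)
      \<le> norm (sqrt_iter C (Suc (n + k)) - sqrt_iter C (n + k)) + norm (sqrt_iter C (n + k) - sqrt_iter C n)"
      using norm_triangle_ineq[of "sqrt_iter C (Suc (n + k)) - sqrt_iter C (n + k)" "sqrt_iter C (n + k) - sqrt_iter C n"]
      by (simp del: sqrt_iter.simps)
    then show ?case using sqrt_iter_bounds(2)[OF assms, of "n + k"] Suc by (simp del: sqrt_iter.simps sqrt_iter_real.simps)
  qed simp
  have "Cauchy sqrt_iter_real" by (rule convergent_Cauchy[OF sqrt_iter_real_convergent])
  have "Cauchy (sqrt_iter C)"
  proof (rule CauchyI')
    fix e :: real assume "e > 0"
    then obtain M where M: "\<And>m n. m \<ge> M \<Longrightarrow> n \<ge> M \<Longrightarrow> norm (sqrt_iter_real m - sqrt_iter_real n) < e"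
      using CauchyD[OF \<open>Cauchy sqrt_iter_real\<close>] by blast
    have "dist (sqrt_iter C m) (sqrt_iter C n) < e" if "m \<ge> M" "n > m" for m n
      using le[of m "n - m"] M[of n m] that by (simp add: dist_norm norm_minus_commute)
    then show "\<exists>M. \<forall>m\<ge>M. \<forall>n>m. dist (sqrt_iter C m) (sqrt_iter C n) < e" by blast
  qed
  then show ?thesis by (rule Cauchy_convergent)
qed

lemma tendsto_blinfun_compose:
  fixes F :: "'i \<Rightarrow> 'b::real_normed_vector \<Rightarrow>\<^sub>L 'c::real_normed_vector" and G :: "'i \<Rightarrow> 'a::real_normed_vector \<Rightarrow>\<^sub>L 'b"
  assumes "(F \<longlongrightarrow> A) net" "(G \<longlongrightarrow> B) net"
  shows "((\<lambda>x. F x o\<^sub>L G x) \<longlongrightarrow> (A o\<^sub>L B)) net"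
  by (rule bounded_bilinear.tendsto[OF bounded_bilinear_blinfun_compose assms])

text \<open>The Cauchy-Schwarz inequality of the form, taken at \<open>f\<close> and
  \<open>C f\<close>, gives \<open>norm (C f)^4 \<le> norm f^2 * norm (C f)^2\<close>.\<close>

lemma norm_blinfun_of_pos_sym:
  fixes C :: "'h::real_inner \<Rightarrow>\<^sub>L 'h"
  assumes "pos_sym C" "\<And>f. inner (C f) f \<le> (norm f)\<^sup>2"
  shows "norm C \<le> 1"
proof (rule norm_blinfun_bound)
  fix f
  have "(norm (C f))\<^sup>2 * (norm (C f))\<^sup>2 = (inner (C f) (C f))\<^sup>2"
    unfolding power2_norm_eq_inner by (simp only: power2_eq_square)
  also have "\<dots> \<le> inner (C f) f * inner (C (C f)) (C f)"
    by (rule pos_sym_Cauchy_Schwarz[OF assms(1)])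
  also have "\<dots> \<le> (norm f)\<^sup>2 * (norm (C f))\<^sup>2"
    using assms by (intro mult_mono) (auto intro: pos_symD)
  finally have "(norm (C f))\<^sup>2 \<le> (norm f)\<^sup>2 \<or> norm (C f) = 0"
    using mult_right_le_imp_le[of "(norm (C f))\<^sup>2" "(norm (C f))\<^sup>2" "(norm f)\<^sup>2"] zero_less_power2 by blast
  then have "norm (C f) \<le> norm f" by (auto intro: power2_le_imp_le)
  then show "norm (C f) \<le> 1 * norm f" by simp
qed simp

text \<open>For \<open>C = 1 - A\<close> the iteration has a limit \<open>Y\<close>, and
  \<open>1 - Y\<close> is the root. Commutation passes from \<open>A\<close> to \<open>C\<close>, to
  all iterates and to the limit; this clause later carries both the uniqueness of the root and its
  complex linearity.\<close>

lemma ex_sqrt_contraction: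
  fixes A :: "'h::{real_inner,banach} \<Rightarrow>\<^sub>L 'h"
  assumes A: "pos_sym A" "\<And>f. inner (A f) f \<le> (norm f)\<^sup>2"
  shows "\<exists>B. pos_sym B \<and> B o\<^sub>L B = A \<and> (\<forall>T. T o\<^sub>L A = A o\<^sub>L T \<longrightarrow> T o\<^sub>L B = B o\<^sub>L T)"
proof -
  define C where "C = id_blinfun - A"
  have Cf: "C f = f - A f" for f by (simp add: C_def blinfun.diff_left)
  have "pos_sym C"
    using A unfolding pos_sym_def Cf
    by (auto simp: inner_diff_left inner_diff_right power2_norm_eq_inner)
  moreover have "inner (C f) f \<le> (norm f)\<^sup>2" for f
    using pos_symD(2)[OF A(1), of f] by (simp add: Cf inner_diff_left power2_norm_eq_inner)
  ultimately have nC: "norm C \<le> 1" by (rule norm_blinfun_of_pos_sym)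
  obtain Y where Y: "sqrt_iter C \<longlonglongrightarrow> Y"
    using sqrt_iter_convergent[OF nC] by (auto simp: convergent_def)
  have "(\<lambda>n. sqrt_iter C (Suc n)) \<longlonglongrightarrow> (1/2) *\<^sub>R (C + (Y o\<^sub>L Y))"
    unfolding sqrt_iter.simps by (intro tendsto_intros tendsto_blinfun_compose Y)
  then have YY: "Y = (1/2) *\<^sub>R (C + (Y o\<^sub>L Y))"
    using LIMSEQ_Suc[OF Y] LIMSEQ_unique by blast
  have nY: "norm Y \<le> 1"
  proof (rule LIMSEQ_le_const2)
    show "(\<lambda>n. norm (sqrt_iter C n)) \<longlonglongrightarrow> norm Y" by (intro tendsto_intros Y)
    show "\<exists>N. \<forall>n\<ge>N. norm (sqrt_iter C n) \<le> 1"
      using sqrt_iter_bounds(1)[OF nC] sqrt_iter_real_bounds order_trans by blast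
  qed
  have symn: "inner (sqrt_iter C n f) g = inner f (sqrt_iter C n g)" for n f g
  proof (induction n arbitrary: f g)
    case (Suc n)
    then show ?case using pos_symD(1)[OF \<open>pos_sym C\<close>]
      by (simp add: blinfun.bilinear_simps inner_add_left inner_add_right)
  qed simp
  have symY: "inner (Y f) g = inner f (Y g)" for f g
  proof (rule LIMSEQ_unique)
    show "(\<lambda>n. inner (sqrt_iter C n f) g) \<longlonglongrightarrow> inner (Y f) g"
      by (intro tendsto_intros Y)
    show "(\<lambda>n. inner (sqrt_iter C n f) g) \<longlonglongrightarrow> inner f (Y g)"
      unfolding symn by (intro tendsto_intros Y)
  qed
  define B where "B = id_blinfun - Y"
  have Bf: "B f = f - Y f" for f by (simp add: B_def blinfun.diff_left)
  have "pos_sym B"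
    unfolding pos_sym_def Bf
  proof (intro conjI allI)
    fix f g
    show "inner (f - Y f) g = inner f (g - Y g)" by (simp add: inner_diff_left inner_diff_right symY)
    have "inner (Y f) f \<le> norm (Y f) * norm f" by (rule norm_cauchy_schwarz)
    also have "\<dots> \<le> (norm Y * norm f) * norm f" by (intro mult_right_mono norm_blinfun) auto
    also have "\<dots> \<le> 1 * norm f * norm f" by (intro mult_right_mono nY) auto
    finally show "0 \<le> inner (f - Y f) f" by (simp add: inner_diff_left power2_norm_eq_inner flip: power2_eq_square)
  qed
  moreover have "B o\<^sub>L B = A"
  proof (rule blinfun_eqI)
    fix f
    have "Y f = (1/2) *\<^sub>R (f - A f + Y (Y f))"
      by (subst YY) (simp add: blinfun.bilinear_simps Cf)
    moreover have "y = (1/2) *\<^sub>R x \<Longrightarrow> 2 *\<^sub>R y = x" for x y :: 'h by simp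
    ultimately have "2 *\<^sub>R Y f = f - A f + Y (Y f)" by blast
    then show "(B o\<^sub>L B) f = A f" by (simp add: Bf blinfun.diff_right scaleR_2 algebra_simps)
  qed
  moreover have "T o\<^sub>L B = B o\<^sub>L T" if T: "T o\<^sub>L A = A o\<^sub>L T" for T
  proof -
    have TC: "T o\<^sub>L C = C o\<^sub>L T"
      using T by (simp add: C_def blinfun_compose_bilinear) (auto intro!: blinfun_eqI)
    have "T o\<^sub>L sqrt_iter C n = sqrt_iter C n o\<^sub>L T" for n
    proof (induction n)
      case (Suc n)
      have "T o\<^sub>L (sqrt_iter C n o\<^sub>L sqrt_iter C n) = (sqrt_iter C n o\<^sub>L sqrt_iter C n) o\<^sub>L T"
        using Suc by (metis blinfun_compose_assoc)
      then show ?case using TC by (simp add: blinfun_compose_bilinear)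
    qed (simp add: blinfun_compose_bilinear)
    moreover have "(\<lambda>n. T o\<^sub>L sqrt_iter C n) \<longlonglongrightarrow> (T o\<^sub>L Y)" "(\<lambda>n. sqrt_iter C n o\<^sub>L T) \<longlonglongrightarrow> (Y o\<^sub>L T)"
      by (intro tendsto_blinfun_compose tendsto_const Y)+
    ultimately have "T o\<^sub>L Y = Y o\<^sub>L T" using LIMSEQ_unique by simp
    then show ?thesis
      by (simp add: B_def blinfun_compose_bilinear) (auto intro!: blinfun_eqI)
  qed
  ultimately show ?thesis by blast
qed

lemma ex_sqrt:
  fixes A :: "'h::{real_inner,banach} \<Rightarrow>\<^sub>L 'h"
  assumes A: "pos_sym A"
  shows "\<exists>B. pos_sym B \<and> B o\<^sub>L B = A \<and> (\<forall>T. T o\<^sub>L A = A o\<^sub>L T \<longrightarrow> T o\<^sub>L B = B o\<^sub>L T)"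
proof -
  \<comment> \<open>The added 1 keeps the scale positive when \<open>A\<close> is zero.\<close>
  define k where "k = norm A + 1"
  have k: "k > 0" by (simp add: k_def add_nonneg_pos)
  have "pos_sym ((1/k) *\<^sub>R A)"
    using A k by (auto simp: pos_sym_def blinfun.scaleR_left)
  moreover have "inner (((1/k) *\<^sub>R A) f) f \<le> (norm f)\<^sup>2" for f
  proof -
    have "inner (A f) f \<le> norm (A f) * norm f" by (rule norm_cauchy_schwarz)
    also have "\<dots> \<le> (norm A * norm f) * norm f" by (intro mult_right_mono norm_blinfun) auto
    also have "\<dots> \<le> k * (norm f)\<^sup>2" by (simp add: k_def power2_eq_square algebra_simps)
    finally show ?thesis using k by (simp add: blinfun.scaleR_left field_simps)
  qed
  ultimately obtain B where B: "pos_sym B" "B o\<^sub>L B = (1/k) *\<^sub>R A"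
    "\<And>T. T o\<^sub>L ((1/k) *\<^sub>R A) = ((1/k) *\<^sub>R A) o\<^sub>L T \<Longrightarrow> T o\<^sub>L B = B o\<^sub>L T"
    using ex_sqrt_contraction by blast
  have "pos_sym (sqrt k *\<^sub>R B)" using B(1) k by (auto simp: pos_sym_def blinfun.scaleR_left)
  moreover have "(sqrt k *\<^sub>R B) o\<^sub>L (sqrt k *\<^sub>R B) = A"
    using B(2) k by (simp add: blinfun_compose_bilinear)
  moreover have "T o\<^sub>L (sqrt k *\<^sub>R B) = (sqrt k *\<^sub>R B) o\<^sub>L T" if "T o\<^sub>L A = A o\<^sub>L T" for T
    using B(3)[of T] that by (simp add: blinfun_compose_bilinear)
  ultimately show ?thesis by blast
qed

text \<open>A root \<open>D\<close> of \<open>B o\<^sub>L B\<close> commutes with it, hence with the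
  constructed root \<open>R\<close>. For \<open>g = D f - R f\<close> this gives
  \<open>(D + R) g = 0\<close>; positivity yields \<open>D g = R g = 0\<close>, and by symmetry
  \<open>g\<close> is orthogonal to itself.\<close>

lemma sqrt_unique:
  fixes B B' :: "'h::{real_inner,banach} \<Rightarrow>\<^sub>L 'h"
  assumes "pos_sym B" "pos_sym B'" "B o\<^sub>L B = B' o\<^sub>L B'"
  shows "B = B'"
proof -
  have "inner (B (B f)) g = inner f (B (B g))" "0 \<le> inner (B (B f)) f" for f g
    using pos_symD(1)[OF assms(1), of "B f" g] pos_symD(1)[OF assms(1), of f "B g"]
      pos_symD(1)[OF assms(1), of "B f" f] by simp_all
  then have "pos_sym (B o\<^sub>L B)" by (simp add: pos_sym_def)
  then obtain R where R: "pos_sym R" "R o\<^sub>L R = B o\<^sub>L B"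
    "\<And>T. T o\<^sub>L (B o\<^sub>L B) = (B o\<^sub>L B) o\<^sub>L T \<Longrightarrow> T o\<^sub>L R = R o\<^sub>L T"
    using ex_sqrt[of "B o\<^sub>L B"] by blast
  have "D = R" if D: "pos_sym D" "D o\<^sub>L D = B o\<^sub>L B" for D
  proof (rule blinfun_eqI)
    fix f
    have comm: "D o\<^sub>L R = R o\<^sub>L D" by (rule R(3)) (simp add: D(2)[symmetric] blinfun_compose_assoc)
    have cf: "D (R x) = R (D x)" for x using arg_cong[OF comm, of "\<lambda>S. blinfun_apply S x"] by simp
    have sq: "D (D x) = R (R x)" for x
      using arg_cong[OF trans[OF D(2) R(2)[symmetric]], of "\<lambda>S. blinfun_apply S x"] by simp
    define g where "g = D f - R f"
    have "D g + R g = 0" by (simp add: g_def blinfun.diff_right cf sq)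
    then have "inner (D g) g + inner (R g) g = 0" by (metis inner_add_left inner_zero_left)
    then have "inner (D g) g = 0" "inner (R g) g = 0"
      using pos_symD(2)[OF D(1), of g] pos_symD(2)[OF R(1), of g] by linarith+
    then have "D g = 0" "R g = 0" using pos_sym_eq_0 D(1) R(1) by blast+
    have "inner g g = inner (D f) g - inner (R f) g" by (simp add: g_def inner_diff_left)
    also have "\<dots> = inner f (D g) - inner f (R g)" using pos_symD(1) D(1) R(1) by metis
    finally have "inner g g = 0" using \<open>D g = 0\<close> \<open>R g = 0\<close> by simp
    then show "D f = R f" by (simp add: g_def)
  qed
  then show ?thesis using assms by metis
qed

subsection \<open>Polar decomposition\<close>

text \<open>Polarisation: the difference of \<open>R\<close> and its adjoint has vanishing quadratic
  form, and testing \<open>f + g\<close> and \<open>f + \<i> *\<^sub>C g\<close> kills the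
  sesquilinear form. This genuinely complex fact supplies the symmetry that \<open>pos_sym\<close>
  asks for.\<close>

lemma cinner_sym_of_real:
  assumes R: "bounded_clinear R" and real: "\<And>f. cinner (R f) f \<in> \<real>"
  shows "cinner (R f) g = cinner f (R g)"
proof -
  define D where "D f = R f - cadjoint R f" for f
  have D: "bounded_clinear D"
    unfolding D_def using R cadjoint(1)[OF R] by (rule bounded_clinear_diff)
  have ad: "cinner (cadjoint R f) g = cinner f (R g)" for f g
    using cadjoint(2)[OF R, of g f] by (metis cinner_commute)
  have 0: "cinner (D h) h = 0" for h
    using real[of h] cinner_commute[of h "R h"]
    by (simp add: D_def cinner_diff_left ad Reals_cnj_iff)
  have a: "cinner (D f) g + cinner (D g) f = 0" for f g
    using 0[of "f + g"] 0[of f] 0[of g]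
    by (simp add: bounded_clinearD[OF D] cinner_add_left cinner_add_right add.commute)
  have "- (\<i> * cinner (D f) g) + \<i> * cinner (D g) f = 0"
    using a[of f "\<i> *\<^sub>C g"] by (simp add: bounded_clinearD[OF D] cinner_scaleC_left cinner_scaleC_right)
  then have "\<i> * cinner (D g) f = \<i> * cinner (D f) g" by (simp only: add.commute eq_neg_iff_add_eq_0[symmetric] neg_equal_iff_equal) simp
  then have "cinner (D g) f = cinner (D f) g" by simp
  with a[of f g] have "cinner (D f) g = 0" by simp
  then show ?thesis by (simp add: D_def cinner_diff_left ad)
qed

lemma positive_operatorD:
  assumes "positive_operator B"
  shows "bounded_clinear B" "cinner (B f) g = cinner f (B g)" "0 \<le> Re (cinner (B f) f)"
proof -
  show 1: "bounded_clinear B" using assms by (simp add: positive_operator_def)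
  have "cinner (B f) f \<in> \<real>\<^sub>\<ge>\<^sub>0" for f using assms by (simp add: positive_operator_def)
  then show "cinner (B f) g = cinner f (B g)" "0 \<le> Re (cinner (B f) f)"
    using nonneg_Reals_subset_Reals
    by (auto intro!: cinner_sym_of_real[OF 1] simp: complex_nonneg_Reals_iff)
qed

lemma pos_sym_Blinfun:
  assumes "bounded_clinear B"
  shows "pos_sym (Blinfun B) \<longleftrightarrow> positive_operator B"
proof -
  have app: "blinfun_apply (Blinfun B) = B"
    using assms by (intro bounded_linear_Blinfun_apply) (simp add: bounded_clinear_def)
  show ?thesis
  proof
    assume B: "positive_operator B"
    show "pos_sym (Blinfun B)"
      using positive_operatorD(2,3)[OF B] by (simp add: pos_sym_def app inner_L2_Re)
  next
    assume ps: "pos_sym (Blinfun B)"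
    have "cinner (B f) g = cinner f (B g)" for f g
      using pos_symD(1)[OF ps, of f g] pos_symD(1)[OF ps, of f "\<i> *\<^sub>C g"] assms
      by (simp add: app cinner_inner bounded_clinearD)
    then have "cinner (B f) f = cnj (cinner (B f) f)" for f
      by (metis cinner_commute)
    then have "Im (cinner (B f) f) = 0" for f
      by (metis Reals_cnj_iff complex_is_Real_iff)
    then show "positive_operator B"
      using assms pos_symD(2)[OF ps]
      by (auto simp: positive_operator_def complex_nonneg_Reals_iff app inner_L2_Re)
  qed
qed

text \<open>Multiplication by a complex scalar is a real-linear operator commuting with
  \<open>A\<close>, hence with its real root; that commutation is complex linearity of the
  root.\<close>

lemma ex_positive_sqrt:
  assumes A: "positive_operator A"
  shows "\<exists>B. positive_operator B \<and> B \<circ> B = A"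
proof -
  have clin: "bounded_clinear A" by (rule positive_operatorD[OF A])
  have app: "blinfun_apply (Blinfun A) = A"
    using clin by (intro bounded_linear_Blinfun_apply) (simp add: bounded_clinear_def)
  have "pos_sym (Blinfun A)" using A clin by (simp add: pos_sym_Blinfun)
  then obtain B where B: "pos_sym B" "B o\<^sub>L B = Blinfun A"
    and comm: "\<And>T. T o\<^sub>L Blinfun A = Blinfun A o\<^sub>L T \<Longrightarrow> T o\<^sub>L B = B o\<^sub>L T"
    using ex_sqrt by blast
  have "B (c *\<^sub>C f) = c *\<^sub>C B f" for c f
  proof -
    have appc: "blinfun_apply (Blinfun (\<lambda>f. c *\<^sub>C f)) = (\<lambda>f. c *\<^sub>C f)"
      by (rule bounded_linear_Blinfun_apply[OF bounded_linear_scaleC])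
    have "Blinfun (\<lambda>f. c *\<^sub>C f) o\<^sub>L B = B o\<^sub>L Blinfun (\<lambda>f. c *\<^sub>C f)"
      by (rule comm) (auto intro!: blinfun_eqI simp: app appc bounded_clinearD[OF clin])
    from arg_cong[OF this, of "\<lambda>S. blinfun_apply S f"] show ?thesis by (simp add: appc)
  qed
  then have clB: "bounded_clinear (blinfun_apply B)"
    by (simp add: bounded_clinear_def blinfun.bounded_linear_right)
  have "positive_operator (blinfun_apply B)"
    using pos_sym_Blinfun[OF clB] B(1) by (simp add: blinfun_apply_inverse)
  moreover have "blinfun_apply B \<circ> blinfun_apply B = A"
    using arg_cong[OF B(2), of blinfun_apply] by (simp add: app o_def fun_eq_iff)
  ultimately show ?thesis by blast
qed

lemma positive_sqrt_unique:
  assumes "positive_operator B" "positive_operator B'" "B \<circ> B = B' \<circ> B'"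
  shows "B = B'"
proof -
  have cl: "bounded_clinear B" "bounded_clinear B'" using assms positive_operatorD(1) by auto
  have app: "blinfun_apply (Blinfun B) = B" "blinfun_apply (Blinfun B') = B'"
    using cl by (auto intro!: bounded_linear_Blinfun_apply simp: bounded_clinear_def)
  have sq: "B (B f) = B' (B' f)" for f using fun_cong[OF assms(3), of f] by simp
  have "Blinfun B o\<^sub>L Blinfun B = Blinfun B' o\<^sub>L Blinfun B'"
    by (rule blinfun_eqI) (simp add: app sq)
  moreover have "pos_sym (Blinfun B)" "pos_sym (Blinfun B')"
    using assms(1,2) cl by (simp_all add: pos_sym_Blinfun)
  ultimately have "Blinfun B = Blinfun B'" using sqrt_unique by blast
  then show ?thesis using app by metis
qed

lemma positive_operator_adjoint_mult:
  assumes "bounded_clinear S"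
  shows "positive_operator (cadjoint S \<circ> S)"
  unfolding positive_operator_def
proof (intro conjI allI)
  show "bounded_clinear (cadjoint S \<circ> S)" by (intro bounded_clinear_compose cadjoint assms)
  fix f
  have "cinner ((cadjoint S \<circ> S) f) f = cnj (cinner (S f) (S f))"
    using cadjoint(2)[OF assms, of f "S f"] cinner_commute[of "cadjoint S (S f)" f] by simp
  then show "cinner ((cadjoint S \<circ> S) f) f \<in> \<real>\<^sub>\<ge>\<^sub>0"
    by (simp add: cinner_norm complex_nonneg_Reals_iff)
qed

lemma abs_operator_eqI:
  assumes "positive_operator B" "B \<circ> B = cadjoint S \<circ> S"
  shows "abs_operator S = B"
  unfolding abs_operator_def
proof (rule the_equality)
  show "positive_operator B \<and> B \<circ> B = cadjoint S \<circ> S" using assms by blast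
  show "B' = B" if "positive_operator B' \<and> B' \<circ> B' = cadjoint S \<circ> S" for B'
    using that assms positive_sqrt_unique[of B' B] by simp
qed

lemma abs_operator:
  assumes "bounded_clinear S"
  shows "positive_operator (abs_operator S)" "abs_operator S \<circ> abs_operator S = cadjoint S \<circ> S"
  using ex_positive_sqrt[OF positive_operator_adjoint_mult[OF assms]] abs_operator_eqI by metis+

lemma abs_operator_positive:
  assumes S: "positive_operator S"
  shows "abs_operator S = S"
proof (rule abs_operator_eqI[OF S])
  have "cadjoint S = S" by (rule cadjoint_eqI) (rule positive_operatorD(2)[OF S])
  then show "S \<circ> S = cadjoint S \<circ> S" by simp
qed

lemma norm_abs_operator:
  assumes S: "bounded_clinear S"
  shows "norm (abs_operator S f) = norm (S f)"
proof -
  note M = abs_operator[OF S]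
  have "cinner (abs_operator S f) (abs_operator S f) = cinner f ((cadjoint S \<circ> S) f)"
    using positive_operatorD(2)[OF M(1)] unfolding M(2)[symmetric] by simp
  also have "\<dots> = cinner (S f) (S f)" using cadjoint(2)[OF S] by simp
  finally have "(norm (abs_operator S f))\<^sup>2 = (norm (S f))\<^sup>2"
    unfolding cinner_norm of_real_eq_iff .
  then show ?thesis by simp
qed

lemma cauchy_image_bounded_clinear:
  fixes X :: "nat \<Rightarrow> 'a::euclidean_space L2"
  assumes "bounded_clinear B" "Cauchy X"
  shows "Cauchy (\<lambda>n. B (X n))"
  using bounded_linear.Cauchy[OF bounded_clinearD(5)[OF assms(1)] assms(2)] .

lemma subspace_closure:
  fixes S :: "'h::real_normed_vector set"
  assumes "subspace S"
  shows "subspace (closure S)"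
  unfolding subspace_def
proof (intro conjI ballI allI)
  show "0 \<in> closure S" using subspace_0[OF assms] closure_subset by blast
  fix x y assume "x \<in> closure S" "y \<in> closure S"
  then obtain X Y where "\<And>n. X n \<in> S" "X \<longlonglongrightarrow> x" "\<And>n. Y n \<in> S" "Y \<longlonglongrightarrow> y"
    unfolding closure_sequential by metis
  then show "x + y \<in> closure S"
    unfolding closure_sequential using assms
    by (intro exI[of _ "\<lambda>n. X n + Y n"]) (auto intro: tendsto_add subspace_add)
next
  fix c x assume "x \<in> closure S"
  then obtain X where "\<And>n. X n \<in> S" "X \<longlonglongrightarrow> x" unfolding closure_sequential by metis
  then show "c *\<^sub>R x \<in> closure S"
    unfolding closure_sequential using assms
    by (intro exI[of _ "\<lambda>n. c *\<^sub>R X n"]) (auto intro: tendsto_scaleR subspace_scale)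
qed

text \<open>In terms of the polar decomposition \<open>T = U |T|\<close> with
  \<open>|T| = B^2\<close>, the operator \<open>W\<close> is \<open>U B\<close>. Only the square
  root of \<open>|T|\<close> is split off, so that both factors of \<open>T = W B\<close> have
  square-summable norms on a basis in which the trace of \<open>|T|\<close> converges.\<close>

lemma polar_factor:
  fixes T B :: "'a::euclidean_space L2 \<Rightarrow> 'a L2"
  assumes T: "bounded_clinear T" and B: "positive_operator B"
    and nT: "\<And>f. norm (T f) = norm (B (B f))"
  obtains W where "bounded_clinear W" "\<And>f. W (B f) = T f" "\<And>f. norm (W f) = norm (B f)"
proof -
  have clB: "bounded_clinear B" by (rule positive_operatorD[OF B])
  \<comment> \<open>The graph of \<open>W\<close>: it has to send \<open>B f\<close> to
    \<open>T f\<close>, is extended by limits to the closure of the range of \<open>B\<close>, and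
    by 0 to the orthogonal complement, where \<open>q\<close> lives.\<close>
  define \<Gamma> where "\<Gamma> h y \<longleftrightarrow> (\<exists>F q. (\<forall>f. cinner q (B f) = 0) \<and> (\<lambda>n. B (F n)) \<longlonglongrightarrow> h - q \<and> (\<lambda>n. T (F n)) \<longlonglongrightarrow> y)"
    for h y
  have norm\<Gamma>: "norm y = norm (B h)" if g: "\<Gamma> h y" for h y
  proof -
    obtain F q where q: "\<forall>f. cinner q (B f) = 0" and F: "(\<lambda>n. B (F n)) \<longlonglongrightarrow> h - q" "(\<lambda>n. T (F n)) \<longlonglongrightarrow> y"
      using g unfolding \<Gamma>_def by blast
    have "B q = 0" using positive_operatorD(2)[OF B, of q] q by (intro L2_eqI) simp
    moreover have "(\<lambda>n. B (B (F n))) \<longlonglongrightarrow> B (h - q)"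
      by (rule bounded_linear.tendsto[OF bounded_clinearD(5)[OF clB] F(1)])
    ultimately have "(\<lambda>n. norm (B (B (F n)))) \<longlonglongrightarrow> norm (B h)"
      by (simp add: bounded_clinearD[OF clB] tendsto_norm)
    then show ?thesis
      using LIMSEQ_unique tendsto_norm[OF F(2)] unfolding nT by blast
  qed
  have add\<Gamma>: "\<Gamma> (h + h') (y + y')" if g: "\<Gamma> h y" and g': "\<Gamma> h' y'" for h h' y y'
  proof -
    obtain F q where q: "\<forall>f. cinner q (B f) = 0" and F: "(\<lambda>n. B (F n)) \<longlonglongrightarrow> h - q" "(\<lambda>n. T (F n)) \<longlonglongrightarrow> y"
      using g unfolding \<Gamma>_def by blast
    obtain F' q' where q': "\<forall>f. cinner q' (B f) = 0" and F': "(\<lambda>n. B (F' n)) \<longlonglongrightarrow> h' - q'" "(\<lambda>n. T (F' n)) \<longlonglongrightarrow> y'"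
      using g' unfolding \<Gamma>_def by blast
    show ?thesis
      unfolding \<Gamma>_def
      using tendsto_add[OF F(1) F'(1)] tendsto_add[OF F(2) F'(2)] q q'
      by (intro exI[of _ "\<lambda>n. F n + F' n"] exI[of _ "q + q'"])
        (simp add: bounded_clinearD[OF clB] bounded_clinearD[OF T] cinner_add_left algebra_simps)
  qed
  have scale\<Gamma>: "\<Gamma> (c *\<^sub>C h) (c *\<^sub>C y)" if g: "\<Gamma> h y" for h y c
  proof -
    obtain F q where q: "\<forall>f. cinner q (B f) = 0" and F: "(\<lambda>n. B (F n)) \<longlonglongrightarrow> h - q" "(\<lambda>n. T (F n)) \<longlonglongrightarrow> y"
      using g unfolding \<Gamma>_def by blast
    show ?thesis
      unfolding \<Gamma>_def
      using bounded_linear.tendsto[OF bounded_linear_scaleC[of c] F(1)]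
        bounded_linear.tendsto[OF bounded_linear_scaleC[of c] F(2)] q
      by (intro exI[of _ "\<lambda>n. c *\<^sub>C F n"] exI[of _ "c *\<^sub>C q"])
        (simp add: bounded_clinearD[OF clB] bounded_clinearD[OF T] cinner_scaleC_left scaleC_diff_right)
  qed
  have unique: "y = y'" if "\<Gamma> h y" "\<Gamma> h y'" for h y y'
  proof -
    have m: "-1 *\<^sub>C x = - x" for x :: "'a L2"
      by (rule L2_eqI) (simp add: cinner_scaleC_left)
    have "\<Gamma> 0 (y - y')" using add\<Gamma>[OF that(1) scale\<Gamma>[OF that(2), of "-1"]] by (simp add: m)
    from norm\<Gamma>[OF this] show ?thesis by (simp add: bounded_clinearD[OF clB])
  qed
  have exists: "\<exists>y. \<Gamma> h y" for h
  proof -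
    have "subspace (range B)"
      by (rule linear_subspace_image[OF bounded_linear.linear[OF bounded_clinearD(5)[OF clB]] subspace_UNIV])
    then have "subspace (closure (range B))" by (rule subspace_closure)
    then obtain p where p: "p \<in> closure (range B)" "\<And>s. s \<in> closure (range B) \<Longrightarrow> inner (h - p) s = 0"
      using hilbert_projection[of "closure (range B)" h] by auto
    have pB: "inner (h - p) (B f) = 0" for f
      by (rule p(2)) (use closure_subset[of "range B"] in auto)
    have "cinner (h - p) (B f) = 0" for f
      using pB[of f] pB[of "\<i> *\<^sub>C f"] by (simp add: cinner_inner bounded_clinearD[OF clB] zero_complex.ctr)
    moreover obtain F where F: "(\<lambda>n. B (F n)) \<longlonglongrightarrow> p"
    proof -
      obtain X where X: "\<And>n. X n \<in> range B" "X \<longlonglongrightarrow> p" using p(1) unfolding closure_sequential by blast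
      then have "\<forall>n. \<exists>f. X n = B f" by blast
      then obtain F where "\<And>n. X n = B (F n)" by metis
      then have "X = (\<lambda>n. B (F n))" by auto
      with X(2) have "(\<lambda>n. B (F n)) \<longlonglongrightarrow> p" by simp
      then show ?thesis by (rule that)
    qed
    moreover have "Cauchy (\<lambda>n. T (F n))"
    proof -
      have "Cauchy (\<lambda>n. B (B (F n)))"
        using cauchy_image_bounded_clinear[OF clB LIMSEQ_imp_Cauchy[OF F]] .
      then show ?thesis
        unfolding Cauchy_def dist_norm bounded_clinearD(2)[OF clB, symmetric] bounded_clinearD(2)[OF T, symmetric] nT .
    qed
    then obtain y where "(\<lambda>n. T (F n)) \<longlonglongrightarrow> y" by (auto simp: Cauchy_convergent_iff convergent_def)
    ultimately have "\<Gamma> h y"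
      unfolding \<Gamma>_def by (intro exI[of _ F] exI[of _ "h - p"]) auto
    then show ?thesis ..
  qed
  define W where "W h = (THE y. \<Gamma> h y)" for h
  have W: "\<Gamma> h (W h)" for h
    unfolding W_def using exists[of h] unique[of h] by (metis theI')
  have nW: "norm (W f) = norm (B f)" for f by (rule norm\<Gamma>[OF W])
  have "bounded_clinear W"
  proof (rule bounded_clinearI)
    show "W (f + g) = W f + W g" for f g by (rule unique[OF W add\<Gamma>[OF W W]])
    show "W (c *\<^sub>C f) = c *\<^sub>C W f" for c f by (rule unique[OF W scale\<Gamma>[OF W]])
    show "norm (W f) \<le> onorm B * norm f" for f unfolding nW by (rule bounded_clinearD[OF clB])
  qed
  moreover have "W (B f) = T f" for f
  proof (rule unique[OF W])
    show "\<Gamma> (B f) (T f)" unfolding \<Gamma>_def by (intro exI[of _ "\<lambda>_. f"] exI[of _ 0]) auto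
  qed
  ultimately show ?thesis using nW by (rule that)
qed

text \<open>Turns a family over a countable set, possibly finite, into a sequence: numbers that are
  not the code of an element get the neutral value 0.\<close>

lemma has_sum_to_nat:
  fixes G :: "'i \<Rightarrow> 'c::{comm_monoid_add, topological_space}"
  assumes "countable E" "(G has_sum s) E"
  shows "((\<lambda>n. if n \<in> to_nat_on E ` E then G (inv_into E (to_nat_on E) n) else 0) has_sum s) UNIV"
proof -
  have inj: "inj_on (to_nat_on E) E" using assms(1) by (rule inj_on_to_nat_on)
  have "((\<lambda>n. G (inv_into E (to_nat_on E) n)) has_sum s) (to_nat_on E ` E)"
    using assms(2) by (subst has_sum_reindex[OF inj]) (simp add: o_def inj cong: has_sum_cong)
  then show ?thesis
    by (subst has_sum_cong_neutral[where T = "to_nat_on E ` E"]) auto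
qed

text \<open>Expand \<open>T f = W (B f)\<close> in a basis in which the trace of \<open>|T|\<close>
  converges. The images of the basis vectors under \<open>W\<close> and \<open>B\<close> serve as
  \<open>u\<close> and \<open>v\<close>; their norms agree, so the product of norms at
  \<open>e\<close> is the diagonal entry of \<open>|T|\<close>.\<close>

lemma trace_class_nuclear:
  fixes T :: "'a::euclidean_space L2 \<Rightarrow> 'a L2"
  assumes "trace_class T"
  shows "\<exists>u v. nuclear_rep T u v"
proof -
  have T: "bounded_clinear T" using assms by (simp add: trace_class_def)
  obtain E where E: "is_onb E" "(\<lambda>e. cinner (abs_operator T e) e) summable_on E"
    using assms by (auto simp: trace_class_def)
  obtain B where B: "positive_operator B" "B \<circ> B = abs_operator T"
    using ex_positive_sqrt[OF abs_operator(1)[OF T]] by blast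
  have clB: "bounded_clinear B" by (rule positive_operatorD[OF B(1)])
  have nT: "norm (T f) = norm (B (B f))" for f
    using norm_abs_operator[OF T, of f] by (simp flip: B(2))
  obtain W where W: "bounded_clinear W" "\<And>f. W (B f) = T f" "\<And>f. norm (W f) = norm (B f)"
    using polar_factor[OF T B(1) nT] by metis
  have "Re (cinner (abs_operator T e) e) = norm (W e) * norm (B e)" for e
    using positive_operatorD(2)[OF B(1), of "B e" e]
    by (simp add: W(3) cinner_norm power2_eq_square flip: B(2))
  moreover have "(\<lambda>e. Re (cinner (abs_operator T e) e)) summable_on E"
    using summable_on_bounded_linear[OF bounded_linear_Re E(2)] by (simp add: o_def)
  ultimately have sE: "(\<lambda>e. norm (W e) * norm (B e)) summable_on E" by simp
  \<comment> \<open>A summable family has countable support. Off the support both \<open>W e\<close>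
    and \<open>B e\<close> vanish, having equal norms, so no rank one term is lost.\<close>
  define E' where "E' = {e \<in> E. norm (W e) * norm (B e) \<noteq> 0}"
  have "countable E'"
    unfolding E'_def by (rule abs_summable_countable) (use sE in simp)
  have sum0: "norm (W e) * norm (B e) = 0" if "e \<in> E - E'" for e
    using that by (auto simp: E'_def)
  define \<iota> where "\<iota> = inv_into E' (to_nat_on E')"
  define N where "N = to_nat_on E' ` E'"
  define u where "u n = (if n \<in> N then W (\<iota> n) else 0)" for n
  define v where "v n = (if n \<in> N then B (\<iota> n) else 0)" for n
  have "nuclear_rep T u v"
    unfolding nuclear_rep_def
  proof (intro conjI allI)
    obtain s where "((\<lambda>e. norm (W e) * norm (B e)) has_sum s) E" using sE by (auto simp: summable_on_def)
    then have "((\<lambda>e. norm (W e) * norm (B e)) has_sum s) E'"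
      by (subst (asm) has_sum_cong_neutral[where T = E']) (use sum0 in \<open>auto simp: E'_def\<close>)
    from has_sum_imp_sums[OF has_sum_to_nat[OF \<open>countable E'\<close> this]]
    have "(\<lambda>n. norm (u n) * norm (v n)) sums s"
      by (rule sums_cong[THEN iffD1, rotated]) (auto simp: u_def v_def N_def \<iota>_def)
    then show "summable (\<lambda>n. norm (u n) * norm (v n))" by (rule sums_summable)
    fix f g
    have "((\<lambda>e. cinner (B f) e * cinner e (cadjoint W g)) has_sum cinner (B f) (cadjoint W g)) E"
      by (rule parseval[OF E(1)])
    then have "((\<lambda>e. cinner f (B e) * cinner (W e) g) has_sum cinner (T f) g) E"
      by (simp add: positive_operatorD(2)[OF B(1)] flip: cadjoint(2)[OF W(1)] W(2))
    then have "((\<lambda>e. cinner f (B e) * cinner (W e) g) has_sum cinner (T f) g) E'"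
      by (subst (asm) has_sum_cong_neutral[where T = E']) (use sum0 W(3) in \<open>auto simp: E'_def\<close>)
    from has_sum_imp_sums[OF has_sum_to_nat[OF \<open>countable E'\<close> this]]
    show "(\<lambda>n. cinner f (v n) * cinner (u n) g) sums cinner (T f) g"
      by (rule sums_cong[THEN iffD1, rotated]) (auto simp: u_def v_def N_def \<iota>_def)
  qed
  then show ?thesis by blast
qed

text \<open>The projection is positive, hence its own absolute value, and in a basis containing
  \<open>\<phi>\<close> its trace series has a single nonzero term.\<close>

lemma rank_one_trace_class:
  fixes \<phi> :: "'a::euclidean_space L2"
  assumes "norm \<phi> = 1"
  shows "trace_class (\<lambda>f. cinner f \<phi> *\<^sub>C \<phi>)" (is "trace_class ?S")
proof -
  have "bounded_clinear ?S"
  proof (rule bounded_clinearI[where C = 1])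
    show "norm (cinner f \<phi> *\<^sub>C \<phi>) \<le> 1 * norm f" for f
      using cinner_Cauchy_Schwarz[of f \<phi>] assms by simp
  qed (simp_all add: cinner_add_left cinner_scaleC_left scaleC_add_left)
  moreover have "cinner (?S f) f = of_real ((cmod (cinner f \<phi>))\<^sup>2)" for f
    using cinner_commute[of \<phi> f] by (simp add: cinner_scaleC_left flip: complex_norm_square)
  ultimately have pos: "positive_operator ?S"
    by (simp add: positive_operator_def complex_nonneg_Reals_iff)
  have "orthonormal {\<phi>}" using assms by (simp add: orthonormal_def cinner_norm)
  then obtain E where E: "\<phi> \<in> E" "is_onb E" using orthonormal_extend[of "{\<phi>}"] by auto
  have "((\<lambda>e. cinner (?S e) e) has_sum cinner (?S \<phi>) \<phi>) E"
    by (rule has_sum_finite_neutralI[where B = "{\<phi>}"])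
      (use E orthonormalD[OF is_onb_orthonormal[OF E(2)]] in \<open>auto simp: cinner_scaleC_left\<close>)
  then have "(\<lambda>e. cinner (abs_operator ?S e) e) summable_on E"
    unfolding abs_operator_positive[OF pos] by (auto simp: summable_on_def)
  with E(2) positive_operatorD(1)[OF pos] show ?thesis by (auto simp: trace_class_def)
qed

subsection \<open>Integration and Gaussians\<close>

lemma integrable_affine:
  fixes f :: "'b::euclidean_space \<Rightarrow> 'c::{banach,second_countable_topology}"
  assumes "integrable lborel f" "\<bar>s\<bar> = 1"
  shows "integrable lborel (\<lambda>t. f (x + s *\<^sub>R t))"
proof -
  have [measurable]: "f \<in> borel_measurable borel" using assms by auto
  have "integrable (distr lborel borel (\<lambda>t. x + s *\<^sub>R t)) f"
    using assms by (simp add: lborel_distr_sign_affine)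
  then show ?thesis by (subst (asm) integrable_distr_eq) auto
qed

lemma integral_affine:
  fixes f :: "'b::euclidean_space \<Rightarrow> 'c::{banach,second_countable_topology}"
  assumes [measurable]: "f \<in> borel_measurable borel" and "\<bar>s\<bar> = 1"
  shows "(\<integral>t. f (x + s *\<^sub>R t) \<partial>lborel) = (\<integral>t. f t \<partial>lborel)"
proof -
  have "(\<integral>t. f t \<partial>lborel) = (\<integral>t. f t \<partial>distr lborel borel (\<lambda>t. x + s *\<^sub>R t))"
    using assms(2) by (simp add: lborel_distr_sign_affine)
  also have "\<dots> = (\<integral>t. f (x + s *\<^sub>R t) \<partial>lborel)" by (rule integral_distr) auto
  finally show ?thesis by simp
qed

lemma nn_integral_affine:
  assumes [measurable]: "f \<in> borel_measurable borel" and "\<bar>s\<bar> = 1"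
  shows "(\<integral>\<^sup>+t. f (x + s *\<^sub>R t) \<partial>lborel) = (\<integral>\<^sup>+t. f t \<partial>(lborel :: 'b::euclidean_space measure))"
proof -
  have "(\<integral>\<^sup>+t. f t \<partial>lborel) = (\<integral>\<^sup>+t. f t \<partial>distr lborel borel (\<lambda>t. x + s *\<^sub>R t))"
    using assms(2) by (simp add: lborel_distr_sign_affine)
  also have "\<dots> = (\<integral>\<^sup>+t. f (x + s *\<^sub>R t) \<partial>lborel)" by (rule nn_integral_distr) auto
  finally show ?thesis by simp
qed

lemma integrable_minus_shift:
  fixes f :: "'b::euclidean_space \<Rightarrow> 'c::{banach,second_countable_topology}"
  shows "integrable lborel f \<Longrightarrow> integrable lborel (\<lambda>t. f (t - x))"
  using integrable_affine[of f 1 "- x"] by (simp add: algebra_simps)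

lemma integral_minus_shift:
  fixes f :: "'b::euclidean_space \<Rightarrow> 'c::{banach,second_countable_topology}"
  shows "f \<in> borel_measurable borel \<Longrightarrow> (\<integral>t. f (t - x) \<partial>lborel) = (\<integral>t. f t \<partial>lborel)"
  using integral_affine[of f 1 "- x"] by (simp add: algebra_simps)

lemma integrable_reflect:
  fixes f :: "'b::euclidean_space \<Rightarrow> 'c::{banach,second_countable_topology}"
  shows "integrable lborel f \<Longrightarrow> integrable lborel (\<lambda>t. f (x - t))"
  using integrable_affine[of f "-1" x] by simp

lemma integral_reflect:
  fixes f :: "'b::euclidean_space \<Rightarrow> 'c::{banach,second_countable_topology}"
  shows "f \<in> borel_measurable borel \<Longrightarrow> (\<integral>t. f (x - t) \<partial>lborel) = (\<integral>t. f t \<partial>lborel)"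
  using integral_affine[of f "-1" x] by simp

section \<open>Continuity of translation in L1\<close>

text \<open>Both indicators have the same integral, so their L1 distance is twice the integral of
  the positive part. That part is dominated by \<open>indicator U\<close> itself and tends to 0
  pointwise because \<open>U\<close> is open.\<close>

lemma tendsto_translation_open:
  fixes U :: "'b::euclidean_space set"
  assumes U: "open U" "emeasure lborel U < \<infinity>"
  shows "((\<lambda>y. \<integral>x. \<bar>indicator U (x - y) - indicator U x\<bar> \<partial>lborel) \<longlongrightarrow> (0::real)) (at 0)"
  unfolding tendsto_at_iff_sequentially o_def
proof (intro allI impI)
  fix Y :: "nat \<Rightarrow> 'b" assume Y: "Y \<longlonglongrightarrow> 0"
  have [measurable]: "U \<in> sets borel" using U by auto
  let ?u = "indicator U :: 'b \<Rightarrow> real"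
  let ?p = "\<lambda>i x. max 0 (?u x - ?u (x - Y i))"
  have int: "integrable lborel ?u" using U by simp
  have ints: "integrable lborel (\<lambda>x. ?u (x - y))" for y by (rule integrable_minus_shift[OF int])
  have "(\<lambda>i. \<integral>x. ?p i x \<partial>lborel) \<longlonglongrightarrow> (\<integral>x. 0 \<partial>(lborel :: 'b measure))"
  proof (rule integral_dominated_convergence[where w = ?u])
    show "AE x in lborel. (\<lambda>i. ?p i x) \<longlonglongrightarrow> 0"
    proof (rule AE_I2)
      fix x
      show "(\<lambda>i. ?p i x) \<longlonglongrightarrow> 0"
      proof (cases "x \<in> U")
        case True
        have "(\<lambda>i. x - Y i) \<longlonglongrightarrow> x - 0" by (intro tendsto_intros Y)
        then have "\<forall>\<^sub>F i in sequentially. x - Y i \<in> U"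
          using U(1) True by (simp add: topological_tendstoD)
        then show ?thesis
          by (intro tendsto_eventually) (auto elim!: eventually_mono simp: True)
      qed (simp add: indicator_def)
    qed
  qed (use int in \<open>auto simp: indicator_def\<close>)
  then have *: "(\<lambda>i. 2 * (\<integral>x. ?p i x \<partial>lborel)) \<longlonglongrightarrow> 2 * 0"
    by (intro tendsto_mult) auto
  have "(\<integral>x. \<bar>?u (x - Y i) - ?u x\<bar> \<partial>lborel) = 2 * (\<integral>x. ?p i x \<partial>lborel)" for i
  proof -
    have ip: "integrable lborel (?p i)"
      using int ints[of "Y i"] by (intro integrable_max) auto
    have "(\<integral>x. \<bar>?u (x - Y i) - ?u x\<bar> \<partial>lborel)
       = (\<integral>x. 2 * ?p i x + (?u (x - Y i) - ?u x) \<partial>lborel)"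
      by (rule Bochner_Integration.integral_cong) (auto simp: max_def abs_real_def)
    also have "\<dots> = 2 * (\<integral>x. ?p i x \<partial>lborel) + ((\<integral>x. ?u (x - Y i) \<partial>lborel) - (\<integral>x. ?u x \<partial>lborel))"
      using ip int ints[of "Y i"] by simp
    also have "(\<integral>x. ?u (x - Y i) \<partial>lborel) = (\<integral>x. ?u x \<partial>lborel)"
      by (rule integral_minus_shift) auto
    finally show ?thesis by simp
  qed
  then show "(\<lambda>i. \<integral>x. \<bar>?u (x - Y i) - ?u x\<bar> \<partial>lborel) \<longlonglongrightarrow> 0"
    using * by simp
qed

text \<open>Translation preserves the L1 distance, so an approximant within \<open>e / 3\<close>
  costs this much twice, and the third part is its own modulus of continuity.\<close>

lemma tendsto_translation_approx:
  fixes f :: "'b::euclidean_space \<Rightarrow> 'c::{banach,second_countable_topology}"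
  assumes f: "integrable lborel f"
    and approx: "\<And>e. e > 0 \<Longrightarrow> \<exists>g. integrable lborel g \<and> (\<integral>x. norm (f x - g x) \<partial>lborel) < e \<and>
       ((\<lambda>y. \<integral>x. norm (g (x - y) - g x) \<partial>lborel) \<longlongrightarrow> 0) (at 0)"
  shows "((\<lambda>y. \<integral>x. norm (f (x - y) - f x) \<partial>lborel) \<longlongrightarrow> 0) (at 0)"
proof (rule tendstoI)
  fix e :: real assume "e > 0"
  then obtain g where g: "integrable lborel g" "(\<integral>x. norm (f x - g x) \<partial>lborel) < e / 3"
    and tg: "((\<lambda>y. \<integral>x. norm (g (x - y) - g x) \<partial>lborel) \<longlongrightarrow> 0) (at 0)"
    using approx[of "e / 3"] by auto
  have [measurable]: "f \<in> borel_measurable borel" "g \<in> borel_measurable borel" using f g(1) by auto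
  have le: "(\<integral>x. norm (f (x - y) - f x) \<partial>lborel)
      \<le> 2 * (\<integral>x. norm (f x - g x) \<partial>lborel) + (\<integral>x. norm (g (x - y) - g x) \<partial>lborel)" for y
  proof -
    have i1: "integrable lborel (\<lambda>x. norm (f x - g x))" using f g by auto
    have i2: "integrable lborel (\<lambda>x. norm (f (x - y) - g (x - y)))"
      using integrable_minus_shift[OF i1] .
    have i3: "integrable lborel (\<lambda>x. norm (g (x - y) - g x))"
      using integrable_minus_shift[OF g(1)] g(1) by auto
    have i4: "integrable lborel (\<lambda>x. norm (f (x - y) - f x))"
      using integrable_minus_shift[OF f] f by auto
    have "(\<integral>x. norm (f (x - y) - f x) \<partial>lborel) \<le>
      (\<integral>x. norm (f (x - y) - g (x - y)) + norm (f x - g x) + norm (g (x - y) - g x) \<partial>lborel)"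
    proof (rule integral_mono)
      fix x
      have "f (x - y) - f x = (f (x - y) - g (x - y)) - (f x - g x) + (g (x - y) - g x)" by simp
      then have "norm (f (x - y) - f x) \<le> norm ((f (x - y) - g (x - y)) - (f x - g x)) + norm (g (x - y) - g x)"
        using norm_triangle_ineq by metis
      then show "norm (f (x - y) - f x) \<le> norm (f (x - y) - g (x - y)) + norm (f x - g x) + norm (g (x - y) - g x)"
        using norm_triangle_ineq4[of "f (x - y) - g (x - y)" "f x - g x"] by linarith
    qed (use i1 i2 i3 i4 in auto)
    also have "\<dots> = (\<integral>x. norm (f (x - y) - g (x - y)) \<partial>lborel) + (\<integral>x. norm (f x - g x) \<partial>lborel)
       + (\<integral>x. norm (g (x - y) - g x) \<partial>lborel)"
      using i1 i2 i3 by simp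
    also have "(\<integral>x. norm (f (x - y) - g (x - y)) \<partial>lborel) = (\<integral>x. norm (f x - g x) \<partial>lborel)"
      by (rule integral_minus_shift[of "\<lambda>x. norm (f x - g x)"]) measurable
    finally show ?thesis by simp
  qed
  have "\<forall>\<^sub>F y in at 0. (\<integral>x. norm (g (x - y) - g x) \<partial>lborel) < e / 3"
    using tg \<open>e > 0\<close> by (auto dest!: order_tendstoD(2)[where a = "e / 3"])
  then show "\<forall>\<^sub>F y in at 0. dist (\<integral>x. norm (f (x - y) - f x) \<partial>lborel) 0 < e"
  proof eventually_elim
    fix y assume "(\<integral>x. norm (g (x - y) - g x) \<partial>lborel) < e / 3"
    then have "(\<integral>x. norm (f (x - y) - f x) \<partial>lborel) < e" using le[of y] g(2) by linarith
    then show "dist (\<integral>x. norm (f (x - y) - f x) \<partial>lborel) 0 < e" by simp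
  qed
qed

text \<open>Outer regularity reduces a set of finite measure to an open set that is larger by an
  arbitrarily small amount.\<close>

lemma tendsto_translation_indicator:
  fixes A :: "'b::euclidean_space set"
  assumes A: "A \<in> sets borel" "emeasure lborel A < \<infinity>"
  shows "((\<lambda>y. \<integral>x. norm (indicator A (x - y) - indicator A x :: real) \<partial>lborel) \<longlongrightarrow> 0) (at 0)"
proof (rule tendsto_translation_approx)
  show "integrable lborel (indicator A :: 'b \<Rightarrow> real)" using A by simp
  fix e :: real assume "e > 0"
  have "A \<in> sets lebesgue" using A by auto
  then obtain U where U: "open U" "A \<subseteq> U" "U - A \<in> lmeasurable" "emeasure lebesgue (U - A) < ennreal e"
    using sets_lebesgue_outer_open \<open>e > 0\<close> by metis
  have [measurable]: "U \<in> sets borel" "A \<in> sets borel" using U A by auto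
  have eUA: "emeasure lborel (U - A) < ennreal e" using U(4) by simp
  then have eUAf: "emeasure lborel (U - A) < \<infinity>" by (rule order.strict_trans) simp
  have "emeasure lborel U \<le> emeasure lborel A + emeasure lborel (U - A)"
    using U(2) by (subst plus_emeasure) (auto simp: Un_absorb1)
  also have "\<dots> < \<infinity>" using A(2) eUAf by (auto simp: ennreal_add_eq_top less_top)
  finally have Ufin: "emeasure lborel U < \<infinity>" .
  have "(\<integral>x. norm (indicator A x - indicator U x :: real) \<partial>lborel) = (\<integral>x. indicator (U - A) x \<partial>lborel)"
    using U(2) by (intro Bochner_Integration.integral_cong) (auto simp: indicator_def)
  also have "\<dots> = measure lborel (U - A)" by simp
  also have "\<dots> < e"
    using eUA eUAf by (simp add: emeasure_eq_ennreal_measure ennreal_less_iff less_top)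
  finally show "\<exists>g. integrable lborel g \<and> (\<integral>x. norm (indicator A x - g x :: real) \<partial>lborel) < e \<and>
       ((\<lambda>y. \<integral>x. norm (g (x - y) - g x) \<partial>lborel) \<longlongrightarrow> 0) (at 0)"
    using tendsto_translation_open[OF U(1) Ufin] Ufin
    by (intro exI[of _ "indicator U"]) auto
qed

lemma tendsto_translation_L1:
  fixes f :: "'b::euclidean_space \<Rightarrow> 'c::{banach,second_countable_topology}"
  assumes "integrable lborel f"
  shows "((\<lambda>y. \<integral>x. norm (f (x - y) - f x) \<partial>lborel) \<longlongrightarrow> 0) (at 0)"
  using assms
proof (induction rule: integrable_induct)
  case (base A c)
  have "((\<lambda>y. norm c * (\<integral>x. norm (indicator A (x - y) - indicator A x :: real) \<partial>lborel)) \<longlongrightarrow> norm c * 0) (at 0)"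
    by (intro tendsto_intros tendsto_translation_indicator) (use base in auto)
  then show ?case
    by (simp add: mult.commute flip: scaleR_diff_left)
next
  case (add f g)
  show ?case
  proof (rule Lim_null_comparison)
    show "((\<lambda>y. (\<integral>x. norm (f (x - y) - f x) \<partial>lborel) + (\<integral>x. norm (g (x - y) - g x) \<partial>lborel)) \<longlongrightarrow> 0) (at 0)"
      by (intro tendsto_add_zero add)
    have "(\<integral>x. norm (f (x - y) + g (x - y) - (f x + g x)) \<partial>lborel) \<le>
      (\<integral>x. norm (f (x - y) - f x) \<partial>lborel) + (\<integral>x. norm (g (x - y) - g x) \<partial>lborel)" for y
    proof -
      have "integrable lborel (\<lambda>x. norm (f (x - y) - f x))" "integrable lborel (\<lambda>x. norm (g (x - y) - g x))"
        using integrable_minus_shift[OF add(1)] integrable_minus_shift[OF add(2)] add(1,2) by auto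
      moreover have "integrable lborel (\<lambda>x. norm (f (x - y) + g (x - y) - (f x + g x)))"
        using integrable_minus_shift[OF add(1), of y] integrable_minus_shift[OF add(2), of y] add(1,2) by simp
      ultimately have "(\<integral>x. norm (f (x - y) + g (x - y) - (f x + g x)) \<partial>lborel) \<le>
          (\<integral>x. norm (f (x - y) - f x) + norm (g (x - y) - g x) \<partial>lborel)"
        by (intro integral_mono) (auto intro: norm_diff_triangle_ineq)
      then show ?thesis
        using \<open>integrable lborel (\<lambda>x. norm (f (x - y) - f x))\<close>
          \<open>integrable lborel (\<lambda>x. norm (g (x - y) - g x))\<close> by simp
    qed
    then show "\<forall>\<^sub>F y in at 0. norm (\<integral>x. norm (f (x - y) + g (x - y) - (f x + g x)) \<partial>lborel)
       \<le> (\<integral>x. norm (f (x - y) - f x) \<partial>lborel) + (\<integral>x. norm (g (x - y) - g x) \<partial>lborel)"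
      by simp
  qed
next
  case (lim f s)
  have [measurable]: "f \<in> borel_measurable borel" "\<And>i. s i \<in> borel_measurable borel" using lim by auto
  show ?case
  proof (rule tendsto_translation_approx)
    fix e :: real assume "e > 0"
    have "(\<lambda>i. \<integral>x. norm (f x - s i x) \<partial>lborel) \<longlonglongrightarrow> (\<integral>x. 0 \<partial>(lborel :: 'b measure))"
    \<comment> \<open>The approximants of the induction satisfy
      \<open>norm (s i x) \<le> 2 * norm (f x)\<close>, whence the factor 3 for the
      difference.\<close>
    proof (rule integral_dominated_convergence[where w = "\<lambda>x. 3 * norm (f x)"])
      show "AE x in lborel. (\<lambda>i. norm (f x - s i x)) \<longlonglongrightarrow> 0"
      proof (rule AE_I2)
        fix x :: 'b
        have "(\<lambda>i. s i x) \<longlonglongrightarrow> f x" using lim by auto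
        then have "(\<lambda>i. norm (f x - s i x)) \<longlonglongrightarrow> norm (f x - f x)" by (intro tendsto_intros)
        then show "(\<lambda>i. norm (f x - s i x)) \<longlonglongrightarrow> 0" by simp
      qed
      show "AE x in lborel. norm (norm (f x - s i x)) \<le> 3 * norm (f x)" for i
      proof (rule AE_I2)
        fix x :: 'b
        have "norm (s i x) \<le> 2 * norm (f x)" using lim by auto
        then show "norm (norm (f x - s i x)) \<le> 3 * norm (f x)"
          using norm_triangle_ineq4[of "f x" "s i x"] by simp
      qed
    qed (use lim in auto)
    then have "\<forall>\<^sub>F i in sequentially. (\<integral>x. norm (f x - s i x) \<partial>lborel) < e"
      using \<open>e > 0\<close> by (auto dest: order_tendstoD(2))
    then obtain i where "(\<integral>x. norm (f x - s i x) \<partial>lborel) < e"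
      by (auto simp: eventually_sequentially)
    then show "\<exists>g. integrable lborel g \<and> (\<integral>x. norm (f x - g x) \<partial>lborel) < e \<and>
       ((\<lambda>y. \<integral>x. norm (g (x - y) - g x) \<partial>lborel) \<longlongrightarrow> 0) (at 0)"
      using lim by blast
  qed (use lim in auto)
qed

section \<open>Gaussian integrals, Fubini and dilations\<close>

lemma
  fixes f :: "'b::euclidean_space \<Rightarrow> real \<Rightarrow> complex"
  assumes "\<And>b. b \<in> Basis \<Longrightarrow> integrable lborel (f b)"
  shows integrable_lborel_prod: "integrable lborel (\<lambda>x. \<Prod>b\<in>Basis. f b (x \<bullet> b))"
    and integral_lborel_prod: "(\<integral>x. (\<Prod>b\<in>Basis. f b (x \<bullet> b)) \<partial>lborel) = (\<Prod>b\<in>Basis. \<integral>x. f b x \<partial>lborel)"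
proof -
  interpret product_sigma_finite "\<lambda>b::'b. lborel :: real measure" ..
  let ?P = "\<Pi>\<^sub>M b\<in>(Basis::'b set). (lborel :: real measure)"
  have meas: "(\<lambda>g. \<Sum>b\<in>Basis. g b *\<^sub>R b) \<in> measurable ?P (borel :: 'b measure)"
    by measurable
  have [measurable]: "f b \<in> borel_measurable borel" if "b \<in> Basis" for b
    using assms[OF that] by auto
  have meas2: "(\<lambda>x. \<Prod>b\<in>Basis. f b (x \<bullet> b)) \<in> borel_measurable borel"
    by measurable
  have eq: "lborel = distr ?P borel (\<lambda>g. \<Sum>b\<in>Basis. g b *\<^sub>R b :: 'b)"
    unfolding lborel_def[where 'a = 'b] by (simp only: lborel_eq_real)
  have coord: "(\<Sum>b\<in>Basis. g b *\<^sub>R b) \<bullet> c = g c" if "c \<in> Basis" for g and c :: 'b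
    using that by (simp add: inner_sum_left inner_Basis if_distrib cong: if_cong)
  have "integrable ?P (\<lambda>g. \<Prod>b\<in>Basis. f b (g b))"
    by (intro product_integrable_prod assms) auto
  then show "integrable lborel (\<lambda>x. \<Prod>b\<in>Basis. f b (x \<bullet> b))"
    by (subst eq) (simp add: integrable_distr_eq[OF meas meas2] coord)
  have "(\<integral>x. (\<Prod>b\<in>Basis. f b (x \<bullet> b)) \<partial>lborel) = (\<integral>g. (\<Prod>b\<in>Basis. f b (g b)) \<partial>?P)"
    by (subst eq) (simp add: integral_distr[OF meas meas2] coord)
  also have "\<dots> = (\<Prod>b\<in>Basis. \<integral>x. f b x \<partial>lborel)"
    by (intro product_integral_prod assms) auto
  finally show "(\<integral>x. (\<Prod>b\<in>Basis. f b (x \<bullet> b)) \<partial>lborel) = (\<Prod>b\<in>Basis. \<integral>x. f b x \<partial>lborel)" .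
qed

text \<open>With the factor \<open>pi\<close> in the exponent the Fourier transform of
  \<open>gauss c\<close> is \<open>gauss (1/c)\<close> divided by \<open>sqrt c ^ DIM\<close>, for
  characters with \<open>2 pi\<close> in the exponent.\<close>

definition gauss :: "real \<Rightarrow> 'b::euclidean_space \<Rightarrow> real" where
  "gauss c x = exp (- pi * c * (norm x)\<^sup>2)"

lemma gauss_pos: "gauss c x > 0" by (simp add: gauss_def)

lemma gauss_le_1: "c \<ge> 0 \<Longrightarrow> gauss c x \<le> 1"
  by (simp add: gauss_def)

lemma gauss_minus [simp]: "gauss c (- x) = gauss c x" by (simp add: gauss_def)

lemma continuous_on_gauss [continuous_intros]:
  "continuous_on S f \<Longrightarrow> continuous_on S (\<lambda>x. gauss c (f x))"
  unfolding gauss_def by (intro continuous_intros)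

lemma borel_measurable_gauss [measurable]: "gauss c \<in> borel_measurable borel"
  by (intro borel_measurable_continuous_onI continuous_intros)

lemma gauss_prod: "gauss c x = (\<Prod>b\<in>Basis. exp (- pi * c * (x \<bullet> b)\<^sup>2))"
  by (simp add: gauss_def exp_sum norm_eq_sqrt_inner euclidean_inner[of x x] sum_distrib_left
      sum_nonneg power2_eq_square flip: exp_sum)

lemma gauss_fourier_1:
  fixes w :: real
  assumes "c > 0"
  shows "integrable lborel (\<lambda>x. complex_of_real (exp (- pi * c * x\<^sup>2)) * exp (- 2 * pi * \<i> * of_real (w * x)))"
    and "(\<integral>x. complex_of_real (exp (- pi * c * x\<^sup>2)) * exp (- 2 * pi * \<i> * of_real (w * x)) \<partial>lborel)
      = of_real (exp (- pi * w\<^sup>2 / c) / sqrt c)"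
proof -
  \<comment> \<open>Dilation by \<open>s\<close> turns the integrand into the standard normal
    density, whose characteristic function is known; \<open>t\<close> is the frequency in the new
    variable.\<close>
  define s where "s = sqrt (2 * pi * c)"
  have s: "s > 0" "s\<^sup>2 = 2 * pi * c" using assms by (simp_all add: s_def)
  define t where "t = - 2 * pi * w / s"
  let ?g = "\<lambda>x. std_normal_density x *\<^sub>R (iexp (t * x) :: complex)"
  have intg: "integrable lborel ?g"
  proof (rule Bochner_Integration.integrable_bound)
    show "integrable lborel std_normal_density" by (rule integrable_normal_density) simp
  qed (auto simp: norm_mult)
  have int: "(\<integral>x. ?g x \<partial>lborel) = of_real (exp (- t\<^sup>2 / 2))"
    using fun_cong[OF char_std_normal_distribution, of t]
    by (simp add: char_def integral_density)
  have eq: "complex_of_real (exp (- pi * c * x\<^sup>2)) * exp (- 2 * pi * \<i> * of_real (w * x))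
     = sqrt (2 * pi) *\<^sub>R ?g (s * x)" for x
  proof -
    have "std_normal_density (s * x) = exp (- pi * c * x\<^sup>2) / sqrt (2 * pi)"
      by (simp add: std_normal_density_def power_mult_distrib s(2))
    moreover have "t * (s * x) = - 2 * pi * w * x" using s(1) by (simp add: t_def)
    ultimately show ?thesis
      by (simp add: scaleR_conv_of_real mult.assoc) (simp add: algebra_simps)
  qed
  have "integrable lborel (\<lambda>x. ?g (0 + s * x))"
    by (rule lborel_integrable_real_affine[OF intg]) (use s in simp)
  then show "integrable lborel (\<lambda>x. complex_of_real (exp (- pi * c * x\<^sup>2)) * exp (- 2 * pi * \<i> * of_real (w * x)))"
    unfolding eq by (intro integrable_scaleR_right) simp
  have "(\<integral>x. ?g x \<partial>lborel) = \<bar>s\<bar> *\<^sub>R (\<integral>x. ?g (0 + s * x) \<partial>lborel)"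
    by (rule lborel_integral_real_affine) (use s in simp)
  then have "of_real (exp (- t\<^sup>2 / 2)) = s *\<^sub>R (\<integral>x. ?g (s * x) \<partial>lborel)"
    unfolding int using s(1) by (simp only: abs_of_pos add_0)
  then have "(\<integral>x. ?g (s * x) \<partial>lborel) = (1 / s) *\<^sub>R of_real (exp (- t\<^sup>2 / 2))"
    using s(1) by (simp del: of_real_exp)
  then have "(\<integral>x. sqrt (2 * pi) *\<^sub>R ?g (s * x) \<partial>lborel) = (sqrt (2 * pi) / s) *\<^sub>R of_real (exp (- t\<^sup>2 / 2))"
    by (subst integral_scaleR_right) simp
  also have "sqrt (2 * pi) / s = 1 / sqrt c" by (simp add: s_def real_sqrt_mult)
  also have "- t\<^sup>2 / 2 = - pi * w\<^sup>2 / c"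
  proof -
    have "t\<^sup>2 = 2 * pi * w\<^sup>2 / c"
      unfolding t_def power_divide s(2) using assms by (simp add: power2_eq_square field_simps)
    then show ?thesis by simp
  qed
  finally show "(\<integral>x. complex_of_real (exp (- pi * c * x\<^sup>2)) * exp (- 2 * pi * \<i> * of_real (w * x)) \<partial>lborel)
      = of_real (exp (- pi * w\<^sup>2 / c) / sqrt c)"
    unfolding eq by (simp add: scaleR_conv_of_real)
qed

lemma gauss_fourier:
  fixes w :: "'b::euclidean_space"
  assumes "c > 0"
  shows integrable_gauss_character: "integrable lborel (\<lambda>x. complex_of_real (gauss c x) * exp (- 2 * pi * \<i> * of_real (w \<bullet> x)))"
    and integral_gauss_character: "(\<integral>x. complex_of_real (gauss c x) * exp (- 2 * pi * \<i> * of_real (w \<bullet> x)) \<partial>lborel)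
      = of_real (gauss (1 / c) w / sqrt c ^ DIM('b))"
proof -
  let ?f = "\<lambda>b x. complex_of_real (exp (- pi * c * x\<^sup>2)) * exp (- 2 * pi * \<i> * of_real ((w \<bullet> b) * x))"
  have eq: "complex_of_real (gauss c x) * exp (- 2 * pi * \<i> * of_real (w \<bullet> x)) = (\<Prod>b\<in>Basis. ?f b (x \<bullet> b))" for x
  proof -
    have "complex_of_real (gauss c x) = (\<Prod>b\<in>Basis. complex_of_real (exp (- pi * c * (x \<bullet> b)\<^sup>2)))"
      by (simp add: gauss_prod)
    moreover have "exp (- 2 * pi * \<i> * of_real (w \<bullet> x))
        = (\<Prod>b\<in>Basis. exp (- 2 * pi * \<i> * of_real ((w \<bullet> b) * (x \<bullet> b))))"
      by (simp add: euclidean_inner[of w x] sum_distrib_left flip: exp_sum)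
    ultimately show ?thesis by (simp only: prod.distrib)
  qed
  show "integrable lborel (\<lambda>x. complex_of_real (gauss c x) * exp (- 2 * pi * \<i> * of_real (w \<bullet> x)))"
    unfolding eq by (intro integrable_lborel_prod gauss_fourier_1 assms)
  have "(\<integral>x. complex_of_real (gauss c x) * exp (- 2 * pi * \<i> * of_real (w \<bullet> x)) \<partial>lborel)
     = (\<Prod>b\<in>Basis. \<integral>x. ?f b x \<partial>lborel)"
    unfolding eq by (intro integral_lborel_prod gauss_fourier_1 assms)
  also have "\<dots> = (\<Prod>b\<in>Basis. of_real (exp (- pi * (w \<bullet> b)\<^sup>2 / c) / sqrt c))"
    by (intro prod.cong refl gauss_fourier_1 assms)
  also have "\<dots> = of_real (gauss (1 / c) w / sqrt c ^ DIM('b))"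
    by (simp add: gauss_prod prod_dividef)
  finally show "(\<integral>x. complex_of_real (gauss c x) * exp (- 2 * pi * \<i> * of_real (w \<bullet> x)) \<partial>lborel)
      = of_real (gauss (1 / c) w / sqrt c ^ DIM('b))" .
qed

lemma integrable_gauss:
  assumes "c > 0"
  shows "integrable lborel (gauss c :: 'b::euclidean_space \<Rightarrow> real)"
    and "(\<integral>x. gauss c (x :: 'b) \<partial>lborel) = 1 / sqrt c ^ DIM('b)"
proof -
  have i: "integrable lborel (\<lambda>x :: 'b. complex_of_real (gauss c x))"
    using integrable_gauss_character[OF assms, of 0] by simp
  then show "integrable lborel (gauss c :: 'b \<Rightarrow> real)"
    by (simp add: complex_of_real_integrable_eq)
  have "complex_of_real (\<integral>x. gauss c (x :: 'b) \<partial>lborel) = of_real (1 / sqrt c ^ DIM('b))"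
    using integral_gauss_character[OF assms, of "0 :: 'b"] by (simp add: gauss_def)
  then show "(\<integral>x. gauss c (x :: 'b) \<partial>lborel) = 1 / sqrt c ^ DIM('b)"
    unfolding of_real_eq_iff .
qed

lemma lborel_fubini:
  fixes F :: "'a::euclidean_space \<Rightarrow> 'b::euclidean_space \<Rightarrow> 'c::{banach,second_countable_topology}"
  assumes [measurable]: "(\<lambda>(x, y). F x y) \<in> borel_measurable (lborel \<Otimes>\<^sub>M lborel)"
    and ae: "AE x in lborel. integrable lborel (\<lambda>y. F x y)"
    and int: "integrable lborel (\<lambda>x. \<integral>y. norm (F x y) \<partial>lborel)"
  shows "integrable lborel (\<lambda>y. \<integral>x. F x y \<partial>lborel)"
    and "integrable lborel (\<lambda>x. \<integral>y. F x y \<partial>lborel)"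
    and "(\<integral>y. (\<integral>x. F x y \<partial>lborel) \<partial>lborel) = (\<integral>x. (\<integral>y. F x y \<partial>lborel) \<partial>lborel)"
    and "AE y in lborel. integrable lborel (\<lambda>x. F x y)"
    and "(\<integral>y. norm (\<integral>x. F x y \<partial>lborel) \<partial>lborel) \<le> (\<integral>x. (\<integral>y. norm (F x y) \<partial>lborel) \<partial>lborel)"
proof -
  have i: "integrable (lborel \<Otimes>\<^sub>M lborel) (\<lambda>(x, y). F x y)"
    by (rule lborel_pair.Fubini_integrable) (use ae int in auto)
  then have n: "integrable (lborel \<Otimes>\<^sub>M lborel) (\<lambda>(x, y). norm (F x y))"
    using integrable_norm[OF i] by (simp add: split_def)
  show 1: "integrable lborel (\<lambda>y. \<integral>x. F x y \<partial>lborel)" by (rule lborel_pair.integrable_snd[OF i])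
  show "integrable lborel (\<lambda>x. \<integral>y. F x y \<partial>lborel)" by (rule lborel_pair.integrable_fst[OF i])
  show "(\<integral>y. (\<integral>x. F x y \<partial>lborel) \<partial>lborel) = (\<integral>x. (\<integral>y. F x y \<partial>lborel) \<partial>lborel)"
    by (rule lborel_pair.Fubini_integral[OF i])
  show "AE y in lborel. integrable lborel (\<lambda>x. F x y)" by (rule lborel_pair.AE_integrable_snd[OF i])
  have "(\<integral>y. norm (\<integral>x. F x y \<partial>lborel) \<partial>lborel) \<le> (\<integral>y. (\<integral>x. norm (F x y) \<partial>lborel) \<partial>lborel)"
    using 1 lborel_pair.integrable_snd[OF n] by (intro integral_mono) auto
  also have "\<dots> = (\<integral>x. (\<integral>y. norm (F x y) \<partial>lborel) \<partial>lborel)"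
    by (rule lborel_pair.Fubini_integral[OF n])
  finally show "(\<integral>y. norm (\<integral>x. F x y \<partial>lborel) \<partial>lborel) \<le> (\<integral>x. (\<integral>y. norm (F x y) \<partial>lborel) \<partial>lborel)" .
qed

lemma lborel_scale:
  fixes f :: "'b::euclidean_space \<Rightarrow> 'c::{banach,second_countable_topology}"
  assumes c: "c \<noteq> 0" and f: "integrable lborel f"
  shows "integrable lborel (\<lambda>x. f (c *\<^sub>R x))"
    and "(\<integral>x. f x \<partial>lborel) = \<bar>c\<bar> ^ DIM('b) *\<^sub>R (\<integral>x. f (c *\<^sub>R x) \<partial>lborel)"
proof -
  have [measurable]: "f \<in> borel_measurable borel" using f by auto
  have eq: "lborel = density (distr lborel borel (\<lambda>x :: 'b. c *\<^sub>R x)) (\<lambda>_. ennreal (\<bar>c\<bar> ^ DIM('b)))"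
    using lborel_affine[OF c, of 0] by simp
  have "integrable (density (distr lborel borel (\<lambda>x :: 'b. c *\<^sub>R x)) (\<lambda>_. ennreal (\<bar>c\<bar> ^ DIM('b)))) f"
    using f by (subst eq[symmetric])
  then have "integrable lborel (\<lambda>x. \<bar>c\<bar> ^ DIM('b) *\<^sub>R f (c *\<^sub>R x))"
    by (simp add: integrable_density integrable_distr_eq)
  from integrable_scaleR_right[of "1 / \<bar>c\<bar> ^ DIM('b)", OF this]
  show "integrable lborel (\<lambda>x. f (c *\<^sub>R x))" using c by simp
  have "(\<integral>x. f x \<partial>lborel) = (\<integral>x. f x \<partial>density (distr lborel borel (\<lambda>x :: 'b. c *\<^sub>R x)) (\<lambda>_. ennreal (\<bar>c\<bar> ^ DIM('b))))"
    by (subst eq) simp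
  then show "(\<integral>x. f x \<partial>lborel) = \<bar>c\<bar> ^ DIM('b) *\<^sub>R (\<integral>x. f (c *\<^sub>R x) \<partial>lborel)"
    by (simp add: integral_density integral_distr)
qed

subsection \<open>Convolution\<close>

definition conv :: "('b::euclidean_space \<Rightarrow> complex) \<Rightarrow> ('b \<Rightarrow> complex) \<Rightarrow> 'b \<Rightarrow> complex" where
  "conv f g x = (\<integral>y. f (x - y) * g y \<partial>lborel)"

text \<open>Fubini and Minkowski's integral inequality for a family of L1 functions with integrable
  majorant. It serves ordinary convolution, the heat remainder, the Fejer means and the convolution
  of an operator with \<open>conv a b\<close>.\<close>

lemma conv_dominated:
  fixes F :: "'b::euclidean_space \<Rightarrow> 'b \<Rightarrow> complex"
  assumes [measurable]: "(\<lambda>(y, x). F y x) \<in> borel_measurable (borel \<Otimes>\<^sub>M borel)"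
    and T: "\<And>y. integrable lborel (T y)" and F: "\<And>y x. cmod (F y x) \<le> T y x * k y"
    and k: "k \<in> borel_measurable borel"
    and Tk: "integrable lborel (\<lambda>y. (\<integral>x. T y x \<partial>lborel) * k y)"
  shows "integrable lborel (\<lambda>x. \<integral>y. F y x \<partial>lborel)"
    and "AE x in lborel. integrable lborel (\<lambda>y. F y x)"
    and "(\<integral>x. cmod (\<integral>y. F y x \<partial>lborel) \<partial>lborel) \<le> (\<integral>y. (\<integral>x. T y x \<partial>lborel) * k y \<partial>lborel)"
    and "(\<integral>x. (\<integral>y. F y x \<partial>lborel) \<partial>lborel) = (\<integral>y. (\<integral>x. F y x \<partial>lborel) \<partial>lborel)"
proof -
  have [measurable]: "(\<lambda>(y, x). F y x) \<in> borel_measurable (lborel \<Otimes>\<^sub>M lborel)"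
    using assms(1) by simp
  have i: "integrable lborel (F y)" for y
  proof (rule Bochner_Integration.integrable_bound)
    show "integrable lborel (\<lambda>x. T y x * k y)" using T by simp
    show "F y \<in> borel_measurable lborel"
      using measurable_Pair2[OF assms(1), of y] by simp
    have "norm (F y x) \<le> norm (T y x * k y)" for x
      using F[of y x] abs_ge_self[of "T y x * k y"] unfolding real_norm_def by linarith
    then show "AE x in lborel. norm (F y x) \<le> norm (T y x * k y)" by simp
  qed
  have le: "(\<integral>x. norm (F y x) \<partial>lborel) \<le> (\<integral>x. T y x \<partial>lborel) * k y" for y
  proof -
    have "(\<integral>x. norm (F y x) \<partial>lborel) \<le> (\<integral>x. T y x * k y \<partial>lborel)"
      using i[of y] T[of y] F by (intro integral_mono) auto
    then show ?thesis by simp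
  qed
  have j: "integrable lborel (\<lambda>y. \<integral>x. norm (F y x) \<partial>lborel)"
  proof (rule Bochner_Integration.integrable_bound[OF Tk])
    show "(\<lambda>y. \<integral>x. norm (F y x) \<partial>lborel) \<in> borel_measurable lborel" by measurable
    have "norm (\<integral>x. norm (F y x) \<partial>lborel) \<le> norm ((\<integral>x. T y x \<partial>lborel) * k y)" for y
      using le[of y] abs_ge_self[of "(\<integral>x. T y x \<partial>lborel) * k y"] unfolding real_norm_def
      by (subst abs_of_nonneg) auto
    then show "AE y in lborel. norm (\<integral>x. norm (F y x) \<partial>lborel) \<le> norm ((\<integral>x. T y x \<partial>lborel) * k y)" by simp
  qed
  note fub = lborel_fubini[of F, OF _ AE_I2 j]
  show "integrable lborel (\<lambda>x. \<integral>y. F y x \<partial>lborel)" "AE x in lborel. integrable lborel (\<lambda>y. F y x)"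
    "(\<integral>x. (\<integral>y. F y x \<partial>lborel) \<partial>lborel) = (\<integral>y. (\<integral>x. F y x \<partial>lborel) \<partial>lborel)"
    using i by (intro fub; measurable)+
  have "(\<integral>x. cmod (\<integral>y. F y x \<partial>lborel) \<partial>lborel) \<le> (\<integral>y. (\<integral>x. norm (F y x) \<partial>lborel) \<partial>lborel)"
    using i by (intro fub; measurable)
  also have "\<dots> \<le> (\<integral>y. (\<integral>x. T y x \<partial>lborel) * k y \<partial>lborel)"
    by (intro integral_mono j Tk le)
  finally show "(\<integral>x. cmod (\<integral>y. F y x \<partial>lborel) \<partial>lborel) \<le> (\<integral>y. (\<integral>x. T y x \<partial>lborel) * k y \<partial>lborel)" .
qed

lemma
  fixes f g :: "'b::euclidean_space \<Rightarrow> complex"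
  assumes f: "integrable lborel f" and g: "integrable lborel g"
  shows integrable_conv: "integrable lborel (conv f g)"
    and AE_integrable_conv: "AE x in lborel. integrable lborel (\<lambda>y. f (x - y) * g y)"
    and conv_norm_le: "(\<integral>x. cmod (conv f g x) \<partial>lborel) \<le> (\<integral>x. cmod (f x) \<partial>lborel) * (\<integral>x. cmod (g x) \<partial>lborel)"
proof -
  have [measurable]: "f \<in> borel_measurable borel" "g \<in> borel_measurable borel" using f g by auto
  have meas: "(\<lambda>(y, x). f (x - y) * g y) \<in> borel_measurable (borel \<Otimes>\<^sub>M borel)" by measurable
  have shift: "(\<integral>x. cmod (f (x - y)) \<partial>lborel) = (\<integral>x. cmod (f x) \<partial>lborel)" for y
    by (rule integral_minus_shift[of "\<lambda>x. cmod (f x)"]) measurable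
  note * = conv_dominated[where F = "\<lambda>y x. f (x - y) * g y" and T = "\<lambda>y x. cmod (f (x - y))" and k = "\<lambda>y. cmod (g y)"]
  have 1: "integrable lborel (\<lambda>x. cmod (f (x - y)))" for y
    using integrable_minus_shift[OF f] by auto
  have 2: "integrable lborel (\<lambda>y. (\<integral>x. cmod (f (x - y)) \<partial>lborel) * cmod (g y))"
    unfolding shift using g by auto
  show "integrable lborel (conv f g)"
    unfolding conv_def by (rule *(1)) (use meas 1 2 in \<open>auto simp: norm_mult\<close>)
  show "AE x in lborel. integrable lborel (\<lambda>y. f (x - y) * g y)"
    by (rule *(2)) (use meas 1 2 in \<open>auto simp: norm_mult\<close>)
  have "(\<integral>x. cmod (conv f g x) \<partial>lborel) \<le> (\<integral>y. (\<integral>x. cmod (f (x - y)) \<partial>lborel) * cmod (g y) \<partial>lborel)"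
    unfolding conv_def by (rule *(3)) (use meas 1 2 in \<open>auto simp: norm_mult\<close>)
  then show "(\<integral>x. cmod (conv f g x) \<partial>lborel) \<le> (\<integral>x. cmod (f x) \<partial>lborel) * (\<integral>x. cmod (g x) \<partial>lborel)"
    unfolding shift by simp
qed

lemma conv_commute:
  assumes [measurable]: "f \<in> borel_measurable borel" "g \<in> borel_measurable borel"
  shows "conv f g = conv g f"
proof
  fix x
  have "(\<integral>y. f (x - y) * g y \<partial>lborel) = (\<integral>y. f (x - (x - y)) * g (x - y) \<partial>lborel)"
    by (rule integral_reflect[symmetric, of "\<lambda>y. f (x - y) * g y"]) measurable
  then show "conv f g x = conv g f x" by (simp add: conv_def mult.commute)
qed

lemma AE_conv_diff_left:
  assumes "integrable lborel f" "integrable lborel g" "integrable lborel h"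
  shows "AE x in lborel. conv (\<lambda>t. f t - g t) h x = conv f h x - conv g h x"
  using AE_integrable_conv[OF assms(1,3)] AE_integrable_conv[OF assms(2,3)]
  by eventually_elim (simp add: conv_def left_diff_distrib)

lemma conv_bounded_integrable:
  fixes f g :: "'b::euclidean_space \<Rightarrow> complex"
  assumes "f \<in> borel_measurable borel" "\<And>x. cmod (f x) \<le> C" and g: "integrable lborel g"
  shows "integrable lborel (\<lambda>y. f (x - y) * g y)"
proof (rule Bochner_Integration.integrable_bound)
  show "integrable lborel (\<lambda>y. C * cmod (g y))" using g by auto
  have [measurable]: "f \<in> borel_measurable borel" "g \<in> borel_measurable borel" using assms by auto
  show "(\<lambda>y. f (x - y) * g y) \<in> borel_measurable lborel" by measurable
  have "0 \<le> C" using assms(2)[of 0] norm_ge_zero order_trans by blast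
  then show "AE y in lborel. norm (f (x - y) * g y) \<le> norm (C * cmod (g y))"
    using assms(2) by (intro AE_I2) (simp add: norm_mult mult_right_mono)
qed

text \<open>The L1 modulus of continuity \<open>\<tau>\<close> is bounded by twice the norm of
  \<open>f\<close> and continuous at 0, so dominated convergence applies. The kernel
  \<open>k\<close> stays fixed and the translation vector is contracted, which is the shape both the
  heat remainder and the Fejer means take.\<close>

lemma approximate_identity_tendsto:
  fixes f k :: "'b::euclidean_space \<Rightarrow> complex" and r :: "nat \<Rightarrow> real"
  assumes f: "integrable lborel f" and k: "integrable lborel k" and r: "r \<longlonglongrightarrow> 0"
  shows "(\<lambda>n. \<integral>y. (\<integral>x. cmod (f (x - r n *\<^sub>R y) - f x) \<partial>lborel) * cmod (k y) \<partial>lborel) \<longlonglongrightarrow> 0"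
    and "integrable lborel (\<lambda>y. (\<integral>x. cmod (f (x - c *\<^sub>R y) - f x) \<partial>lborel) * cmod (k y))"
proof -
  have [measurable]: "f \<in> borel_measurable borel" "k \<in> borel_measurable borel" using f k by auto
  define \<tau> where "\<tau> y = (\<integral>x. cmod (f (x - y) - f x) \<partial>lborel)" for y
  have \<tau>_le: "\<tau> y \<le> 2 * (\<integral>x. cmod (f x) \<partial>lborel)" for y
  proof -
    have i: "integrable lborel (\<lambda>x. cmod (f (x - y)))" using integrable_minus_shift[OF f] by auto
    have "\<tau> y \<le> (\<integral>x. cmod (f (x - y)) + cmod (f x) \<partial>lborel)"
      unfolding \<tau>_def using integrable_minus_shift[OF f, of y] f i
      by (intro integral_mono norm_triangle_ineq4) auto
    also have "\<dots> = (\<integral>x. cmod (f (x - y)) \<partial>lborel) + (\<integral>x. cmod (f x) \<partial>lborel)"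
      using i f by simp
    also have "(\<integral>x. cmod (f (x - y)) \<partial>lborel) = (\<integral>x. cmod (f x) \<partial>lborel)"
      by (rule integral_minus_shift[of "\<lambda>x. cmod (f x)"]) measurable
    finally show ?thesis by simp
  qed
  have \<tau>0: "0 \<le> \<tau> y" for y by (simp add: \<tau>_def)
  have [measurable]: "\<tau> \<in> borel_measurable borel" unfolding \<tau>_def by measurable
  have \<tau>lim: "(\<tau> \<longlongrightarrow> \<tau> 0) (nhds 0)"
    using tendsto_translation_L1[OF f] unfolding \<tau>_def by (simp add: tendsto_nhds_iff)
  have "\<tau> 0 = 0" by (simp add: \<tau>_def)
  have "(\<lambda>n. \<integral>y. \<tau> (r n *\<^sub>R y) * cmod (k y) \<partial>lborel) \<longlonglongrightarrow> (\<integral>y. 0 \<partial>(lborel :: 'b measure))"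
  proof (rule integral_dominated_convergence[where w = "\<lambda>y. 2 * (\<integral>x. cmod (f x) \<partial>lborel) * cmod (k y)"])
    show "AE y in lborel. (\<lambda>n. \<tau> (r n *\<^sub>R y) * cmod (k y)) \<longlonglongrightarrow> 0"
    proof (rule AE_I2)
      fix y :: 'b
      have "(\<lambda>n. r n *\<^sub>R y) \<longlonglongrightarrow> 0 *\<^sub>R y" by (intro tendsto_intros r)
      then have "(\<lambda>n. \<tau> (r n *\<^sub>R y)) \<longlonglongrightarrow> 0"
        using filterlim_compose[OF \<tau>lim] \<open>\<tau> 0 = 0\<close> by simp
      then show "(\<lambda>n. \<tau> (r n *\<^sub>R y) * cmod (k y)) \<longlonglongrightarrow> 0" by (rule tendsto_mult_left_zero)
    qed
    show "AE y in lborel. norm (\<tau> (r n *\<^sub>R y) * cmod (k y)) \<le> 2 * (\<integral>x. cmod (f x) \<partial>lborel) * cmod (k y)" for n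
      using \<tau>_le \<tau>0 by (intro AE_I2) (simp add: norm_mult mult_right_mono)
  qed (use k in auto)
  then show "(\<lambda>n. \<integral>y. (\<integral>x. cmod (f (x - r n *\<^sub>R y) - f x) \<partial>lborel) * cmod (k y) \<partial>lborel) \<longlonglongrightarrow> 0"
    by (simp add: \<tau>_def)
  have "integrable lborel (\<lambda>y. \<tau> (c *\<^sub>R y) * cmod (k y))"
  proof (rule Bochner_Integration.integrable_bound)
    show "integrable lborel (\<lambda>y. 2 * (\<integral>x. cmod (f x) \<partial>lborel) * cmod (k y))" using k by auto
    show "AE y in lborel. norm (\<tau> (c *\<^sub>R y) * cmod (k y)) \<le> norm (2 * (\<integral>x. cmod (f x) \<partial>lborel) * cmod (k y))"
    proof (rule AE_I2)
      fix y :: 'b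
      have "norm (\<tau> (c *\<^sub>R y) * cmod (k y)) \<le> 2 * (\<integral>x. cmod (f x) \<partial>lborel) * cmod (k y)"
        using \<tau>_le \<tau>0 by (simp add: norm_mult mult_right_mono)
      then show "norm (\<tau> (c *\<^sub>R y) * cmod (k y)) \<le> norm (2 * (\<integral>x. cmod (f x) \<partial>lborel) * cmod (k y))"
        by (rule order_trans) simp
    qed
  qed measurable
  then show "integrable lborel (\<lambda>y. (\<integral>x. cmod (f (x - c *\<^sub>R y) - f x) \<partial>lborel) * cmod (k y))"
    by (simp add: \<tau>_def)
qed

subsection \<open>Wiener's theorem on closed ideals\<close>

definition fourier :: "('b::euclidean_space \<Rightarrow> complex) \<Rightarrow> 'b \<Rightarrow> complex" where
  "fourier a w = (\<integral>x. a x * exp (- 2 * pi * \<i> * of_real (w \<bullet> x)) \<partial>lborel)"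

definition character :: "'b::euclidean_space \<Rightarrow> 'b \<Rightarrow> complex" where
  "character w x = exp (2 * pi * \<i> * of_real (w \<bullet> x))"

lemma norm_character [simp]: "cmod (character w x) = 1"
  by (simp add: character_def)

lemma character_add: "character w (x + y) = character w x * character w y"
  by (simp add: character_def inner_add_right algebra_simps flip: exp_add)

lemma character_add_left: "character (v + w) x = character v x * character w x"
  by (simp add: character_def inner_add_left algebra_simps flip: exp_add)

lemma character_0 [simp]: "character 0 x = 1"
  by (simp add: character_def)

lemma character_diff: "character w (x - y) = character w x * character w (- y)"
  using character_add[of w x "- y"] by simp

lemma continuous_on_character: "continuous_on S (character w)"
  unfolding character_def by (intro continuous_intros)

lemma borel_measurable_character [measurable]: "character w \<in> borel_measurable borel"
  by (rule borel_measurable_continuous_onI[OF continuous_on_character])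

lemma fourier_character: "fourier a w = (\<integral>x. a x * character w (- x) \<partial>lborel)"
  by (simp add: fourier_def character_def)

lemma continuous_on_fourier:
  fixes a :: "'b::euclidean_space \<Rightarrow> complex"
  assumes "integrable lborel a"
  shows "continuous_on UNIV (fourier a)"
  unfolding continuous_on_sequentially
proof (intro allI ballI impI, elim conjE)
  fix X :: "nat \<Rightarrow> 'b" and w assume X: "X \<longlonglongrightarrow> w"
  have [measurable]: "a \<in> borel_measurable borel" using assms by auto
  show "(fourier a \<circ> X) \<longlonglongrightarrow> fourier a w"
    unfolding o_def fourier_def
  proof (rule integral_dominated_convergence[where w = "\<lambda>x. cmod (a x)"])
    show "AE x in lborel. (\<lambda>n. a x * exp (- 2 * pi * \<i> * of_real (X n \<bullet> x))) \<longlonglongrightarrow> a x * exp (- 2 * pi * \<i> * of_real (w \<bullet> x))"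
      by (intro AE_I2 tendsto_intros X)
    show "(\<lambda>x. a x * exp (- 2 * pi * \<i> * of_real (w \<bullet> x))) \<in> borel_measurable lborel" for w
      by (simp add: borel_measurable_continuous_onI continuous_intros)
  qed (use assms in \<open>auto simp: norm_mult\<close>)
qed

section \<open>Modulated heat kernels\<close>

text \<open>Total mass one, with \<open>t\<close> proportional to the variance. The Fourier
  transform is \<open>gauss t\<close>, so large \<open>t\<close> means a narrow band.\<close>

definition heat :: "real \<Rightarrow> 'b::euclidean_space \<Rightarrow> complex" where
  "heat t x = of_real (gauss (1 / t) x / sqrt t ^ DIM('b))"

lemma heat_nonneg: "t > 0 \<Longrightarrow> cmod (heat t (x :: 'b::euclidean_space)) = gauss (1 / t) x / sqrt t ^ DIM('b)"
  using less_imp_le[OF gauss_pos[of "1/t" x]] unfolding heat_def norm_of_real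
  by (intro abs_of_nonneg divide_nonneg_nonneg) auto

lemma borel_measurable_heat [measurable]: "heat t \<in> borel_measurable borel"
  unfolding heat_def by measurable

lemma integrable_heat: "t > 0 \<Longrightarrow> integrable lborel (heat t)"
  unfolding heat_def by (intro integrable_of_real integrable_divide_zero) (simp add: integrable_gauss)

lemma integral_norm_heat: "t > 0 \<Longrightarrow> (\<integral>x. cmod (heat t (x :: 'b::euclidean_space)) \<partial>lborel) = 1"
  by (simp add: heat_nonneg integrable_gauss real_sqrt_divide power_divide)

lemma gauss_completing_square:
  fixes x y :: "'b::euclidean_space"
  assumes "s > 0" "t > 0"
  shows "gauss (1 / s) (x - y) * gauss (1 / t) y
    = gauss (1 / (s + t)) x * gauss ((s + t) / (s * t)) (y - (t / (s + t)) *\<^sub>R x)"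
proof -
  define X Y Z where "X = inner x x" "Y = inner y y" "Z = inner x y"
  have n1: "(norm (x - y))\<^sup>2 = X - 2 * Z + Y"
    unfolding power2_norm_eq_inner X_Y_Z_def by (simp add: inner_diff_left inner_diff_right inner_commute)
  have n2: "(norm (y - c *\<^sub>R x))\<^sup>2 = Y - 2 * c * Z + c\<^sup>2 * X" for c
    unfolding power2_norm_eq_inner X_Y_Z_def
    by (simp add: inner_diff_left inner_diff_right inner_commute power2_eq_square algebra_simps)
  have st: "s + t > 0" using assms by simp
  have "(X - 2 * Z + Y) / s + Y / t
      = X / (s + t) + (s + t) / (s * t) * (Y - 2 * (t / (s + t)) * Z + (t / (s + t))\<^sup>2 * X)"
  proof -
    have "q / (s * t) * (Y - 2 * (t / q) * Z + (t / q)\<^sup>2 * X)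
       = q / (s * t) * Y - 2 * Z / s + t / (s * q) * X" if "q > 0" for q
      using assms that by (simp add: power2_eq_square field_simps)
    note this[OF st]
    moreover have "(s + t) / (s * t) * Y = Y / s + Y / t"
      using assms by (simp add: field_simps)
    moreover have "X / (s + t) + t / (s * (s + t)) * X = X / s"
    proof -
      have "X / q + t / (s * q) * X = X * (s + t) / (s * q)" if "q > 0" for q
        using assms that by (simp add: field_simps)
      from this[OF st] show ?thesis using st by simp
    qed
    ultimately show ?thesis by (simp add: add_divide_distrib diff_divide_distrib)
  qed
  then have eq: "1 / s * (X - 2 * Z + Y) + 1 / t * Y
      = 1 / (s + t) * X + (s + t) / (s * t) * (Y - 2 * (t / (s + t)) * Z + (t / (s + t))\<^sup>2 * X)"
    by simp
  have g: "gauss c v = exp (- pi * (c * (norm v)\<^sup>2))" for c and v :: 'b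
    by (simp add: gauss_def)
  have e: "exp (- pi * p) * exp (- pi * q) = exp (- pi * (p + q))" for p q :: real
    by (simp add: distrib_left flip: exp_add)
  have nX: "(norm x)\<^sup>2 = X" "(norm y)\<^sup>2 = Y"
    by (simp_all add: X_Y_Z_def power2_norm_eq_inner)
  show ?thesis
    unfolding g e n1 n2 nX eq ..
qed

text \<open>Variances of Gaussians add, and a character, being multiplicative, comes out of the
  convolution. This semigroup law lets the errors multiply in \<open>near_heat_step\<close>.\<close>

lemma conv_heat:
  assumes "s > 0" "t > 0"
  shows "conv (\<lambda>x. character w x * heat s x) (\<lambda>x. character w x * heat t x)
    = (\<lambda>x :: 'b::euclidean_space. character w x * heat (s + t) x)"
proof
  fix x :: 'b
  let ?n = "DIM('b)" and ?c = "(s + t) / (s * t)"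
  have c: "?c > 0" using assms by (simp add: zero_less_divide_iff)
  have int: "integrable lborel (\<lambda>y :: 'b. gauss ?c (y - v))" for v
    by (rule integrable_minus_shift[OF integrable_gauss(1)[OF c]])
  have "conv (\<lambda>x. character w x * heat s x) (\<lambda>x. character w x * heat t x) x
     = (\<integral>y. character w x * of_real (gauss (1 / (s + t)) x / (sqrt s ^ ?n * sqrt t ^ ?n) * gauss ?c (y - (t / (s + t)) *\<^sub>R x)) \<partial>lborel)"
    unfolding conv_def
  proof (rule Bochner_Integration.integral_cong[OF refl])
    fix y :: 'b
    have "character w (x - y) * character w y = character w x"
      using character_add[of w "x - y" y] by simp
    then have "character w (x - y) * heat s (x - y) * (character w y * heat t y) = character w x * (heat s (x - y) * heat t y)"
      by (simp add: algebra_simps)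
    also have "heat s (x - y) * heat t y = of_real (gauss (1 / s) (x - y) * gauss (1 / t) y / (sqrt s ^ ?n * sqrt t ^ ?n))"
      by (simp add: heat_def)
    also have "\<dots> = of_real (gauss (1 / (s + t)) x / (sqrt s ^ ?n * sqrt t ^ ?n) * gauss ?c (y - (t / (s + t)) *\<^sub>R x))"
      by (subst gauss_completing_square[OF assms]) simp
    finally show "character w (x - y) * heat s (x - y) * (character w y * heat t y)
      = character w x * of_real (gauss (1 / (s + t)) x / (sqrt s ^ ?n * sqrt t ^ ?n) * gauss ?c (y - (t / (s + t)) *\<^sub>R x))" .
  qed
  also have "\<dots> = character w x * of_real (gauss (1 / (s + t)) x / (sqrt s ^ ?n * sqrt t ^ ?n)
       * (\<integral>y. gauss ?c (y - (t / (s + t)) *\<^sub>R x) \<partial>lborel))"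
    by (simp only: integral_mult_right_zero integral_complex_of_real)
  also have "(\<integral>y. gauss ?c (y - (t / (s + t)) *\<^sub>R x) \<partial>lborel) = 1 / sqrt ?c ^ ?n"
    using integral_minus_shift[of "gauss ?c", of "(t / (s + t)) *\<^sub>R x"] integrable_gauss(2)[OF c, where 'b = 'b]
    by simp
  also have "gauss (1 / (s + t)) x / (sqrt s ^ ?n * sqrt t ^ ?n) * (1 / sqrt ?c ^ ?n) = gauss (1 / (s + t)) x / sqrt (s + t) ^ ?n"
  proof -
    have "sqrt s * sqrt t * sqrt ?c = sqrt (s + t)"
      using assms by (simp flip: real_sqrt_mult)
    then have "sqrt s ^ ?n * sqrt t ^ ?n * sqrt ?c ^ ?n = sqrt (s + t) ^ ?n"
      by (metis power_mult_distrib)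
    then show ?thesis by simp
  qed
  finally show "conv (\<lambda>x. character w x * heat s x) (\<lambda>x. character w x * heat t x) x = character w x * heat (s + t) x"
    by (simp add: heat_def)
qed

lemma heat_le: "t > 0 \<Longrightarrow> cmod (heat t (x :: 'b::euclidean_space)) \<le> 1 / sqrt t ^ DIM('b)"
  using gauss_le_1[of "1/t" x] by (simp add: heat_nonneg divide_right_mono)

text \<open>\<open>heat t\<close> is the mass-preserving dilation of \<open>heat 1\<close> by
  \<open>sqrt t\<close>, so relative to the width of the kernel a translation by \<open>y\<close>
  shrinks to \<open>y / sqrt t\<close>.\<close>

lemma integral_heat_translation:
  fixes y :: "'b::euclidean_space"
  assumes "t > 0"
  shows "(\<integral>x. cmod (heat t (x - y) - heat t x) \<partial>lborel)
    = (\<integral>x. cmod (heat 1 (x - (1 / sqrt t) *\<^sub>R y) - heat 1 x) \<partial>lborel)"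
proof -
  let ?c = "1 / sqrt t"
  have c: "?c \<noteq> 0" "?c > 0" using assms by auto
  have "integrable lborel (\<lambda>u :: 'b. cmod (heat 1 (u - ?c *\<^sub>R y) - heat 1 u))"
    by (intro integrable_norm Bochner_Integration.integrable_diff integrable_minus_shift integrable_heat) auto
  from lborel_scale(2)[OF c(1) this]
  have "(\<integral>x. cmod (heat 1 (x - ?c *\<^sub>R y) - heat 1 x) \<partial>lborel)
     = (\<integral>x. ?c ^ DIM('b) * cmod (heat 1 (?c *\<^sub>R x - ?c *\<^sub>R y) - heat 1 (?c *\<^sub>R x)) \<partial>lborel)"
    using c(2) by simp
  also have "\<dots> = (\<integral>x. cmod (heat t (x - y) - heat t x) \<partial>lborel)"
  proof (rule Bochner_Integration.integral_cong[OF refl])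
    fix x :: 'b
    have h: "heat t v = of_real (?c ^ DIM('b)) * heat 1 (?c *\<^sub>R v)" for v :: 'b
      using assms by (simp add: heat_def gauss_def power_mult_distrib power_divide)
    show "?c ^ DIM('b) * cmod (heat 1 (?c *\<^sub>R x - ?c *\<^sub>R y) - heat 1 (?c *\<^sub>R x)) = cmod (heat t (x - y) - heat t x)"
      unfolding h right_diff_distrib[symmetric] norm_mult norm_of_real
      using c(2) by (simp add: scaleR_diff_right)
  qed
  finally show ?thesis by simp
qed

text \<open>Writing \<open>fourier a w\<close> as an integral as well, the remainder becomes an
  integral over \<open>y\<close> of increments of \<open>heat t\<close> against \<open>a\<close>,
  with a unimodular factor. The frequency therefore drops out of the bound, and by
  \<open>approximate_identity_tendsto\<close> the bound tends to 0 as \<open>t\<close>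
  grows.\<close>

lemma heat_remainder:
  fixes a :: "'b::euclidean_space \<Rightarrow> complex"
  assumes a: "integrable lborel a" and t: "t > 0"
  defines "r \<equiv> \<lambda>w x. conv (\<lambda>x. character w x * heat t x) a x - fourier a w * (character w x * heat t x)"
  shows "integrable lborel (r w)"
    and "(\<integral>x. cmod (r w x) \<partial>lborel)
      \<le> (\<integral>y. (\<integral>x. cmod (heat 1 (x - (1 / sqrt t) *\<^sub>R y) - heat 1 x) \<partial>lborel) * cmod (a y) \<partial>lborel)"
proof -
  have [measurable]: "a \<in> borel_measurable borel" using a by auto
  define F where "F y x = character w (x - y) * (heat t (x - y) - heat t x) * a y" for y x
  have ch [simp]: "cmod (character w x * heat t x) \<le> 1 / sqrt t ^ DIM('b)" for x
    using heat_le[OF t, of x] by (simp add: norm_mult)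
  have req: "r w = (\<lambda>x. \<integral>y. F y x \<partial>lborel)"
  proof
    fix x
    have i1: "integrable lborel (\<lambda>y. character w (x - y) * heat t (x - y) * a y)"
      by (rule conv_bounded_integrable[where f = "\<lambda>x. character w x * heat t x", OF _ _ a]) (measurable, rule ch)
    have i2: "integrable lborel (\<lambda>y. a y * character w (- y))"
      by (rule Bochner_Integration.integrable_bound[OF a]) (auto simp: norm_mult)
    have "r w x = (\<integral>y. character w (x - y) * heat t (x - y) * a y \<partial>lborel)
       - (\<integral>y. a y * character w (- y) * (character w x * heat t x) \<partial>lborel)"
      unfolding r_def conv_def fourier_character by simp
    also have "\<dots> = (\<integral>y. character w (x - y) * heat t (x - y) * a y - a y * character w (- y) * (character w x * heat t x) \<partial>lborel)"
      using i1 i2 by (intro Bochner_Integration.integral_diff[symmetric]) auto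
    also have "\<dots> = (\<integral>y. F y x \<partial>lborel)"
      by (rule Bochner_Integration.integral_cong) (auto simp: F_def character_diff algebra_simps)
    finally show "r w x = (\<integral>y. F y x \<partial>lborel)" .
  qed
  have m: "(\<lambda>(y, x). F y x) \<in> borel_measurable (borel \<Otimes>\<^sub>M borel)"
    unfolding F_def by measurable
  have T: "integrable lborel (\<lambda>x. cmod (heat t (x - y) - heat t x))" for y :: 'b
    by (intro integrable_norm Bochner_Integration.integrable_diff integrable_minus_shift integrable_heat t)
  have Tk: "integrable lborel (\<lambda>y. (\<integral>x. cmod (heat t (x - y) - heat t x) \<partial>lborel) * cmod (a y))"
    using approximate_identity_tendsto(2)[OF integrable_heat[OF t] a, of "\<lambda>_. 0" 1] by simp
  note * = conv_dominated[OF m T _ _ Tk]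
  show "integrable lborel (r w)"
    unfolding req by (rule *(1)) (auto simp: F_def norm_mult)
  have "(\<integral>x. cmod (r w x) \<partial>lborel) \<le> (\<integral>y. (\<integral>x. cmod (heat t (x - y) - heat t x) \<partial>lborel) * cmod (a y) \<partial>lborel)"
    unfolding req by (rule *(3)) (auto simp: F_def norm_mult)
  then show "(\<integral>x. cmod (r w x) \<partial>lborel)
      \<le> (\<integral>y. (\<integral>x. cmod (heat 1 (x - (1 / sqrt t) *\<^sub>R y) - heat 1 x) \<partial>lborel) * cmod (a y) \<partial>lborel)"
    unfolding integral_heat_translation[OF t] .
qed

section \<open>Trigonometric polynomials with controlled band and coefficients\<close>

text \<open>\<open>N\<close> bounds the frequencies and \<open>C\<close> the sum of the moduli of
  the coefficients. Both are recorded because \<open>near_heat\<close> is uniform over bounded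
  frequencies only, and the errors add up with the coefficients.\<close>

inductive trig_poly :: "real \<Rightarrow> real \<Rightarrow> ('b::euclidean_space \<Rightarrow> complex) \<Rightarrow> bool" where
  trig_poly_character: "norm w \<le> N \<Longrightarrow> cmod c \<le> C \<Longrightarrow> trig_poly N C (\<lambda>x. c * character w x)"
| trig_poly_add: "trig_poly N C u \<Longrightarrow> trig_poly N D v \<Longrightarrow> trig_poly N (C + D) (\<lambda>x. u x + v x)"

lemma trig_poly_continuous: "trig_poly N C u \<Longrightarrow> continuous_on UNIV u"
  by (induction rule: trig_poly.induct) (auto intro!: continuous_intros continuous_on_character)

lemma trig_poly_norm_le: "trig_poly N C u \<Longrightarrow> cmod (u x) \<le> C"
  by (induction rule: trig_poly.induct)
    (auto simp: norm_mult intro: order_trans[OF norm_triangle_ineq] add_mono)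

lemma trig_poly_mult_character:
  assumes "trig_poly N C u" "norm w \<le> M" "cmod c \<le> D"
  shows "trig_poly (N + M) (C * D) (\<lambda>x. u x * (c * character w x))"
  using assms(1)
proof (induction rule: trig_poly.induct)
  case (trig_poly_character v N d C)
  have "cmod (d * c) \<le> C * D"
    using trig_poly_character assms unfolding norm_mult by (intro mult_mono) (auto intro: order_trans[OF norm_ge_zero])
  moreover have "norm (v + w) \<le> N + M"
    using trig_poly_character assms by (intro norm_triangle_le add_mono)
  ultimately have "trig_poly (N + M) (C * D) (\<lambda>x. (d * c) * character (v + w) x)"
    by (intro trig_poly.intros)
  then show ?case by (simp add: character_add_left algebra_simps)
next
  case (trig_poly_add N C u D' v)
  then show ?case
    using trig_poly.trig_poly_add[OF trig_poly_add.IH] by (simp add: algebra_simps)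
qed

lemma trig_poly_mult:
  assumes u: "trig_poly N C u" and v: "trig_poly M D v"
  shows "trig_poly (N + M) (C * D) (\<lambda>x. u x * v x)"
  using v
proof (induction rule: trig_poly.induct)
  case (trig_poly_character w N c D)
  then show ?case by (intro trig_poly_mult_character u)
next
  case (trig_poly_add N D v D' v')
  then show ?case
    using trig_poly.trig_poly_add[OF trig_poly_add.IH] by (simp add: algebra_simps)
qed

lemma trig_poly_sum:
  assumes "finite I" "\<And>i. i \<in> I \<Longrightarrow> trig_poly N (C i) (u i)" "N \<ge> 0"
  shows "trig_poly N (\<Sum>i\<in>I. C i) (\<lambda>x. \<Sum>i\<in>I. u i x)"
  using assms(1,2)
proof (induction I)
  case empty
  show ?case using trig_poly_character[of 0 N 0 0] assms(3) by simp
next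
  case (insert i I)
  then show ?case using trig_poly_add[of N "C i" "u i"] by simp
qed

lemma trig_poly_prod:
  assumes "finite I" "\<And>i. i \<in> I \<Longrightarrow> trig_poly N 1 (u i)"
  shows "trig_poly (of_nat (card I) * N) 1 (\<lambda>x. \<Prod>i\<in>I. u i x)"
  using assms
proof (induction I)
  case empty
  show ?case using trig_poly_character[of 0 0 1 1] by simp
next
  case (insert i I)
  then have "trig_poly (N + of_nat (card I) * N) (1 * 1) (\<lambda>x. u i x * (\<Prod>i\<in>I. u i x))"
    by (intro trig_poly_mult) auto
  then show ?case using insert by (simp add: distrib_right)
qed

section \<open>Approximation by elements of a closed ideal\<close>

text \<open>The ideal is a predicate on functions instead of classes; \<open>J_closed\<close> makes
  it invariant under changes on null sets, as these have L1 distance 0.\<close>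

locale closed_L1_ideal =
  fixes J :: "('b::euclidean_space \<Rightarrow> complex) \<Rightarrow> bool"
  assumes J_integrable: "J f \<Longrightarrow> integrable lborel f"
    and J_zero: "J (\<lambda>x. 0)"
    and J_add: "J f \<Longrightarrow> J g \<Longrightarrow> J (\<lambda>x. f x + g x)"
    and J_scale: "J f \<Longrightarrow> J (\<lambda>x. c * f x)"
    and J_closed: "integrable lborel f \<Longrightarrow>
      (\<And>e. e > 0 \<Longrightarrow> \<exists>g. J g \<and> (\<integral>x. cmod (f x - g x) \<partial>lborel) < e) \<Longrightarrow> J f"
    and J_conv: "J f \<Longrightarrow> integrable lborel g \<Longrightarrow> J (conv f g)"
begin

text \<open>A witness instead of an infimum, since the approximating element of the ideal is itself
  convolved further in \<open>near_heat_step\<close>.\<close>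

definition near :: "('b \<Rightarrow> complex) \<Rightarrow> real \<Rightarrow> bool" where
  "near f e \<longleftrightarrow> integrable lborel f \<and> (\<exists>j. J j \<and> (\<integral>x. cmod (f x - j x) \<partial>lborel) \<le> e)"

lemma J_diff: "J f \<Longrightarrow> J g \<Longrightarrow> J (\<lambda>x. f x - g x)"
  using J_add[OF _ J_scale[of g "-1"], of f] by simp

lemma J_conv': 
  assumes "J f" "integrable lborel g"
  shows "J (conv g f)"
  using J_conv[OF assms] conv_commute[of g f] J_integrable[OF assms(1)] assms(2) by simp

lemma near_add:
  assumes "near f e" "near g d"
  shows "near (\<lambda>x. f x + g x) (e + d)"
proof -
  obtain j k where j: "J j" "(\<integral>x. cmod (f x - j x) \<partial>lborel) \<le> e" and k: "J k" "(\<integral>x. cmod (g x - k x) \<partial>lborel) \<le> d"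
    using assms by (auto simp: near_def)
  have i: "integrable lborel f" "integrable lborel g" "integrable lborel j" "integrable lborel k"
    using assms j k J_integrable by (auto simp: near_def)
  have "(\<integral>x. cmod ((f x + g x) - (j x + k x)) \<partial>lborel) \<le> (\<integral>x. cmod (f x - j x) + cmod (g x - k x) \<partial>lborel)"
    using i by (intro integral_mono norm_diff_triangle_ineq) auto
  also have "\<dots> \<le> e + d" using i j k by simp
  finally show ?thesis using i J_add[OF j(1) k(1)] by (auto simp: near_def)
qed

lemma near_scale:
  assumes "near f e" "cmod c \<le> C"
  shows "near (\<lambda>x. c * f x) (C * e)"
proof -
  obtain j where j: "J j" "(\<integral>x. cmod (f x - j x) \<partial>lborel) \<le> e" using assms by (auto simp: near_def)
  have i: "integrable lborel f" "integrable lborel j"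
    using assms j J_integrable by (auto simp: near_def)
  have "(\<integral>x. cmod (c * f x - c * j x) \<partial>lborel) = cmod c * (\<integral>x. cmod (f x - j x) \<partial>lborel)"
    by (simp add: norm_mult flip: right_diff_distrib)
  also have "\<dots> \<le> C * e"
    using assms(2) j(2) by (intro mult_mono) (auto intro: order_trans[OF norm_ge_zero])
  finally show ?thesis using i J_scale[OF j(1), of c] by (auto simp: near_def)
qed

lemma near_approx:
  assumes "near g e" "integrable lborel f" "(\<integral>x. cmod (f x - g x) \<partial>lborel) \<le> d"
  shows "near f (e + d)"
proof -
  obtain j where j: "J j" "(\<integral>x. cmod (g x - j x) \<partial>lborel) \<le> e" using assms by (auto simp: near_def)
  have i: "integrable lborel f" "integrable lborel j" "integrable lborel g"
    using assms j J_integrable by (auto simp: near_def)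
  have "(\<integral>x. cmod (f x - j x) \<partial>lborel) \<le> (\<integral>x. cmod (f x - g x) + cmod (g x - j x) \<partial>lborel)"
    using i by (intro integral_mono norm_diff_triangle_le[OF order_refl order_refl]) auto
  also have "\<dots> \<le> e + d" using i j assms by simp
  finally show ?thesis using i j by (auto simp: near_def)
qed

lemma J_of_near:
  assumes "\<And>e. e > 0 \<Longrightarrow> near f e"
  shows "J f"
proof (rule J_closed)
  show "integrable lborel f" using assms[of 1] by (simp add: near_def)
  fix e :: real assume "e > 0"
  then show "\<exists>g. J g \<and> (\<integral>x. cmod (f x - g x) \<partial>lborel) < e"
    using assms[of "e / 2"] by (force simp: near_def)
qed

text \<open>The remainder of the division of \<open>conv (heat t) a\<close> by the number \<open>fourier a w\<close> is small
  for large \<open>t\<close>, so a factor is gained each time the bandwidth of the heat kernel shrinks.\<close>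

lemma near_heat_step:
  assumes a: "J a" and c: "fourier a w \<noteq> 0" and st: "s > 0" "t > 0"
    and near: "near (\<lambda>x. character w x * heat s x) e"
    and rem: "(\<integral>x. cmod (conv (\<lambda>x. character w x * heat t x) a x - fourier a w * (character w x * heat t x)) \<partial>lborel)
      \<le> cmod (fourier a w) * d"
  shows "near (\<lambda>x. character w x * heat (s + t) x) (e * d)"
proof -
  define c where "c = fourier a w"
  define G where "G t x = character w x * heat t x" for t x
  define r where "r x = conv (G t) a x - c * G t x" for x
  have inta: "integrable lborel a" by (rule J_integrable[OF a])
  have intG: "integrable lborel (G t)" if "t > 0" for t
    unfolding G_def by (rule Bochner_Integration.integrable_bound[OF integrable_heat[OF that]]) (auto simp: norm_mult)
  have G_le: "cmod (G s x) \<le> 1 / sqrt s ^ DIM('b)" for x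
    using heat_le[OF st(1), of x] by (simp add: G_def norm_mult)
  have [measurable]: "G s \<in> borel_measurable borel" using intG[OF st(1)] by auto
  have intr: "integrable lborel r"
    unfolding r_def using integrable_conv[OF intG[OF st(2)] inta] intG[OF st(2)] by simp
  have Jh: "J (conv (G t) a)" by (rule J_conv'[OF a intG[OF st(2)]])
  have intg_s: "integrable lborel (\<lambda>y. G s (x - y) * h y)" if "integrable lborel h" for h x
    by (rule conv_bounded_integrable[OF _ G_le that]) measurable
  \<comment> \<open>This is \<open>c * G t = conv (G t) a - r\<close> convolved with
    \<open>G s\<close>. The first term on the right is already in the ideal.\<close>
  have eq: "G (s + t) x = (1 / c) * (conv (G s) (conv (G t) a) x - conv (G s) r x)" for x
  proof -
    have "G (s + t) x = conv (G s) (G t) x"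
      using fun_cong[OF conv_heat[OF st, of w], of x] by (simp add: G_def[abs_def])
    also have "\<dots> = (\<integral>y. (1 / c) * (G s (x - y) * conv (G t) a y - G s (x - y) * r y) \<partial>lborel)"
      unfolding conv_def[of "G s" "G t"]
      by (rule Bochner_Integration.integral_cong) (use c in \<open>auto simp: r_def c_def field_simps\<close>)
    also have "\<dots> = (1 / c) * (conv (G s) (conv (G t) a) x - conv (G s) r x)"
      using intg_s[OF J_integrable[OF Jh], of x] intg_s[OF intr, of x] by (simp add: conv_def[of "G s"])
    finally show ?thesis .
  qed
  obtain j where j: "J j" "(\<integral>x. cmod (G s x - j x) \<partial>lborel) \<le> e"
    using near by (auto simp: near_def G_def)
  have intj: "integrable lborel j" by (rule J_integrable[OF j(1)])
  \<comment> \<open>Replacing \<open>G s\<close> by its approximant \<open>j\<close> in the second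
    term puts everything into the ideal. The error is \<open>conv (G s - j) r / c\<close>, a product
    of two small norms, which is why the bounds multiply.\<close>
  define j' where "j' x = (1 / c) * (conv (G s) (conv (G t) a) x - conv j r x)" for x
  have "J j'"
    unfolding j'_def by (intro J_scale J_diff J_conv' Jh intG st J_conv j intr)
  have "(\<integral>x. cmod (G (s + t) x - j' x) \<partial>lborel) = (\<integral>x. cmod (- (1 / c) * conv (\<lambda>t. G s t - j t) r x) \<partial>lborel)"
  proof (rule integral_cong_AE)
    have m: "conv j r \<in> borel_measurable lborel" "conv (G s) (conv (G t) a) \<in> borel_measurable lborel"
      using integrable_conv[OF intj intr] integrable_conv[OF intG[OF st(1)] J_integrable[OF Jh]] by auto
    have "G (s + t) \<in> borel_measurable lborel" using intG st by auto
    with m show "(\<lambda>x. cmod (G (s + t) x - j' x)) \<in> borel_measurable lborel"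
      unfolding j'_def by measurable
    have "conv (\<lambda>t. G s t - j t) r \<in> borel_measurable lborel"
      using integrable_conv[OF Bochner_Integration.integrable_diff[OF intG[OF st(1)] intj] intr] by auto
    then show "(\<lambda>x. cmod (- (1 / c) * conv (\<lambda>t. G s t - j t) r x)) \<in> borel_measurable lborel" by measurable
    show "AE x in lborel. cmod (G (s + t) x - j' x) = cmod (- (1 / c) * conv (\<lambda>t. G s t - j t) r x)"
      using AE_conv_diff_left[OF intG[OF st(1)] intj intr]
    proof eventually_elim
      fix x assume x: "conv (\<lambda>t. G s t - j t) r x = conv (G s) r x - conv j r x"
      show "cmod (G (s + t) x - j' x) = cmod (- (1 / c) * conv (\<lambda>t. G s t - j t) r x)"
        unfolding x eq j'_def by (rule arg_cong[of _ _ cmod]) (simp add: algebra_simps)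
    qed
  qed
  also have "\<dots> = (1 / cmod c) * (\<integral>x. cmod (conv (\<lambda>t. G s t - j t) r x) \<partial>lborel)"
    by (simp add: norm_divide)
  also have "\<dots> \<le> (1 / cmod c) * ((\<integral>x. cmod (G s x - j x) \<partial>lborel) * (\<integral>x. cmod (r x) \<partial>lborel))"
    using conv_norm_le[OF Bochner_Integration.integrable_diff[OF intG[OF st(1)] intj] intr]
    by (intro mult_left_mono) auto
  also have "\<dots> \<le> (1 / cmod c) * (e * (cmod c * d))"
  proof -
    have "(\<integral>x. cmod (r x) \<partial>lborel) \<le> cmod c * d"
      using rem by (simp add: r_def G_def[abs_def] c_def)
    moreover have "0 \<le> e"
      by (rule order_trans[OF _ j(2)]) simp
    ultimately show ?thesis using j(2) by (intro mult_left_mono mult_mono) auto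
  qed
  also have "\<dots> = e * d" using c by (simp add: c_def)
  finally show ?thesis
    using \<open>J j'\<close> intG[of "s + t"] st by (auto simp: near_def G_def[abs_def])
qed

text \<open>On the compact ball of radius \<open>N\<close> the modulus of \<open>fourier a\<close>
  has a positive lower bound \<open>m\<close>, so a single \<open>t\<close> brings the relative
  remainder below 1/2 for all these frequencies. Each further \<open>t\<close> of heat time then
  gains a factor 1/2.\<close>

lemma near_heat:
  assumes a: "J a" "\<And>w. fourier a w \<noteq> 0"
  obtains t where "t > 0" "\<And>w k. norm w \<le> N \<Longrightarrow> near (\<lambda>x. character w x * heat (real (Suc k) * t) x) ((1/2) ^ k)"
proof -
  have inta: "integrable lborel a" by (rule J_integrable[OF a(1)])
  obtain m where m: "m > 0" "\<And>w. norm w \<le> N \<Longrightarrow> m \<le> cmod (fourier a w)"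
  proof (cases "cball (0::'b) N = {}")
    case False
    have "continuous_on (cball 0 N) (\<lambda>w. cmod (fourier a w))"
      using continuous_on_fourier[OF inta] by (intro continuous_on_norm) (auto intro: continuous_on_subset)
    from continuous_attains_inf[OF compact_cball False this] obtain v
      where "\<forall>w\<in>cball 0 N. cmod (fourier a v) \<le> cmod (fourier a w)" by blast
    then show ?thesis using a(2)[of v] that[of "cmod (fourier a v)"] by auto
  next
    case True
    then have "\<not> norm w \<le> N" for w :: 'b
      using norm_ge_zero[of w] by (auto simp del: norm_ge_zero)
    then show ?thesis using that[of 1] by auto
  qed
  have "(\<lambda>n. 1 / sqrt (real n)) \<longlonglongrightarrow> 0" by real_asymp
  from approximate_identity_tendsto(1)[OF integrable_heat[of 1] inta this]
  have "(\<lambda>n. \<integral>y. (\<integral>x. cmod (heat 1 (x - (1 / sqrt (real n)) *\<^sub>R y) - heat 1 x) \<partial>lborel) * cmod (a y) \<partial>lborel) \<longlonglongrightarrow> 0"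
    by simp
  then have "\<forall>\<^sub>F n in sequentially. (\<integral>y. (\<integral>x. cmod (heat 1 (x - (1 / sqrt (real n)) *\<^sub>R y) - heat 1 x) \<partial>lborel) * cmod (a y) \<partial>lborel) < m / 2"
    by (rule order_tendstoD(2)) (use m(1) in simp)
  then have "\<forall>\<^sub>F n in sequentially. n > 0 \<and> (\<integral>y. (\<integral>x. cmod (heat 1 (x - (1 / sqrt (real n)) *\<^sub>R y) - heat 1 x) \<partial>lborel) * cmod (a y) \<partial>lborel) < m / 2"
    using eventually_gt_at_top[of "0::nat"] by eventually_elim simp
  then obtain n :: nat where n: "n > 0"
    "(\<integral>y. (\<integral>x. cmod (heat 1 (x - (1 / sqrt (real n)) *\<^sub>R y) - heat 1 x) \<partial>lborel) * cmod (a y) \<partial>lborel) < m / 2"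
    by (auto simp: eventually_sequentially)
  define t where "t = real n"
  have t: "t > 0" using n by (simp add: t_def)
  have "near (\<lambda>x. character w x * heat (real (Suc k) * t) x) ((1/2) ^ k)" if w: "norm w \<le> N" for w k
  proof (induction k)
    \<comment> \<open>The zero function is within distance 1, as the modulated heat kernel has norm
      1.\<close>
    case 0
    have "integrable lborel (\<lambda>x. character w x * heat t x)"
      by (rule Bochner_Integration.integrable_bound[OF integrable_heat[OF t]]) (auto simp: norm_mult)
    then show ?case
      using integral_norm_heat[OF t, where 'b = 'b] J_zero
      by (auto simp: near_def norm_mult intro!: exI[of _ "\<lambda>_. 0"])
  next
    case (Suc k)
    have "near (\<lambda>x. character w x * heat (real (Suc k) * t + t) x) ((1/2) ^ k * (1/2))"
    proof (rule near_heat_step[OF a(1) a(2) _ t Suc])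
      show "0 < real (Suc k) * t" using t by simp
      have "(\<integral>x. cmod (conv (\<lambda>x. character w x * heat t x) a x - fourier a w * (character w x * heat t x)) \<partial>lborel) \<le> m / 2"
        using heat_remainder(2)[OF inta t, of w] n(2) by (simp add: t_def)
      also have "\<dots> \<le> cmod (fourier a w) * (1/2)" using m(2)[OF w] by simp
      finally show "(\<integral>x. cmod (conv (\<lambda>x. character w x * heat t x) a x - fourier a w * (character w x * heat t x)) \<partial>lborel)
        \<le> cmod (fourier a w) * (1/2)" .
    qed
    moreover have "real (Suc (Suc k)) * t = real (Suc k) * t + t" by (simp add: algebra_simps)
    ultimately show ?case by (simp only: power_Suc2)
  qed
  with t show ?thesis by (rule that)
qed

lemma near_trig_poly:
  assumes "trig_poly N C u" and "\<And>w. norm w \<le> N \<Longrightarrow> near (\<lambda>x. character w x * g x) e"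
  shows "near (\<lambda>x. u x * g x) (C * e)"
  using assms
proof (induction rule: trig_poly.induct)
  case (trig_poly_character w N c C)
  then have "near (\<lambda>x. c * (character w x * g x)) (C * e)" by (intro near_scale) auto
  then show ?case by (simp add: mult.assoc)
next
  case (trig_poly_add N C u D v)
  then show ?case using near_add[of "\<lambda>x. u x * g x" "C * e" "\<lambda>x. v x * g x" "D * e"]
    by (simp add: distrib_right)
qed

text \<open>A wide Gaussian weight changes \<open>p\<close> little in L1, and under the weight the
  pointwise convergence of \<open>u n\<close> becomes L1 convergence. First \<open>k\<close> is
  fixed and then \<open>n\<close> is chosen; this order is possible because the distance of
  \<open>u n\<close> times the Gaussian from the ideal has a bound independent of
  \<open>n\<close>.\<close>

lemma J_limit_trig_poly:
  assumes a: "J a" "\<And>w. fourier a w \<noteq> 0"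
    and u: "\<And>n. trig_poly N 1 (u n)" "\<And>x. (\<lambda>n. u n x) \<longlonglongrightarrow> p x" and p: "integrable lborel p"
  shows "J p"
proof (rule J_of_near)
  fix e :: real assume e: "e > 0"
  obtain t where t: "t > 0" "\<And>w k. norm w \<le> N \<Longrightarrow> near (\<lambda>x. character w x * heat (real (Suc k) * t) x) ((1/2) ^ k)"
    using near_heat[OF a] by blast
  define T where "T k = real (Suc k) * t" for k
  have T: "T k > 0" for k using t by (simp add: T_def)
  have [measurable]: "p \<in> borel_measurable borel" using p by auto
  have [measurable]: "u n \<in> borel_measurable borel" for n
    by (rule borel_measurable_continuous_onI[OF trig_poly_continuous[OF u(1)]])
  let ?g = "\<lambda>k x. complex_of_real (gauss (1 / T k) x)"
  have g_le: "cmod (?g k x) \<le> 1" for k and x :: 'b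
    using gauss_le_1[of "1 / T k" x] gauss_pos[of "1 / T k" x] T[of k] by simp
  have intg: "integrable lborel (\<lambda>x :: 'b. ?g k x)" for k
    using T[of k] by (intro integrable_of_real integrable_gauss(1)) simp
  have "(\<lambda>k. \<integral>x. cmod (p x - p x * ?g k x) \<partial>lborel) \<longlonglongrightarrow> (\<integral>x. 0 \<partial>(lborel :: 'b measure))"
  proof (rule integral_dominated_convergence[where w = "\<lambda>x. 2 * cmod (p x)"])
    show "AE x in lborel. (\<lambda>k. cmod (p x - p x * ?g k x)) \<longlonglongrightarrow> 0"
    proof (rule AE_I2)
      fix x :: 'b
      have "(\<lambda>k. gauss (1 / T k) x) \<longlonglongrightarrow> 1"
        unfolding gauss_def T_def using t(1) by real_asymp
      then have "(\<lambda>k. cmod (p x - p x * ?g k x)) \<longlonglongrightarrow> cmod (p x - p x * of_real 1)"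
        by (intro tendsto_intros)
      then show "(\<lambda>k. cmod (p x - p x * ?g k x)) \<longlonglongrightarrow> 0" by simp
    qed
    show "AE x in lborel. norm (cmod (p x - p x * ?g k x)) \<le> 2 * cmod (p x)" for k
    proof (rule AE_I2)
      fix x :: 'b
      have "cmod (p x - p x * ?g k x) \<le> cmod (p x) + cmod (p x) * cmod (?g k x)"
        by (metis norm_mult norm_triangle_ineq4)
      also have "\<dots> \<le> cmod (p x) + cmod (p x) * 1" by (intro add_left_mono mult_left_mono g_le) auto
      finally show "norm (cmod (p x - p x * ?g k x)) \<le> 2 * cmod (p x)" by simp
    qed
  qed (use p in auto)
  then have ev1: "\<forall>\<^sub>F k in sequentially. (\<integral>x. cmod (p x - p x * ?g k x) \<partial>lborel) < e / 3"
    using e by (auto dest: order_tendstoD(2)[where a = "e / 3"])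
  \<comment> \<open>The cost of raising \<open>heat (T k)\<close> to height one against the gain
    \<open>(1/2) ^ k\<close>: as \<open>T k\<close> is linear in \<open>k\<close>, the geometric
    factor wins.\<close>
  have "(\<lambda>k. sqrt (T k) ^ DIM('b) * (1/2) ^ k) \<longlonglongrightarrow> 0"
    unfolding T_def using t(1) by real_asymp
  then have ev2: "\<forall>\<^sub>F k in sequentially. sqrt (T k) ^ DIM('b) * (1/2) ^ k < e / 3"
    using e by (auto dest: order_tendstoD(2)[where a = "e / 3"])
  obtain k where k: "(\<integral>x. cmod (p x - p x * ?g k x) \<partial>lborel) < e / 3" "sqrt (T k) ^ DIM('b) * (1/2) ^ k < e / 3"
    using eventually_conj[OF ev1 ev2] by (auto simp: eventually_sequentially)
  have u_le: "cmod (u n x) \<le> 1" for n x by (rule trig_poly_norm_le[OF u(1)])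
  have p_le: "cmod (p x) \<le> 1" for x
    by (rule LIMSEQ_le_const2[OF tendsto_norm[OF u(2)]]) (use u_le in auto)
  have "(\<lambda>n. \<integral>x. cmod (p x * ?g k x - u n x * ?g k x) \<partial>lborel) \<longlonglongrightarrow> (\<integral>x. 0 \<partial>(lborel :: 'b measure))"
  proof (rule integral_dominated_convergence[where w = "\<lambda>x. 2 * cmod (?g k x)"])
    show "AE x in lborel. (\<lambda>n. cmod (p x * ?g k x - u n x * ?g k x)) \<longlonglongrightarrow> 0"
    proof (rule AE_I2)
      fix x :: 'b
      have "(\<lambda>n. cmod (p x * ?g k x - u n x * ?g k x)) \<longlonglongrightarrow> cmod (p x * ?g k x - p x * ?g k x)"
        by (intro tendsto_intros u)
      then show "(\<lambda>n. cmod (p x * ?g k x - u n x * ?g k x)) \<longlonglongrightarrow> 0" by simp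
    qed
    show "AE x in lborel. norm (cmod (p x * ?g k x - u n x * ?g k x)) \<le> 2 * cmod (?g k x)" for n
    proof (rule AE_I2)
      fix x :: 'b
      have "cmod (p x - u n x) \<le> 2"
        using norm_triangle_ineq4[of "p x" "u n x"] u_le[of n x] p_le[of x] by linarith
      then have "cmod (p x - u n x) * cmod (?g k x) \<le> 2 * cmod (?g k x)" by (intro mult_right_mono) auto
      then show "norm (cmod (p x * ?g k x - u n x * ?g k x)) \<le> 2 * cmod (?g k x)"
        by (simp add: norm_mult flip: left_diff_distrib)
    qed
  qed (use integrable_norm[OF intg[of k]] in \<open>auto simp del: norm_of_real\<close>)
  then have "\<forall>\<^sub>F n in sequentially. (\<integral>x. cmod (p x * ?g k x - u n x * ?g k x) \<partial>lborel) < e / 3"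
    using e by (auto dest: order_tendstoD(2)[where a = "e / 3"])
  then obtain n where n: "(\<integral>x. cmod (p x * ?g k x - u n x * ?g k x) \<partial>lborel) < e / 3"
    by (auto simp: eventually_sequentially)
  have sT: "sqrt (T k) ^ DIM('b) > 0" using T[of k] by simp
  have "near (\<lambda>x. u n x * heat (T k) x) (1 * (1/2) ^ k)"
    using near_trig_poly[OF u(1)[of n], of "heat (T k)"] t(2) by (simp add: T_def)
  then have "near (\<lambda>x. of_real (sqrt (T k) ^ DIM('b)) * (u n x * heat (T k) x)) (sqrt (T k) ^ DIM('b) * (1 * (1/2) ^ k))"
    using sT by (intro near_scale) (simp_all only: norm_of_real abs_of_pos)
  then have near1: "near (\<lambda>x. u n x * ?g k x) (sqrt (T k) ^ DIM('b) * (1/2) ^ k)"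
    using sT T[of k] by (simp add: heat_def field_simps)
  have intpg: "integrable lborel (\<lambda>x. p x * ?g k x)"
    using p_le by (intro Bochner_Integration.integrable_bound[OF intg[of k]]) (auto simp: norm_mult mult_left_le_one_le)
  have "near p (sqrt (T k) ^ DIM('b) * (1/2) ^ k + e / 3 + e / 3)"
    by (rule near_approx[OF near_approx[OF near1 intpg] p]) (use n k in auto)
  then show "near p e"
    using k(2) by (auto simp: near_def intro: order_trans)
qed

end

section \<open>The Fejer kernel as a limit of trigonometric polynomials\<close>

text \<open>Riemann sum for the integral of \<open>exp (2 pi i s y)\<close> over \<open>s\<close> in
  the unit interval, whose value is \<open>box_transform y\<close>. The coefficients are nonnegative
  with sum 1 and the frequencies stay in the unit interval for every \<open>n\<close>.\<close>

definition dirichlet_mean :: "nat \<Rightarrow> real \<Rightarrow> complex" where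
  "dirichlet_mean n y = (\<Sum>j<Suc n. exp (2 * pi * \<i> * of_real (of_nat j / of_nat (Suc n) * y))) / of_nat (Suc n)"

definition box_transform :: "real \<Rightarrow> complex" where
  "box_transform y = (if y = 0 then 1 else (exp (2 * pi * \<i> * of_real y) - 1) / (2 * pi * \<i> * of_real y))"

text \<open>The mean is a geometric sum with ratio \<open>exp (h n)\<close>, where
  \<open>h n\<close> is \<open>z\<close> divided by the number of terms. It equals the difference
  quotient of \<open>exp\<close> between 0 and \<open>z\<close> divided by the one between 0 and
  \<open>h n\<close>, and the latter tends to 1.\<close>

lemma dirichlet_mean_tendsto: "(\<lambda>n. dirichlet_mean n y) \<longlonglongrightarrow> box_transform y"
proof (cases "y = 0")
  case True
  have "dirichlet_mean n 0 = 1" for n by (simp add: dirichlet_mean_def del: of_nat_Suc)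
  then show ?thesis using True by (simp add: box_transform_def)
next
  case False
  define z where "z = 2 * pi * \<i> * complex_of_real y"
  have z: "z \<noteq> 0" using False by (simp add: z_def)
  define h where "h n = z / of_nat (Suc n)" for n
  have h0: "h n \<noteq> 0" for n using z by (simp add: h_def del: of_nat_Suc)
  have hlim: "h \<longlonglongrightarrow> 0"
    unfolding h_def using LIMSEQ_Suc[OF tendsto_divide_0[OF tendsto_const tendsto_of_nat]] by blast
  have "((\<lambda>x. (exp (0 + x) - exp 0) / x) \<longlongrightarrow> exp 0) (at (0 :: complex))"
    using DERIV_exp[of "0 :: complex"] unfolding DERIV_def .
  then have "((\<lambda>x. (exp x - 1) / x) \<longlongrightarrow> 1) (at (0 :: complex))" by simp
  then have lim: "(\<lambda>n. (exp (h n) - 1) / h n) \<longlonglongrightarrow> 1"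
    using hlim h0 by (auto elim!: filterlim_compose simp: filterlim_at)
  then have main: "(\<lambda>n. ((exp z - 1) / z) / ((exp (h n) - 1) / h n)) \<longlonglongrightarrow> ((exp z - 1) / z) / 1"
    by (intro tendsto_intros) auto
  have "\<forall>\<^sub>F n in sequentially. (exp (h n) - 1) / h n \<noteq> 0"
    by (rule tendsto_imp_eventually_ne[OF lim]) simp
  then have "\<forall>\<^sub>F n in sequentially. ((exp z - 1) / z) / ((exp (h n) - 1) / h n) = dirichlet_mean n y"
  proof eventually_elim
    fix n assume ne: "(exp (h n) - 1) / h n \<noteq> 0"
    then have q: "exp (h n) \<noteq> 1" by auto
    have zn: "z = of_nat (Suc n) * h n" by (simp add: h_def del: of_nat_Suc)
    have "dirichlet_mean n y = (\<Sum>j<Suc n. exp (h n) ^ j) / of_nat (Suc n)"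
    proof -
      have "exp (2 * pi * \<i> * of_real (of_nat j / of_nat (Suc n) * y)) = exp (h n) ^ j" for j
        unfolding exp_of_nat_mult[symmetric] by (rule arg_cong[of _ _ exp]) (simp add: h_def z_def)
      then show ?thesis unfolding dirichlet_mean_def by simp
    qed
    also have "(\<Sum>j<Suc n. exp (h n) ^ j) = (exp (h n) ^ Suc n - 1) / (exp (h n) - 1)"
      by (rule geometric_sum[OF q])
    also have "exp (h n) ^ Suc n = exp z"
      unfolding zn by (rule exp_of_nat_mult[symmetric])
    finally have "dirichlet_mean n y = (exp z - 1) / (exp (h n) - 1) / of_nat (Suc n)" .
    moreover have "1 / z * h n = 1 / of_nat (Suc n)"
      unfolding zn using h0[of n] by (simp del: of_nat_Suc)
    ultimately show "((exp z - 1) / z) / ((exp (h n) - 1) / h n) = dirichlet_mean n y"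
      using q by (metis (no_types, lifting) divide_divide_eq_left' divide_divide_eq_right mult.commute mult.left_commute mult.right_neutral times_divide_eq_left times_divide_eq_right)
  qed
  from Lim_transform_eventually[OF main this]
  have "(\<lambda>n. dirichlet_mean n y) \<longlonglongrightarrow> (exp z - 1) / z" by simp
  then show ?thesis using False by (simp add: box_transform_def z_def)
qed

lemma norm_dirichlet_mean: "cmod (dirichlet_mean n y) \<le> 1"
proof -
  have "cmod (\<Sum>j<Suc n. exp (2 * pi * \<i> * of_real (of_nat j / of_nat (Suc n) * y))) \<le> (\<Sum>j<Suc n. 1)"
    by (rule sum_norm_le) simp
  then show ?thesis by (simp add: dirichlet_mean_def norm_divide del: of_nat_Suc)
qed

text \<open>The modulus is at most 1 everywhere and at most \<open>1 / \<bar>y\<bar>\<close> for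
  large \<open>y\<close>; the constant 2 merges both cases into a multiple of an integrable
  function.\<close>

lemma box_transform_bound: "(cmod (box_transform y))\<^sup>2 \<le> 2 * inverse (1 + y\<^sup>2)"
proof (cases "\<bar>y\<bar> \<le> 1")
  case True
  have "cmod (box_transform y) \<le> 1"
    by (rule LIMSEQ_le_const2[OF tendsto_norm[OF dirichlet_mean_tendsto]]) (use norm_dirichlet_mean in auto)
  then have "(cmod (box_transform y))\<^sup>2 \<le> 1" by (simp add: power_le_one)
  also have "1 \<le> 2 * inverse (1 + y\<^sup>2)"
    using True abs_square_le_1[of y] by (simp add: field_simps add_pos_nonneg)
  finally show ?thesis .
next
  case False
  have "cmod (exp (2 * pi * \<i> * of_real y) - 1) \<le> cmod (exp (2 * pi * \<i> * of_real y)) + cmod 1"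
    by (rule norm_triangle_ineq4)
  also have "\<dots> = 2" by simp
  finally have "cmod (exp (2 * pi * \<i> * of_real y) - 1) / (2 * pi * \<bar>y\<bar>) \<le> 2 / (2 * pi * \<bar>y\<bar>)"
    by (rule divide_right_mono) simp
  moreover have "cmod (box_transform y) = cmod (exp (2 * pi * \<i> * of_real y) - 1) / (2 * pi * \<bar>y\<bar>)"
    using False by (auto simp: box_transform_def norm_divide norm_mult)
  ultimately have "cmod (box_transform y) \<le> 2 / (2 * pi * \<bar>y\<bar>)" by simp
  also have "\<dots> \<le> 1 / \<bar>y\<bar>"
    using False pi_ge_two by (auto simp: field_simps)
  finally have "(cmod (box_transform y))\<^sup>2 \<le> (1 / \<bar>y\<bar>)\<^sup>2" by (intro power_mono) auto
  also have "\<dots> = 1 / y\<^sup>2" by (simp add: power_divide)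
  also have "\<dots> \<le> 2 * inverse (1 + y\<^sup>2)"
  proof -
    have "1 \<le> y\<^sup>2" using False abs_square_less_1[of y] by (simp add: not_less)
    moreover have "1 \<le> Y \<Longrightarrow> 1 / Y \<le> 2 * inverse (1 + Y)" for Y :: real by (simp add: field_simps)
    ultimately show ?thesis by blast
  qed
  finally show ?thesis .
qed

lemma borel_measurable_box_transform [measurable]: "box_transform \<in> borel_measurable borel"
proof (rule borel_measurable_LIMSEQ_metric)
  show "(\<lambda>n. dirichlet_mean n y) \<longlonglongrightarrow> box_transform y" for y by (rule dirichlet_mean_tendsto)
  show "dirichlet_mean n \<in> borel_measurable borel" for n
    unfolding dirichlet_mean_def by (intro borel_measurable_continuous_onI continuous_intros) (simp del: of_nat_Suc)
qed

lemma integrable_box_transform_square: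
  "integrable lborel (\<lambda>y. box_transform y * cnj (box_transform y))"
proof (rule Bochner_Integration.integrable_bound)
  show "integrable lborel (\<lambda>y :: real. 2 * inverse (1 + y\<^sup>2))"
    using integrable_inverse_1_plus_square by (simp add: set_integrable_def)
  show "AE y in lborel. norm (box_transform y * cnj (box_transform y)) \<le> norm (2 * inverse (1 + y\<^sup>2))"
    using box_transform_bound by (intro AE_I2) (simp add: norm_mult abs_of_nonneg flip: power2_eq_square)
qed measurable

text \<open>\<open>box_transform\<close> can vanish only at nonzero integers, so if its square had
  integral 0 the open unit interval would be a null set.\<close>

lemma integral_box_transform_square: "(\<integral>y. box_transform y * cnj (box_transform y) \<partial>lborel) \<noteq> 0"
proof
  have eq: "box_transform y * cnj (box_transform y) = of_real ((cmod (box_transform y))\<^sup>2)" for y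
    by (rule complex_norm_square[symmetric])
  assume "(\<integral>y. box_transform y * cnj (box_transform y) \<partial>lborel) = 0"
  then have 0: "(\<integral>y. (cmod (box_transform y))\<^sup>2 \<partial>lborel) = 0"
    unfolding eq integral_complex_of_real by simp
  have "integrable lborel (\<lambda>y. (cmod (box_transform y))\<^sup>2)"
    using integrable_box_transform_square unfolding eq complex_of_real_integrable_eq .
  then have "AE y in lborel. (cmod (box_transform y))\<^sup>2 = 0"
    using 0 by (subst (asm) integral_nonneg_eq_0_iff_AE) auto
  then have "AE y in lborel. y \<notin> {0<..<1 :: real}"
  proof eventually_elim
    fix y :: real assume "(cmod (box_transform y))\<^sup>2 = 0"
    then have "y \<noteq> 0" and e: "exp (2 * pi * \<i> * of_real y) = 1"
      by (auto simp: box_transform_def split: if_splits)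
    then obtain n :: int where "2 * pi * \<i> * of_real y = of_int (2 * n) * pi * \<i>"
      unfolding exp_eq_1 by (auto simp: complex_eq_iff)
    then have "y = of_int n" by (simp add: complex_eq_iff)
    then show "y \<notin> {0<..<1}" by auto
  qed
  then have "emeasure lborel {0<..<1 :: real} = 0"
    by (subst (asm) AE_iff_measurable[where N = "{0<..<1}"]) auto
  then show False by simp
qed

text \<open>In each coordinate the squared modulus of the transform of an interval, that is the
  transform of a triangle. Squaring gives integrability, while the band stays bounded. The integral
  is only shown to be nonzero, never evaluated.\<close>

definition fejer :: "'b::euclidean_space \<Rightarrow> complex" where
  "fejer x = (\<Prod>b\<in>Basis. box_transform (x \<bullet> b) * cnj (box_transform (x \<bullet> b)))"

lemma integrable_fejer: "integrable lborel fejer"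
  unfolding fejer_def by (intro integrable_lborel_prod integrable_box_transform_square)

lemma integral_fejer: "(\<integral>x. fejer x \<partial>lborel) \<noteq> 0"
  unfolding fejer_def using integral_box_transform_square
  by (subst integral_lborel_prod) (auto intro: integrable_box_transform_square)

lemma norm_fejer_le: "cmod (fejer x) \<le> 1"
proof -
  have "cmod (box_transform y) \<le> 1" for y
    by (rule LIMSEQ_le_const2[OF tendsto_norm[OF dirichlet_mean_tendsto]]) (use norm_dirichlet_mean in auto)
  then show ?thesis
    unfolding fejer_def prod_norm[symmetric] norm_mult by (intro prod_le_1) (auto intro: mult_le_one)
qed

text \<open>Each coordinate multiplies a mean with frequencies up to \<open>r\<close> by its
  conjugate, whence \<open>r + r\<close>, and coefficient sums multiply to 1. The bounds do not
  involve \<open>n\<close>, as \<open>J_limit_trig_poly\<close> requires.\<close>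

lemma fejer_trig_poly:
  assumes "r \<ge> 0"
  shows "trig_poly (real DIM('b) * (r + r)) 1
    (\<lambda>x :: 'b::euclidean_space. \<Prod>b\<in>Basis. dirichlet_mean n (r * (x \<bullet> b)) * cnj (dirichlet_mean n (r * (x \<bullet> b))))"
proof (rule trig_poly_prod)
  fix b :: 'b assume b: "b \<in> Basis"
  let ?v = "\<lambda>s j. (s * r * (of_nat j / of_nat (Suc n))) *\<^sub>R b"
  have "trig_poly r 1 (\<lambda>x. \<Sum>j<Suc n. (1 / of_nat (Suc n)) * character (?v s j) x)" if s: "\<bar>s\<bar> = 1" for s
  proof -
    have "trig_poly r (\<Sum>j<Suc n. 1 / of_nat (Suc n)) (\<lambda>x. \<Sum>j<Suc n. (1 / of_nat (Suc n)) * character (?v s j) x)"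
    proof (rule trig_poly_sum)
      fix j assume "j \<in> {..<Suc n}"
      then have "r * (real j / real (Suc n)) \<le> r * 1"
        using assms by (intro mult_left_mono) (auto simp: divide_le_eq)
      then have "norm (?v s j) \<le> r"
        using b s assms by (simp add: abs_mult del: of_nat_Suc)
      then show "trig_poly r (1 / of_nat (Suc n)) (\<lambda>x. (1 / of_nat (Suc n)) * character (?v s j) x)"
        by (intro trig_poly_character) (simp_all add: norm_divide del: of_nat_Suc)
    qed (use assms in auto)
    then show ?thesis by (simp del: of_nat_Suc)
  qed
  from this[of 1] this[of "-1"]
  have "trig_poly (r + r) (1 * 1) (\<lambda>x. (\<Sum>j<Suc n. (1 / of_nat (Suc n)) * character (?v 1 j) x) *
     (\<Sum>j<Suc n. (1 / of_nat (Suc n)) * character (?v (-1) j) x))"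
    by (intro trig_poly_mult) simp_all
  moreover have "(\<Sum>j<Suc n. (1 / of_nat (Suc n)) * character (?v 1 j) x) = dirichlet_mean n (r * (x \<bullet> b))" for x
    unfolding dirichlet_mean_def sum_divide_distrib
    by (intro sum.cong refl) (simp add: character_def inner_commute algebra_simps)
  moreover have "(\<Sum>j<Suc n. (1 / of_nat (Suc n)) * character (?v (-1) j) x) = cnj (dirichlet_mean n (r * (x \<bullet> b)))" for x
    unfolding dirichlet_mean_def sum_divide_distrib cnj_sum
    by (intro sum.cong refl) (simp add: character_def inner_commute exp_cnj algebra_simps)
  ultimately show "trig_poly (r + r) 1 (\<lambda>x. dirichlet_mean n (r * (x \<bullet> b)) * cnj (dirichlet_mean n (r * (x \<bullet> b))))"
    by simp
qed simp

theorem (in closed_L1_ideal) wiener: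
  assumes a: "J a" "\<And>w. fourier a w \<noteq> 0" and f: "integrable lborel f"
  shows "J f"
proof -
  have [measurable]: "f \<in> borel_measurable borel" using f by auto
  have [measurable]: "(fejer :: 'b \<Rightarrow> complex) \<in> borel_measurable borel" using borel_measurable_integrable[OF integrable_fejer] by simp
  define c where "c = (\<integral>x. fejer (x :: 'b) \<partial>lborel)"
  have c: "c \<noteq> 0" unfolding c_def by (rule integral_fejer)
  define r where "r n = inverse (real (Suc n))" for n
  define P where "P n x = of_real ((1 / r n) ^ DIM('b)) * fejer ((1 / r n) *\<^sub>R x)" for n and x :: 'b
  have r: "r n > 0" for n by (simp add: r_def)
  have JP: "J (P n)" for n
    unfolding P_def
  proof (intro J_scale J_limit_trig_poly[OF a])
    let ?u = "\<lambda>m (x :: 'b). \<Prod>b\<in>Basis. dirichlet_mean m ((1 / r n) * (x \<bullet> b)) * cnj (dirichlet_mean m ((1 / r n) * (x \<bullet> b)))"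
    show "trig_poly (real DIM('b) * (1 / r n + 1 / r n)) 1 (?u m)" for m
      using fejer_trig_poly[of "1 / r n" m, where 'b = 'b] r[of n] by simp
    show "(\<lambda>m. ?u m x) \<longlonglongrightarrow> fejer ((1 / r n) *\<^sub>R x)" for x
      unfolding fejer_def inner_scaleR_left by (intro tendsto_intros dirichlet_mean_tendsto)
    show "integrable lborel (\<lambda>x :: 'b. fejer ((1 / r n) *\<^sub>R x))"
      using r[of n] by (intro lborel_scale integrable_fejer) simp
  qed
  have Jconv: "J (conv f (P n))" for n by (rule J_conv'[OF JP f])
  \<comment> \<open>The substitution by \<open>r n\<close> moves the dilation from the kernel into
    the argument of \<open>f\<close>, where \<open>approximate_identity_tendsto\<close> expects
    it.\<close>
  have convP: "conv f (P n) x = (\<integral>u. f (x - r n *\<^sub>R u) * fejer u \<partial>lborel)" for n x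
  proof -
    have ne: "r n \<noteq> 0" using r[of n] by simp
    have "integrable lborel (\<lambda>u. f (x - r n *\<^sub>R u) * fejer u)"
    proof (rule Bochner_Integration.integrable_bound)
      show "integrable lborel (\<lambda>u. f (x - r n *\<^sub>R u))"
        by (rule lborel_scale(1)[OF ne integrable_reflect[OF f]])
      show "AE u in lborel. norm (f (x - r n *\<^sub>R u) * fejer u) \<le> norm (f (x - r n *\<^sub>R u))"
        by (intro AE_I2) (simp add: norm_mult mult_left_le norm_fejer_le)
    qed measurable
    from lborel_scale(2)[OF _ this, of "1 / r n"]
    have "(\<integral>u. f (x - r n *\<^sub>R u) * fejer u \<partial>lborel)
        = of_real ((1 / r n) ^ DIM('b)) * (\<integral>u. f (x - u) * fejer ((1 / r n) *\<^sub>R u) \<partial>lborel)"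
      using r[of n] by (simp add: scaleR_conv_of_real)
    also have "\<dots> = conv f (P n) x"
      unfolding conv_def P_def integral_mult_right_zero[symmetric]
      by (rule Bochner_Integration.integral_cong) (auto simp: mult_ac)
    finally show ?thesis ..
  qed
  have "J (\<lambda>x. c * f x)"
  proof (rule J_closed)
    show "integrable lborel (\<lambda>x. c * f x)" using f by simp
    fix e :: real assume "e > 0"
    have "r \<longlonglongrightarrow> 0" unfolding r_def by (rule LIMSEQ_inverse_real_of_nat)
    from approximate_identity_tendsto(1)[OF f integrable_fejer this]
    have "\<forall>\<^sub>F n in sequentially. (\<integral>y. (\<integral>x. cmod (f (x - r n *\<^sub>R y) - f x) \<partial>lborel) * cmod (fejer y) \<partial>lborel) < e"
      using \<open>e > 0\<close> by (auto dest: order_tendstoD(2))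
    then obtain n where n: "(\<integral>y. (\<integral>x. cmod (f (x - r n *\<^sub>R y) - f x) \<partial>lborel) * cmod (fejer y) \<partial>lborel) < e"
      by (auto simp: eventually_sequentially)
    define F where "F y x = (f (x - r n *\<^sub>R y) - f x) * fejer y" for y x
    have eq: "conv f (P n) x - c * f x = (\<integral>y. F y x \<partial>lborel)" for x
    proof -
      have ne: "r n \<noteq> 0" using r[of n] by simp
      have "integrable lborel (\<lambda>u. f (x - r n *\<^sub>R u))"
        by (rule lborel_scale(1)[OF ne integrable_reflect[OF f]])
      then have i1: "integrable lborel (\<lambda>u. f (x - r n *\<^sub>R u) * fejer u)"
        by (rule Bochner_Integration.integrable_bound)
          (measurable, intro AE_I2, simp add: norm_mult mult_left_le norm_fejer_le)
      have i2: "integrable lborel (\<lambda>u. f x * fejer u)"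
        by (intro integrable_mult_right integrable_fejer)
      show ?thesis
        unfolding convP c_def F_def left_diff_distrib Bochner_Integration.integral_diff[OF i1 i2]
        by (simp add: mult.commute)
    qed
    have "(\<integral>x. cmod (\<integral>y. F y x \<partial>lborel) \<partial>lborel)
      \<le> (\<integral>y. (\<integral>x. cmod (f (x - r n *\<^sub>R y) - f x) \<partial>lborel) * cmod (fejer y) \<partial>lborel)"
    proof (rule conv_dominated(3))
      show "(\<lambda>(y, x). F y x) \<in> borel_measurable (borel \<Otimes>\<^sub>M borel)" unfolding F_def by measurable
      show "integrable lborel (\<lambda>x. cmod (f (x - r n *\<^sub>R y) - f x))" for y
        by (intro integrable_norm Bochner_Integration.integrable_diff integrable_minus_shift f)
      show "integrable lborel (\<lambda>y. (\<integral>x. cmod (f (x - r n *\<^sub>R y) - f x) \<partial>lborel) * cmod (fejer y))"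
        using approximate_identity_tendsto(2)[OF f integrable_fejer, of "\<lambda>_. 0" "r n"] by simp
    qed (auto simp: F_def norm_mult)
    also have "(\<integral>x. cmod (\<integral>y. F y x \<partial>lborel) \<partial>lborel) = (\<integral>x. cmod (c * f x - conv f (P n) x) \<partial>lborel)"
      unfolding eq[symmetric] by (simp add: norm_minus_commute)
    finally have "(\<integral>x. cmod (c * f x - conv f (P n) x) \<partial>lborel) < e" using n by simp
    then show "\<exists>g. J g \<and> (\<integral>x. cmod (c * f x - g x) \<partial>lborel) < e" using Jconv by blast
  qed
  from J_scale[OF this, of "1 / c"] show ?thesis using c by simp
qed

subsection \<open>Time-frequency shifts\<close>

lemma tf_shift_abs_L2:
  assumes "square_integrable f"
  shows "tf_shift (x, \<omega>) (abs_L2 f) = abs_L2 (\<lambda>t. exp (2 * pi * \<i> * of_real (\<omega> \<bullet> t)) * f (t - x))"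
  using assms by (subst tf_shift.abs_eq) (auto simp: L2_rel_def eq_onp_def)

lemma square_integrable_tf:
  assumes "square_integrable f"
  shows "square_integrable (\<lambda>t. exp (2 * pi * \<i> * of_real (\<omega> \<bullet> t)) * f (t - x))"
proof (rule square_integrable_unimodular)
  show "square_integrable (\<lambda>t. f (t - x))"
    using square_integrable_affine[OF assms, of 1 "- x"] by simp
  show "(\<lambda>t. exp (2 * pi * \<i> * of_real (\<omega> \<bullet> t))) \<in> borel_measurable lborel"
    by (simp add: borel_measurable_continuous_onI continuous_intros)
qed simp

lemma L2_cases:
  obtains f where "square_integrable f" "X = abs_L2 f"
  using that[of "rep_L2 X"] by simp

lemma tf_shift_add: "tf_shift z (X + Y) = tf_shift z X + tf_shift z Y"
proof -
  obtain f where f: "square_integrable f" "X = abs_L2 f" by (rule L2_cases)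
  obtain g where g: "square_integrable g" "Y = abs_L2 g" by (rule L2_cases)
  obtain x \<omega> where z: "z = (x, \<omega>)" by (cases z)
  show ?thesis
    unfolding f(2) g(2) z plus_abs_L2[OF f(1) g(1)] tf_shift_abs_L2[OF square_integrable_add[OF f(1) g(1)]]
      tf_shift_abs_L2[OF f(1)] tf_shift_abs_L2[OF g(1)]
      plus_abs_L2[OF square_integrable_tf[OF f(1)] square_integrable_tf[OF g(1)]] distrib_left ..
qed

lemma tf_shift_scaleC: "tf_shift z (c *\<^sub>C X) = c *\<^sub>C tf_shift z X"
proof -
  obtain f where f: "square_integrable f" "X = abs_L2 f" by (rule L2_cases)
  obtain x \<omega> where z: "z = (x, \<omega>)" by (cases z)
  show ?thesis
    unfolding f(2) z scaleC_abs_L2[OF f(1)] tf_shift_abs_L2[OF square_integrable_scale[OF f(1)]]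
      tf_shift_abs_L2[OF f(1)] scaleC_abs_L2[OF square_integrable_tf[OF f(1)]] mult.left_commute[of c] ..
qed

lemma cinner_tf_shift_tf_shift: "cinner (tf_shift z X) (tf_shift z Y) = cinner X Y"
proof -
  obtain f where f: "square_integrable f" "X = abs_L2 f" by (rule L2_cases)
  obtain g where g: "square_integrable g" "Y = abs_L2 g" by (rule L2_cases)
  obtain x \<omega> where z: "z = (x, \<omega>)" by (cases z)
  have [measurable]: "f \<in> borel_measurable borel" "g \<in> borel_measurable borel"
    using f g by (auto simp: square_integrable_def)
  have "cinner (tf_shift z X) (tf_shift z Y) = (\<integral>t. f (t - x) * cnj (g (t - x)) \<partial>lborel)"
    unfolding f(2) g(2) z tf_shift_abs_L2[OF f(1)] tf_shift_abs_L2[OF g(1)]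
      cinner_abs_L2[OF square_integrable_tf[OF f(1)] square_integrable_tf[OF g(1)]]
  proof (rule Bochner_Integration.integral_cong[OF refl])
    fix t
    let ?e = "exp (2 * pi * \<i> * of_real (\<omega> \<bullet> t))"
    have "?e * cnj ?e = 1" using complex_norm_square[of ?e] by simp
    then show "?e * f (t - x) * cnj (?e * g (t - x)) = f (t - x) * cnj (g (t - x))"
      by (simp add: algebra_simps)
  qed
  also have "\<dots> = (\<integral>t. f t * cnj (g t) \<partial>lborel)"
    by (rule integral_minus_shift[of "\<lambda>t. f t * cnj (g t)"]) measurable
  finally show ?thesis using f g by (simp add: cinner_abs_L2)
qed

lemma norm_tf_shift [simp]: "norm (tf_shift z X) = norm X"
  by (simp add: norm_eq_sqrt_inner inner_L2_Re cinner_tf_shift_tf_shift)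

lemma tf_shift_bounded_clinear: "bounded_clinear (tf_shift z)"
  by (rule bounded_clinearI[where C = 1]) (simp_all add: tf_shift_add tf_shift_scaleC)

lemmas tf_shift_simps = bounded_clinearD(1-4)[OF tf_shift_bounded_clinear]

text \<open>The phase arises because the outer translation evaluates the inner modulation at
  \<open>t - x\<close> in place of \<open>t\<close>.\<close>

lemma tf_shift_tf_shift:
  "tf_shift (x, \<omega>) (tf_shift (x', \<omega>') X) = exp (- 2 * pi * \<i> * of_real (\<omega>' \<bullet> x)) *\<^sub>C tf_shift (x + x', \<omega> + \<omega>') X"
proof -
  obtain f where f: "square_integrable f" "X = abs_L2 f" by (rule L2_cases)
  have "exp (2 * pi * \<i> * of_real (\<omega> \<bullet> t)) * (exp (2 * pi * \<i> * of_real (\<omega>' \<bullet> (t - x))) * f (t - x - x'))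
    = exp (- 2 * pi * \<i> * of_real (\<omega>' \<bullet> x)) * (exp (2 * pi * \<i> * of_real ((\<omega> + \<omega>') \<bullet> t)) * f (t - (x + x')))" for t
  proof -
    have e: "exp (2 * pi * \<i> * of_real (\<omega> \<bullet> t)) * exp (2 * pi * \<i> * of_real (\<omega>' \<bullet> (t - x)))
      = exp (- 2 * pi * \<i> * of_real (\<omega>' \<bullet> x)) * exp (2 * pi * \<i> * of_real ((\<omega> + \<omega>') \<bullet> t))"
      by (simp only: exp_add[symmetric], rule arg_cong[of _ _ exp])
        (simp add: inner_diff_right inner_add_left algebra_simps)
    show ?thesis unfolding mult.assoc[symmetric] e diff_diff_eq ..
  qed
  then show ?thesis
    unfolding f(2) tf_shift_abs_L2[OF f(1)] tf_shift_abs_L2[OF square_integrable_tf[OF f(1)]]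
      scaleC_abs_L2[OF square_integrable_tf[OF f(1)]]
    by (intro arg_cong[of _ _ abs_L2] ext)
qed

lemma tf_shift_0 [simp]: "tf_shift 0 X = X"
proof -
  obtain f where f: "square_integrable f" "X = abs_L2 f" by (rule L2_cases)
  then show ?thesis by (simp add: tf_shift_abs_L2 zero_prod_def)
qed

lemma tf_shift_compose:
  "tf_shift z (tf_shift z' X) = exp (- 2 * pi * \<i> * of_real (snd z' \<bullet> fst z)) *\<^sub>C tf_shift (z + z') X"
  using tf_shift_tf_shift[of "fst z" "snd z" "fst z'" "snd z'"] by (simp add: plus_prod_def)

text \<open>The phases of the two orders of composition differ by the symplectic form. This is how
  characters of phase space enter all computations with matrix coefficients.\<close>

lemma tf_shift_commute:
  "tf_shift z (tf_shift z' X) = exp (2 * pi * \<i> * of_real (symplectic z z')) *\<^sub>C tf_shift z' (tf_shift z X)"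
  unfolding tf_shift_compose scaleC_scaleC exp_add[symmetric]
  by (simp add: symplectic_def add.commute algebra_simps)

lemma tf_shift_inverse:
  "tf_shift z (exp (- 2 * pi * \<i> * of_real (snd z \<bullet> fst z)) *\<^sub>C tf_shift (- z) X) = X"
  by (simp add: tf_shift_simps tf_shift_compose flip: exp_add)

lemma cinner_tf_shift_left:
  "cinner (tf_shift z X) Y = cinner X (exp (- 2 * pi * \<i> * of_real (snd z \<bullet> fst z)) *\<^sub>C tf_shift (- z) Y)"
  using cinner_tf_shift_tf_shift[of z X "exp (- 2 * pi * \<i> * of_real (snd z \<bullet> fst z)) *\<^sub>C tf_shift (- z) Y"]
  by (simp only: tf_shift_inverse)

lemma cadjoint_tf_shift:
  "cadjoint (tf_shift z) = (\<lambda>X. exp (- 2 * pi * \<i> * of_real (snd z \<bullet> fst z)) *\<^sub>C tf_shift (- z) X)"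
  by (rule cadjoint_eqI) (rule cinner_tf_shift_left)

lemma parity_abs_L2:
  assumes "square_integrable f"
  shows "parity (abs_L2 f) = abs_L2 (\<lambda>t. f (- t))"
  using assms by (subst parity.abs_eq) (auto simp: L2_rel_def eq_onp_def)

lemma square_integrable_reflect: "square_integrable f \<Longrightarrow> square_integrable (\<lambda>t. f (- t))"
  using square_integrable_affine[of f "-1" 0] by simp

lemma parity_parity [simp]: "parity (parity X) = X"
proof -
  obtain f where f: "square_integrable f" "X = abs_L2 f" by (rule L2_cases)
  then show ?thesis by (simp add: parity_abs_L2 square_integrable_reflect)
qed

lemma cinner_parity: "cinner (parity X) Y = cinner X (parity Y)"
proof -
  obtain f where f: "square_integrable f" "X = abs_L2 f" by (rule L2_cases)
  obtain g where g: "square_integrable g" "Y = abs_L2 g" by (rule L2_cases)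
  have [measurable]: "f \<in> borel_measurable borel" "g \<in> borel_measurable borel"
    using f g by (auto simp: square_integrable_def)
  have "(\<integral>t. f (- t) * cnj (g t) \<partial>lborel) = (\<integral>t. f t * cnj (g (- t)) \<partial>lborel)"
    using integral_reflect[of "\<lambda>t. f t * cnj (g (- t))" 0] by simp
  then show ?thesis using f g by (simp add: parity_abs_L2 square_integrable_reflect cinner_abs_L2)
qed

lemma parity_bounded_clinear: "bounded_clinear parity"
proof (rule bounded_clinearI[where C = 1])
  show "parity (X + Y) = parity X + parity Y" for X Y :: "'a L2"
    by (rule L2_eqI) (simp add: cinner_parity cinner_add_left)
  show "parity (c *\<^sub>C X) = c *\<^sub>C parity X" for c and X :: "'a L2"
    by (rule L2_eqI) (simp add: cinner_parity cinner_scaleC_left)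
  have "cinner (parity X) (parity X) = cinner X X" for X :: "'a L2" by (simp add: cinner_parity)
  then show "norm (parity X) \<le> 1 * norm X" for X :: "'a L2"
    by (simp add: norm_eq_sqrt_inner inner_L2_Re)
qed

lemma norm_parity [simp]: "norm (parity X) = norm X"
  by (simp add: norm_eq_sqrt_inner inner_L2_Re cinner_parity)

lemma parity_tf_shift: "parity (tf_shift z X) = tf_shift (- z) (parity X)"
proof -
  obtain f where f: "square_integrable f" "X = abs_L2 f" by (rule L2_cases)
  obtain x \<omega> where z: "z = (x, \<omega>)" by (cases z)
  show ?thesis
    unfolding f(2) z uminus_prod_def fst_conv snd_conv
      tf_shift_abs_L2[OF f(1)] parity_abs_L2[OF square_integrable_tf[OF f(1)]] parity_abs_L2[OF f(1)]
      tf_shift_abs_L2[OF square_integrable_reflect[OF f(1)]] by simp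
qed

text \<open>The bound \<open>K\<close> is uniform in the index \<open>z\<close>, so the limit along
  the filter can be exchanged with a norm limit of vectors.\<close>

lemma closed_tendsto_0_functional:
  fixes L :: "'i \<Rightarrow> 'a::euclidean_space L2 \<Rightarrow> complex"
  assumes "\<And>z f g. L z (f - g) = L z f - L z g" "\<And>z f. cmod (L z f) \<le> K * norm f"
  shows "closed {f. ((\<lambda>z. L z f) \<longlongrightarrow> 0) F}"
  unfolding closed_sequential_limits
proof (intro allI impI, elim conjE)
  fix X f assume X: "\<forall>n. X n \<in> {f. ((\<lambda>z. L z f) \<longlongrightarrow> 0) F}" and lim: "X \<longlonglongrightarrow> f"
  have "((\<lambda>z. L z f) \<longlongrightarrow> 0) F"
  proof (rule tendstoI)
    fix e :: real assume e: "e > 0"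
    have "(\<lambda>n. K * norm (f - X n)) \<longlonglongrightarrow> K * norm (f - f)" by (intro tendsto_intros lim)
    then have "\<forall>\<^sub>F n in sequentially. K * norm (f - X n) < e / 2"
      by (rule order_tendstoD(2)) (use e in simp)
    then obtain n where n: "K * norm (f - X n) < e / 2" by (auto simp: eventually_sequentially)
    have "((\<lambda>z. L z (X n)) \<longlongrightarrow> 0) F" using X by auto
    then have "\<forall>\<^sub>F z in F. dist (L z (X n)) 0 < e / 2" by (rule tendstoD) (use e in simp)
    then show "\<forall>\<^sub>F z in F. dist (L z f) 0 < e"
    proof eventually_elim
      fix z assume "dist (L z (X n)) 0 < e / 2"
      moreover have "cmod (L z f) \<le> cmod (L z (f - X n)) + cmod (L z (X n))"
        using norm_triangle_ineq[of "L z (f - X n)" "L z (X n)"] by (simp add: assms(1))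
      moreover have "cmod (L z (f - X n)) \<le> K * norm (f - X n)" by (rule assms(2))
      ultimately show "dist (L z f) 0 < e" using n by simp
    qed
  qed
  then show "f \<in> {f. ((\<lambda>z. L z f) \<longlongrightarrow> 0) F}" by simp
qed

section \<open>Strong continuity of time-frequency shifts\<close>

lemma square_integrable_indicator:
  assumes "A \<in> sets borel" "emeasure lborel A < \<infinity>"
  shows "square_integrable (\<lambda>t. complex_of_real (indicator A t))"
proof -
  have "(cmod (complex_of_real (indicator A t)))\<^sup>2 = indicator A t" for t
    by (simp add: indicator_def)
  then show ?thesis using assms by (simp add: square_integrable_def)
qed

text \<open>For \<open>c\<close> among 1, -1, \<open>\<i>\<close>, \<open>-\<i>\<close>, test
  against the set where the real part of \<open>c\<close> times the representative is positive, cut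
  down to a ball for finite measure. The four sign conditions force the representative to vanish
  almost everywhere.\<close>

lemma indicator_total:
  fixes X :: "'a::euclidean_space L2"
  assumes "\<And>A. A \<in> sets borel \<Longrightarrow> emeasure lborel A < \<infinity> \<Longrightarrow>
    cinner X (abs_L2 (\<lambda>t. complex_of_real (indicator A t))) = 0"
  shows "X = 0"
proof -
  have "AE t in lborel. Re (c * rep_L2 X t) \<le> 0" for c
  proof -
    define f where "f t = c * rep_L2 X t" for t
    have [measurable]: "f \<in> borel_measurable borel" unfolding f_def by measurable
    have sf: "square_integrable f" unfolding f_def by (intro square_integrable_scale) simp
    have absf: "abs_L2 f = c *\<^sub>C X"
      unfolding f_def using scaleC_abs_L2[of "rep_L2 X" c] by simp
    have "AE t in lborel. t \<in> ball 0 (real n) \<longrightarrow> Re (f t) \<le> 0" for n :: nat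
    proof -
      define A where "A = {t \<in> ball 0 (real n). Re (f t) > 0}"
      have [measurable]: "A \<in> sets borel" unfolding A_def by measurable
      have "emeasure lborel A \<le> emeasure lborel (cball (0::'a) (real n))"
        by (intro emeasure_mono) (auto simp: A_def)
      also have "\<dots> < \<infinity>" by (rule emeasure_lborel_cball_finite)
      finally have fin: "emeasure lborel A < \<infinity>" .
      have "(\<integral>t. f t * cnj (complex_of_real (indicator A t)) \<partial>lborel) = 0"
        using cinner_abs_L2[OF sf square_integrable_indicator[of A]] fin assms[of A]
        by (simp add: absf cinner_scaleC_left)
      moreover have int: "integrable lborel (\<lambda>t. f t * cnj (complex_of_real (indicator A t)))"
        by (intro integrable_mult_cnj sf square_integrable_indicator fin) simp
      ultimately have "(\<integral>t. Re (f t * cnj (complex_of_real (indicator A t))) \<partial>lborel) = 0"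
        by (subst integral_Re[OF int]) simp
      then have "(\<integral>t. Re (f t) * indicator A t \<partial>lborel) = 0" by simp
      moreover have "integrable lborel (\<lambda>t. Re (f t) * indicator A t)"
        using integrable_Re[OF int] by simp
      ultimately have "AE t in lborel. Re (f t) * indicator A t = 0"
        by (subst (asm) integral_nonneg_eq_0_iff_AE) (auto simp: A_def indicator_def)
      then show ?thesis by eventually_elim (auto simp: A_def indicator_def split: if_splits)
    qed
    then have "AE t in lborel. \<forall>n::nat. t \<in> ball 0 (real n) \<longrightarrow> Re (f t) \<le> 0"
      unfolding AE_all_countable by blast
    then show ?thesis
      by eventually_elim (metis f_def mem_ball_0 reals_Archimedean2)
  qed
  from this[of 1] this[of "-1"] this[of \<i>] this[of "-\<i>"]
  have "AE t in lborel. rep_L2 X t = 0"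
    by eventually_elim (simp add: complex_eq_iff)
  then have "abs_L2 (rep_L2 X) = abs_L2 (\<lambda>_. 0)"
    by (subst abs_L2_eq_iff) (simp_all add: square_integrable_zero)
  then show ?thesis by (simp add: zero_L2_def)
qed

text \<open>For an indicator the squared L2 distance from its translate is the L1 distance, because
  the difference takes only the values 0, 1 and -1. Totality of the indicators and isometry of
  translations extend this to all vectors.\<close>

lemma translation_tendsto:
  fixes X :: "'a::euclidean_space L2"
  shows "((\<lambda>y. norm (tf_shift (y, 0) X - X)) \<longlongrightarrow> 0) (at 0)"
proof -
  let ?C = "{X :: 'a L2. ((\<lambda>y. tf_shift (y, 0) X - X) \<longlongrightarrow> 0) (at 0)}"
  have ind: "abs_L2 (\<lambda>t. complex_of_real (indicator A t)) \<in> ?C"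
    if A: "A \<in> sets borel" "emeasure lborel A < \<infinity>" for A
  proof -
    let ?I = "\<lambda>t. complex_of_real (indicator A t)"
    have sI: "square_integrable ?I" "square_integrable (\<lambda>t. ?I (t - y))" for y
      using square_integrable_indicator[OF A] square_integrable_affine[OF square_integrable_indicator[OF A], of 1 "- y"]
      by simp_all
    have "(norm (tf_shift (y, 0) (abs_L2 ?I) - abs_L2 ?I))\<^sup>2 = (\<integral>x. norm (indicator A (x - y) - indicator A x :: real) \<partial>lborel)" for y
    proof -
      have "tf_shift (y, 0) (abs_L2 ?I) - abs_L2 ?I = abs_L2 (\<lambda>t. ?I (t - y) - ?I t)"
        using sI by (simp add: tf_shift_abs_L2 minus_abs_L2)
      then have "(norm (tf_shift (y, 0) (abs_L2 ?I) - abs_L2 ?I))\<^sup>2 = (\<integral>t. (cmod (?I (t - y) - ?I t))\<^sup>2 \<partial>lborel)"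
        using norm_abs_L2[OF square_integrable_diff[OF sI(2)[of y] sI(1)]] by simp
      also have "\<dots> = (\<integral>x. norm (indicator A (x - y) - indicator A x :: real) \<partial>lborel)"
        by (rule Bochner_Integration.integral_cong) (auto simp: indicator_def)
      finally show ?thesis .
    qed
    then have "((\<lambda>y. sqrt ((norm (tf_shift (y, 0) (abs_L2 ?I) - abs_L2 ?I))\<^sup>2)) \<longlongrightarrow> sqrt 0) (at 0)"
      using tendsto_translation_indicator[OF A] by (intro tendsto_real_sqrt) simp
    then show ?thesis by (simp add: tendsto_norm_zero_iff)
  qed
  have "X \<in> ?C"
  proof (rule closed_csubspace_total)
    show "closed ?C"
      unfolding closed_sequential_limits
    proof (intro allI impI, elim conjE)
      fix F f assume F: "\<forall>n. F n \<in> ?C" and lim: "F \<longlonglongrightarrow> f"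
      have "((\<lambda>y. tf_shift (y, 0) f - f) \<longlongrightarrow> 0) (at 0)"
      proof (rule tendstoI)
        fix e :: real assume e: "e > 0"
        then obtain n where n: "norm (F n - f) < e / 3"
          using LIMSEQ_D[OF lim, of "e / 3"] by auto
        have "((\<lambda>y. tf_shift (y, 0) (F n) - F n) \<longlongrightarrow> 0) (at 0)" using F by auto
        then have "\<forall>\<^sub>F y in at 0. dist (tf_shift (y, 0) (F n) - F n) 0 < e / 3" by (rule tendstoD) (use e in simp)
        then show "\<forall>\<^sub>F y in at 0. dist (tf_shift (y, 0) f - f) 0 < e"
        proof eventually_elim
          fix y assume y: "dist (tf_shift (y, 0) (F n) - F n) 0 < e / 3"
          have "tf_shift (y, 0) f - f = (tf_shift (y, 0) (F n) - F n) - (tf_shift (y, 0) (F n - f)) + (F n - f)"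
            by (simp add: tf_shift_simps)
          then have "norm (tf_shift (y, 0) f - f) \<le> norm ((tf_shift (y, 0) (F n) - F n) - (tf_shift (y, 0) (F n - f))) + norm (F n - f)"
            using norm_triangle_ineq by metis
          also have "norm ((tf_shift (y, 0) (F n) - F n) - (tf_shift (y, 0) (F n - f))) \<le> norm (tf_shift (y, 0) (F n) - F n) + norm (F n - f)"
            using norm_triangle_ineq4[of "tf_shift (y, 0) (F n) - F n" "tf_shift (y, 0) (F n - f)"] by simp
          finally show "dist (tf_shift (y, 0) f - f) 0 < e" using y n by simp
        qed
      qed
      then show "f \<in> ?C" by simp
    qed
    show "0 \<in> ?C" by (simp add: tf_shift_simps)
    show "f + g \<in> ?C" if fg: "f \<in> ?C" "g \<in> ?C" for f g
    proof -
      have "((\<lambda>y. (tf_shift (y, 0) f - f) + (tf_shift (y, 0) g - g)) \<longlongrightarrow> 0) (at 0)"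
        using fg by (intro tendsto_add_zero) auto
      moreover have "(tf_shift (y, 0) f - f) + (tf_shift (y, 0) g - g) = tf_shift (y, 0) (f + g) - (f + g)" for y
        by (simp add: tf_shift_simps)
      ultimately show ?thesis by simp
    qed
    show "c *\<^sub>C f \<in> ?C" if f: "f \<in> ?C" for c f
    proof -
      have "((\<lambda>y. c *\<^sub>C (tf_shift (y, 0) f - f)) \<longlongrightarrow> 0) (at 0)"
        using bounded_linear.tendsto_zero[OF bounded_linear_scaleC, of "\<lambda>y. tf_shift (y, 0) f - f"] f by simp
      then show ?thesis by (simp add: tf_shift_simps scaleC_diff_right)
    qed
    show "f = 0" if "\<And>g. g \<in> ?C \<Longrightarrow> cinner f g = 0" for f
      using that ind by (intro indicator_total) blast
  qed
  then have "((\<lambda>y. tf_shift (y, 0) X - X) \<longlongrightarrow> 0) (at 0)" by simp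
  then show ?thesis by (rule tendsto_norm_zero)
qed

text \<open>Translation and modulation are separated. The outer modulation is isometric, so the
  translation error can be measured before it; the modulation error at the limiting position is a
  dominated convergence for one fixed representative.\<close>

lemma continuous_on_tf_shift:
  fixes X :: "'a::euclidean_space L2"
  shows "continuous_on UNIV (\<lambda>z. tf_shift z X)"
  unfolding continuous_on_sequentially o_def
proof (intro allI ballI impI, elim conjE)
  fix Z :: "nat \<Rightarrow> 'a \<times> 'a" and z assume Z: "Z \<longlonglongrightarrow> z"
  define x \<omega> where "x n = fst (Z n)" and "\<omega> n = snd (Z n)" for n
  have x: "x \<longlonglongrightarrow> fst z" and \<omega>: "\<omega> \<longlonglongrightarrow> snd z"
    unfolding x_def \<omega>_def by (intro tendsto_intros Z)+
  have split: "tf_shift v X = tf_shift (0, snd v) (tf_shift (fst v, 0) X)" for v and X :: "'a L2"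
    by (simp add: tf_shift_compose)
  define Y where "Y = tf_shift (fst z, 0) X"
  have "(\<lambda>n. x n - fst z) \<longlonglongrightarrow> 0" using x by (rule LIM_zero)
  moreover have "((\<lambda>y. norm (tf_shift (y, 0) X - X)) \<longlongrightarrow> 0) (nhds 0)"
    using translation_tendsto[of X] by (simp add: tendsto_nhds_iff flip: zero_prod_def)
  ultimately have "(\<lambda>n. norm (tf_shift (x n - fst z, 0) X - X)) \<longlonglongrightarrow> 0"
    by (rule filterlim_compose[rotated])
  moreover have "norm (tf_shift (x n, 0) X - Y) = norm (tf_shift (x n - fst z, 0) X - X)" for n
  proof -
    have "tf_shift (x n, 0) X - Y = tf_shift (fst z, 0) (tf_shift (x n - fst z, 0) X - X)"
      by (simp add: Y_def tf_shift_simps tf_shift_compose)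
    then show ?thesis by simp
  qed
  ultimately have 1: "(\<lambda>n. norm (tf_shift (x n, 0) X - Y)) \<longlonglongrightarrow> 0" by simp
  define f where "f = rep_L2 Y"
  have sf: "square_integrable f" and Y: "Y = abs_L2 f" by (simp_all add: f_def)
  have [measurable]: "f \<in> borel_measurable borel" using sf by (simp add: square_integrable_def)
  let ?e = "\<lambda>\<omega> t. exp (2 * pi * \<i> * of_real (\<omega> \<bullet> t))"
  have em [measurable]: "?e v \<in> borel_measurable borel" for v :: 'a
    by (intro borel_measurable_continuous_onI continuous_intros)
  have sef: "square_integrable (\<lambda>t. ?e v t * f t)" for v
    using square_integrable_tf[OF sf, of v 0] by simp
  have "(norm (tf_shift (0, \<omega> n) Y - tf_shift (0, snd z) Y))\<^sup>2 = (\<integral>t. (cmod (?e (\<omega> n) t * f t - ?e (snd z) t * f t))\<^sup>2 \<partial>lborel)" for n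
    unfolding Y tf_shift_abs_L2[OF sf]
    using norm_abs_L2[OF square_integrable_diff[OF sef sef], of "\<omega> n" "snd z"] minus_abs_L2[OF sef sef, of "\<omega> n" "snd z"] by simp
  moreover have "(\<lambda>n. \<integral>t. (cmod (?e (\<omega> n) t * f t - ?e (snd z) t * f t))\<^sup>2 \<partial>lborel) \<longlonglongrightarrow> (\<integral>t. 0 \<partial>(lborel :: 'a measure))"
  proof (rule integral_dominated_convergence[where w = "\<lambda>t. 4 * (cmod (f t))\<^sup>2"])
    show "AE t in lborel. (\<lambda>n. (cmod (?e (\<omega> n) t * f t - ?e (snd z) t * f t))\<^sup>2) \<longlonglongrightarrow> 0"
    proof (rule AE_I2)
      fix t
      have "(\<lambda>n. (cmod (?e (\<omega> n) t * f t - ?e (snd z) t * f t))\<^sup>2) \<longlonglongrightarrow> (cmod (?e (snd z) t * f t - ?e (snd z) t * f t))\<^sup>2"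
        by (intro tendsto_intros \<omega>)
      then show "(\<lambda>n. (cmod (?e (\<omega> n) t * f t - ?e (snd z) t * f t))\<^sup>2) \<longlonglongrightarrow> 0" by simp
    qed
    show "AE t in lborel. norm ((cmod (?e (\<omega> n) t * f t - ?e (snd z) t * f t))\<^sup>2) \<le> 4 * (cmod (f t))\<^sup>2" for n
    proof (rule AE_I2)
      fix t
      have "cmod (?e (\<omega> n) t * f t - ?e (snd z) t * f t) \<le> cmod (?e (\<omega> n) t * f t) + cmod (?e (snd z) t * f t)"
        by (rule norm_triangle_ineq4)
      also have "\<dots> = 2 * cmod (f t)" by (simp add: norm_mult)
      finally have "(cmod (?e (\<omega> n) t * f t - ?e (snd z) t * f t))\<^sup>2 \<le> (2 * cmod (f t))\<^sup>2" by (intro power_mono) auto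
      then show "norm ((cmod (?e (\<omega> n) t * f t - ?e (snd z) t * f t))\<^sup>2) \<le> 4 * (cmod (f t))\<^sup>2"
        by (simp add: power_mult_distrib)
    qed
    show "integrable lborel (\<lambda>t. 4 * (cmod (f t))\<^sup>2)" using sf by (simp add: square_integrable_def)
  qed measurable
  ultimately have "(\<lambda>n. sqrt ((norm (tf_shift (0, \<omega> n) Y - tf_shift (0, snd z) Y))\<^sup>2)) \<longlonglongrightarrow> sqrt 0"
    by (intro tendsto_real_sqrt) simp
  then have 2: "(\<lambda>n. norm (tf_shift (0, \<omega> n) Y - tf_shift (0, snd z) Y)) \<longlonglongrightarrow> 0" by simp
  have "(\<lambda>n. tf_shift (Z n) X - tf_shift z X) \<longlonglongrightarrow> 0"
  proof (rule Lim_null_comparison)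
    show "(\<lambda>n. norm (tf_shift (x n, 0) X - Y) + norm (tf_shift (0, \<omega> n) Y - tf_shift (0, snd z) Y)) \<longlonglongrightarrow> 0"
      by (rule tendsto_add_zero[OF 1 2])
    have "norm (tf_shift (Z n) X - tf_shift z X) \<le> norm (tf_shift (x n, 0) X - Y) + norm (tf_shift (0, \<omega> n) Y - tf_shift (0, snd z) Y)" for n
    proof -
      have "tf_shift (Z n) X - tf_shift z X = tf_shift (0, \<omega> n) (tf_shift (x n, 0) X - Y) + (tf_shift (0, \<omega> n) Y - tf_shift (0, snd z) Y)"
        unfolding split[of "Z n"] split[of z] x_def \<omega>_def Y_def by (simp add: tf_shift_simps)
      then show ?thesis using norm_triangle_ineq by (metis norm_tf_shift)
    qed
    then show "\<forall>\<^sub>F n in sequentially. norm (tf_shift (Z n) X - tf_shift z X)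
      \<le> norm (tf_shift (x n, 0) X - Y) + norm (tf_shift (0, \<omega> n) Y - tf_shift (0, snd z) Y)" by simp
  qed
  then show "(\<lambda>n. tf_shift (Z n) X) \<longlonglongrightarrow> tf_shift z X" by (rule LIM_zero_cancel)
qed

lemma continuous_on_tf_shift' [continuous_intros]:
  "continuous_on S h \<Longrightarrow> continuous_on S (\<lambda>y. tf_shift (h y) X)"
  by (rule continuous_on_compose2[OF continuous_on_tf_shift]) auto

subsection \<open>Plancherel's and Moyal's identities\<close>

lemma integrable_nonneg_bound:
  fixes f g :: "'m \<Rightarrow> real"
  assumes "integrable M g" "f \<in> borel_measurable M" "\<And>x. 0 \<le> f x" "\<And>x. f x \<le> g x"
  shows "integrable M f"
proof (rule Bochner_Integration.integrable_bound[OF assms(1,2)])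
  have "norm (f x) \<le> norm (g x)" for x using assms(3,4)[of x] by simp
  then show "AE x in M. norm (f x) \<le> norm (g x)" by simp
qed

lemma norm_fourier_le:
  assumes "integrable lborel p"
  shows "cmod (fourier p w) \<le> (\<integral>x. cmod (p x) \<partial>lborel)"
proof -
  have "cmod (fourier p w) \<le> (\<integral>x. cmod (p x * exp (- 2 * pi * \<i> * of_real (w \<bullet> x))) \<partial>lborel)"
    unfolding fourier_def by (rule integral_norm_bound)
  then show ?thesis by (simp add: norm_mult)
qed

lemma borel_measurable_fourier:
  "integrable lborel p \<Longrightarrow> fourier p \<in> borel_measurable borel"
  by (rule borel_measurable_continuous_onI[OF continuous_on_fourier])

text \<open>The Gaussian weight makes both unfoldings of \<open>fourier p\<close> absolutely
  integrable, so the frequency integral can be carried out first. It leaves a Gaussian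
  \<open>H\<close> concentrated at 0, integrated against the autocorrelation of \<open>p\<close>;
  dilation by \<open>1 / sqrt k\<close> gives \<open>H\<close> a fixed shape.\<close>

lemma plancherel_regularized:
  fixes p :: "'a::euclidean_space \<Rightarrow> complex"
  assumes p: "integrable lborel p" and sp: "square_integrable p" and k: "k > 0"
  shows "(\<integral>w. of_real (gauss (1 / k) w) * cnj (fourier p w) * fourier p w \<partial>lborel)
    = (\<integral>u. of_real (gauss 1 u) * cinner (abs_L2 p) (tf_shift ((1 / sqrt k) *\<^sub>R u, 0) (abs_L2 p)) \<partial>lborel)"
proof -
  let ?N = "\<integral>x. cmod (p x) \<partial>lborel" and ?n = "DIM('a)"
  have [measurable]: "p \<in> borel_measurable borel" using p by auto
  have [measurable]: "fourier p \<in> borel_measurable borel" by (rule borel_measurable_fourier[OF p])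
  have N0: "?N \<ge> 0" by simp
  define H where "H y = complex_of_real (gauss k y * sqrt k ^ ?n)" for y :: 'a
  have [measurable]: "H \<in> borel_measurable borel" unfolding H_def by measurable
  have Hmax: "cmod (H y) \<le> sqrt k ^ ?n" for y
    using gauss_le_1[of k y] gauss_pos[of k y] k unfolding H_def norm_of_real
    by (simp add: abs_mult mult_left_le_one_le)
  have intH: "integrable lborel H"
    unfolding H_def using k by (intro integrable_of_real integrable_mult_left integrable_gauss)
  have H: "(\<integral>w. of_real (gauss (1 / k) w) * exp (- 2 * pi * \<i> * of_real (v \<bullet> w)) \<partial>lborel) = H v" for v :: 'a
    using integral_gauss_character[of "1 / k" v] k by (simp add: H_def real_sqrt_divide power_divide)
  have intE: "integrable lborel (\<lambda>w :: 'a. gauss (1 / k) w)" using k by (intro integrable_gauss) simp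
  have Eabs: "cmod (of_real (gauss (1 / k) w)) = gauss (1 / k) w" for w :: 'a
    using gauss_pos[of "1 / k" w] by simp
  have ip: "integrable lborel (\<lambda>s. p s * exp (- 2 * pi * \<i> * of_real (w \<bullet> s)))" for w
    by (rule Bochner_Integration.integrable_bound[OF p])
      (auto simp: norm_mult intro!: borel_measurable_times borel_measurable_continuous_onI continuous_intros)
  have icp: "integrable lborel (\<lambda>t. cnj (p t) * exp (2 * pi * \<i> * of_real (w \<bullet> t)))" for w
    by (rule Bochner_Integration.integrable_bound[OF p])
      (auto simp: norm_mult intro!: borel_measurable_times borel_measurable_continuous_onI continuous_intros)
  have meas_exp [measurable]: "(\<lambda>(w, s). exp (c * of_real ((w :: 'a) \<bullet> s))) \<in> borel_measurable (borel \<Otimes>\<^sub>M borel)" for c :: complex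
    unfolding borel_prod by (intro borel_measurable_continuous_onI) (simp add: split_def continuous_intros)
  have meas_exp1 [measurable]: "(\<lambda>w. exp (c * of_real ((w :: 'a) \<bullet> s))) \<in> borel_measurable borel" for c :: complex and s
    by (intro borel_measurable_continuous_onI continuous_intros)
  define F where "F w s = of_real (gauss (1 / k) w) * cnj (fourier p w) * (p s * exp (- 2 * pi * \<i> * of_real (w \<bullet> s)))" for w s
  have F3: "(\<integral>s. (\<integral>w. F w s \<partial>lborel) \<partial>lborel) = (\<integral>w. (\<integral>s. F w s \<partial>lborel) \<partial>lborel)"
  proof (rule lborel_fubini(3))
    show "(\<lambda>(w, s). F w s) \<in> borel_measurable (lborel \<Otimes>\<^sub>M lborel)" unfolding F_def by measurable
    show "AE w in lborel. integrable lborel (F w)" unfolding F_def using ip by (intro AE_I2 integrable_mult_right)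
    have eq: "(\<integral>s. norm (F w s) \<partial>lborel) = gauss (1 / k) w * cmod (fourier p w) * ?N" for w
      unfolding F_def by (simp add: norm_mult Eabs del: norm_of_real)
    show "integrable lborel (\<lambda>w. \<integral>s. norm (F w s) \<partial>lborel)"
      unfolding eq
    proof (rule Bochner_Integration.integrable_bound[OF integrable_mult_left[OF intE, of "?N * ?N"]])
      show "AE w in lborel. norm (gauss (1 / k) w * cmod (fourier p w) * ?N) \<le> norm (gauss (1 / k) w * (?N * ?N))"
        using norm_fourier_le[OF p] less_imp_le[OF gauss_pos] N0
        by (intro AE_I2) (simp add: abs_mult abs_of_nonneg mult_left_mono mult_right_mono mult.assoc)
    qed measurable
  qed
  have Fs: "(\<integral>s. F w s \<partial>lborel) = of_real (gauss (1 / k) w) * cnj (fourier p w) * fourier p w" for w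
    unfolding F_def fourier_def[of p w] by simp
  have Fw: "(\<integral>w. F w s \<partial>lborel) = p s * (\<integral>t. cnj (p t) * H (s - t) \<partial>lborel)" for s
  proof -
    define G where "G w t = of_real (gauss (1 / k) w) * exp (- 2 * pi * \<i> * of_real (w \<bullet> s)) * (cnj (p t) * exp (2 * pi * \<i> * of_real (w \<bullet> t)))" for w t
    have G3: "(\<integral>t. (\<integral>w. G w t \<partial>lborel) \<partial>lborel) = (\<integral>w. (\<integral>t. G w t \<partial>lborel) \<partial>lborel)"
    proof (rule lborel_fubini(3))
      show "(\<lambda>(w, t). G w t) \<in> borel_measurable (lborel \<Otimes>\<^sub>M lborel)" unfolding G_def by measurable
      show "AE w in lborel. integrable lborel (G w)" unfolding G_def using icp by (intro AE_I2 integrable_mult_right)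
      have "(\<integral>t. norm (G w t) \<partial>lborel) = gauss (1 / k) w * ?N" for w
        unfolding G_def by (simp add: norm_mult Eabs del: norm_of_real)
      then show "integrable lborel (\<lambda>w. \<integral>t. norm (G w t) \<partial>lborel)" using intE by simp
    qed
    have Gt: "(\<integral>t. G w t \<partial>lborel) = of_real (gauss (1 / k) w) * exp (- 2 * pi * \<i> * of_real (w \<bullet> s)) * cnj (fourier p w)" for w
    proof -
      have "(\<integral>t. cnj (p t) * exp (2 * pi * \<i> * of_real (w \<bullet> t)) \<partial>lborel) = (\<integral>t. cnj (p t * exp (- 2 * pi * \<i> * of_real (w \<bullet> t))) \<partial>lborel)"
        by (rule Bochner_Integration.integral_cong) (simp_all add: exp_cnj)
      also have "\<dots> = cnj (fourier p w)" unfolding fourier_def by (rule Bochner_Integration.integral_cnj)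
      finally show ?thesis unfolding G_def by simp
    qed
    have Gw: "(\<integral>w. G w t \<partial>lborel) = cnj (p t) * H (s - t)" for t
    proof -
      have "G w t = cnj (p t) * (of_real (gauss (1 / k) w) * exp (- 2 * pi * \<i> * of_real ((s - t) \<bullet> w)))" for w
      proof -
        have "exp (- 2 * pi * \<i> * of_real (w \<bullet> s)) * exp (2 * pi * \<i> * of_real (w \<bullet> t)) = exp (- 2 * pi * \<i> * of_real ((s - t) \<bullet> w))"
          by (simp only: exp_add[symmetric], rule arg_cong[of _ _ exp])
            (simp add: inner_diff_left inner_commute algebra_simps)
        then show ?thesis unfolding G_def by (simp only: mult_ac)
      qed
      then show ?thesis using H[of "s - t"] by simp
    qed
    have "(\<integral>w. F w s \<partial>lborel) = p s * (\<integral>w. (\<integral>t. G w t \<partial>lborel) \<partial>lborel)"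
      unfolding Gt F_def integral_mult_right_zero[symmetric]
      by (rule Bochner_Integration.integral_cong) (simp_all only: mult_ac)
    also have "\<dots> = p s * (\<integral>t. cnj (p t) * H (s - t) \<partial>lborel)"
      unfolding G3[symmetric] Gw ..
    finally show ?thesis .
  qed
  define K where "K s y = p s * (cnj (p (s - y)) * H y)" for s y
  have "(\<integral>y. (\<integral>s. K s y \<partial>lborel) \<partial>lborel) = (\<integral>s. (\<integral>y. K s y \<partial>lborel) \<partial>lborel)"
    and intK: "integrable lborel (\<lambda>y. \<integral>s. K s y \<partial>lborel)"
  proof -
    have m: "(\<lambda>(s, y). K s y) \<in> borel_measurable (lborel \<Otimes>\<^sub>M lborel)" unfolding K_def by measurable
    have i: "integrable lborel (\<lambda>y. cnj (p (s - y)) * H y)" for s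
    proof (rule Bochner_Integration.integrable_bound)
      show "integrable lborel (\<lambda>y. sqrt k ^ ?n * cmod (p (s - y)))"
        by (intro integrable_mult_right integrable_norm integrable_reflect p)
      show "AE y in lborel. norm (cnj (p (s - y)) * H y) \<le> norm (sqrt k ^ ?n * cmod (p (s - y)))"
        using k by (intro AE_I2) (simp add: norm_mult Hmax mult_right_mono mult.commute)
    qed measurable
    have a: "AE s in lborel. integrable lborel (K s)"
      unfolding K_def by (intro AE_I2 integrable_mult_right i)
    have b: "integrable lborel (\<lambda>s. \<integral>y. norm (K s y) \<partial>lborel)"
    proof (rule integrable_nonneg_bound)
      show "integrable lborel (\<lambda>s. cmod (p s) * (sqrt k ^ ?n * ?N))"
        by (intro integrable_mult_left integrable_norm p)
      show "(\<integral>y. norm (K s y) \<partial>lborel) \<le> cmod (p s) * (sqrt k ^ ?n * ?N)" for s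
      proof -
        have "(\<integral>y. norm (K s y) \<partial>lborel) = cmod (p s) * (\<integral>y. cmod (cnj (p (s - y)) * H y) \<partial>lborel)"
          unfolding K_def norm_mult[of "p s"] by simp
        also have "(\<integral>y. cmod (cnj (p (s - y)) * H y) \<partial>lborel) \<le> (\<integral>y. sqrt k ^ ?n * cmod (p (s - y)) \<partial>lborel)"
          using k i[of s] by (intro integral_mono integrable_mult_right integrable_norm integrable_reflect p)
            (simp_all add: norm_mult Hmax mult_right_mono mult.commute)
        also have "\<dots> = sqrt k ^ ?n * ?N"
          using integral_reflect[of "\<lambda>y. cmod (p y)" s] by simp
        finally show ?thesis by (simp add: mult_left_mono)
      qed
      show "(\<lambda>s. \<integral>y. norm (K s y) \<partial>lborel) \<in> borel_measurable lborel" using m by measurable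
    qed simp
    show "(\<integral>y. (\<integral>s. K s y \<partial>lborel) \<partial>lborel) = (\<integral>s. (\<integral>y. K s y \<partial>lborel) \<partial>lborel)"
      "integrable lborel (\<lambda>y. \<integral>s. K s y \<partial>lborel)"
      by (rule lborel_fubini[OF m a b])+
  qed
  have Ky: "(\<integral>y. K s y \<partial>lborel) = p s * (\<integral>t. cnj (p t) * H (s - t) \<partial>lborel)" for s
    using integral_reflect[of "\<lambda>t. cnj (p t) * H (s - t)" s] unfolding K_def by simp
  define A where "A y = cinner (abs_L2 p) (tf_shift (y, 0) (abs_L2 p))" for y
  have Ks: "(\<integral>s. K s y \<partial>lborel) = H y * A y" for y
  proof -
    have "A y = (\<integral>s. p s * cnj (p (s - y)) \<partial>lborel)"
      using sp square_integrable_tf[OF sp, of 0 y] by (simp add: A_def tf_shift_abs_L2 cinner_abs_L2)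
    then show ?thesis
      unfolding K_def integral_mult_right_zero[symmetric]
      by (simp only: integral_mult_right_zero[symmetric] mult_ac)
  qed
  have "(\<integral>w. of_real (gauss (1 / k) w) * cnj (fourier p w) * fourier p w \<partial>lborel) = (\<integral>y. H y * A y \<partial>lborel)"
    unfolding Fs[symmetric] F3[symmetric] Fw Ky[symmetric] Ks[symmetric]
    by (rule \<open>(\<integral>y. (\<integral>s. K s y \<partial>lborel) \<partial>lborel) = (\<integral>s. (\<integral>y. K s y \<partial>lborel) \<partial>lborel)\<close>[symmetric])
  also have "\<dots> = \<bar>1 / sqrt k\<bar> ^ ?n *\<^sub>R (\<integral>u. H ((1 / sqrt k) *\<^sub>R u) * A ((1 / sqrt k) *\<^sub>R u) \<partial>lborel)"
    by (rule lborel_scale(2)) (use k intK in \<open>auto simp: Ks\<close>)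
  also have "\<dots> = (\<integral>u. of_real (gauss 1 u) * A ((1 / sqrt k) *\<^sub>R u) \<partial>lborel)"
  proof -
    have "\<bar>1 / sqrt k\<bar> ^ ?n *\<^sub>R H ((1 / sqrt k) *\<^sub>R u) = of_real (gauss 1 u)" for u
    proof -
      have "gauss k ((1 / sqrt k) *\<^sub>R u) = gauss 1 u"
        using k by (simp add: gauss_def power_mult_distrib power_divide)
      moreover have "\<bar>1 / sqrt k\<bar> ^ ?n * (g * sqrt k ^ ?n) = g" for g
        using k by (simp add: power_divide)
      ultimately show ?thesis by (simp only: H_def scaleR_conv_of_real of_real_mult[symmetric])
    qed
    then have "\<bar>1 / sqrt k\<bar> ^ ?n *\<^sub>R (H ((1 / sqrt k) *\<^sub>R u) * A ((1 / sqrt k) *\<^sub>R u)) = of_real (gauss 1 u) * A ((1 / sqrt k) *\<^sub>R u)" for u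
      by (simp only: mult_scaleR_left[symmetric])
    then show ?thesis by (simp only: integral_scaleR_right[symmetric])
  qed
  finally show ?thesis by (simp only: A_def)
qed

text \<open>Let the weight tend to 1. The frequency side increases, so monotone convergence yields
  finiteness together with the value; the other side tends to the squared norm by strong continuity
  of translation.\<close>

lemma plancherel:
  fixes p :: "'a::euclidean_space \<Rightarrow> complex"
  assumes p: "integrable lborel p" and sp: "square_integrable p"
  shows "(\<integral>\<^sup>+w. ennreal ((cmod (fourier p w))\<^sup>2) \<partial>lborel) = ennreal ((norm (abs_L2 p))\<^sup>2)"
proof -
  define P where "P = abs_L2 p"
  have [measurable]: "fourier p \<in> borel_measurable borel" by (rule borel_measurable_fourier[OF p])
  define k where "k m = real (Suc m)" for m
  have k: "k m > 0" for m by (simp add: k_def)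
  define I where "I m = (\<integral>u. of_real (gauss 1 (u :: 'a)) * cinner P (tf_shift ((1 / sqrt (k m)) *\<^sub>R u, 0) P) \<partial>lborel)" for m
  have Ilim: "I \<longlonglongrightarrow> (\<integral>u. of_real (gauss 1 (u :: 'a)) * cinner P P \<partial>lborel)"
    unfolding I_def
  proof (rule integral_dominated_convergence[where w = "\<lambda>u. gauss 1 u * (norm P * norm P)"])
    show "integrable lborel (\<lambda>u :: 'a. gauss 1 u * (norm P * norm P))"
      by (intro integrable_mult_left integrable_gauss) simp
    show "AE u in lborel. (\<lambda>m. of_real (gauss 1 u) * cinner P (tf_shift ((1 / sqrt (k m)) *\<^sub>R u, 0) P)) \<longlonglongrightarrow> of_real (gauss 1 u) * cinner P P"
    proof (rule AE_I2)
      fix u :: 'a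
      have "(\<lambda>m. 1 / sqrt (k m)) \<longlonglongrightarrow> 0" unfolding k_def by real_asymp
      then have "(\<lambda>m. ((1 / sqrt (k m)) *\<^sub>R u, 0 :: 'a)) \<longlonglongrightarrow> (0 *\<^sub>R u, 0)" by (intro tendsto_intros)
      then have "(\<lambda>m. tf_shift ((1 / sqrt (k m)) *\<^sub>R u, 0) P) \<longlonglongrightarrow> tf_shift (0 *\<^sub>R u, 0) P"
        by (intro continuous_on_tendsto_compose[OF continuous_on_tf_shift]) auto
      then have "(\<lambda>m. tf_shift ((1 / sqrt (k m)) *\<^sub>R u, 0) P) \<longlonglongrightarrow> P"
        by (simp flip: zero_prod_def)
      then show "(\<lambda>m. of_real (gauss 1 u) * cinner P (tf_shift ((1 / sqrt (k m)) *\<^sub>R u, 0) P)) \<longlonglongrightarrow> of_real (gauss 1 u) * cinner P P"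
        by (intro tendsto_intros)
    qed
    show "AE u in lborel. norm (of_real (gauss 1 u) * cinner P (tf_shift ((1 / sqrt (k m)) *\<^sub>R u, 0) P)) \<le> gauss 1 u * (norm P * norm P)" for m
    proof (rule AE_I2)
      fix u :: 'a
      show "norm (of_real (gauss 1 u) * cinner P (tf_shift ((1 / sqrt (k m)) *\<^sub>R u, 0) P)) \<le> gauss 1 u * (norm P * norm P)"
        using cinner_Cauchy_Schwarz[of P "tf_shift ((1 / sqrt (k m)) *\<^sub>R u, 0) P"] gauss_pos[of 1 u]
        by (simp add: norm_mult mult_left_mono)
    qed
    show "(\<lambda>u. of_real (gauss 1 u) * cinner P (tf_shift ((1 / sqrt (k m)) *\<^sub>R u, 0) P)) \<in> borel_measurable lborel" for m
      by (simp, intro borel_measurable_continuous_onI continuous_intros)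
  qed measurable
  have "(\<integral>u. complex_of_real (gauss 1 (u :: 'a)) \<partial>lborel) = 1"
    unfolding integral_complex_of_real using integrable_gauss(2)[of 1, where 'b = 'a] by simp
  then have "I \<longlonglongrightarrow> cinner P P" using Ilim by simp
  then have ReI: "(\<lambda>m. Re (I m)) \<longlonglongrightarrow> (norm P)\<^sup>2"
    using tendsto_Re[of I "cinner P P"] by (simp add: cinner_norm)
  define h where "h m w = gauss (1 / k m) w * (cmod (fourier p w))\<^sup>2" for m w
  have hmeas [measurable]: "h m \<in> borel_measurable borel" for m unfolding h_def by measurable
  have h0: "0 \<le> h m w" for m w using gauss_pos[of "1 / k m" w] by (simp add: h_def)
  have hint: "integrable lborel (h m)" for m
  proof (rule integrable_nonneg_bound)
    show "integrable lborel (\<lambda>w. gauss (1 / k m) w * (\<integral>x. cmod (p x) \<partial>lborel)\<^sup>2)"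
      using k[of m] by (intro integrable_mult_left integrable_gauss) simp
    show "h m w \<le> gauss (1 / k m) w * (\<integral>x. cmod (p x) \<partial>lborel)\<^sup>2" for w
      unfolding h_def using norm_fourier_le[OF p, of w] less_imp_le[OF gauss_pos[of "1 / k m" w]]
      by (intro mult_left_mono power_mono) auto
    show "0 \<le> h m w" for w by (rule h0)
  qed measurable
  have hI: "(\<integral>w. h m w \<partial>lborel) = Re (I m)" for m
  proof -
    have "complex_of_real (h m w) = of_real (gauss (1 / k m) w) * cnj (fourier p w) * fourier p w" for w
      using complex_norm_square[of "fourier p w"] by (simp add: h_def mult.assoc mult.commute[of "fourier p w"])
    then have "complex_of_real (\<integral>w. h m w \<partial>lborel) = I m"
      using plancherel_regularized[OF p sp k[of m]] by (simp add: I_def P_def flip: integral_complex_of_real)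
    then show ?thesis by (metis Re_complex_of_real)
  qed
  have mono: "h m w \<le> h m' w" if "m \<le> m'" for m m' w
  proof -
    have "1 / k m' \<le> 1 / k m" using that by (simp add: k_def frac_le)
    then have "pi * (1 / k m' * (norm w)\<^sup>2) \<le> pi * (1 / k m * (norm w)\<^sup>2)"
      by (intro mult_left_mono mult_right_mono) auto
    then have "gauss (1 / k m) w \<le> gauss (1 / k m') w"
      by (simp add: gauss_def)
    then show ?thesis by (simp add: h_def mult_right_mono)
  qed
  have hlim: "(\<lambda>m. h m w) \<longlonglongrightarrow> (cmod (fourier p w))\<^sup>2" for w
  proof -
    have "(\<lambda>m. gauss (1 / k m) w) \<longlonglongrightarrow> 1" unfolding gauss_def k_def by real_asymp
    then have "(\<lambda>m. h m w) \<longlonglongrightarrow> 1 * (cmod (fourier p w))\<^sup>2" unfolding h_def by (intro tendsto_intros)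
    then show ?thesis by simp
  qed
  have "(\<lambda>m. \<integral>\<^sup>+w. ennreal (h m w) \<partial>lborel) \<longlonglongrightarrow> (\<integral>\<^sup>+w. ennreal ((cmod (fourier p w))\<^sup>2) \<partial>lborel)"
  proof (rule nn_integral_LIMSEQ)
    show "incseq (\<lambda>m w. ennreal (h m w))" by (auto simp: incseq_def le_fun_def intro: ennreal_leI mono)
    show "(\<lambda>m. ennreal (h m w)) \<longlonglongrightarrow> ennreal ((cmod (fourier p w))\<^sup>2)" for w by (intro tendsto_ennrealI hlim)
  qed measurable
  moreover have "(\<integral>\<^sup>+w. ennreal (h m w) \<partial>lborel) = ennreal (Re (I m))" for m
    using nn_integral_eq_integral[OF hint[of m]] h0 by (simp add: hI)
  ultimately have "(\<lambda>m. ennreal (Re (I m))) \<longlonglongrightarrow> (\<integral>\<^sup>+w. ennreal ((cmod (fourier p w))\<^sup>2) \<partial>lborel)" by simp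
  moreover have "(\<lambda>m. ennreal (Re (I m))) \<longlonglongrightarrow> ennreal ((norm P)\<^sup>2)" by (intro tendsto_ennrealI ReI)
  ultimately show ?thesis unfolding P_def by (rule LIMSEQ_unique)
qed

section \<open>The short-time Fourier transform\<close>

definition stft :: "'a::euclidean_space L2 \<Rightarrow> 'a L2 \<Rightarrow> 'a \<times> 'a \<Rightarrow> complex" where
  "stft f g z = cinner f (tf_shift z g)"

lemma stft_add_left: "stft (f + f') g z = stft f g z + stft f' g z"
  and stft_scaleC_left: "stft (c *\<^sub>C f) g z = c * stft f g z"
  and stft_add_right: "stft f (g + g') z = stft f g z + stft f g' z"
  and stft_scaleC_right: "stft f (c *\<^sub>C g) z = cnj c * stft f g z"
  by (simp_all add: stft_def cinner_add_left cinner_scaleC_left cinner_add_right cinner_scaleC_right tf_shift_simps)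

lemma norm_stft_le: "cmod (stft f g z) \<le> norm f * norm g"
  using cinner_Cauchy_Schwarz[of f "tf_shift z g"] by (simp add: stft_def)

lemma continuous_on_stft [continuous_intros]:
  "continuous_on S h \<Longrightarrow> continuous_on S (\<lambda>y. stft f g (h y))"
  unfolding stft_def by (intro continuous_intros)

lemma borel_measurable_stft [measurable]: "stft f g \<in> borel_measurable borel"
  by (intro borel_measurable_continuous_onI continuous_intros)

lemma stft_fourier:
  assumes f: "square_integrable f" and g: "square_integrable g"
  shows "stft (abs_L2 f) (abs_L2 g) (x, \<omega>) = fourier (\<lambda>t. f t * cnj (g (t - x))) \<omega>"
  unfolding stft_def tf_shift_abs_L2[OF g] cinner_abs_L2[OF f square_integrable_tf[OF g]] fourier_def
  by (rule Bochner_Integration.integral_cong) (simp_all add: exp_cnj)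

text \<open>For fixed \<open>x\<close> the transform is the Fourier transform of \<open>p x\<close>
  in the frequency, and Plancherel applies wherever \<open>p x\<close> is square integrable. Tonelli
  shows that this is so for almost every \<open>x\<close> and computes the total.\<close>

lemma nn_integral_stft:
  fixes f g :: "'a::euclidean_space L2"
  shows "(\<integral>\<^sup>+z. ennreal ((cmod (stft f g z))\<^sup>2) \<partial>lborel) = ennreal ((norm f)\<^sup>2 * (norm g)\<^sup>2)"
proof -
  define F where "F = rep_L2 f"
  define G where "G = rep_L2 g"
  have sF: "square_integrable F" and sG: "square_integrable G" and f: "f = abs_L2 F" and g: "g = abs_L2 G"
    by (simp_all add: F_def G_def)
  have [measurable]: "F \<in> borel_measurable borel" "G \<in> borel_measurable borel"
    using sF sG by (auto simp: square_integrable_def)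
  have sGx: "square_integrable (\<lambda>t. G (t - x))" for x
    using square_integrable_affine[OF sG, of 1 "- x"] by simp
  define p where "p x t = F t * cnj (G (t - x))" for x t
  have [measurable]: "(\<lambda>(x, t). p x t) \<in> borel_measurable (borel \<Otimes>\<^sub>M borel)" unfolding p_def by measurable
  have pm [measurable]: "p x \<in> borel_measurable borel" for x unfolding p_def by measurable
  have ip: "integrable lborel (p x)" for x
    unfolding p_def by (rule integrable_mult_cnj[OF sF sGx])
  have total: "(\<integral>\<^sup>+x. \<integral>\<^sup>+t. ennreal ((cmod (p x t))\<^sup>2) \<partial>lborel \<partial>lborel) = ennreal ((norm f)\<^sup>2 * (norm g)\<^sup>2)"
  proof -
    have "(\<integral>\<^sup>+x. \<integral>\<^sup>+t. ennreal ((cmod (p x t))\<^sup>2) \<partial>lborel \<partial>lborel)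
       = (\<integral>\<^sup>+t. \<integral>\<^sup>+x. ennreal ((cmod (p x t))\<^sup>2) \<partial>lborel \<partial>lborel)"
      by (rule lborel_pair.Fubini'[symmetric]) measurable
    also have "\<dots> = (\<integral>\<^sup>+t. ennreal ((cmod (F t))\<^sup>2) * ennreal ((norm g)\<^sup>2) \<partial>lborel)"
    proof (rule nn_integral_cong)
      fix t
      have "(\<integral>\<^sup>+x. ennreal ((cmod (p x t))\<^sup>2) \<partial>lborel) = (\<integral>\<^sup>+x. ennreal ((cmod (F t))\<^sup>2) * ennreal ((cmod (G (t - x)))\<^sup>2) \<partial>lborel)"
        by (simp add: p_def norm_mult power_mult_distrib ennreal_mult')
      also have "\<dots> = ennreal ((cmod (F t))\<^sup>2) * (\<integral>\<^sup>+x. ennreal ((cmod (G (t - x)))\<^sup>2) \<partial>lborel)"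
        by (rule nn_integral_cmult) measurable
      also have "(\<integral>\<^sup>+x. ennreal ((cmod (G (t - x)))\<^sup>2) \<partial>lborel) = (\<integral>\<^sup>+x. ennreal ((cmod (G x))\<^sup>2) \<partial>lborel)"
        using nn_integral_affine[of "\<lambda>x. ennreal ((cmod (G x))\<^sup>2)" "-1" t] by simp
      also have "\<dots> = ennreal ((norm g)\<^sup>2)" unfolding g by (rule nn_integral_norm_L2[OF sG])
      finally show "(\<integral>\<^sup>+x. ennreal ((cmod (p x t))\<^sup>2) \<partial>lborel) = ennreal ((cmod (F t))\<^sup>2) * ennreal ((norm g)\<^sup>2)" .
    qed
    also have "\<dots> = (\<integral>\<^sup>+t. ennreal ((cmod (F t))\<^sup>2) \<partial>lborel) * ennreal ((norm g)\<^sup>2)"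
      by (rule nn_integral_multc) measurable
    also have "\<dots> = ennreal ((norm f)\<^sup>2 * (norm g)\<^sup>2)"
      unfolding f nn_integral_norm_L2[OF sF] by (simp add: ennreal_mult)
    finally show ?thesis .
  qed
  then have "(\<integral>\<^sup>+x. \<integral>\<^sup>+t. ennreal ((cmod (p x t))\<^sup>2) \<partial>lborel \<partial>lborel) \<noteq> \<infinity>" by simp
  then have "AE x in lborel. (\<integral>\<^sup>+t. ennreal ((cmod (p x t))\<^sup>2) \<partial>lborel) \<noteq> \<infinity>"
    by (intro nn_integral_PInf_AE) measurable
  then have ae: "AE x in lborel. (\<integral>\<^sup>+\<omega>. ennreal ((cmod (fourier (p x) \<omega>))\<^sup>2) \<partial>lborel) = (\<integral>\<^sup>+t. ennreal ((cmod (p x t))\<^sup>2) \<partial>lborel)"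
  proof eventually_elim
    fix x assume "(\<integral>\<^sup>+t. ennreal ((cmod (p x t))\<^sup>2) \<partial>lborel) \<noteq> \<infinity>"
    then have sp: "square_integrable (p x)" using square_integrable_iff_nn[OF pm[of x]] by (simp add: less_top)
    show "(\<integral>\<^sup>+\<omega>. ennreal ((cmod (fourier (p x) \<omega>))\<^sup>2) \<partial>lborel) = (\<integral>\<^sup>+t. ennreal ((cmod (p x t))\<^sup>2) \<partial>lborel)"
      unfolding plancherel[OF ip sp] nn_integral_norm_L2[OF sp] ..
  qed
  have "(\<integral>\<^sup>+z. ennreal ((cmod (stft f g z))\<^sup>2) \<partial>lborel)
     = (\<integral>\<^sup>+z. ennreal ((cmod (stft f g z))\<^sup>2) \<partial>(lborel \<Otimes>\<^sub>M lborel))"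
    by (simp only: lborel_prod)
  also have "\<dots> = (\<integral>\<^sup>+x. \<integral>\<^sup>+\<omega>. ennreal ((cmod (stft f g (x, \<omega>)))\<^sup>2) \<partial>lborel \<partial>lborel)"
  proof (rule lborel.nn_integral_fst[symmetric])
    show "(\<lambda>z. ennreal ((cmod (stft f g z))\<^sup>2)) \<in> borel_measurable (lborel \<Otimes>\<^sub>M lborel)"
      unfolding lborel_prod by measurable
  qed
  also have "\<dots> = (\<integral>\<^sup>+x. \<integral>\<^sup>+t. ennreal ((cmod (p x t))\<^sup>2) \<partial>lborel \<partial>lborel)"
    unfolding f g stft_fourier[OF sF sG] p_def[symmetric] by (rule nn_integral_cong_AE[OF ae])
  also have "\<dots> = ennreal ((norm f)\<^sup>2 * (norm g)\<^sup>2)" by (rule total)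
  finally show ?thesis .
qed

lemma integrable_stft_square: "integrable lborel (\<lambda>z. (cmod (stft f g z))\<^sup>2)"
  by (rule integrableI_bounded) (simp_all add: nn_integral_stft)

lemma integral_stft_square: "(\<integral>z. (cmod (stft f g z))\<^sup>2 \<partial>lborel) = (norm f)\<^sup>2 * (norm g)\<^sup>2"
  by (subst integral_eq_nn_integral) (simp_all add: nn_integral_stft)

lemma
  fixes f g :: "'m \<Rightarrow> complex"
  assumes [measurable]: "f \<in> borel_measurable M" "g \<in> borel_measurable M"
    and f: "integrable M (\<lambda>x. (cmod (f x))\<^sup>2)" and g: "integrable M (\<lambda>x. (cmod (g x))\<^sup>2)"
  shows integrable_mult_L2: "integrable M (\<lambda>x. f x * g x)"
    and integral_mult_L2_le: "(\<integral>x. cmod (f x * g x) \<partial>M)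
      \<le> sqrt (\<integral>x. (cmod (f x))\<^sup>2 \<partial>M) * sqrt (\<integral>x. (cmod (g x))\<^sup>2 \<partial>M)"
proof -
  have le: "2 * cmod (f x * g x) \<le> (cmod (f x))\<^sup>2 + (cmod (g x))\<^sup>2" for x
    using sum_squares_bound[of "cmod (f x)" "cmod (g x)"] by (simp add: norm_mult)
  show i: "integrable M (\<lambda>x. f x * g x)"
  proof (rule Bochner_Integration.integrable_bound)
    show "integrable M (\<lambda>x. (cmod (f x))\<^sup>2 + (cmod (g x))\<^sup>2)" using f g by simp
    have "cmod (f x * g x) \<le> (cmod (f x))\<^sup>2 + (cmod (g x))\<^sup>2" for x
      using le[of x] norm_ge_zero[of "f x * g x"] by linarith
    then show "AE x in M. norm (f x * g x) \<le> norm ((cmod (f x))\<^sup>2 + (cmod (g x))\<^sup>2)" by simp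
  qed measurable
  define I where "I = (\<integral>x. cmod (f x * g x) \<partial>M)"
  define a where "a = (\<integral>x. (cmod (f x))\<^sup>2 \<partial>M)"
  define b where "b = (\<integral>x. (cmod (g x))\<^sup>2 \<partial>M)"
  have ab: "a \<ge> 0" "b \<ge> 0" "I \<ge> 0" by (simp_all add: a_def b_def I_def)
  have q: "2 * t * I \<le> a + t\<^sup>2 * b" if "t \<ge> 0" for t
  proof -
    have "(\<integral>x. 2 * t * cmod (f x * g x) \<partial>M) \<le> (\<integral>x. (cmod (f x))\<^sup>2 + t\<^sup>2 * (cmod (g x))\<^sup>2 \<partial>M)"
    proof (rule integral_mono)
      fix x
      show "2 * t * cmod (f x * g x) \<le> (cmod (f x))\<^sup>2 + t\<^sup>2 * (cmod (g x))\<^sup>2"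
        using sum_squares_bound[of "cmod (f x)" "t * cmod (g x)"] by (simp add: norm_mult power_mult_distrib mult_ac)
    qed (use f g i in auto)
    then show ?thesis using f g by (simp add: I_def a_def b_def)
  qed
  have "I\<^sup>2 \<le> a * b"
  proof (cases "b = 0")
    case True
    have "I = 0"
    proof (rule ccontr)
      assume "I \<noteq> 0"
      then have "I > 0" using ab by simp
      have "2 * ((a + 1) / I) * I \<le> a" using q[of "(a + 1) / I"] True \<open>I > 0\<close> ab by simp
      then show False using \<open>I > 0\<close> ab by simp
    qed
    then show ?thesis using ab by simp
  next
    case False
    then have b: "b > 0" using ab by simp
    have "2 * (I / b) * I \<le> a + (I / b)\<^sup>2 * b" using q[of "I / b"] b ab by simp
    then show ?thesis using b by (simp add: power2_eq_square field_simps)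
  qed
  then have "sqrt (I\<^sup>2) \<le> sqrt (a * b)" by (rule real_sqrt_le_mono)
  then show "(\<integral>x. cmod (f x * g x) \<partial>M) \<le> sqrt (\<integral>x. (cmod (f x))\<^sup>2 \<partial>M) * sqrt (\<integral>x. (cmod (g x))\<^sup>2 \<partial>M)"
    using ab by (simp add: real_sqrt_mult I_def a_def b_def)
qed

lemma integrable_stft_mult: "integrable lborel (\<lambda>z. stft f g z * cnj (stft f' g' z))"
  by (rule integrable_mult_L2) (simp_all add: integrable_stft_square)

lemma integral_stft_mult_le:
  "(\<integral>z. cmod (stft f g z * cnj (stft f' g' z)) \<partial>lborel) \<le> norm f * norm g * (norm f' * norm g')"
  using integral_mult_L2_le[of "stft f g" lborel "\<lambda>z. cnj (stft f' g' z)"]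
  by (simp add: integrable_stft_square integral_stft_square real_sqrt_mult)

text \<open>Complex polarisation: testing \<open>f + g\<close> and
  \<open>f + \<i> *\<^sub>C g\<close> on the diagonal determines the form.\<close>

lemma sesquilinear_form_eq_0:
  fixes B :: "'a::euclidean_space L2 \<Rightarrow> 'a L2 \<Rightarrow> complex"
  assumes "\<And>f f' g. B (f + f') g = B f g + B f' g" "\<And>c f g. B (c *\<^sub>C f) g = c * B f g"
    and "\<And>f g g'. B f (g + g') = B f g + B f g'" "\<And>c f g. B f (c *\<^sub>C g) = cnj c * B f g"
    and diag: "\<And>f. B f f = 0"
  shows "B f g = 0"
proof -
  have a: "B f g + B g f = 0" for f g
    using diag[of "f + g"] diag[of f] diag[of g] by (simp add: assms(1,3) add.commute)
  have "- (\<i> * B f g) + \<i> * B g f = 0"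
    using a[of f "\<i> *\<^sub>C g"] by (simp add: assms(2,4))
  then have "\<i> * B g f = \<i> * B f g" by (simp only: add.commute eq_neg_iff_add_eq_0[symmetric] neg_equal_iff_equal) simp
  then have "B g f = B f g" by simp
  with a[of f g] show ?thesis by simp
qed

text \<open>Two polarisations of the norm identity \<open>integral_stft_square\<close>: first in the
  analysed vectors with equal windows, then in the windows.\<close>

theorem moyal:
  "(\<integral>z. stft f g z * cnj (stft f' g' z) \<partial>lborel) = cinner f f' * cnj (cinner g g')"
proof -
  note simps = stft_add_left stft_add_right stft_scaleC_left stft_scaleC_right
    cinner_add_left cinner_add_right cinner_scaleC_left cinner_scaleC_right
    integrable_stft_mult distrib_left distrib_right
  define M where "M f g f' g' = (\<integral>z. stft f g z * cnj (stft f' g' z) \<partial>lborel)"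
    for f g f' g' :: "'a L2"
  have lin: "M (f1 + f2) g f' g' = M f1 g f' g' + M f2 g f' g'" "M (c *\<^sub>C f1) g f' g' = c * M f1 g f' g'"
    "M f g (f1 + f2) g' = M f g f1 g' + M f g f2 g'" "M f g (c *\<^sub>C f1) g' = cnj c * M f g f1 g'"
    "M f (f1 + f2) f' g' = M f f1 f' g' + M f f2 f' g'" "M f (c *\<^sub>C f1) f' g' = cnj c * M f f1 f' g'"
    "M f g f' (f1 + f2) = M f g f' f1 + M f g f' f2" "M f g f' (c *\<^sub>C f1) = c * M f g f' f1"
    for f f' g g' f1 f2 c
    unfolding M_def by (simp_all add: simps mult.assoc mult.left_commute)
  have diag: "M f g f g = cinner f f * cnj (cinner g g)" for f g
  proof -
    have "stft f g z * cnj (stft f g z) = of_real ((cmod (stft f g z))\<^sup>2)" for z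
      by (rule complex_norm_square[symmetric])
    then have "M f g f g = of_real (\<integral>z. (cmod (stft f g z))\<^sup>2 \<partial>lborel)"
      unfolding M_def by (simp only: integral_complex_of_real)
    then show ?thesis by (simp add: integral_stft_square cinner_norm)
  qed
  have 1: "M f g f' g - cinner f f' * cnj (cinner g g) = 0" for f g f'
    by (rule sesquilinear_form_eq_0) (simp_all add: lin simps diag algebra_simps)
  have "M f g f' g' - cinner f f' * cnj (cinner g g') = 0"
  \<comment> \<open>The left window enters conjugate linearly, so the pair is read in the order
    \<open>g'\<close>, \<open>g\<close> to get a form that is linear in its first argument.\<close>
  proof (rule sesquilinear_form_eq_0[where B = "\<lambda>g' g. M f g f' g' - cinner f f' * cnj (cinner g g')"])
    show "M f g f' g - cinner f f' * cnj (cinner g g) = 0" for g by (rule 1)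
  qed (simp_all add: lin simps algebra_simps)
  then show ?thesis by (simp add: M_def)
qed

subsection \<open>The Gaussian window\<close>

text \<open>The constant is \<open>2 powr (DIM / 4)\<close>: the square of the Gaussian is
  \<open>gauss 2\<close>, with integral \<open>1 / sqrt 2 ^ DIM\<close>, so the norm is 1.\<close>

definition window :: "'a::euclidean_space L2" where
  "window = abs_L2 (\<lambda>t. of_real (sqrt (sqrt 2 ^ DIM('a)) * gauss 1 t))"

lemma gauss_square: "(gauss c x)\<^sup>2 = gauss (2 * c) x"
  by (simp add: gauss_def power2_eq_square flip: exp_add)

lemma square_integrable_gauss: "square_integrable (\<lambda>t :: 'a::euclidean_space. of_real (r * gauss 1 t))"
proof -
  have "(cmod (of_real (r * gauss 1 t)))\<^sup>2 = r\<^sup>2 * gauss 2 t" for t :: 'a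
    unfolding norm_of_real using gauss_square[of 1 t] by (simp add: power_mult_distrib)
  then show ?thesis
    unfolding square_integrable_def using integrable_gauss(1)[of 2, where 'b = 'a] by simp
qed

lemma parity_window [simp]: "parity window = window"
  unfolding window_def parity_abs_L2[OF square_integrable_gauss] by simp

text \<open>Completing the square centres the product of the Gaussian and its translate at half of
  \<open>x\<close>. Moving the integration variable there produces the phase, and the remaining
  Fourier integral gives the Gaussian in the frequency.\<close>

lemma stft_window:
  "stft window window (x, \<omega>) = of_real (gauss (1/2) x * gauss (1/2) \<omega>) * exp (- pi * \<i> * of_real (\<omega> \<bullet> x))"
proof -
  let ?n = "DIM('a)"
  define c where "c = sqrt (sqrt 2 ^ ?n)"
  have c: "c * c = sqrt 2 ^ ?n" by (simp add: c_def)
  define f where "f s = of_real (gauss 2 s) * exp (- 2 * pi * \<i> * of_real (\<omega> \<bullet> s))" for s :: 'a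
  have fm: "f \<in> borel_measurable borel"
    unfolding f_def by (intro borel_measurable_continuous_onI continuous_intros)
  have "stft window window (x, \<omega>) = fourier (\<lambda>t. of_real (c * gauss 1 t) * cnj (of_real (c * gauss 1 (t - x)))) \<omega>"
    unfolding window_def c_def by (rule stft_fourier[OF square_integrable_gauss square_integrable_gauss])
  also have "\<dots> = (\<integral>t. of_real (c * c * gauss (1/2) x) * exp (- pi * \<i> * of_real (\<omega> \<bullet> x)) * f (t - (1/2) *\<^sub>R x) \<partial>lborel)"
    unfolding fourier_def
  proof (rule Bochner_Integration.integral_cong[OF refl])
    fix t :: 'a
    have "gauss 1 (t - x) * gauss 1 t = gauss (1/2) x * gauss 2 (t - (1/2) *\<^sub>R x)"
      using gauss_completing_square[of 1 1 x t] by (simp add: gauss_def norm_minus_commute)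
    then have g: "of_real (c * gauss 1 t) * cnj (of_real (c * gauss 1 (t - x)))
      = complex_of_real (c * c * gauss (1/2) x * gauss 2 (t - (1/2) *\<^sub>R x))"
      unfolding complex_cnj_complex_of_real of_real_mult[symmetric] of_real_eq_iff by (simp add: mult_ac)
    have e: "exp (- 2 * pi * \<i> * of_real (\<omega> \<bullet> t)) = exp (- pi * \<i> * of_real (\<omega> \<bullet> x)) * exp (- 2 * pi * \<i> * of_real (\<omega> \<bullet> (t - (1/2) *\<^sub>R x)))"
      by (simp only: exp_add[symmetric], rule arg_cong[of _ _ exp]) (simp add: inner_diff_right algebra_simps)
    show "of_real (c * gauss 1 t) * cnj (of_real (c * gauss 1 (t - x))) * exp (- 2 * pi * \<i> * of_real (\<omega> \<bullet> t))
      = of_real (c * c * gauss (1/2) x) * exp (- pi * \<i> * of_real (\<omega> \<bullet> x)) * f (t - (1/2) *\<^sub>R x)"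
      unfolding g e f_def by (simp only: of_real_mult mult_ac)
  qed
  also have "\<dots> = of_real (c * c * gauss (1/2) x) * exp (- pi * \<i> * of_real (\<omega> \<bullet> x)) * (\<integral>t. f t \<partial>lborel)"
    using integral_minus_shift[OF fm, of "(1/2) *\<^sub>R x"] by simp
  also have "(\<integral>t. f t \<partial>lborel) = of_real (gauss (1/2) \<omega> / sqrt 2 ^ ?n)"
    unfolding f_def using integral_gauss_character[of 2 \<omega>] by simp
  also have "of_real (c * c * gauss (1/2) x) * exp (- pi * \<i> * of_real (\<omega> \<bullet> x)) * complex_of_real (gauss (1/2) \<omega> / sqrt 2 ^ ?n)
    = of_real (gauss (1/2) x * gauss (1/2) \<omega>) * exp (- pi * \<i> * of_real (\<omega> \<bullet> x))"
    unfolding c by simp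
  finally show ?thesis .
qed

text \<open>Without the phase the two Gaussians combine into one on phase space, from which
  integrability, decay and absence of zeros are read off.\<close>

lemma norm_stft_window: "cmod (stft window window z) = gauss (1/2) z"
proof -
  obtain x \<omega> where z: "z = (x, \<omega>)" by (cases z)
  have "gauss (1/2) x * gauss (1/2) \<omega> = gauss (1/2) z"
    unfolding z by (simp add: gauss_def norm_Pair distrib_left flip: exp_add)
  then show ?thesis
    using gauss_pos[of "1/2" z] unfolding z stft_window norm_mult by (simp del: of_real_mult)
qed

lemma norm_window [simp]: "norm (window :: 'a::euclidean_space L2) = 1"
proof -
  have "cinner (window :: 'a L2) window = stft (window :: 'a L2) window 0" by (simp add: stft_def)
  also have "\<dots> = 1" using stft_window[of "0 :: 'a" 0] by (simp add: gauss_def zero_prod_def)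
  finally have "(norm (window :: 'a L2))\<^sup>2 = 1"
    by (metis cinner_norm of_real_eq_1_iff)
  then show ?thesis using norm_ge_zero[of "window :: 'a L2"] by (auto simp: power2_eq_1_iff simp del: norm_ge_zero)
qed

lemma integrable_stft_window: "integrable lborel (stft window window)"
  by (rule Bochner_Integration.integrable_bound[OF integrable_gauss(1)[of "1/2"]]) (auto simp: norm_stft_window)

lemma stft_window_tendsto_0:
  fixes c :: "'a::euclidean_space \<times> 'a"
  shows "((\<lambda>z. stft window window (c - z)) \<longlongrightarrow> 0) at_infinity"
proof -
  have 1: "((\<lambda>z :: 'a \<times> 'a. cmod (stft window window z)) \<longlongrightarrow> 0) at_infinity"
    unfolding norm_stft_window gauss_def
  proof -
    have "((\<lambda>r :: real. exp (- pi * (1/2) * r\<^sup>2)) \<longlongrightarrow> 0) at_top" by real_asymp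
    from filterlim_compose[OF this filterlim_norm_at_top]
    show "((\<lambda>z :: 'a \<times> 'a. exp (- pi * (1/2) * (norm z)\<^sup>2)) \<longlongrightarrow> 0) at_infinity" .
  qed
  have "filterlim (\<lambda>z. c - z) at_infinity at_infinity"
  proof -
    have "filterlim (\<lambda>z. c + (- z)) at_infinity at_infinity"
      by (rule tendsto_add_filterlim_at_infinity[OF tendsto_const])
        (simp add: filterlim_at_infinity_conv_norm_at_top filterlim_norm_at_top)
    then show ?thesis by simp
  qed
  from filterlim_compose[OF 1 this] show ?thesis by (rule tendsto_norm_zero_cancel)
qed

text \<open>Continuity extends the vanishing of the short-time transform from \<open>D\<close> to
  all of phase space, and the transform preserves the norm. A dense set is allowed because
  \<open>compact_operatorI\<close> needs a countable total family.\<close>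

lemma window_total:
  assumes D: "closure D = UNIV" and f: "\<And>z. z \<in> D \<Longrightarrow> cinner f (tf_shift z window) = 0"
  shows "f = 0"
proof -
  have "stft f window z = 0" for z
  proof (rule continuous_constant_on_closure[of D "stft f window" 0])
    show "continuous_on (closure D) (stft f window)" by (intro continuous_intros)
    show "stft f window x = 0" if "x \<in> D" for x using f[OF that] by (simp add: stft_def)
    show "z \<in> closure D" using D by simp
  qed
  then have "(norm f)\<^sup>2 * (norm (window :: 'a L2))\<^sup>2 = 0" using integral_stft_square[of f window] by simp
  then show ?thesis by simp
qed

subsection \<open>Weak convergence and compact operators\<close>

lemma weakly_null_of_total:
  fixes x :: "'i \<Rightarrow> 'a::euclidean_space L2"
  assumes bound: "\<And>z. norm (x z) \<le> K"
    and G: "\<And>g. g \<in> G \<Longrightarrow> ((\<lambda>z. cinner g (x z)) \<longlongrightarrow> 0) F"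
    and total: "\<And>f. (\<And>g. g \<in> G \<Longrightarrow> cinner f g = 0) \<Longrightarrow> f = 0"
  shows "((\<lambda>z. cinner g (x z)) \<longlongrightarrow> 0) F"
proof -
  have "g \<in> {g. ((\<lambda>z. cinner g (x z)) \<longlongrightarrow> 0) F}"
  proof (rule closed_csubspace_total)
    show "closed {g. ((\<lambda>z. cinner g (x z)) \<longlongrightarrow> 0) F}"
    proof (rule closed_tendsto_0_functional)
      show "cmod (cinner f (x z)) \<le> K * norm f" for f z
        using cinner_Cauchy_Schwarz[of f "x z"] mult_left_mono[OF bound[of z] norm_ge_zero[of f]]
        by (simp add: mult.commute)
    qed (rule cinner_diff_left)
    show "f + g \<in> {g. ((\<lambda>z. cinner g (x z)) \<longlongrightarrow> 0) F}"
      if "f \<in> {g. ((\<lambda>z. cinner g (x z)) \<longlongrightarrow> 0) F}" "g \<in> {g. ((\<lambda>z. cinner g (x z)) \<longlongrightarrow> 0) F}" for f g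
      using that by (auto simp: cinner_add_left intro: tendsto_add_zero)
    show "c *\<^sub>C f \<in> {g. ((\<lambda>z. cinner g (x z)) \<longlongrightarrow> 0) F}"
      if "f \<in> {g. ((\<lambda>z. cinner g (x z)) \<longlongrightarrow> 0) F}" for c f
      using that by (auto simp: cinner_scaleC_left intro: tendsto_mult_right_zero)
    show "f = 0" if "\<And>g. g \<in> {g. ((\<lambda>z. cinner g (x z)) \<longlongrightarrow> 0) F} \<Longrightarrow> cinner f g = 0" for f
      using that G by (intro total) auto
  qed simp
  then show ?thesis by simp
qed

text \<open>For two vectors in the orbit of the window the coefficient has the modulus of a
  reflected and translated Gaussian. Totality extends the decay in one argument; exchanging the two
  vectors, which replaces \<open>z\<close> by \<open>- z\<close>, extends it in the other.\<close>

lemma tf_shift_weakly_null: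
  fixes f g :: "'a::euclidean_space L2"
  shows "((\<lambda>z. cinner g (tf_shift z f)) \<longlongrightarrow> 0) at_infinity"
proof -
  let ?W = "range (\<lambda>w. tf_shift w (window :: 'a L2))"
  have total: "f = 0" if "\<And>g. g \<in> ?W \<Longrightarrow> cinner f g = 0" for f
    using that by (intro window_total[of UNIV]) auto
  have ww: "((\<lambda>z. cinner (tf_shift v window) (tf_shift z (tf_shift w window :: 'a L2))) \<longlongrightarrow> 0) at_infinity" for v w
  proof -
    have "cmod (cinner (tf_shift v window) (tf_shift z (tf_shift w window))) = cmod (stft window window ((v - w) - z :: 'a \<times> 'a))" for z
    proof -
      have a: "cmod (cinner (tf_shift p window) (tf_shift q window)) = cmod (stft window window (q - p :: 'a \<times> 'a))" for p q
        by (simp add: cinner_tf_shift_left cinner_scaleC_right norm_mult tf_shift_compose stft_def)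
      have b: "cmod (stft window window (- u :: 'a \<times> 'a)) = cmod (stft window window u)" for u
        by (simp add: norm_stft_window)
      show ?thesis
        using a[of v "z + w"] b[of "v - w - z"]
        by (simp add: tf_shift_compose cinner_scaleC_right norm_mult algebra_simps)
    qed
    then have "((\<lambda>z. cmod (cinner (tf_shift v window) (tf_shift z (tf_shift w window :: 'a L2)))) \<longlongrightarrow> 0) at_infinity"
      using tendsto_norm_zero[OF stft_window_tendsto_0[of "v - w"]] by simp
    then show ?thesis by (rule tendsto_norm_zero_cancel)
  qed
  have gw: "((\<lambda>z. cinner g (tf_shift z (tf_shift w window))) \<longlongrightarrow> 0) at_infinity" for g :: "'a L2" and w
  proof (rule weakly_null_of_total[where G = ?W and K = 1])
    fix g assume "g \<in> ?W"
    then show "((\<lambda>z. cinner g (tf_shift z (tf_shift w window))) \<longlongrightarrow> 0) at_infinity"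
      using ww[of _ w] by blast
  qed (use total in auto)
  have eq: "cmod (cinner g (tf_shift z f)) = cmod (cinner f (tf_shift (- z) g))" for z and f g :: "'a L2"
  proof -
    have "cinner g (tf_shift z f) = cnj (cinner (tf_shift z f) g)" by (rule cinner_commute)
    then show ?thesis by (simp add: cinner_tf_shift_left cinner_scaleC_right norm_mult)
  qed
  have neg: "filterlim uminus at_infinity (at_infinity :: ('a \<times> 'a) filter)"
    by (simp add: filterlim_at_infinity_conv_norm_at_top filterlim_norm_at_top)
  have fg: "((\<lambda>z. cinner f (tf_shift (- z) g)) \<longlongrightarrow> 0) at_infinity"
  proof (rule weakly_null_of_total[where G = ?W and K = "norm g"])
    fix h assume "h \<in> ?W"
    then obtain w where h: "h = tf_shift w window" by auto
    have "((\<lambda>z. cmod (cinner h (tf_shift (- z) g))) \<longlongrightarrow> 0) at_infinity"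
      using tendsto_norm_zero[OF gw[of g w]] by (simp only: eq[of g _ "tf_shift w window"] h)
    then show "((\<lambda>z. cinner h (tf_shift (- z) g)) \<longlongrightarrow> 0) at_infinity" by (rule tendsto_norm_zero_cancel)
  qed (use total in auto)
  have "((\<lambda>z. cmod (cinner g (tf_shift z f))) \<longlongrightarrow> 0) at_infinity"
    using tendsto_norm_zero[OF fg] by (simp only: eq[of g _ f])
  then show ?thesis by (rule tendsto_norm_zero_cancel)
qed

text \<open>The images have a finite \<open>d\<close>-net. Along the filter they become almost
  orthogonal to every point of the net while staying \<open>d\<close>-close to one of them, so they
  are short. The filter is arbitrary to cover sequences as well as
  \<open>at_infinity\<close>.\<close>

lemma compact_operator_weakly_null:
  fixes x :: "'i \<Rightarrow> 'a::euclidean_space L2"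
  assumes K: "compact_operator K" and bound: "\<And>z. norm (x z) \<le> C"
    and weak: "\<And>g. ((\<lambda>z. cinner g (x z)) \<longlongrightarrow> 0) F"
  shows "((\<lambda>z. norm (K (x z))) \<longlongrightarrow> 0) F"
proof -
  have cl: "bounded_clinear K" and comp: "compact (closure (K ` cball 0 1))"
    using K by (auto simp: compact_operator_def)
  define c where "c = \<bar>C\<bar> + 1"
  have c: "c > 0" by (simp add: c_def)
  define y where "y z = complex_of_real (1 / c) *\<^sub>C x z" for z
  have y1: "norm (y z) \<le> 1" for z
    using bound[of z] c by (simp add: y_def norm_divide c_def)
  have "((\<lambda>z. norm (K (y z))) \<longlongrightarrow> 0) F"
  proof (rule tendstoI)
    fix e :: real assume e: "e > 0"
    define d where "d = e / 3"
    have d: "d > 0" using e by (simp add: d_def)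
    then obtain T where T: "finite T" "closure (K ` cball 0 1) \<subseteq> (\<Union>x\<in>T. ball x d)"
      using comp unfolding compact_eq_totally_bounded by blast
    have "\<forall>\<^sub>F z in F. cmod (cinner (K (y z)) t) < d\<^sup>2" for t
    proof -
      have "((\<lambda>z. of_real (1 / c) * cnj (cinner (cadjoint K t) (x z))) \<longlongrightarrow> of_real (1 / c) * cnj 0) F"
        by (intro tendsto_intros weak)
      moreover have "cinner (K (y z)) t = of_real (1 / c) * cnj (cinner (cadjoint K t) (x z))" for z
        using cinner_commute[of "x z" "cadjoint K t"]
        by (simp add: cadjoint(2)[OF cl] y_def cinner_scaleC_left)
      ultimately have "((\<lambda>z. cinner (K (y z)) t) \<longlongrightarrow> 0) F" by simp
      then have "\<forall>\<^sub>F z in F. dist (cinner (K (y z)) t) 0 < d\<^sup>2" by (rule tendstoD) (use d in simp)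
      then show ?thesis by simp
    qed
    then have "\<forall>\<^sub>F z in F. \<forall>t\<in>T. cmod (cinner (K (y z)) t) < d\<^sup>2"
      using T(1) by (simp add: eventually_ball_finite)
    then show "\<forall>\<^sub>F z in F. dist (norm (K (y z))) 0 < e"
    proof eventually_elim
      fix z assume *: "\<forall>t\<in>T. cmod (cinner (K (y z)) t) < d\<^sup>2"
      have "K (y z) \<in> closure (K ` cball 0 1)" using y1[of z] closure_subset by fastforce
      then obtain t where t: "t \<in> T" "norm (K (y z) - t) < d" using T(2) by (auto simp: dist_norm norm_minus_commute)
      define n where "n = norm (K (y z))"
      have "n\<^sup>2 = cmod (cinner (K (y z)) (K (y z)))" by (simp add: cinner_norm norm_power n_def)
      also have "cinner (K (y z)) (K (y z)) = cinner (K (y z)) t + cinner (K (y z)) (K (y z) - t)"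
        by (simp add: cinner_diff_right)
      also have "cmod \<dots> \<le> d\<^sup>2 + n * d"
      proof (rule norm_triangle_mono)
        show "cmod (cinner (K (y z)) t) \<le> d\<^sup>2" using * t(1) by force
        have "cmod (cinner (K (y z)) (K (y z) - t)) \<le> n * norm (K (y z) - t)"
          unfolding n_def by (rule cinner_Cauchy_Schwarz)
        also have "\<dots> \<le> n * d" using t(2) by (intro mult_left_mono) (auto simp: n_def)
        finally show "cmod (cinner (K (y z)) (K (y z) - t)) \<le> n * d" .
      qed
      finally have q: "n\<^sup>2 \<le> d\<^sup>2 + n * d" .
      \<comment> \<open>Otherwise \<open>n^2 - n d - d^2 = (n - 2 d) (n + d) + d^2\<close> would be
        positive.\<close>
      have "n \<le> 2 * d"
      proof (rule ccontr)
        assume "\<not> n \<le> 2 * d"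
        then have "0 < (n - 2 * d) * (n + d) + d * d" using d by (intro add_pos_pos mult_pos_pos) auto
        then show False using q by (simp add: power2_eq_square algebra_simps)
      qed
      then show "dist (norm (K (y z))) 0 < e" using d by (simp add: n_def d_def)
    qed
  qed
  then have "((\<lambda>z. c * norm (K (y z))) \<longlongrightarrow> 0) F" by (rule tendsto_mult_right_zero)
  moreover have "c * norm (K (y z)) = norm (K (x z))" for z
    using c by (simp add: y_def bounded_clinearD[OF cl] norm_divide)
  ultimately show ?thesis by simp
qed

text \<open>A diagonal subsequence converges against a countable total part of the window orbit, so
  its differences are weakly null and the images under \<open>K\<close> are Cauchy. The bound 2 is
  that of a difference of two vectors of the unit ball.\<close>

lemma compact_operatorI:
  fixes K :: "'a::euclidean_space L2 \<Rightarrow> 'a L2"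
  assumes cl: "bounded_clinear K"
    and null: "\<And>x :: nat \<Rightarrow> 'a L2. (\<And>n. norm (x n) \<le> 2) \<Longrightarrow> (\<And>g. (\<lambda>n. cinner g (x n)) \<longlonglongrightarrow> 0) \<Longrightarrow>
      (\<lambda>n. norm (K (x n))) \<longlonglongrightarrow> 0"
  shows "compact_operator K"
proof -
  obtain D :: "('a \<times> 'a) set" where D: "countable D" "\<forall>X. open X \<longrightarrow> X \<noteq> {} \<longrightarrow> (\<exists>d\<in>D. d \<in> X)"
    using countable_dense_exists by blast
  have "closure D = UNIV"
  proof (rule ccontr)
    assume "closure D \<noteq> UNIV"
    then obtain d where "d \<in> D" "d \<in> - closure D" using spec[OF D(2), of "- closure D"] by auto
    then show False using closure_subset by blast
  qed
  let ?W = "(\<lambda>w. tf_shift w (window :: 'a L2)) ` D"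
  have total: "f = 0" if "\<And>g. g \<in> ?W \<Longrightarrow> cinner f g = 0" for f
    using that by (intro window_total[OF \<open>closure D = UNIV\<close>]) auto
  have sub: "\<exists>l r. strict_mono r \<and> (\<lambda>n. K (x (r n))) \<longlonglongrightarrow> l" if x: "\<And>n. norm (x n) \<le> 1" for x :: "nat \<Rightarrow> 'a L2"
  proof -
    have "norm (cinner g (x n)) \<le> 1" if "g \<in> ?W" for n g
      using that cinner_Cauchy_Schwarz[of g "x n"] x[of n] by auto
    from function_convergent_subsequence[of ?W "\<lambda>n g. cinner g (x n)", OF _ this] D(1)
    obtain r where r: "strict_mono r" "\<And>g. g \<in> ?W \<Longrightarrow> \<exists>l. (\<lambda>n. cinner g (x (r n))) \<longlonglongrightarrow> l" by auto
    \<comment> \<open>Differences are indexed by pairs along a product filter, so that any failure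
      of the Cauchy property can be read as one weakly null sequence.\<close>
    have weak: "((\<lambda>p. cinner g (x (r (fst p)) - x (r (snd p)))) \<longlongrightarrow> 0) (sequentially \<times>\<^sub>F sequentially)" for g
    proof (rule weakly_null_of_total[where G = ?W and K = 2])
      show "norm (x (r (fst p)) - x (r (snd p))) \<le> 2" for p
        using norm_triangle_ineq4[of "x (r (fst p))" "x (r (snd p))"] x[of "r (fst p)"] x[of "r (snd p)"] by linarith
      fix g assume "g \<in> ?W"
      then obtain l where l: "(\<lambda>n. cinner g (x (r n))) \<longlonglongrightarrow> l" using r(2) by blast
      have "((\<lambda>p. cinner g (x (r (fst p))) - cinner g (x (r (snd p)))) \<longlongrightarrow> l - l) (sequentially \<times>\<^sub>F sequentially)"
        by (intro tendsto_diff filterlim_compose[OF l] filterlim_fst filterlim_snd)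
      then show "((\<lambda>p. cinner g (x (r (fst p)) - x (r (snd p)))) \<longlongrightarrow> 0) (sequentially \<times>\<^sub>F sequentially)"
        by (simp add: cinner_diff_right)
    qed (use total in auto)
    have "Cauchy (\<lambda>n. K (x (r n)))"
    proof (rule ccontr)
      assume "\<not> Cauchy (\<lambda>n. K (x (r n)))"
      then obtain e where e: "e > 0" and "\<forall>M. \<exists>m\<ge>M. \<exists>n\<ge>M. \<not> dist (K (x (r m))) (K (x (r n))) < e"
        unfolding Cauchy_def by blast
      then obtain m n where mn: "\<And>M. m M \<ge> M" "\<And>M. n M \<ge> M" "\<And>M. \<not> dist (K (x (r (m M)))) (K (x (r (n M)))) < e"
        by metis
      have fm: "filterlim m sequentially sequentially" "filterlim n sequentially sequentially"
        using mn(1,2) by (auto intro: filterlim_at_top_mono[OF filterlim_ident])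
      then have fp: "filterlim (\<lambda>M. (m M, n M)) (sequentially \<times>\<^sub>F sequentially) sequentially"
        by (rule filterlim_Pair)
      have "(\<lambda>M. norm (K (x (r (m M)) - x (r (n M))))) \<longlonglongrightarrow> 0"
      proof (rule null)
        show "norm (x (r (m M)) - x (r (n M))) \<le> 2" for M
          using norm_triangle_ineq4[of "x (r (m M))" "x (r (n M))"] x[of "r (m M)"] x[of "r (n M)"] by linarith
        show "(\<lambda>M. cinner g (x (r (m M)) - x (r (n M)))) \<longlonglongrightarrow> 0" for g
          using filterlim_compose[OF weak fp] by simp
      qed
      then have "\<forall>\<^sub>F M in sequentially. norm (K (x (r (m M)) - x (r (n M)))) < e"
        by (rule order_tendstoD(2)) (rule e)
      then obtain M where "norm (K (x (r (m M)) - x (r (n M)))) < e" by (auto simp: eventually_sequentially)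
      then show False using mn(3)[of M] by (simp add: dist_norm bounded_clinearD[OF cl])
    qed
    then show ?thesis using r(1) by (auto simp: Cauchy_convergent_iff convergent_def)
  qed
  have "seq_compact (closure (K ` cball 0 1))"
    unfolding seq_compact_def
  proof (intro allI impI)
    fix Y :: "nat \<Rightarrow> 'a L2" assume Y: "\<forall>n. Y n \<in> closure (K ` cball 0 1)"
    have "\<exists>v. norm v \<le> 1 \<and> dist (K v) (Y n) < inverse (real (Suc n))" for n
      using Y closure_approachableD[of "Y n" "K ` cball 0 1" "inverse (real (Suc n))"]
      by (force simp: dist_commute)
    then obtain x where x: "\<And>n. norm (x n) \<le> 1" "\<And>n. dist (K (x n)) (Y n) < inverse (real (Suc n))" by metis
    obtain l r where r: "strict_mono r" "(\<lambda>n. K (x (r n))) \<longlonglongrightarrow> l" using sub[of x, OF x(1)] by blast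
    have "(\<lambda>n. dist (K (x n)) (Y n)) \<longlonglongrightarrow> 0"
      by (rule tendsto_sandwich[OF _ always_eventually[OF allI[OF less_imp_le[OF x(2)]]]
            tendsto_const LIMSEQ_inverse_real_of_nat]) simp
    then have "(\<lambda>n. dist (K (x (r n))) (Y (r n))) \<longlonglongrightarrow> 0"
      using LIMSEQ_subseq_LIMSEQ[OF _ r(1)] by (simp add: o_def)
    then have "(\<lambda>n. K (x (r n)) - Y (r n)) \<longlonglongrightarrow> 0"
      unfolding dist_norm by (rule tendsto_norm_zero_cancel)
    from tendsto_diff[OF r(2) this] have "(\<lambda>n. Y (r n)) \<longlonglongrightarrow> l" by simp
    moreover from this have "l \<in> closure (K ` cball 0 1)"
      using closed_sequentially[OF closed_closure, of "\<lambda>n. Y (r n)" "K ` cball 0 1" l] Y by blast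
    ultimately show "\<exists>l\<in>closure (K ` cball 0 1). \<exists>r. strict_mono r \<and> (Y \<circ> r) \<longlonglongrightarrow> l"
      using r(1) by (auto simp: o_def)
  qed
  then show ?thesis
    using cl by (simp add: compact_operator_def compact_eq_seq_compact_metric)
qed

subsection \<open>Convolutions in terms of matrix coefficients\<close>

text \<open>The matrix coefficient of \<open>alpha (- z) R\<close>, written without the adjoint in
  \<open>alpha\<close>; both kinds of convolution are sums or integrals of such functions.\<close>

definition orbit_form :: "('a::euclidean_space L2 \<Rightarrow> 'a L2) \<Rightarrow> 'a L2 \<Rightarrow> 'a L2 \<Rightarrow> 'a \<times> 'a \<Rightarrow> complex" where
  "orbit_form R f g z = cinner (R (tf_shift z f)) (tf_shift z g)"

lemma norm_le_of_cinner_le: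
  fixes X :: "'a::euclidean_space L2"
  assumes "\<And>Y. cmod (cinner X Y) \<le> B * norm Y" "B \<ge> 0"
  shows "norm X \<le> B"
proof (cases "X = 0")
  case False
  have "norm X * norm X = cmod (cinner X X)" by (simp add: cinner_norm norm_power power2_eq_square norm_mult)
  also have "\<dots> \<le> B * norm X" by (rule assms)
  finally show ?thesis using False by simp
qed (use assms in simp)

locale bounded_operator =
  fixes R :: "'a::euclidean_space L2 \<Rightarrow> 'a L2"
  assumes R: "bounded_clinear R"
begin

lemma norm_R: "norm (R f) \<le> onorm R * norm f"
  by (rule bounded_clinearD[OF R])

lemma onorm_R: "0 \<le> onorm R"
  by (rule onorm_pos_le[OF bounded_clinearD(5)[OF R]])

lemma continuous_on_R [continuous_intros]: "continuous_on S h \<Longrightarrow> continuous_on S (\<lambda>z. R (h z))"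
  by (rule bounded_linear.continuous_on[OF bounded_clinearD(5)[OF R]])

lemma continuous_on_orbit_form [continuous_intros]:
  "continuous_on S h \<Longrightarrow> continuous_on S (\<lambda>z. orbit_form R f g (h z))"
  unfolding orbit_form_def by (intro continuous_intros)

lemma borel_measurable_orbit_form [measurable]: "orbit_form R f g \<in> borel_measurable borel"
  by (intro borel_measurable_continuous_onI continuous_intros)

lemma norm_orbit_form_le: "cmod (orbit_form R f g z) \<le> onorm R * norm f * norm g"
proof -
  have "cmod (orbit_form R f g z) \<le> norm (R (tf_shift z f)) * norm (tf_shift z g)"
    unfolding orbit_form_def by (rule cinner_Cauchy_Schwarz)
  also have "\<dots> \<le> (onorm R * norm (tf_shift z f)) * norm (tf_shift z g)"
    by (intro mult_right_mono norm_R) simp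
  finally show ?thesis by simp
qed

lemma orbit_form_bilinear:
  "orbit_form R (f + f') g z = orbit_form R f g z + orbit_form R f' g z"
  "orbit_form R f (g + g') z = orbit_form R f g z + orbit_form R f g' z"
  "orbit_form R (f - f') g z = orbit_form R f g z - orbit_form R f' g z"
  "orbit_form R f (g - g') z = orbit_form R f g z - orbit_form R f g' z"
  "orbit_form R (c *\<^sub>C f) g z = c * orbit_form R f g z"
  "orbit_form R f (c *\<^sub>C g) z = cnj c * orbit_form R f g z"
  by (simp_all add: orbit_form_def tf_shift_simps bounded_clinearD[OF R] cinner_add_left cinner_add_right
      cinner_diff_left cinner_diff_right cinner_scaleC_left cinner_scaleC_right)

text \<open>The phases of the two time-frequency shifts cancel.\<close>

lemma orbit_form_tf_shift: "orbit_form R (tf_shift w f) (tf_shift w g) z = orbit_form R f g (z + w)"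
proof -
  define c where "c = exp (- 2 * pi * \<i> * of_real (snd w \<bullet> fst z))"
  have "c * cnj c = 1" using complex_norm_square[of c] by (simp add: c_def)
  then have "cnj c * c = 1" by (simp only: mult.commute)
  then show ?thesis
    unfolding orbit_form_def tf_shift_compose c_def[symmetric]
    by (simp add: bounded_clinearD[OF R] cinner_scaleC_left cinner_scaleC_right flip: mult.assoc)
qed

text \<open>The adjoint of \<open>tf_shift z\<close> is, up to a phase that cancels, the shift by
  \<open>- z\<close>. This is the source of the reversed argument in the weak integrals
  below.\<close>

lemma cinner_alpha: "cinner (alpha z R f) g = orbit_form R f g (- z)"
proof -
  define c where "c = exp (- 2 * pi * \<i> * of_real (snd z \<bullet> fst z))"
  have "c * cnj c = 1" using complex_norm_square[of c] by (simp add: c_def)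
  then have cc: "cnj c * c = 1" by (simp only: mult.commute)
  have "cinner (alpha z R f) g = cinner (R (c *\<^sub>C tf_shift (- z) f)) (c *\<^sub>C tf_shift (- z) g)"
    unfolding alpha_def o_def cadjoint_tf_shift cinner_tf_shift_left c_def ..
  then show ?thesis
    using cc by (simp add: orbit_form_def bounded_clinearD[OF R] cinner_scaleC_left cinner_scaleC_right flip: mult.assoc)
qed

text \<open>For a rank one operator the trace in the convolution is a single matrix coefficient of
  \<open>R\<close>; conjugation with the parity moves onto both vectors.\<close>

lemma conv_op_op_sums:
  assumes T: "nuclear_rep T u v"
  shows "(\<lambda>n. orbit_form R (parity (u n)) (parity (v n)) z) sums conv_op_op R T z"
proof -
  have "nuclear_rep ((R \<circ> tf_shift z \<circ> parity) \<circ> T \<circ> (parity \<circ> cadjoint (tf_shift z)))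
    (\<lambda>n. (R \<circ> tf_shift z \<circ> parity) (u n)) (\<lambda>n. (tf_shift z \<circ> parity) (v n))"
  proof (rule nuclear_rep_compose[OF T, where C = 1])
    show "bounded_clinear (R \<circ> tf_shift z \<circ> parity)"
      by (intro bounded_clinear_compose R tf_shift_bounded_clinear parity_bounded_clinear)
    show "cinner ((parity \<circ> cadjoint (tf_shift z)) f) g = cinner f ((tf_shift z \<circ> parity) g)" for f g
      using cadjoint(2)[OF tf_shift_bounded_clinear, of z "parity g" f]
        cinner_commute[of "cadjoint (tf_shift z) f" "parity g"] cinner_commute[of f "tf_shift z (parity g)"]
      by (simp add: cinner_parity)
  qed simp
  from op_trace_nuclear[OF this] show ?thesis
    by (simp add: conv_op_op_def alpha_def orbit_form_def comp_assoc)
qed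

lemma integrable_orbit_form:
  assumes "integrable lborel a"
  shows "integrable lborel (\<lambda>z. a z * orbit_form R f g (- z))"
proof (rule Bochner_Integration.integrable_bound)
  show "(\<lambda>z. a z * orbit_form R f g (- z)) \<in> borel_measurable lborel"
    using borel_measurable_integrable[OF assms] by (rule borel_measurable_times) simp
  show "integrable lborel (\<lambda>z. (onorm R * norm f * norm g) * cmod (a z))"
    by (intro integrable_mult_right integrable_norm assms)
  have "norm (a z * orbit_form R f g (- z)) \<le> norm ((onorm R * norm f * norm g) * cmod (a z))" for z
    using mult_left_mono[OF norm_orbit_form_le[of f g "- z"] norm_ge_zero[of "a z"]] onorm_R
    by (simp add: norm_mult mult_ac)
  then show "AE z in lborel. norm (a z * orbit_form R f g (- z)) \<le> norm ((onorm R * norm f * norm g) * cmod (a z))"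
    by simp
qed

text \<open>Shows that the definite description is met: the weak integral is a bounded form, hence
  given by an operator, and an operator is determined by its form.\<close>

lemma conv_op_fun:
  assumes a: "integrable lborel a"
  shows "bounded_clinear (conv_op_fun R a)"
    and "cinner (conv_op_fun R a f) g = (\<integral>z. a z * orbit_form R f g (- z) \<partial>lborel)"
proof -
  let ?B = "\<lambda>f g. \<integral>z. a z * orbit_form R f g (- z) \<partial>lborel"
  let ?P = "\<lambda>T. bounded_clinear T \<and> (\<forall>f g. cinner (T f) g = (\<integral>z. a z * cinner (alpha z R f) g \<partial>lborel))"
  have "\<exists>T. bounded_clinear T \<and> (\<forall>f g. cinner (T f) g = ?B f g)"
  proof (rule sesquilinear_operator)
    show "cmod (?B f g) \<le> ((\<integral>z. cmod (a z) \<partial>lborel) * onorm R) * norm f * norm g" for f g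
    proof -
      have "cmod (?B f g) \<le> (\<integral>z. cmod (a z * orbit_form R f g (- z)) \<partial>lborel)" by (rule integral_norm_bound)
      also have "\<dots> \<le> (\<integral>z. cmod (a z) * (onorm R * norm f * norm g) \<partial>lborel)"
        by (intro integral_mono integrable_norm integrable_orbit_form a integrable_mult_left)
          (simp add: norm_mult mult_left_mono norm_orbit_form_le)
      finally show ?thesis by (simp add: mult_ac)
    qed
  qed (simp_all add: orbit_form_bilinear integrable_orbit_form[OF a] distrib_left mult.left_commute)
  then obtain T where T: "?P T" unfolding cinner_alpha by blast
  have "conv_op_fun R a = T"
    unfolding conv_op_fun_def
  proof (rule the_equality)
    show "?P T" by (rule T)
    show "T' = T" if "?P T'" for T' using that T by (intro ext L2_eqI) simp
  qed
  with T show "bounded_clinear (conv_op_fun R a)" "cinner (conv_op_fun R a f) g = ?B f g"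
    by (simp_all add: cinner_alpha)
qed

lemma conv_op_fun_linear:
  assumes a: "integrable lborel a" and b: "integrable lborel b"
  shows "conv_op_fun R (\<lambda>z. a z + b z) f = conv_op_fun R a f + conv_op_fun R b f"
    and "conv_op_fun R (\<lambda>z. a z - b z) f = conv_op_fun R a f - conv_op_fun R b f"
    and "conv_op_fun R (\<lambda>z. c * a z) f = c *\<^sub>C conv_op_fun R a f"
    and "conv_op_fun R (\<lambda>z. 0) f = 0"
  using a b
  by (auto intro!: L2_eqI simp: conv_op_fun cinner_add_left cinner_diff_left cinner_scaleC_left
      distrib_right left_diff_distrib integrable_orbit_form mult.assoc)

lemma norm_conv_op_fun_le:
  assumes a: "integrable lborel a"
  shows "norm (conv_op_fun R a f) \<le> (\<integral>z. cmod (a z) \<partial>lborel) * onorm R * norm f"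
proof (rule norm_le_of_cinner_le)
  fix g
  have "cmod (cinner (conv_op_fun R a f) g) \<le> (\<integral>z. cmod (a z * orbit_form R f g (- z)) \<partial>lborel)"
    unfolding conv_op_fun(2)[OF a] by (rule integral_norm_bound)
  also have "\<dots> \<le> (\<integral>z. cmod (a z) * (onorm R * norm f * norm g) \<partial>lborel)"
    by (intro integral_mono integrable_norm integrable_orbit_form a integrable_mult_left)
      (simp add: norm_mult mult_left_mono norm_orbit_form_le)
  finally show "cmod (cinner (conv_op_fun R a f) g) \<le> (\<integral>z. cmod (a z) \<partial>lborel) * onorm R * norm f * norm g"
    by (simp add: mult_ac)
qed (simp add: onorm_R)

text \<open>By Fubini and covariance, convolution with \<open>conv a b\<close> averages translates
  of \<open>conv_op_fun R a\<close> with weight \<open>b\<close>. The estimate is kept for the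
  individual vector \<open>f\<close>, so that dominated convergence over \<open>w\<close> can be
  used on sequences.\<close>

lemma norm_conv_op_fun_conv_le:
  assumes a: "integrable lborel a" and b: "integrable lborel b"
  shows "norm (conv_op_fun R (conv a b) f) \<le> (\<integral>w. cmod (b w) * norm (conv_op_fun R a (tf_shift (- w) f)) \<partial>lborel)"
proof (rule norm_le_of_cinner_le)
  let ?M = "conv_op_fun R a"
  have [measurable]: "a \<in> borel_measurable borel" "b \<in> borel_measurable borel" using a b by auto
  have contM: "continuous_on S h \<Longrightarrow> continuous_on S (\<lambda>w. ?M (h w))" for S :: "('a \<times> 'a) set" and h
    by (rule bounded_linear.continuous_on[OF bounded_clinearD(5)[OF conv_op_fun(1)[OF a]]])
  have mM: "(\<lambda>w. norm (?M (tf_shift (- w) f))) \<in> borel_measurable borel"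
    by (intro borel_measurable_continuous_onI continuous_intros contM)
  show "0 \<le> (\<integral>w. cmod (b w) * norm (?M (tf_shift (- w) f)) \<partial>lborel)" by simp
  have ibM: "integrable lborel (\<lambda>w. cmod (b w) * norm (?M (tf_shift (- w) f)))"
  proof (rule integrable_nonneg_bound)
    show "integrable lborel (\<lambda>w. cmod (b w) * ((\<integral>z. cmod (a z) \<partial>lborel) * onorm R * norm f))"
      by (intro integrable_mult_left integrable_norm b)
    show "cmod (b w) * norm (?M (tf_shift (- w) f)) \<le> cmod (b w) * ((\<integral>z. cmod (a z) \<partial>lborel) * onorm R * norm f)" for w
      using norm_conv_op_fun_le[OF a, of "tf_shift (- w) f"] by (intro mult_left_mono) simp_all
    show "(\<lambda>w. cmod (b w) * norm (?M (tf_shift (- w) f))) \<in> borel_measurable lborel"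
    proof -
      have "(\<lambda>w. cmod (b w)) \<in> borel_measurable borel" by measurable
      from borel_measurable_times[OF this mM] show ?thesis by simp
    qed
  qed simp
  fix g
  define F where "F w z = a (z - w) * b w * orbit_form R f g (- z)" for w z
  have m: "(\<lambda>(w, z). F w z) \<in> borel_measurable (borel \<Otimes>\<^sub>M borel)" unfolding F_def by measurable
  let ?C = "onorm R * norm f * norm g"
  have ia: "integrable lborel (\<lambda>z. cmod (a (z - w)) * ?C)" for w
    by (intro integrable_mult_left integrable_norm integrable_minus_shift a)
  have sh: "(\<integral>z. cmod (a (z - w)) \<partial>lborel) = (\<integral>z. cmod (a z) \<partial>lborel)" for w
    by (rule integral_minus_shift[of "\<lambda>z. cmod (a z)"]) measurable
  have ib: "integrable lborel (\<lambda>w. (\<integral>z. cmod (a (z - w)) * ?C \<partial>lborel) * cmod (b w))"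
    using b by (simp add: sh)
  have F_le: "cmod (F w z) \<le> cmod (a (z - w)) * ?C * cmod (b w)" for w z
  proof -
    have "cmod (F w z) = cmod (a (z - w)) * cmod (b w) * cmod (orbit_form R f g (- z))"
      by (simp add: F_def norm_mult)
    also have "\<dots> \<le> cmod (a (z - w)) * cmod (b w) * ?C"
      by (intro mult_left_mono norm_orbit_form_le) simp
    finally show ?thesis by (simp add: mult_ac)
  qed
  have "cinner (conv_op_fun R (conv a b) f) g = (\<integral>z. (\<integral>w. F w z \<partial>lborel) \<partial>lborel)"
    unfolding conv_op_fun(2)[OF integrable_conv[OF a b]] conv_def F_def by simp
  also have "\<dots> = (\<integral>w. (\<integral>z. F w z \<partial>lborel) \<partial>lborel)"
    by (rule conv_dominated(4)[OF m ia F_le _ ib]) measurable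
  also have "\<dots> = (\<integral>w. b w * cinner (?M (tf_shift (- w) f)) (tf_shift (- w) g) \<partial>lborel)"
  proof (rule Bochner_Integration.integral_cong[OF refl])
    fix w
    have "(\<integral>z. F w z \<partial>lborel) = b w * (\<integral>z. a (z - w) * orbit_form R f g (- z) \<partial>lborel)"
      unfolding F_def integral_mult_right_zero[symmetric]
      by (rule Bochner_Integration.integral_cong) (simp_all add: mult_ac)
    also have "(\<integral>z. a (z - w) * orbit_form R f g (- z) \<partial>lborel) = (\<integral>z. a z * orbit_form R f g (- (z + w)) \<partial>lborel)"
      using integral_minus_shift[of "\<lambda>z. a z * orbit_form R f g (- (z + w))" w] by simp
    also have "\<dots> = cinner (?M (tf_shift (- w) f)) (tf_shift (- w) g)"
      unfolding conv_op_fun(2)[OF a] orbit_form_tf_shift by (simp add: algebra_simps)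
    finally show "(\<integral>z. F w z \<partial>lborel) = b w * cinner (?M (tf_shift (- w) f)) (tf_shift (- w) g)" .
  qed
  finally have "cmod (cinner (conv_op_fun R (conv a b) f) g) \<le> (\<integral>w. cmod (b w * cinner (?M (tf_shift (- w) f)) (tf_shift (- w) g)) \<partial>lborel)"
    using integral_norm_bound by simp
  also have "\<dots> \<le> (\<integral>w. cmod (b w) * norm (?M (tf_shift (- w) f)) * norm g \<partial>lborel)"
  proof (rule integral_mono')
    show "integrable lborel (\<lambda>w. cmod (b w) * norm (?M (tf_shift (- w) f)) * norm g)"
      by (intro integrable_mult_left ibM)
    show "cmod (b w * cinner (?M (tf_shift (- w) f)) (tf_shift (- w) g)) \<le> cmod (b w) * norm (?M (tf_shift (- w) f)) * norm g" for w
      using mult_left_mono[OF cinner_Cauchy_Schwarz[of "?M (tf_shift (- w) f)" "tf_shift (- w) g"] norm_ge_zero[of "b w"]]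
      by (simp add: norm_mult mult.assoc)
  qed simp
  finally show "cmod (cinner (conv_op_fun R (conv a b) f) g)
    \<le> (\<integral>w. cmod (b w) * norm (?M (tf_shift (- w) f)) \<partial>lborel) * norm g" by simp
qed

text \<open>All axioms are checked on weakly null sequences. For closedness, the L1 norm controls
  the operator norm; for convolution, a shifted weakly null sequence is weakly null again, so the
  integrand of \<open>norm_conv_op_fun_conv_le\<close> tends to 0 pointwise.\<close>

lemma closed_L1_ideal_compact:
  "closed_L1_ideal (\<lambda>a. integrable lborel a \<and> compact_operator (conv_op_fun R a))"
proof
  let ?M = "conv_op_fun R"
  show "integrable lborel a" if "integrable lborel a \<and> compact_operator (?M a)" for a using that by simp
  show "integrable lborel (\<lambda>_ :: 'a \<times> 'a. 0 :: complex) \<and> compact_operator (?M (\<lambda>_. 0))"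
    using conv_op_fun(1)[of "\<lambda>_. 0"] conv_op_fun_linear(4)[of "\<lambda>_. 0" "\<lambda>_. 0"]
    by (auto intro!: compact_operatorI)
  show "integrable lborel (\<lambda>z. a z + b z) \<and> compact_operator (?M (\<lambda>z. a z + b z))"
    if a: "integrable lborel a \<and> compact_operator (?M a)" and b: "integrable lborel b \<and> compact_operator (?M b)" for a b
  proof
    show i: "integrable lborel (\<lambda>z. a z + b z)" using a b by simp
    show "compact_operator (?M (\<lambda>z. a z + b z))"
    proof (rule compact_operatorI[OF conv_op_fun(1)[OF i]])
      fix x :: "nat \<Rightarrow> 'a L2" assume x: "\<And>n. norm (x n) \<le> 2" "\<And>g. (\<lambda>n. cinner g (x n)) \<longlonglongrightarrow> 0"
      have "(\<lambda>n. norm (?M a (x n)) + norm (?M b (x n))) \<longlonglongrightarrow> 0"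
        using a b x by (intro tendsto_add_zero compact_operator_weakly_null[where C = 2]) auto
      moreover have "norm (?M (\<lambda>z. a z + b z) f) \<le> norm (?M a f) + norm (?M b f)" for f
        using a b by (simp add: conv_op_fun_linear(1) norm_triangle_ineq)
      ultimately show "(\<lambda>n. norm (?M (\<lambda>z. a z + b z) (x n))) \<longlonglongrightarrow> 0"
        using Lim_null_comparison[of "\<lambda>n. norm (?M (\<lambda>z. a z + b z) (x n))"
          "\<lambda>n. norm (?M a (x n)) + norm (?M b (x n))" sequentially] by simp
    qed
  qed
  show "integrable lborel (\<lambda>z. c * a z) \<and> compact_operator (?M (\<lambda>z. c * a z))"
    if a: "integrable lborel a \<and> compact_operator (?M a)" for a c
  proof
    show i: "integrable lborel (\<lambda>z. c * a z)" using a by simp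
    show "compact_operator (?M (\<lambda>z. c * a z))"
    proof (rule compact_operatorI[OF conv_op_fun(1)[OF i]])
      fix x :: "nat \<Rightarrow> 'a L2" assume x: "\<And>n. norm (x n) \<le> 2" "\<And>g. (\<lambda>n. cinner g (x n)) \<longlonglongrightarrow> 0"
      have "(\<lambda>n. cmod c * norm (?M a (x n))) \<longlonglongrightarrow> 0"
        using a x by (intro tendsto_mult_right_zero compact_operator_weakly_null[where C = 2]) auto
      then show "(\<lambda>n. norm (?M (\<lambda>z. c * a z) (x n))) \<longlonglongrightarrow> 0"
        using a conv_op_fun_linear(3)[of a a c] by simp
    qed
  qed
  show "integrable lborel a \<and> compact_operator (?M a)"
    if a: "integrable lborel a" and
      ex: "\<And>e. e > 0 \<Longrightarrow> \<exists>b. (integrable lborel b \<and> compact_operator (?M b)) \<and> (\<integral>z. cmod (a z - b z) \<partial>lborel) < e" for a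
  proof
    show "compact_operator (?M a)"
    proof (rule compact_operatorI[OF conv_op_fun(1)[OF a]])
      fix x :: "nat \<Rightarrow> 'a L2" assume x: "\<And>n. norm (x n) \<le> 2" "\<And>g. (\<lambda>n. cinner g (x n)) \<longlonglongrightarrow> 0"
      show "(\<lambda>n. norm (?M a (x n))) \<longlonglongrightarrow> 0"
      proof (rule tendstoI)
        fix e :: real assume e: "e > 0"
        \<comment> \<open>Makes the approximation error at most \<open>e / 2\<close> on vectors of
          norm at most 2; the added 1 covers \<open>onorm R = 0\<close>.\<close>
        define d where "d = e / (4 * (onorm R + 1))"
        have d: "d > 0" using e onorm_R by (simp add: d_def)
        obtain b where b: "integrable lborel b" "compact_operator (?M b)" "(\<integral>z. cmod (a z - b z) \<partial>lborel) < d"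
          using ex[OF d] by blast
        have "(\<lambda>n. norm (?M b (x n))) \<longlonglongrightarrow> 0"
          using b x by (intro compact_operator_weakly_null[where C = 2]) auto
        then have "\<forall>\<^sub>F n in sequentially. norm (?M b (x n)) < e / 2" by (rule order_tendstoD(2)) (use e in simp)
        then show "\<forall>\<^sub>F n in sequentially. dist (norm (?M a (x n))) 0 < e"
        proof eventually_elim
          fix n assume n: "norm (?M b (x n)) < e / 2"
          have "norm (?M a (x n) - ?M b (x n)) \<le> (\<integral>z. cmod (a z - b z) \<partial>lborel) * onorm R * norm (x n)"
            using norm_conv_op_fun_le[of "\<lambda>z. a z - b z" "x n"] a b by (simp add: conv_op_fun_linear(2))
          also have "\<dots> \<le> d * (onorm R + 1) * 2"
            using b(3) x(1)[of n] onorm_R d by (intro mult_mono) auto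
          also have "\<dots> = e / 2" using onorm_R by (simp add: d_def field_simps)
          finally have "norm (?M a (x n) - ?M b (x n)) \<le> e / 2" .
          then have "norm (?M a (x n)) < e"
            using n norm_triangle_ineq[of "?M a (x n) - ?M b (x n)" "?M b (x n)"] by simp
          then show "dist (norm (?M a (x n))) 0 < e" by simp
        qed
      qed
    qed
  qed (rule a)
  show "integrable lborel (conv a b) \<and> compact_operator (?M (conv a b))"
    if a: "integrable lborel a \<and> compact_operator (?M a)" and b: "integrable lborel b" for a b
  proof
    show i: "integrable lborel (conv a b)" using a b by (intro integrable_conv) auto
    have [measurable]: "b \<in> borel_measurable borel" using b by auto
    show "compact_operator (?M (conv a b))"
    proof (rule compact_operatorI[OF conv_op_fun(1)[OF i]])
      fix x :: "nat \<Rightarrow> 'a L2" assume x: "\<And>n. norm (x n) \<le> 2" "\<And>g. (\<lambda>n. cinner g (x n)) \<longlonglongrightarrow> 0"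
      have contM: "continuous_on S h \<Longrightarrow> continuous_on S (\<lambda>w. ?M a (h w))" for S :: "('a \<times> 'a) set" and h
        using a by (intro bounded_linear.continuous_on[OF bounded_clinearD(5)[OF conv_op_fun(1)]]) auto
      have meas: "(\<lambda>w. norm (?M a (tf_shift (- w) (x n)))) \<in> borel_measurable borel" for n
        by (intro borel_measurable_continuous_onI continuous_intros contM)
      define A where "A = (\<integral>z. cmod (a z) \<partial>lborel) * onorm R * 2"
      have "(\<lambda>n. \<integral>w. cmod (b w) * norm (?M a (tf_shift (- w) (x n))) \<partial>lborel) \<longlonglongrightarrow> (\<integral>w. 0 \<partial>(lborel :: ('a \<times> 'a) measure))"
      proof (rule integral_dominated_convergence[where w = "\<lambda>w. cmod (b w) * A"])
        show "AE w in lborel. (\<lambda>n. cmod (b w) * norm (?M a (tf_shift (- w) (x n)))) \<longlonglongrightarrow> 0"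
        proof (rule AE_I2)
          fix w :: "'a \<times> 'a"
          have weak: "(\<lambda>n. cinner g (tf_shift (- w) (x n))) \<longlonglongrightarrow> 0" for g
          proof -
            have "cinner g (tf_shift (- w) (x n)) = cinner (cadjoint (tf_shift (- w)) g) (x n)" for n
              using cadjoint(2)[OF tf_shift_bounded_clinear, of "- w" "x n" g] by (metis cinner_commute)
            then show ?thesis using x(2) by simp
          qed
          have "(\<lambda>n. norm (?M a (tf_shift (- w) (x n)))) \<longlonglongrightarrow> 0"
            using a x(1) weak by (intro compact_operator_weakly_null[where C = 2]) auto
          then show "(\<lambda>n. cmod (b w) * norm (?M a (tf_shift (- w) (x n)))) \<longlonglongrightarrow> 0" by (rule tendsto_mult_right_zero)
        qed
        have le: "norm (?M a (tf_shift (- w) (x n))) \<le> A" for n w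
        proof -
          have "norm (?M a (tf_shift (- w) (x n))) \<le> (\<integral>z. cmod (a z) \<partial>lborel) * onorm R * norm (tf_shift (- w) (x n))"
            using a by (intro norm_conv_op_fun_le) auto
          also have "\<dots> \<le> A"
            unfolding A_def norm_tf_shift using x(1)[of n] onorm_R by (intro mult_left_mono) auto
          finally show ?thesis .
        qed
        show "AE w in lborel. norm (cmod (b w) * norm (?M a (tf_shift (- w) (x n)))) \<le> cmod (b w) * A" for n
          using le by (intro AE_I2) (simp add: mult_left_mono)
        show "integrable lborel (\<lambda>w. cmod (b w) * A)" by (intro integrable_mult_left integrable_norm b)
        show "(\<lambda>w. cmod (b w) * norm (?M a (tf_shift (- w) (x n)))) \<in> borel_measurable lborel" for n
        proof -
          have "(\<lambda>w. cmod (b w)) \<in> borel_measurable borel" by measurable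
          from borel_measurable_times[OF this meas] show ?thesis by simp
        qed
      qed simp
      then have "(\<lambda>n. \<integral>w. cmod (b w) * norm (?M a (tf_shift (- w) (x n))) \<partial>lborel) \<longlonglongrightarrow> 0" by simp
      then show "(\<lambda>n. norm (?M (conv a b) (x n))) \<longlonglongrightarrow> 0"
        using Lim_null_comparison[of "\<lambda>n. norm (?M (conv a b) (x n))"
          "\<lambda>n. \<integral>w. cmod (b w) * norm (?M a (tf_shift (- w) (x n))) \<partial>lborel" sequentially]
          norm_conv_op_fun_conv_le[of a b] a b by simp
    qed
  qed
qed

text \<open>The ordinary Fourier transform on phase space is the symplectic one after a linear
  bijection swapping position and frequency up to sign, so the absence of zeros is the same for
  both.\<close>

lemma compact_conv_op_fun_wiener:
  assumes a: "a \<in> wiener_functions" "compact_operator (conv_op_fun R a)" and g: "integrable lborel g"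
  shows "compact_operator (conv_op_fun R g)"
proof -
  interpret closed_L1_ideal "\<lambda>a. integrable lborel a \<and> compact_operator (conv_op_fun R a)"
    by (rule closed_L1_ideal_compact)
  have "fourier a w \<noteq> 0" for w
  proof -
    have "symplectic (- snd w, fst w) z = w \<bullet> z" for z :: "'a \<times> 'a"
      by (simp add: symplectic_def inner_prod_def inner_commute)
    then have "fourier a w = symplectic_fourier a (- snd w, fst w)"
      by (simp add: fourier_def symplectic_fourier_def)
    then show ?thesis using a(1) by (simp add: wiener_functions_def)
  qed
  then show ?thesis
    using wiener[of a g] a g by (simp add: wiener_functions_def)
qed

end

subsection \<open>Convolutions and functions vanishing at infinity\<close>

lemma C0_uniform_limit:
  fixes h :: "'b::real_normed_vector \<Rightarrow> complex"
  assumes F: "\<And>n. F n \<in> C0_functions" and lim: "uniform_limit UNIV F h sequentially"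
  shows "h \<in> C0_functions"
  unfolding C0_functions_def
proof (intro CollectI conjI)
  show "continuous_on UNIV h"
    by (rule uniform_limit_theorem[OF _ lim]) (use F in \<open>auto simp: C0_functions_def\<close>)
  show "(h \<longlongrightarrow> 0) at_infinity"
  proof (rule tendstoI)
    fix e :: real assume e: "e > 0"
    then have "\<forall>\<^sub>F n in sequentially. \<forall>x\<in>UNIV. dist (F n x) (h x) < e / 2"
      using uniform_limitD[OF lim, of "e / 2"] by simp
    then obtain n where n: "\<And>x. dist (F n x) (h x) < e / 2" by (auto simp: eventually_sequentially)
    have "(F n \<longlongrightarrow> 0) at_infinity" using F by (auto simp: C0_functions_def)
    then have "\<forall>\<^sub>F x in at_infinity. dist (F n x) 0 < e / 2" by (rule tendstoD) (use e in simp)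
    then show "\<forall>\<^sub>F x in at_infinity. dist (h x) 0 < e"
    proof eventually_elim
      fix x assume "dist (F n x) 0 < e / 2"
      then show "dist (h x) 0 < e"
        using n[of x] dist_triangle[of "h x" 0 "F n x"] by (simp add: dist_commute)
    qed
  qed
qed

text \<open>Read from right to left, it absorbs a character of phase space into a short-time
  transform, after which \<open>moyal\<close> applies.\<close>

lemma stft_tf_shift:
  "stft (tf_shift w f) (tf_shift w g) z = exp (2 * pi * \<i> * of_real (symplectic w z)) * stft f g z"
proof -
  have "symplectic z w = - symplectic w z" by (simp add: symplectic_def)
  then show ?thesis
    unfolding stft_def tf_shift_commute[of z w] cinner_scaleC_right cinner_tf_shift_tf_shift
    by (simp add: exp_cnj)
qed

lemma stft_minus_window: "stft f window (- z) = stft (parity f) window z"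
  unfolding stft_def cinner_parity parity_tf_shift by simp

context bounded_operator
begin

text \<open>The terms of the series are bounded by multiples of
  \<open>norm (u n) * norm (v n)\<close>, so it converges uniformly, and uniform limits preserve
  continuity and decay.\<close>

lemma conv_op_op_C0_of_orbit_form:
  assumes T: "nuclear_rep T u v" and C0: "\<And>f g. orbit_form R f g \<in> C0_functions"
  shows "conv_op_op R T \<in> C0_functions"
proof (rule C0_uniform_limit)
  let ?q = "\<lambda>n. orbit_form R (parity (u n)) (parity (v n))"
  show "(\<lambda>z. \<Sum>i<n. ?q i z) \<in> C0_functions" for n
    using C0 by (auto simp: C0_functions_def intro!: continuous_on_sum tendsto_null_sum)
  have "uniform_limit UNIV (\<lambda>n z. \<Sum>i<n. ?q i z) (\<lambda>z. \<Sum>i. ?q i z) sequentially"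
  proof (rule Weierstrass_m_test)
    show "norm (?q n z) \<le> onorm R * (norm (u n) * norm (v n))" for n z
      using norm_orbit_form_le[of "parity (u n)" "parity (v n)" z] by (simp add: mult.assoc)
    show "summable (\<lambda>n. onorm R * (norm (u n) * norm (v n)))"
      using T by (intro summable_mult) (simp add: nuclear_rep_def)
  qed
  moreover have "(\<Sum>i. ?q i z) = conv_op_op R T z" for z
    using conv_op_op_sums[OF T] by (rule sums_unique[symmetric])
  ultimately show "uniform_limit UNIV (\<lambda>n z. \<Sum>i<n. ?q i z) (conv_op_op R T) sequentially"
    by simp
qed

text \<open>Averaging over a small ball changes the coefficient by at most \<open>e / 2\<close>,
  uniformly in \<open>z\<close>, because the small shifts act on the fixed vectors \<open>f\<close>
  and \<open>g\<close>. The averaged coefficient belongs to a compact operator applied to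
  \<open>tf_shift z f\<close>, which tends weakly to 0.\<close>

lemma orbit_form_C0:
  assumes comp: "\<And>b. integrable lborel b \<Longrightarrow> compact_operator (conv_op_fun R b)"
  shows "orbit_form R f g \<in> C0_functions"
  unfolding C0_functions_def
proof (intro CollectI conjI)
  show "continuous_on UNIV (orbit_form R f g)" by (intro continuous_intros)
  show "(orbit_form R f g \<longlongrightarrow> 0) at_infinity"
  proof (rule tendstoI)
    fix e :: real assume e: "e > 0"
    \<comment> \<open>Bounds the change of the coefficient when both vectors are shifted by
      \<open>- w\<close>; it vanishes at 0 and is continuous by strong continuity.\<close>
    define F where "F w = onorm R * (norm (tf_shift (- w) f - f) * norm g) + onorm R * (norm f * norm (tf_shift (- w) g - g))" for w
    have "continuous_on UNIV F" unfolding F_def by (intro continuous_intros)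
    then have "(F \<longlongrightarrow> F 0) (at 0)"
      unfolding continuous_on_def by (rule bspec) (rule UNIV_I)
    then have "\<forall>\<^sub>F w in at 0. F w < e / 2"
      by (rule order_tendstoD(2)) (use e in \<open>simp add: F_def\<close>)
    then obtain d where d: "d > 0" and
      small: "\<And>w. w \<noteq> 0 \<Longrightarrow> norm w < d \<Longrightarrow> F w < e / 2"
      unfolding eventually_at by (auto simp: dist_norm)
    have small: "onorm R * (norm (tf_shift (- w) f - f) * norm g) + onorm R * (norm f * norm (tf_shift (- w) g - g)) \<le> e / 2"
      if "norm w < d" for w
      using small[of w] that e by (cases "w = 0") (auto simp: less_imp_le F_def)
    have near: "cmod (orbit_form R (tf_shift (- w) f) (tf_shift (- w) g) z - orbit_form R f g z) \<le> e / 2"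
      if "norm w < d" for w z
    proof -
      have "orbit_form R (tf_shift (- w) f) (tf_shift (- w) g) z - orbit_form R f g z
        = orbit_form R (tf_shift (- w) f - f) (tf_shift (- w) g) z + orbit_form R f (tf_shift (- w) g - g) z"
        by (simp add: orbit_form_bilinear)
      also have "cmod \<dots> \<le> onorm R * norm (tf_shift (- w) f - f) * norm (tf_shift (- w) g) + onorm R * norm f * norm (tf_shift (- w) g - g)"
        by (intro norm_triangle_mono norm_orbit_form_le)
      also have "\<dots> \<le> e / 2" using small[OF that] by (simp add: mult.assoc)
      finally show ?thesis .
    qed
    define V where "V = measure lborel (ball (0 :: 'a \<times> 'a) d)"
    have fin: "emeasure lborel (ball (0 :: 'a \<times> 'a) d) < \<infinity>" by (rule emeasure_lborel_ball_finite)
    have V: "V > 0"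
      unfolding V_def using content_ball_pos[OF d, of "0 :: 'a \<times> 'a"] by simp
    \<comment> \<open>The normalised indicator of the ball: its integral and its L1 norm are both
      1.\<close>
    define b where "b w = complex_of_real (indicator (ball 0 d) w / V)" for w :: "'a \<times> 'a"
    have intb: "integrable lborel b"
      unfolding b_def using fin by (intro integrable_of_real integrable_divide_zero) simp
    have intb1: "(\<integral>w. b w \<partial>lborel) = 1"
      unfolding b_def integral_complex_of_real using V fin by (simp add: V_def)
    have absb: "cmod (b w) = indicator (ball 0 d) w / V" for w
      unfolding b_def norm_of_real using V by (intro abs_of_nonneg) simp
    have intabsb: "integrable lborel (\<lambda>w. cmod (b w))" "(\<integral>w. cmod (b w) \<partial>lborel) = 1"
      unfolding absb using V fin by (simp_all add: V_def)
    let ?M = "conv_op_fun R b"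
    have diff: "cmod (orbit_form R f g z) \<le> norm (?M (tf_shift z f)) * norm g + e / 2" for z
    proof -
      \<comment> \<open>On matrix coefficients shifts commute, so the averaging variable can act on
        \<open>f\<close> and \<open>g\<close> while \<open>z\<close> stays outside.\<close>
      have shift: "orbit_form R (tf_shift z f) (tf_shift z g) (- w) = orbit_form R (tf_shift (- w) f) (tf_shift (- w) g) z" for w
        by (simp add: orbit_form_tf_shift add.commute)
      have i1: "integrable lborel (\<lambda>w. b w * orbit_form R (tf_shift (- w) f) (tf_shift (- w) g) z)"
        using integrable_orbit_form[OF intb, of "tf_shift z f" "tf_shift z g"] unfolding shift .
      have i2: "integrable lborel (\<lambda>w. b w * orbit_form R f g z)" using intb by simp
      have "orbit_form R f g z - cinner (?M (tf_shift z f)) (tf_shift z g)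
         = - (\<integral>w. b w * orbit_form R (tf_shift (- w) f) (tf_shift (- w) g) z - b w * orbit_form R f g z \<partial>lborel)"
        unfolding Bochner_Integration.integral_diff[OF i1 i2] conv_op_fun(2)[OF intb] shift
        by (simp add: intb1)
      also have "cmod \<dots> \<le> (\<integral>w. cmod (b w * orbit_form R (tf_shift (- w) f) (tf_shift (- w) g) z - b w * orbit_form R f g z) \<partial>lborel)"
        unfolding norm_minus_cancel by (rule integral_norm_bound)
      also have "\<dots> \<le> (\<integral>w. cmod (b w) * (e / 2) \<partial>lborel)"
      proof (rule integral_mono)
        show "cmod (b w * orbit_form R (tf_shift (- w) f) (tf_shift (- w) g) z - b w * orbit_form R f g z) \<le> cmod (b w) * (e / 2)" for w
        proof (cases "norm w < d")
          case True
          then show ?thesis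
            unfolding right_diff_distrib[symmetric] norm_mult by (intro mult_left_mono near) simp_all
        qed (simp add: b_def)
      qed (use i1 i2 intabsb in auto)
      also have "\<dots> = e / 2" using intabsb by simp
      finally have "cmod (orbit_form R f g z - cinner (?M (tf_shift z f)) (tf_shift z g)) \<le> e / 2" .
      moreover have "cmod (cinner (?M (tf_shift z f)) (tf_shift z g)) \<le> norm (?M (tf_shift z f)) * norm g"
        using cinner_Cauchy_Schwarz[of "?M (tf_shift z f)" "tf_shift z g"] by simp
      ultimately show ?thesis
        using norm_triangle_sub[of "orbit_form R f g z" "cinner (?M (tf_shift z f)) (tf_shift z g)"] by linarith
    qed
    have "((\<lambda>z. norm (?M (tf_shift z f))) \<longlongrightarrow> 0) at_infinity"
      by (rule compact_operator_weakly_null[OF comp[OF intb], where C = "norm f"])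
        (simp_all add: tf_shift_weakly_null)
    then have "((\<lambda>z. norm (?M (tf_shift z f)) * norm g) \<longlongrightarrow> 0) at_infinity" by (rule tendsto_mult_left_zero)
    then have "\<forall>\<^sub>F z in at_infinity. norm (?M (tf_shift z f)) * norm g < e / 2"
      by (rule order_tendstoD(2)) (use e in simp)
    then show "\<forall>\<^sub>F z in at_infinity. dist (orbit_form R f g z) 0 < e"
    proof eventually_elim
      fix z assume "norm (?M (tf_shift z f)) * norm g < e / 2"
      then show "dist (orbit_form R f g z) 0 < e" using diff[of z] by simp
    qed
  qed
qed

text \<open>Both sides are iterated integrals of the same function of \<open>(z, w)\<close>, by Moyal's identity
  in \<open>w\<close> and in \<open>z\<close>. For \<open>g\<close> in the orbit of the window, this function is integrable.\<close>

lemma convolution_exchange: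
  assumes g: "g = tf_shift w\<^sub>0 window"
  shows "(\<integral>z. stft u window z * cnj (stft v window z) * orbit_form R f g z \<partial>lborel)
    = (\<integral>w. orbit_form R u v w * (stft f window w * cnj (stft g window w)) \<partial>lborel)"
proof -
  let ?e = "\<lambda>w z. exp (2 * pi * \<i> * of_real (symplectic w z))"
  let ?R' = "cadjoint R"
  \<comment> \<open>The phase is inserted so that for fixed \<open>w\<close> (\<open>Bz\<close>) and
    for fixed \<open>z\<close> (\<open>Bw\<close>) the function is a constant times a product of two
    short-time transforms, as \<open>moyal\<close> needs.\<close>
  define B where "B w z = ?e w z * stft u window z * cinner (R (tf_shift z f)) (tf_shift w v) * cnj (stft g window w)" for w z
  have adj: "cinner (R (tf_shift z f)) (tf_shift w v) = cnj (stft (?R' (tf_shift w v)) f z)" for z w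
    unfolding stft_def cadjoint(2)[OF R] by (rule cinner_commute)
  obtain C where C: "C \<ge> 0" "\<And>f. norm (?R' f) \<le> C * norm f"
    using bounded_clinear_bound[OF cadjoint(1)[OF R]] by metis
  have contB: "continuous_on UNIV (\<lambda>(w, z). B w z)"
    unfolding B_def split_def symplectic_def by (intro continuous_intros)
  have measB: "(\<lambda>(w, z). B w z) \<in> borel_measurable (lborel \<Otimes>\<^sub>M lborel)"
    unfolding lborel_prod using contB by (simp add: borel_measurable_continuous_onI)
  have Bz: "B w z = cnj (stft g window w) * (stft (tf_shift w u) (tf_shift w window) z * cnj (stft (?R' (tf_shift w v)) f z))" for w z
    unfolding B_def adj stft_tf_shift by (simp only: mult_ac)
  have Bw: "B w z = stft u window z * (stft (R (tf_shift z f)) v w * cnj (stft (tf_shift z g) (tf_shift z window) w))" for w z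
  proof -
    have "symplectic z w = - symplectic w z" by (simp add: symplectic_def)
    then have "cnj (?e z w) = ?e w z" by (simp add: exp_cnj)
    then show ?thesis unfolding B_def stft_tf_shift complex_cnj_mult stft_def[of "R (tf_shift z f)"] by (simp only: mult_ac)
  qed
  have intz: "integrable lborel (B w)" for w
    unfolding Bz by (intro integrable_mult_right integrable_stft_mult)
  \<comment> \<open>Here the form of \<open>g\<close> enters: up to a phase its transform is a
    translate of that of the window, hence integrable. After Cauchy-Schwarz in \<open>z\<close> this
    is the factor that controls the integral over \<open>w\<close>.\<close>
  have intg: "integrable lborel (\<lambda>w. cmod (stft g window w))"
  proof -
    have "cmod (stft g window w) = cmod (stft window window (w - w\<^sub>0))" for w
      unfolding g stft_def by (simp add: cinner_tf_shift_left cinner_scaleC_right norm_mult tf_shift_compose)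
    then show ?thesis using integrable_norm[OF integrable_minus_shift[OF integrable_stft_window, of w\<^sub>0]] by simp
  qed
  have intw: "integrable lborel (\<lambda>w. \<integral>z. norm (B w z) \<partial>lborel)"
  proof (rule integrable_nonneg_bound)
    show "integrable lborel (\<lambda>w. cmod (stft g window w) * (norm u * (C * norm v * norm f)))"
      by (intro integrable_mult_left intg)
    show "(\<lambda>w. \<integral>z. norm (B w z) \<partial>lborel) \<in> borel_measurable lborel"
      using measB by measurable
    fix w
    have "(\<integral>z. norm (B w z) \<partial>lborel) = cmod (stft g window w) * (\<integral>z. cmod (stft (tf_shift w u) (tf_shift w window) z * cnj (stft (?R' (tf_shift w v)) f z)) \<partial>lborel)"
      unfolding Bz norm_mult[of "cnj (stft g window w)"] by simp
    also have "\<dots> \<le> cmod (stft g window w) * (norm u * (C * norm v * norm f))"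
    proof (intro mult_left_mono)
      have "(\<integral>z. cmod (stft (tf_shift w u) (tf_shift w window) z * cnj (stft (?R' (tf_shift w v)) f z)) \<partial>lborel)
        \<le> norm u * (norm (?R' (tf_shift w v)) * norm f)"
        using integral_stft_mult_le[of "tf_shift w u" "tf_shift w window" "?R' (tf_shift w v)" f] by simp
      also have "\<dots> \<le> norm u * (C * norm v * norm f)"
        using C(2)[of "tf_shift w v"] by (intro mult_left_mono mult_right_mono) simp_all
      finally show "(\<integral>z. cmod (stft (tf_shift w u) (tf_shift w window) z * cnj (stft (?R' (tf_shift w v)) f z)) \<partial>lborel)
        \<le> norm u * (C * norm v * norm f)" .
    qed simp
    finally show "(\<integral>z. norm (B w z) \<partial>lborel) \<le> cmod (stft g window w) * (norm u * (C * norm v * norm f))" .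
  qed simp
  have "(\<integral>z. (\<integral>w. B w z \<partial>lborel) \<partial>lborel) = (\<integral>w. (\<integral>z. B w z \<partial>lborel) \<partial>lborel)"
    by (rule lborel_fubini(3)[OF measB _ intw]) (use intz in auto)
  moreover have "(\<integral>w. B w z \<partial>lborel) = stft u window z * cnj (stft v window z) * orbit_form R f g z" for z
  proof -
    have "(\<integral>w. B w z \<partial>lborel) = stft u window z * (cinner (R (tf_shift z f)) (tf_shift z g) * cnj (cinner v (tf_shift z window)))"
      unfolding Bw by (simp add: moyal)
    then show ?thesis by (simp add: stft_def orbit_form_def mult_ac)
  qed
  moreover have "(\<integral>z. B w z \<partial>lborel) = orbit_form R u v w * (stft f window w * cnj (stft g window w))" for w
  proof -
    have "(\<integral>z. B w z \<partial>lborel) = cnj (stft g window w) * (cinner (tf_shift w u) (?R' (tf_shift w v)) * cnj (cinner (tf_shift w window) f))"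
      unfolding Bz by (simp add: moyal)
    also have "cnj (cinner (tf_shift w window) f) = stft f window w"
      unfolding stft_def by (rule cinner_commute[symmetric])
    finally show ?thesis by (simp add: orbit_form_def cadjoint(2)[OF R] mult_ac)
  qed
  ultimately show ?thesis by simp
qed

end

text \<open>\<open>a\<close> is the convolution of \<open>S\<close> with the projection onto the (even) window.\<close>

lemma
  fixes S :: "'a::euclidean_space L2 \<Rightarrow> 'a L2"
  assumes S: "nuclear_rep S u v"
  defines "a \<equiv> \<lambda>z. cinner (S (tf_shift z window)) (tf_shift z window)"
  shows integrable_berezin: "integrable lborel a"
    and berezin_sums: "\<And>k. k \<in> borel_measurable borel \<Longrightarrow> (\<And>z. cmod (k z) \<le> C) \<Longrightarrow>
      (\<lambda>n. \<integral>z. stft (u n) window z * cnj (stft (v n) window z) * k z \<partial>lborel) sums (\<integral>z. a z * k z \<partial>lborel)"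
proof -
  let ?t = "\<lambda>n z. stft (u n) window z * cnj (stft (v n) window z)"
  have sums: "(\<lambda>n. ?t n z) sums a z" for z
  proof -
    have "(\<lambda>n. cinner (tf_shift z window) (v n) * cinner (u n) (tf_shift z window)) sums a z"
      using S by (simp add: nuclear_rep_def a_def)
    moreover have "cinner (tf_shift z window) (v n) * cinner (u n) (tf_shift z window) = ?t n z" for n
      using cinner_commute[of "tf_shift z window" "v n"] by (simp add: stft_def mult.commute)
    ultimately show ?thesis by simp
  qed
  have suv: "summable (\<lambda>n. norm (u n) * norm (v n))" using S by (simp add: nuclear_rep_def)
  \<comment> \<open>Integrability and termwise integration are proved together for a bounded weight
    \<open>k\<close>. The weight 1 gives integrability of \<open>a\<close>; characters and matrix
    coefficients are used as weights later.\<close>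
  have key: "integrable lborel (\<lambda>z. a z * k z) \<and> (\<lambda>n. \<integral>z. ?t n z * k z \<partial>lborel) sums (\<integral>z. a z * k z \<partial>lborel)"
    if k: "k \<in> borel_measurable borel" "\<And>z. cmod (k z) \<le> C" for k C
  proof -
    have C0: "C \<ge> 0" using order_trans[OF norm_ge_zero k(2)] .
    have it: "integrable lborel (\<lambda>z. ?t n z * k z)" for n
    proof (rule Bochner_Integration.integrable_bound)
      show "integrable lborel (\<lambda>z. C * cmod (?t n z))" by (intro integrable_mult_right integrable_norm integrable_stft_mult)
      show "AE z in lborel. norm (?t n z * k z) \<le> norm (C * cmod (?t n z))"
      proof (rule AE_I2)
        fix z
        show "norm (?t n z * k z) \<le> norm (C * cmod (?t n z))"
          using mult_right_mono[OF k(2) norm_ge_zero, of z "?t n z"] C0 by (simp add: norm_mult mult_ac)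
      qed
      show "(\<lambda>z. ?t n z * k z) \<in> borel_measurable lborel" using k(1) by measurable
    qed
    have le: "(\<integral>z. norm (?t n z * k z) \<partial>lborel) \<le> C * (norm (u n) * norm (v n))" for n
    proof -
      have "(\<integral>z. norm (?t n z * k z) \<partial>lborel) \<le> (\<integral>z. C * cmod (?t n z) \<partial>lborel)"
        by (intro integral_mono integrable_norm it integrable_mult_right integrable_stft_mult)
          (subst norm_mult, subst mult.commute, intro mult_right_mono k(2), simp)
      also have "\<dots> = C * (\<integral>z. cmod (?t n z) \<partial>lborel)" by (rule integral_mult_right_zero)
      also have "\<dots> \<le> C * (norm (u n) * norm (v n))"
        using integral_stft_mult_le[of "u n" window "v n" window] C0 by (intro mult_left_mono) simp_all
      finally show ?thesis .
    qed
    have s1: "summable (\<lambda>n. \<integral>z. norm (?t n z * k z) \<partial>lborel)"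
      by (rule summable_comparison_test'[OF summable_mult[OF suv, of C]]) (use le in auto)
    have s2: "summable (\<lambda>n. norm (?t n z * k z))" for z
    proof (rule summable_comparison_test'[OF summable_mult[OF suv, of C]])
      fix n
      have "norm (?t n z * k z) \<le> norm (u n) * norm (v n) * C"
        unfolding norm_mult complex_mod_cnj
        using norm_stft_le[of "u n" window z] norm_stft_le[of "v n" window z] k(2)[of z]
        by (intro mult_mono) simp_all
      then show "norm (norm (?t n z * k z)) \<le> C * (norm (u n) * norm (v n))" by (simp add: mult.commute)
    qed
    have "integrable lborel (\<lambda>z. \<Sum>n. ?t n z * k z)"
      by (rule integrable_suminf[OF it _ s1]) (use s2 in auto)
    moreover have "(\<lambda>n. \<integral>z. ?t n z * k z \<partial>lborel) sums (\<integral>z. (\<Sum>n. ?t n z * k z) \<partial>lborel)"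
      by (rule sums_integral[OF it _ s1]) (use s2 in auto)
    moreover have "(\<Sum>n. ?t n z * k z) = a z * k z" for z
      by (rule sums_unique[symmetric]) (rule sums_mult2[OF sums])
    ultimately show ?thesis by simp
  qed
  have "integrable lborel (\<lambda>z. a z * 1)" by (rule key[of "\<lambda>_. 1" 1, THEN conjunct1]) simp_all
  then show "integrable lborel a" unfolding mult_1_right .
  show "(\<lambda>n. \<integral>z. ?t n z * k z \<partial>lborel) sums (\<integral>z. a z * k z \<partial>lborel)"
    if "k \<in> borel_measurable borel" "\<And>z. cmod (k z) \<le> C" for k
    using key[OF that] by simp
qed

lemma fourier_wigner_sums:
  assumes S: "nuclear_rep S u v"
  shows "(\<lambda>n. cinner (tf_shift (- z) (u n)) (v n)) sums op_trace (tf_shift (- z) \<circ> S)"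
proof -
  have "nuclear_rep (tf_shift (- z) \<circ> S \<circ> id) (\<lambda>n. tf_shift (- z) (u n)) (\<lambda>n. id (v n))"
    by (rule nuclear_rep_compose[OF S tf_shift_bounded_clinear, where C = 1]) simp_all
  from op_trace_nuclear[OF this] show ?thesis by simp
qed

text \<open>By \<open>moyal\<close> each rank one term contributes a coefficient of
  \<open>tf_shift (- z)\<close> times the transform of the window at \<open>- z\<close>. The sum is,
  up to a phase, the Fourier-Wigner transform of \<open>S\<close> times a function without
  zeros.\<close>

lemma berezin_wiener:
  fixes S :: "'a::euclidean_space L2 \<Rightarrow> 'a L2"
  assumes S: "nuclear_rep S u v" and nz: "\<And>z. fourier_wigner S z \<noteq> 0"
  shows "(\<lambda>z. cinner (S (tf_shift z window)) (tf_shift z window)) \<in> wiener_functions"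
proof -
  let ?a = "\<lambda>z. cinner (S (tf_shift z window)) (tf_shift z window)"
  have "symplectic_fourier ?a z \<noteq> 0" for z
  proof -
    let ?k = "\<lambda>z'. exp (- 2 * pi * \<i> * of_real (symplectic z z'))"
    have "(\<lambda>n. \<integral>z'. stft (u n) window z' * cnj (stft (v n) window z') * ?k z' \<partial>lborel) sums symplectic_fourier ?a z"
      unfolding symplectic_fourier_def
    proof (rule berezin_sums[OF S, where C = 1])
      show "?k \<in> borel_measurable borel"
        unfolding symplectic_def by (intro borel_measurable_continuous_onI continuous_intros)
    qed simp
    moreover have "(\<integral>z'. stft (u n) window z' * cnj (stft (v n) window z') * ?k z' \<partial>lborel)
       = cinner (tf_shift (- z) (u n)) (v n) * stft window window (- z)" for n
    proof -
      have "symplectic (- z) z' = - symplectic z z'" for z' by (simp add: symplectic_def)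
      then have "stft (u n) window z' * cnj (stft (v n) window z') * ?k z'
          = stft (tf_shift (- z) (u n)) (tf_shift (- z) window) z' * cnj (stft (v n) window z')" for z'
        by (simp add: stft_tf_shift mult_ac)
      then have "(\<integral>z'. stft (u n) window z' * cnj (stft (v n) window z') * ?k z' \<partial>lborel)
          = cinner (tf_shift (- z) (u n)) (v n) * cnj (cinner (tf_shift (- z) window) window)"
        by (simp only: moyal)
      then show ?thesis using cinner_commute[of window "tf_shift (- z) window"] by (simp add: stft_def)
    qed
    ultimately have "(\<lambda>n. cinner (tf_shift (- z) (u n)) (v n) * stft window window (- z)) sums symplectic_fourier ?a z"
      by simp
    then have "symplectic_fourier ?a z = op_trace (tf_shift (- z) \<circ> S) * stft window window (- z)"
      by (rule sums_unique2[OF _ sums_mult2[OF fourier_wigner_sums[OF S]]])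
    moreover have "op_trace (tf_shift (- z) \<circ> S) \<noteq> 0" using nz[of z] by (simp add: fourier_wigner_def)
    moreover have "stft window window (- z) \<noteq> 0"
      using norm_stft_window[of "- z"] gauss_pos[of "1/2" "- z"] by force
    ultimately show ?thesis by simp
  qed
  then show ?thesis using integrable_berezin[OF S] by (simp add: wiener_functions_def)
qed

text \<open>The operator is identified with the localisation operator \<open>N\<close>, whose form
  weights two short-time transforms by the symbol \<open>h\<close>. Since \<open>h\<close> decays, a
  bounded region of phase space decides, and there the transforms of a weakly null sequence tend to
  0 boundedly.\<close>

lemma (in bounded_operator) compact_conv_op_fun_berezin:
  assumes S: "nuclear_rep S u v" and C0: "conv_op_op R S \<in> C0_functions"
  shows "compact_operator (conv_op_fun R (\<lambda>z. cinner (S (tf_shift z window)) (tf_shift z window)))"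
proof -
  define a where "a z = cinner (S (tf_shift z window)) (tf_shift z window)" for z
  define h where "h = conv_op_op R S"
  have inta: "integrable lborel a"
    unfolding a_def by (rule integrable_berezin[OF S])
  have conth: "continuous_on UNIV h" and limh: "(h \<longlongrightarrow> 0) at_infinity"
    using C0 by (auto simp: C0_functions_def h_def)
  have [measurable]: "h \<in> borel_measurable borel" by (rule borel_measurable_continuous_onI[OF conth])
  have suv: "summable (\<lambda>n. norm (u n) * norm (v n))" using S by (simp add: nuclear_rep_def)
  let ?q = "\<lambda>n. orbit_form R (parity (u n)) (parity (v n))"
  have q_le: "cmod (?q n z) \<le> onorm R * (norm (u n) * norm (v n))" for n z
    using norm_orbit_form_le[of "parity (u n)" "parity (v n)" z] by (simp add: mult.assoc)
  have sR: "summable (\<lambda>n. onorm R * (norm (u n) * norm (v n)))" by (rule summable_mult[OF suv])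
  have hsums: "(\<lambda>n. ?q n z) sums h z" for z unfolding h_def by (rule conv_op_op_sums[OF S])
  define H where "H = (\<Sum>n. onorm R * (norm (u n) * norm (v n)))"
  have H0: "H \<ge> 0" unfolding H_def using onorm_R by (intro suminf_nonneg sR) simp
  have h_le: "cmod (h z) \<le> H" for z
    unfolding H_def sums_unique[OF hsums[of z]] by (rule norm_suminf_le[OF q_le sR])
  define G where "G f g w = stft f window w * cnj (stft g window w)" for f g :: "'a L2" and w
  have [measurable]: "G f g \<in> borel_measurable borel" for f g unfolding G_def by measurable
  have intG: "integrable lborel (G f g)" for f g unfolding G_def by (rule integrable_stft_mult)
  have G_le: "(\<integral>w. cmod (G f g w) \<partial>lborel) \<le> norm f * norm g" for f g
    unfolding G_def using integral_stft_mult_le[of f window g window] by simp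
  have inthG: "integrable lborel (\<lambda>w. h w * G f g w)" for f g
  proof (rule Bochner_Integration.integrable_bound)
    show "integrable lborel (\<lambda>w. H * cmod (G f g w))" by (intro integrable_mult_right integrable_norm intG)
    show "AE w in lborel. norm (h w * G f g w) \<le> norm (H * cmod (G f g w))"
      using h_le H0 by (intro AE_I2) (simp add: norm_mult mult_right_mono)
  qed measurable
  have "\<exists>N. bounded_clinear N \<and> (\<forall>f g. cinner (N f) g = (\<integral>w. h w * G f g w \<partial>lborel))"
  proof (rule sesquilinear_operator)
    show "cmod (\<integral>w. h w * G f g w \<partial>lborel) \<le> H * norm f * norm g" for f g
    proof -
      have "cmod (\<integral>w. h w * G f g w \<partial>lborel) \<le> (\<integral>w. cmod (h w * G f g w) \<partial>lborel)" by (rule integral_norm_bound)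
      also have "\<dots> \<le> (\<integral>w. H * cmod (G f g w) \<partial>lborel)"
        by (intro integral_mono integrable_norm inthG integrable_mult_right intG)
          (simp add: norm_mult mult_right_mono h_le)
      also have "\<dots> \<le> H * (norm f * norm g)"
        using G_le[of f g] H0 by (simp add: mult_left_mono)
      finally show ?thesis by (simp add: mult.assoc)
    qed
    show "(\<integral>w. h w * G (f + f') g w \<partial>lborel) = (\<integral>w. h w * G f g w \<partial>lborel) + (\<integral>w. h w * G f' g w \<partial>lborel)" for f f' g
      by (subst Bochner_Integration.integral_add[symmetric, OF inthG inthG])
        (simp add: G_def stft_add_left distrib_left distrib_right)
    show "(\<integral>w. h w * G f (g + g') w \<partial>lborel) = (\<integral>w. h w * G f g w \<partial>lborel) + (\<integral>w. h w * G f g' w \<partial>lborel)" for f g g'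
      by (subst Bochner_Integration.integral_add[symmetric, OF inthG inthG])
        (simp add: G_def stft_add_left distrib_left)
    show "(\<integral>w. h w * G (c *\<^sub>C f) g w \<partial>lborel) = c * (\<integral>w. h w * G f g w \<partial>lborel)" for c f g
      unfolding integral_mult_right_zero[symmetric] by (simp add: G_def stft_scaleC_left mult_ac)
    show "(\<integral>w. h w * G f (c *\<^sub>C g) w \<partial>lborel) = cnj c * (\<integral>w. h w * G f g w \<partial>lborel)" for c f g
      unfolding integral_mult_right_zero[symmetric] by (simp add: G_def stft_scaleC_left mult_ac)
  qed
  then obtain N where N: "\<And>f g. cinner (N f) g = (\<integral>w. h w * G f g w \<partial>lborel)" by blast
  let ?M = "conv_op_fun R a"
  \<comment> \<open>The two forms are compared on the orbit of the window, where
    \<open>convolution_exchange\<close> holds; the orbit is total, so the operators agree.\<close>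
  have "cinner (N f - ?M f) (tf_shift w\<^sub>0 window) = 0" for f w\<^sub>0
  proof -
    define g where "g = tf_shift w\<^sub>0 (window :: 'a L2)"
    have "(\<lambda>n. \<integral>w. ?q n w * G f g w \<partial>lborel) sums (\<integral>w. (\<Sum>n. ?q n w * G f g w) \<partial>lborel)"
    proof (rule sums_integral)
      have le: "norm (?q n w * G f g w) \<le> onorm R * (norm (u n) * norm (v n)) * cmod (G f g w)" for n w
        unfolding norm_mult by (intro mult_right_mono q_le) simp
      show i: "integrable lborel (\<lambda>w. ?q n w * G f g w)" for n
      proof (rule Bochner_Integration.integrable_bound)
        show "integrable lborel (\<lambda>w. onorm R * (norm (u n) * norm (v n)) * cmod (G f g w))"
          by (intro integrable_mult_right integrable_norm intG)
        show "AE w in lborel. norm (?q n w * G f g w) \<le> norm (onorm R * (norm (u n) * norm (v n)) * cmod (G f g w))"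
          using le onorm_R by (intro AE_I2) (simp add: abs_mult)
      qed measurable
      show "AE w in lborel. summable (\<lambda>n. norm (?q n w * G f g w))"
        by (intro AE_I2 summable_comparison_test'[OF summable_mult2[OF sR]]) (use le in auto)
      show "summable (\<lambda>n. \<integral>w. norm (?q n w * G f g w) \<partial>lborel)"
      proof (rule summable_comparison_test'[OF summable_mult2[OF sR, of "norm f * norm g"]])
        fix n :: nat
        have "(\<integral>w. norm (?q n w * G f g w) \<partial>lborel) \<le> (\<integral>w. onorm R * (norm (u n) * norm (v n)) * cmod (G f g w) \<partial>lborel)"
          by (intro integral_mono integrable_norm i integrable_mult_right intG le)
        also have "\<dots> = onorm R * (norm (u n) * norm (v n)) * (\<integral>w. cmod (G f g w) \<partial>lborel)"
          by (rule integral_mult_right_zero)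
        also have "\<dots> \<le> onorm R * (norm (u n) * norm (v n)) * (norm f * norm g)"
          using onorm_R by (intro mult_left_mono G_le) simp
        finally show "norm (\<integral>w. norm (?q n w * G f g w) \<partial>lborel) \<le> onorm R * (norm (u n) * norm (v n)) * (norm f * norm g)"
          by simp
      qed
    qed
    moreover have "(\<Sum>n. ?q n w * G f g w) = h w * G f g w" for w
      by (rule sums_unique[symmetric]) (rule sums_mult2[OF hsums])
    ultimately have 1: "(\<lambda>n. \<integral>w. ?q n w * G f g w \<partial>lborel) sums cinner (N f) g" by (simp add: N)
    have "(\<lambda>n. \<integral>z. stft (u n) window z * cnj (stft (v n) window z) * orbit_form R f g (- z) \<partial>lborel) sums cinner (?M f) g"
      unfolding conv_op_fun(2)[OF inta] a_def
      by (rule berezin_sums[OF S, where C = "onorm R * norm f * norm g"]) (auto intro: norm_orbit_form_le)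
    moreover have "(\<integral>z. stft (u n) window z * cnj (stft (v n) window z) * orbit_form R f g (- z) \<partial>lborel)
      = (\<integral>w. ?q n w * G f g w \<partial>lborel)" for n
    proof -
      \<comment> \<open>The reversed argument is traded for parity on the vectors, the window being
        even.\<close>
      have "(\<integral>z. stft (u n) window z * cnj (stft (v n) window z) * orbit_form R f g (- z) \<partial>lborel)
        = (\<integral>z. stft (u n) window (0 - z) * cnj (stft (v n) window (0 - z)) * orbit_form R f g (- (0 - z)) \<partial>lborel)"
        by (rule integral_reflect[symmetric]) measurable
      also have "\<dots> = (\<integral>z. stft (parity (u n)) window z * cnj (stft (parity (v n)) window z) * orbit_form R f g z \<partial>lborel)"
        by (simp add: stft_minus_window)
      also have "\<dots> = (\<integral>w. ?q n w * G f g w \<partial>lborel)"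
        unfolding G_def by (rule convolution_exchange) (rule g_def)
      finally show ?thesis .
    qed
    ultimately have "cinner (N f) g = cinner (?M f) g" using sums_unique2[OF 1] by simp
    then show ?thesis by (simp add: g_def cinner_diff_left)
  qed
  then have NM: "N f = ?M f" for f
    using window_total[of UNIV "N f - ?M f"] by simp
  \<comment> \<open>Cauchy-Schwarz keeps the whole weight \<open>h\<close> with the transform of
    \<open>f\<close>; the transform of \<open>g\<close> contributes just
    \<open>norm g\<close>.\<close>
  have M_le: "norm (?M f) \<le> sqrt (\<integral>w. (cmod (h w * stft f window w))\<^sup>2 \<partial>lborel)" for f
  proof (rule norm_le_of_cinner_le)
    fix g
    have int: "integrable lborel (\<lambda>w. (cmod (h w * stft f window w))\<^sup>2)"
    proof (rule integrable_nonneg_bound)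
      show "integrable lborel (\<lambda>w. H\<^sup>2 * (cmod (stft f window w))\<^sup>2)" by (intro integrable_mult_right integrable_stft_square)
      show "(cmod (h w * stft f window w))\<^sup>2 \<le> H\<^sup>2 * (cmod (stft f window w))\<^sup>2" for w
        unfolding norm_mult power_mult_distrib by (intro mult_right_mono power_mono h_le) simp_all
      show "(\<lambda>w. (cmod (h w * stft f window w))\<^sup>2) \<in> borel_measurable lborel" by measurable
    qed simp
    have "cmod (cinner (?M f) g) \<le> (\<integral>w. cmod ((h w * stft f window w) * cnj (stft g window w)) \<partial>lborel)"
      unfolding NM[symmetric] N G_def mult.assoc by (rule integral_norm_bound)
    also have "\<dots> \<le> sqrt (\<integral>w. (cmod (h w * stft f window w))\<^sup>2 \<partial>lborel) * sqrt (\<integral>w. (cmod (cnj (stft g window w)))\<^sup>2 \<partial>lborel)"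
      using int by (intro integral_mult_L2_le) (simp_all add: integrable_stft_square)
    also have "sqrt (\<integral>w. (cmod (cnj (stft g window w)))\<^sup>2 \<partial>lborel) = norm g"
      by (simp add: integral_stft_square)
    finally show "cmod (cinner (?M f) g) \<le> sqrt (\<integral>w. (cmod (h w * stft f window w))\<^sup>2 \<partial>lborel) * norm g" .
  qed simp
  have "compact_operator ?M"
  proof (rule compact_operatorI[OF conv_op_fun(1)[OF inta]])
    fix x :: "nat \<Rightarrow> 'a L2" assume x: "\<And>n. norm (x n) \<le> 2" "\<And>g. (\<lambda>n. cinner g (x n)) \<longlonglongrightarrow> 0"
    define I where "I n = (\<integral>w. (cmod (h w * stft (x n) window w))\<^sup>2 \<partial>lborel)" for n
    have stft2: "cmod (stft (x n) window w) \<le> 2" for n w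
      using norm_stft_le[of "x n" window w] x(1)[of n] by simp
    have "I \<longlonglongrightarrow> 0"
    proof (rule tendstoI)
      fix e :: real assume e: "e > 0"
      \<comment> \<open>Outside the ball the contribution is at most
        \<open>d^2 * norm (x n)^2\<close>, and \<open>norm (x n)\<close> is at most 2, so the 8
        leaves \<open>e / 2\<close>.\<close>
      define d where "d = sqrt (e / 8)"
      have d: "d > 0" "d\<^sup>2 = e / 8" using e by (simp_all add: d_def)
      have "\<forall>\<^sub>F w in at_infinity. dist (h w) 0 < d" using limh d(1) by (rule tendstoD)
      then obtain r where r: "\<And>w. r \<le> norm w \<Longrightarrow> cmod (h w) < d" by (auto simp: eventually_at_infinity)
      let ?i = "indicator (cball 0 r) :: 'a \<times> 'a \<Rightarrow> real"
      have inti: "integrable lborel ?i"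
        using emeasure_lborel_cball_finite[of "0 :: 'a \<times> 'a" r] by simp
      have "(\<lambda>n. \<integral>w. ?i w * (cmod (stft (x n) window w))\<^sup>2 \<partial>lborel) \<longlonglongrightarrow> (\<integral>w. 0 \<partial>(lborel :: ('a \<times> 'a) measure))"
      proof (rule integral_dominated_convergence[where w = "\<lambda>w. ?i w * 2\<^sup>2"])
        show "AE w in lborel. (\<lambda>n. ?i w * (cmod (stft (x n) window w))\<^sup>2) \<longlonglongrightarrow> 0"
        proof (rule AE_I2)
          fix w
          have "(\<lambda>n. cnj (cinner (tf_shift w window) (x n))) \<longlonglongrightarrow> cnj 0" by (intro tendsto_intros x(2))
          moreover have "cnj (cinner (tf_shift w window) (x n)) = stft (x n) window w" for n
            unfolding stft_def by (rule cinner_commute[symmetric])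
          ultimately have "(\<lambda>n. stft (x n) window w) \<longlonglongrightarrow> 0" by simp
          then have "(\<lambda>n. ?i w * (cmod (stft (x n) window w))\<^sup>2) \<longlonglongrightarrow> ?i w * (cmod 0)\<^sup>2" by (intro tendsto_intros)
          then show "(\<lambda>n. ?i w * (cmod (stft (x n) window w))\<^sup>2) \<longlonglongrightarrow> 0" by simp
        qed
        show "AE w in lborel. norm (?i w * (cmod (stft (x n) window w))\<^sup>2) \<le> ?i w * 2\<^sup>2" for n
        proof (rule AE_I2)
          fix w
          have "?i w * (cmod (stft (x n) window w))\<^sup>2 \<le> ?i w * 2\<^sup>2"
            by (intro mult_left_mono power_mono stft2) simp_all
          then show "norm (?i w * (cmod (stft (x n) window w))\<^sup>2) \<le> ?i w * 2\<^sup>2" by (simp add: abs_mult)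
        qed
        show "integrable lborel (\<lambda>w. ?i w * 2\<^sup>2)" by (intro integrable_mult_left inti)
        have [measurable]: "?i \<in> borel_measurable borel" by (rule borel_measurable_indicator) simp
        show "(\<lambda>w. ?i w * (cmod (stft (x n) window w))\<^sup>2) \<in> borel_measurable lborel" for n by measurable
      qed simp
      then have "(\<lambda>n. H\<^sup>2 * (\<integral>w. ?i w * (cmod (stft (x n) window w))\<^sup>2 \<partial>lborel)) \<longlonglongrightarrow> 0"
        by (intro tendsto_mult_right_zero) simp
      then have "\<forall>\<^sub>F n in sequentially. H\<^sup>2 * (\<integral>w. ?i w * (cmod (stft (x n) window w))\<^sup>2 \<partial>lborel) < e / 2"
        by (rule order_tendstoD(2)) (use e in simp)
      then show "\<forall>\<^sub>F n in sequentially. dist (I n) 0 < e"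
      proof eventually_elim
        fix n assume n: "H\<^sup>2 * (\<integral>w. ?i w * (cmod (stft (x n) window w))\<^sup>2 \<partial>lborel) < e / 2"
        let ?s = "\<lambda>w. (cmod (stft (x n) window w))\<^sup>2"
        have ii: "integrable lborel (\<lambda>w. ?i w * ?s w)"
          by (rule integrable_nonneg_bound[OF integrable_stft_square[of "x n" window]])
            (measurable, auto simp: indicator_def)
        have "I n \<le> (\<integral>w. d\<^sup>2 * ?s w + H\<^sup>2 * (?i w * ?s w) \<partial>lborel)"
          unfolding I_def
        proof (rule integral_mono')
          show "integrable lborel (\<lambda>w. d\<^sup>2 * ?s w + H\<^sup>2 * (?i w * ?s w))"
            by (intro Bochner_Integration.integrable_add integrable_mult_right integrable_stft_square ii)
          show "(cmod (h w * stft (x n) window w))\<^sup>2 \<le> d\<^sup>2 * ?s w + H\<^sup>2 * (?i w * ?s w)" for w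
          proof (cases "w \<in> cball 0 r")
            case True
            have "0 + (cmod (h w))\<^sup>2 * ?s w \<le> d\<^sup>2 * ?s w + H\<^sup>2 * ?s w"
              by (intro add_mono mult_right_mono power_mono h_le) simp_all
            then show ?thesis unfolding norm_mult power_mult_distrib using True by simp
          next
            case False
            then have "cmod (h w) \<le> d" using r[of w] by simp
            then have "(cmod (h w))\<^sup>2 * ?s w \<le> d\<^sup>2 * ?s w" by (intro mult_right_mono power_mono) simp_all
            then show ?thesis unfolding norm_mult power_mult_distrib using False by simp
          qed
        qed simp
        also have "\<dots> = d\<^sup>2 * (norm (x n))\<^sup>2 + H\<^sup>2 * (\<integral>w. ?i w * ?s w \<partial>lborel)"
          using integrable_stft_square[of "x n" window] ii by (simp add: integral_stft_square)
        also have "\<dots> < d\<^sup>2 * 2\<^sup>2 + e / 2"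
          using x(1)[of n] by (intro add_le_less_mono mult_left_mono power_mono n) simp_all
        also have "\<dots> = e" by (simp add: d(2))
        finally have "I n < e" .
        moreover have "I n \<ge> 0" by (simp add: I_def)
        ultimately show "dist (I n) 0 < e" by simp
      qed
    qed
    then have "(\<lambda>n. sqrt (I n)) \<longlonglongrightarrow> sqrt 0" by (intro tendsto_real_sqrt)
    then have "(\<lambda>n. sqrt (I n)) \<longlonglongrightarrow> 0" by simp
    then show "(\<lambda>n. norm (?M (x n))) \<longlonglongrightarrow> 0"
      by (rule Lim_null_comparison[rotated]) (simp add: I_def M_le)
  qed
  then show ?thesis unfolding a_def[abs_def] .
qed

lemma window_projection_nuclear:
  "nuclear_rep (\<lambda>f. cinner f window *\<^sub>C window) (\<lambda>n. if n = 0 then window else 0) (\<lambda>n. if n = 0 then window else 0)"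
  unfolding nuclear_rep_def
proof (intro conjI allI)
  show "summable (\<lambda>n. norm (if n = 0 then window else 0 :: 'a L2) * norm (if n = 0 then window else 0 :: 'a L2))"
    by (rule summable_finite[of "{0}"]) auto
  fix f g :: "'a L2"
  show "(\<lambda>n. cinner f (if n = 0 then window else 0) * cinner (if n = 0 then window else 0) g) sums cinner (cinner f window *\<^sub>C window) g"
    using sums_finite[of "{0 :: nat}" "\<lambda>n. cinner f (if n = 0 then window else 0) * cinner (if n = 0 then window else 0) g"]
    by (simp add: cinner_scaleC_left)
qed

text \<open>The Fourier-Wigner transform of the projection is, up to a phase, the short-time
  transform of the window with itself, and so has the modulus of a Gaussian.\<close>

lemma window_projection_wiener:
  "(\<lambda>f. cinner f window *\<^sub>C window) \<in> (wiener_operators :: ('a::euclidean_space L2 \<Rightarrow> 'a L2) set)"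
proof -
  let ?S = "\<lambda>f :: 'a L2. cinner f window *\<^sub>C window"
  have "fourier_wigner ?S z \<noteq> 0" for z
  proof -
    let ?u = "\<lambda>n :: nat. if n = 0 then window else 0 :: 'a L2"
    have "(\<lambda>n. cinner (tf_shift (- z) (?u n)) (?u n)) sums (\<Sum>n\<in>{0}. cinner (tf_shift (- z) (?u n)) (?u n))"
      by (rule sums_finite) (auto simp: tf_shift_simps)
    then have "op_trace (tf_shift (- z) \<circ> ?S) = cinner (tf_shift (- z) window) window"
      using sums_unique2[OF fourier_wigner_sums[OF window_projection_nuclear]] by simp
    moreover have "cmod (cinner (tf_shift (- z) window) (window :: 'a L2)) = gauss (1/2) (- z)"
      using norm_stft_window[of "- z"] cinner_commute[of "tf_shift (- z) window" window] by (simp add: stft_def)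
    ultimately show ?thesis
      using gauss_pos[of "1/2" "- z"] by (auto simp: fourier_wigner_def)
  qed
  then show ?thesis by (simp add: wiener_operators_def rank_one_trace_class)
qed

theorem theorem5p1:
  fixes R :: "(real ^ 'd::finite) L2 \<Rightarrow> (real ^ 'd) L2" and A :: complex
  assumes "bounded_clinear R"
  shows
    "((\<exists>S\<in>wiener_operators. \<exists>h\<in>C0_functions.
          \<forall>z. conv_op_op R S z = A * op_trace S + h z) \<longleftrightarrow>
      (\<exists>a\<in>wiener_functions. \<exists>K. compact_operator K \<and>
          (\<forall>f. conv_op_fun R a f = (A * (\<integral>z. a z \<partial>lborel)) *\<^sub>C f + K f))) \<and>
     ((\<exists>S\<in>wiener_operators. \<exists>h\<in>C0_functions.
          \<forall>z. conv_op_op R S z = A * op_trace S + h z) \<or>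
      (\<exists>a\<in>wiener_functions. \<exists>K. compact_operator K \<and>
          (\<forall>f. conv_op_fun R a f = (A * (\<integral>z. a z \<partial>lborel)) *\<^sub>C f + K f)) \<longrightarrow>
        (\<forall>T. trace_class T \<longrightarrow>
          (\<exists>h\<in>C0_functions. \<forall>z. conv_op_op R T z = A * op_trace T + h z)) \<and>
        (\<forall>g. integrable lborel g \<longrightarrow>
          (\<exists>K. compact_operator K \<and>
            (\<forall>f. conv_op_fun R g f = (A * (\<integral>z. g z \<partial>lborel)) *\<^sub>C f + K f))))"
proof -
  define Q where "Q f = R f - A *\<^sub>C f" for f
  interpret R: bounded_operator R by unfold_locales fact
  interpret Q: bounded_operator Q
    unfolding Q_def by unfold_locales (intro bounded_clinear_diff assms bounded_clinear_scaleC)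
  \<comment> \<open>Shifts are unitary, so subtracting \<open>A\<close> times the identity changes
    every matrix coefficient by the constant \<open>A * cinner f g\<close>. Summed over rank one
    terms this becomes the trace term, integrated against a function the integral term.\<close>
  have form: "orbit_form Q f g z = orbit_form R f g z - A * cinner f g" for f g z
    by (simp add: orbit_form_def Q_def cinner_diff_left cinner_scaleC_left cinner_tf_shift_tf_shift)
  have op: "conv_op_op R T z = A * op_trace T + conv_op_op Q T z" if tc: "trace_class T" for T z
  proof -
    obtain u v where T: "nuclear_rep T u v" using trace_class_nuclear[OF tc] by blast
    have "(\<lambda>n. orbit_form R (parity (u n)) (parity (v n)) z - A * cinner (u n) (v n)) sums (conv_op_op R T z - A * op_trace T)"
      by (intro sums_diff sums_mult R.conv_op_op_sums[OF T] op_trace_nuclear[OF T])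
    then have "conv_op_op R T z - A * op_trace T = conv_op_op Q T z"
      by (rule sums_unique2) (use Q.conv_op_op_sums[OF T, of z] in \<open>simp add: form cinner_parity\<close>)
    then show ?thesis by (simp add: algebra_simps)
  qed
  have fn: "conv_op_fun R a f = (A * (\<integral>z. a z \<partial>lborel)) *\<^sub>C f + conv_op_fun Q a f" if a: "integrable lborel a" for a f
  proof (rule L2_eqI)
    fix g
    have "(\<integral>z. a z * orbit_form Q f g (- z) \<partial>lborel)
      = (\<integral>z. a z * orbit_form R f g (- z) \<partial>lborel) - (\<integral>z. a z * (A * cinner f g) \<partial>lborel)"
      unfolding form right_diff_distrib
      by (rule Bochner_Integration.integral_diff[OF R.integrable_orbit_form[OF a]]) (use a in simp)
    then show "cinner (conv_op_fun R a f) g = cinner ((A * (\<integral>z. a z \<partial>lborel)) *\<^sub>C f + conv_op_fun Q a f) g"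
      by (simp add: R.conv_op_fun(2)[OF a] Q.conv_op_fun(2)[OF a] cinner_add_left cinner_scaleC_left)
  qed
  have C0_iff: "(\<exists>h\<in>C0_functions. \<forall>z. conv_op_op R T z = A * op_trace T + h z) \<longleftrightarrow> conv_op_op Q T \<in> C0_functions"
    if "trace_class T" for T
  proof
    assume "\<exists>h\<in>C0_functions. \<forall>z. conv_op_op R T z = A * op_trace T + h z"
    then obtain h where "h \<in> C0_functions" "\<And>z. conv_op_op R T z = A * op_trace T + h z" by blast
    moreover from this have "conv_op_op Q T = h" using op[OF that] by (intro ext) simp
    ultimately show "conv_op_op Q T \<in> C0_functions" by simp
  qed (use op[OF that] in blast)
  have compact_iff: "(\<exists>K. compact_operator K \<and> (\<forall>f. conv_op_fun R a f = (A * (\<integral>z. a z \<partial>lborel)) *\<^sub>C f + K f))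
    \<longleftrightarrow> compact_operator (conv_op_fun Q a)" if "integrable lborel a" for a
  proof
    assume "\<exists>K. compact_operator K \<and> (\<forall>f. conv_op_fun R a f = (A * (\<integral>z. a z \<partial>lborel)) *\<^sub>C f + K f)"
    then obtain K where "compact_operator K" "\<And>f. conv_op_fun R a f = (A * (\<integral>z. a z \<partial>lborel)) *\<^sub>C f + K f" by blast
    moreover from this have "conv_op_fun Q a = K" using fn[OF that] by (intro ext) simp
    ultimately show "compact_operator (conv_op_fun Q a)" by simp
  qed (use fn[OF that] in blast)
  have i_ii: "\<exists>a\<in>wiener_functions. compact_operator (conv_op_fun Q a)"
    if S: "S \<in> wiener_operators" "conv_op_op Q S \<in> C0_functions" for S
  proof -
    obtain u v where uv: "nuclear_rep S u v"
      using trace_class_nuclear[of S] S(1) by (auto simp: wiener_operators_def)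
    show ?thesis
      using berezin_wiener[OF uv] Q.compact_conv_op_fun_berezin[OF uv S(2)] S(1)
      by (auto simp: wiener_operators_def)
  qed
  have ii_1: "conv_op_op Q T \<in> C0_functions"
    if a: "a \<in> wiener_functions" "compact_operator (conv_op_fun Q a)" and T: "trace_class T" for a T
  proof -
    obtain u v where uv: "nuclear_rep T u v" using trace_class_nuclear[OF T] by blast
    show ?thesis
      by (intro Q.conv_op_op_C0_of_orbit_form[OF uv] Q.orbit_form_C0 Q.compact_conv_op_fun_wiener[OF a])
  qed
  have W: "\<And>S. S \<in> wiener_operators \<Longrightarrow> trace_class S" "\<And>a. a \<in> wiener_functions \<Longrightarrow> integrable lborel a"
    by (simp_all add: wiener_operators_def wiener_functions_def)
  have i: "(\<exists>S\<in>wiener_operators. \<exists>h\<in>C0_functions. \<forall>z. conv_op_op R S z = A * op_trace S + h z)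
    \<longleftrightarrow> (\<exists>S\<in>wiener_operators. conv_op_op Q S \<in> C0_functions)"
    by (intro bex_cong refl C0_iff W)
  have ii: "(\<exists>a\<in>wiener_functions. \<exists>K. compact_operator K \<and> (\<forall>f. conv_op_fun R a f = (A * (\<integral>z. a z \<partial>lborel)) *\<^sub>C f + K f))
    \<longleftrightarrow> (\<exists>a\<in>wiener_functions. compact_operator (conv_op_fun Q a))"
    by (intro bex_cong refl compact_iff W)
  have equiv: "(\<exists>S\<in>wiener_operators. conv_op_op Q S \<in> C0_functions)
    \<longleftrightarrow> (\<exists>a\<in>wiener_functions. compact_operator (conv_op_fun Q a))"
    using i_ii ii_1 window_projection_wiener W(1) by blast
  have "(\<forall>T. trace_class T \<longrightarrow> (\<exists>h\<in>C0_functions. \<forall>z. conv_op_op R T z = A * op_trace T + h z)) \<and>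
    (\<forall>g. integrable lborel g \<longrightarrow> (\<exists>K. compact_operator K \<and>
      (\<forall>f. conv_op_fun R g f = (A * (\<integral>z. g z \<partial>lborel)) *\<^sub>C f + K f)))"
    if "\<exists>a\<in>wiener_functions. compact_operator (conv_op_fun Q a)"
    using that C0_iff compact_iff ii_1 Q.compact_conv_op_fun_wiener by blast
  then show ?thesis
    unfolding i ii equiv by blast
qed

end
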